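(* Let $\mathbf\Omega=\{\Omega_i\}$ be a multi-region configuration in $\mathbb{R}^{n+1}$ with a skeletal linking structure $\{(M_i,U_i,\ell_i)\}$, where $\ell_i$ is set equal to $\infty$ on $M_{i\infty}$. If $g:\mathbb{R}^{n+1}\to\mathbb{R}$ is a Borel measurable and Lebesgue integrable function with compact support, then the function $$\tilde g(x)=\int_0^{\ell_i}g(x+t\,\mathbf{u}_i(x))\,\det(I-tS_{rad})\,dt$$ (for $x\in M_i$ with each value $U_i=r_i\mathbf{u}_i$, i.e. for points of $\tilde M_i$) is defined for almost all $x\in\tilde M=\coprod_{i>0}\tilde M_i$, it is integrable on $\tilde M$, and $$\int_{\mathbb{R}^{n+1}}g\,dV=\int_{\tilde M}\tilde g\,dM .$$
   Context: A multi-region configuration is a finite collection of compact connected $(n+1)$-dimensional regions $\Omega_i$, $i\ge1$, in $\mathbb{R}^{n+1}$ that are smooth manifolds with boundaries and corners, with boundaries $\mathcal{B}_i$, meeting pairwise only along unions of boundary strata (with generic local models where they meet). **Skeletal structure $(M,U)$.** $M$ is a Whitney stratified set with $n$-dimensional strata $M_{reg}$, singular strata $M_{sing}$, and $\partial M\subset M_{sing}$ where $M$ is locally a manifold with boundary; near $x_0\in M_{sing}$ each local component of $M_{reg}$ has a unique limiting tangent space, and $M$ is locally a union of smooth $n$-manifolds with boundaries and corners $M_{\alpha_j}$ meeting only along facets (those meeting $\partial M$ doing so in an $(n-1)$-dimensional facet). $U=r\mathbf{u}$ ($\|\mathbf{u}\|=1$) is a multivalued vector field: two values at regular points on opposite sides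 of $M$, smooth on each side; at singular non-edge points values extend smoothly from each $M_{\alpha_j}$, with a unique value pointing into each local complementary component, forming a continuous, stratawise smooth field; at $\partial M$ a unique value, tangent to $M$ and pointing away from $M$; the radial flow $x+tU$ is one-to-one and stratawise nonsingular for small $t>0$. The double $\tilde M$ is the set of pairs ($x$, value of $U$ at $x$), with projection $\pi:\tilde M\to M$. $(M,U)$ is a skeletal structure for $\Omega$ if the radial flow, $0\le t\le1$, is a stratawise diffeomorphism from $\tilde M\times(0,1]$ to $\Omega\setminus M$, with time-one image $\partial\Omega$. **Skeletal linking structure**: (S1) $(M_i,U_i)$ is a skeletal structure for $\Omega_i$; (S2) a multivalued linking function $\ell_i\ge r_i$ on $M_i$ (one value per value of $U_i$, except on strata $M_{i\infty}\subset\tilde M_i$), with $L_i=\ell_i\mathbf{u}_i$; (S3) a labeled stratified refinement $\mathcal{S}_i$ of $\tilde M_i$; (L1) $\ell_i,L_i$ are continuous and smooth on strata of $\mathcal{S}_i$; (L2) the linking flow $\lambda_i(x,t)=x+\chi_i(x,t)\mathbf{u}_i(x)$, $\chi_i=2tr_i$ for $0\le t\le\frac12$ and $\chi_i=2(1-t)r_i+(2t-1)\ell_i$ for $\frac12\le t\le1$, is nonsingular (piecewise smooth homeomorphism, smooth and nonsingular on strata on each half interval, except constant in $t\ge\frac12$ where $\ell_i=r_i$, on strata corresponding to shared boundary), with disjoint images of strata, and each $W_{ij}=\{x+L_i(x):x\in S_{ij}\}$, $S_{ij}$ a stratum of $\mathcal{S}_i$, is smooth; (L3) the $W_{ij}$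 from distinct regions agree or are disjoint and together form a stratified set $M_0$; (L4) with $M_\infty=\bigcup M_{i\infty}$, the global radial flow $(x,c)\mapsto x+cU$, $c\ge0$, on $M_\infty$ is a diffeomorphism onto the complement of the image of the linking flow. Radial shape operator: $S_{rad}(v)=-\mathrm{proj}_U(\partial\mathbf{u}/\partial v)$, with $\mathrm{proj}_U$ the projection onto $T_xM$ along $U$, for the given smooth value of $U$. The measure $dM$ on $\tilde M$ is the positive Borel measure which on each smooth piece of $\tilde M_i$ (a copy of a smooth piece of $M_i$ with a value of $U_i$) equals $\rho\,dV$, where $dV$ is the $n$-dimensional Riemannian volume on $M_i$ and $\rho=\mathbf{u}_i\cdot\mathbf{n}_i$, $\mathbf{n}_i$ the unit normal pointing to the same side as $U_i$. $\int_{\tilde M}=\sum_{i>0}\int_{\tilde M_i}$. *)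

theory Defs
  imports "HOL-Analysis.Analysis"
begin

text \<open>The ambient space is a Euclidean space of dimension \<open>n + 1\<close>, so \<open>n\<close> appears below as
  \<open>DIM('a) - 1\<close>. The double of a multivalued field \<open>U\<close> on \<open>M\<close> is the set of pairs
  (point, value), a subset of \<open>'a \<times> 'a\<close> with its subspace topology; its points are written
  \<open>p\<close>, so that \<open>fst p\<close> is the point of \<open>M\<close> and \<open>snd p\<close> the chosen value of \<open>U\<close> there,
  with \<open>r = norm (snd p)\<close> and \<open>u = sgn (snd p)\<close>.\<close>


section \<open>Smooth maps, manifolds with corners, stratifications\<close>

text \<open>\<open>C_k_on k f W\<close> is only meaningful for open \<open>W\<close>.\<close>

primrec C_k_on ::
  "nat \<Rightarrow> ('a::euclidean_space \<Rightarrow> 'b::real_normed_vector) \<Rightarrow> 'a set \<Rightarrow> bool" where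
  "C_k_on 0 f W \<longleftrightarrow> continuous_on W f"
| "C_k_on (Suc k) f W \<longleftrightarrow> (\<forall>x\<in>W. f differentiable (at x)) \<and>
     (\<forall>v. C_k_on k (\<lambda>x. frechet_derivative f (at x) v) W)"

text \<open>Smoothness on an arbitrary set: locally the restriction of a smooth function on an open set.\<close>

definition smooth_on ::
  "'a::euclidean_space set \<Rightarrow> ('a \<Rightarrow> 'b::real_normed_vector) \<Rightarrow> bool" where
  "smooth_on S f \<longleftrightarrow> (\<forall>x\<in>S. \<exists>W F. open W \<and> x \<in> W \<and> (\<forall>k. C_k_on k F W) \<and>
     (\<forall>y\<in>S \<inter> W. F y = f y))"

definition diffeomorphism ::
  "'a::euclidean_space set \<Rightarrow> 'b::euclidean_space set \<Rightarrow> ('a \<Rightarrow> 'b) \<Rightarrow> bool" where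
  "diffeomorphism S T f \<longleftrightarrow>
     bij_betw f S T \<and> smooth_on S f \<and> smooth_on T (the_inv_into S f)"

text \<open>Points of \<open>N\<close> near which \<open>N\<close> is, in a smooth ambient chart, a neighbourhood of the origin in
  \<open>[0,\<infinity>)\<^sup>d \<times> \<real>\<^sup>k\<^sup>-\<^sup>d\<close>, i.e. a \<open>k\<close>-dimensional manifold with a corner of codimension \<open>d\<close>
  (\<open>d = 0\<close>: interior point, \<open>d = 1\<close>: smooth boundary point).\<close>

definition corner_points :: "nat \<Rightarrow> nat \<Rightarrow> 'a::euclidean_space set \<Rightarrow> 'a set" where
  "corner_points k d N = {x. \<exists>W V \<phi> K C. open W \<and> open V \<and> x \<in> W \<and> diffeomorphism W V \<phi> \<and>
     \<phi> x = (0::'a) \<and> K \<subseteq> Basis \<and> card K = k \<and> C \<subseteq> K \<and> card C = d \<and>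
     \<phi> ` (N \<inter> W) = V \<inter> {y \<in> span K. \<forall>b\<in>C. 0 \<le> b \<bullet> y}}"

definition manifold_with_corners :: "nat \<Rightarrow> 'a::euclidean_space set \<Rightarrow> bool" where
  "manifold_with_corners k N \<longleftrightarrow> (\<forall>x\<in>N. \<exists>d. x \<in> corner_points k d N)"

definition submanifold :: "nat \<Rightarrow> 'a::euclidean_space set \<Rightarrow> bool" where
  "submanifold k N \<longleftrightarrow> N \<subseteq> corner_points k 0 N"

text \<open>Closed boundary faces (of all codimensions \<open>d \<ge> 1\<close>).\<close>

definition faces :: "nat \<Rightarrow> nat \<Rightarrow> 'a::euclidean_space set \<Rightarrow> 'a set set" where
  "faces k d N = {N \<inter> closure F | F. F \<in> components (corner_points k d N)}"

definition facets :: "nat \<Rightarrow> 'a::euclidean_space set \<Rightarrow> 'a set set" where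
  "facets k N = (\<Union>d\<in>{1..k}. faces k d N)"

text \<open>Velocities of one-sided smooth curves. At a corner point this is the cone of inward
  directions, whose span is the (limiting) tangent space.\<close>

definition tangent_cone :: "'a::euclidean_space set \<Rightarrow> 'a \<Rightarrow> 'a set" where
  "tangent_cone N x = {v. \<exists>\<gamma>::real \<Rightarrow> 'a. \<gamma> 0 = x \<and> \<gamma> ` {0..<1} \<subseteq> N \<and> smooth_on {0..<1} \<gamma> \<and>
     (\<gamma> has_vector_derivative v) (at 0 within {0..<1})}"

definition tangent_space :: "'a::euclidean_space set \<Rightarrow> 'a \<Rightarrow> 'a set" where
  "tangent_space N x = span (tangent_cone N x)"

definition nonsingular_on ::
  "'a::euclidean_space set \<Rightarrow> ('a \<Rightarrow> 'b::euclidean_space) \<Rightarrow> bool" where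
  "nonsingular_on N f \<longleftrightarrow> smooth_on N f \<and>
     (\<forall>x\<in>N. \<forall>f'. (f has_derivative f') (at x within N) \<longrightarrow> inj_on f' (tangent_space N x))"

text \<open>Convergence in the Grassmannian, as convergence of orthogonal projections.\<close>

definition subspaces_tendsto :: "(nat \<Rightarrow> 'a::euclidean_space set) \<Rightarrow> 'a set \<Rightarrow> bool" where
  "subspaces_tendsto T \<tau> \<longleftrightarrow> subspace \<tau> \<and>
     (\<forall>w. (\<lambda>k. closest_point (T k) w) \<longlonglongrightarrow> closest_point \<tau> w)"

definition stratification :: "'a::euclidean_space set set \<Rightarrow> 'a set \<Rightarrow> bool" where
  "stratification \<X> N \<longleftrightarrow> disjoint \<X> \<and> \<Union>\<X> = N \<and>
     (\<forall>X\<in>\<X>. X \<noteq> {} \<and> (\<exists>k. submanifold k X)) \<and>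
     (\<forall>x\<in>N. \<exists>W. open W \<and> x \<in> W \<and> finite {X\<in>\<X>. X \<inter> W \<noteq> {}}) \<and>
     (\<forall>X\<in>\<X>. \<forall>Y\<in>\<X>. X \<noteq> Y \<and> X \<inter> closure Y \<noteq> {} \<longrightarrow>
        X \<subseteq> closure Y \<and> (\<forall>k k'. submanifold k X \<and> submanifold k' Y \<longrightarrow> k < k'))"

definition whitney_a :: "'a::euclidean_space set \<Rightarrow> 'a set \<Rightarrow> bool" where
  "whitney_a X Y \<longleftrightarrow> (\<forall>y\<in>Y. \<forall>\<xi> \<tau>. (\<forall>k. \<xi> k \<in> X) \<and> \<xi> \<longlonglongrightarrow> y \<and>
     subspaces_tendsto (\<lambda>k. tangent_space X (\<xi> k)) \<tau> \<longrightarrow> tangent_space Y y \<subseteq> \<tau>)"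

definition whitney_b :: "'a::euclidean_space set \<Rightarrow> 'a set \<Rightarrow> bool" where
  "whitney_b X Y \<longleftrightarrow> (\<forall>y\<in>Y. \<forall>\<xi> \<eta> \<tau> L.
     (\<forall>k. \<xi> k \<in> X \<and> \<eta> k \<in> Y \<and> \<xi> k \<noteq> \<eta> k) \<and> \<xi> \<longlonglongrightarrow> y \<and> \<eta> \<longlonglongrightarrow> y \<and>
     subspaces_tendsto (\<lambda>k. tangent_space X (\<xi> k)) \<tau> \<and>
     subspaces_tendsto (\<lambda>k. span {\<xi> k - \<eta> k}) L \<longrightarrow> L \<subseteq> \<tau>)"

definition whitney_stratification :: "'a::euclidean_space set set \<Rightarrow> 'a set \<Rightarrow> bool" where
  "whitney_stratification \<X> N \<longleftrightarrow> stratification \<X> N \<and> closed N \<and>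
     (\<forall>X\<in>\<X>. \<forall>Y\<in>\<X>. whitney_a X Y \<and> whitney_b X Y)"


section \<open>Multi-region configurations\<close>

text \<open>Local models for the way regions meet, up to diffeomorphism. For linear forms \<open>a \<in> L\<close>, the
  sector of \<open>a\<close> is where \<open>a\<close> is the smallest form. With \<open>L = insert 0 C\<close> and \<open>C\<close> a set of
  \<open>k\<close> coordinates, the sectors give the decomposition of space into \<open>k + 1\<close> simplicial sectors,
  linearly equivalent to \<open>{x\<^sub>i = min\<^sub>j x\<^sub>j} \<times> \<real>\<^sup>m\<close> (model P). In model Q such a decomposition of a
  half-space is placed along the smooth boundary of the opposite half-space.\<close>

definition sector :: "'a::euclidean_space set \<Rightarrow> 'a \<Rightarrow> 'a set" where
  "sector L a = {y. \<forall>c\<in>L. a \<bullet> y \<le> c \<bullet> y}"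

definition model_P :: "'a::euclidean_space set \<Rightarrow> 'a set set" where
  "model_P C = sector (insert 0 C) ` insert 0 C"

definition model_Q :: "'a::euclidean_space set \<Rightarrow> 'a \<Rightarrow> 'a set set" where
  "model_Q C e = insert {y. e \<bullet> y \<le> 0} ((\<lambda>Q. Q \<inter> {y. 0 \<le> e \<bullet> y}) ` model_P C)"

text \<open>At a point lying in several regions, all sectors of a model but at most one (which then
  belongs to the complement of the configuration) are filled by distinct regions.\<close>

definition meet_generically_at ::
  "'i set \<Rightarrow> ('i \<Rightarrow> 'a::euclidean_space set) \<Rightarrow> 'a \<Rightarrow> bool" where
  "meet_generically_at I \<Omega> x \<longleftrightarrow>
     (\<exists>W V \<phi> C \<Q> \<kappa>. open W \<and> open V \<and> x \<in> W \<and> diffeomorphism W V \<phi> \<and> \<phi> x = (0::'a) \<and>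
        C \<subseteq> Basis \<and> C \<noteq> {} \<and> (\<Q> = model_P C \<or> (\<exists>e\<in>Basis - C. \<Q> = model_Q C e)) \<and>
        inj_on \<kappa> {i\<in>I. x \<in> \<Omega> i} \<and> \<kappa> ` {i\<in>I. x \<in> \<Omega> i} \<subseteq> \<Q> \<and>
        card (\<Q> - \<kappa> ` {i\<in>I. x \<in> \<Omega> i}) \<le> 1 \<and>
        (\<forall>i\<in>I. if x \<in> \<Omega> i then \<phi> ` (\<Omega> i \<inter> W) = V \<inter> \<kappa> i else \<Omega> i \<inter> W = {}))"

definition multi_region_configuration ::
  "'i set \<Rightarrow> ('i \<Rightarrow> 'a::euclidean_space set) \<Rightarrow> bool" where
  "multi_region_configuration I \<Omega> \<longleftrightarrow> finite I \<and>
     (\<forall>i\<in>I. \<Omega> i \<noteq> {} \<and> compact (\<Omega> i) \<and> connected (\<Omega> i) \<and> manifold_with_corners DIM('a) (\<Omega> i)) \<and>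
     (\<exists>\<B>. (\<forall>i\<in>I. whitney_stratification (\<B> i) (frontier (\<Omega> i)) \<and>
              (\<forall>X\<in>\<B> i. \<exists>d\<ge>1. X \<subseteq> corner_points DIM('a) d (\<Omega> i))) \<and>
          (\<forall>i\<in>I. \<forall>j\<in>I. i \<noteq> j \<longrightarrow> (\<exists>\<C>. \<C> \<subseteq> \<B> i \<inter> \<B> j \<and> \<Omega> i \<inter> \<Omega> j = \<Union>\<C>))) \<and>
     (\<forall>x. (\<exists>i\<in>I. \<exists>j\<in>I. i \<noteq> j \<and> x \<in> \<Omega> i \<and> x \<in> \<Omega> j) \<longrightarrow> meet_generically_at I \<Omega> x)"


section \<open>Skeletal structures\<close>

text \<open>A skeletal set \<open>M = \<Union>\<T>\<close> is given by its set \<open>\<T>\<close> of strata.\<close>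

definition regular_part :: "'a::euclidean_space set set \<Rightarrow> 'a set" where
  "regular_part \<T> = \<Union>{X\<in>\<T>. submanifold (DIM('a) - 1) X}"

definition singular_part :: "'a::euclidean_space set set \<Rightarrow> 'a set" where
  "singular_part \<T> = \<Union>\<T> - regular_part \<T>"

definition edge :: "'a::euclidean_space set \<Rightarrow> 'a set" where
  "edge M = corner_points (DIM('a) - 1) 1 M"

definition local_pieces ::
  "'a::euclidean_space set \<Rightarrow> 'a \<Rightarrow> 'a set \<Rightarrow> 'a set set \<Rightarrow> bool" where
  "local_pieces M x W \<A> \<longleftrightarrow> open W \<and> x \<in> W \<and> finite \<A> \<and> M \<inter> W = \<Union>\<A> \<and>
     (\<forall>A\<in>\<A>. x \<in> A \<and> closedin (top_of_set W) A \<and> manifold_with_corners (DIM('a) - 1) A) \<and>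
     (\<forall>A\<in>\<A>. \<forall>B\<in>\<A>. A \<noteq> B \<longrightarrow>
        (\<exists>\<F>. \<F> \<subseteq> facets (DIM('a) - 1) A \<and> A \<inter> B = \<Union>\<F>)) \<and>
     (\<forall>A\<in>\<A>. A \<inter> edge M \<noteq> {} \<longrightarrow> A \<inter> closure (edge M) \<in> faces (DIM('a) - 1) 1 A)"

definition skeletal_set :: "'a::euclidean_space set set \<Rightarrow> bool" where
  "skeletal_set \<T> \<longleftrightarrow> whitney_stratification \<T> (\<Union>\<T>) \<and>
     (\<forall>X\<in>\<T>. \<exists>k\<le>DIM('a) - 1. submanifold k X) \<and>
     edge (\<Union>\<T>) \<subseteq> singular_part \<T> \<and>
     (\<forall>x\<in>singular_part \<T>. \<exists>\<epsilon>>0. \<forall>C\<in>components (regular_part \<T> \<inter> ball x \<epsilon>). x \<in> closure C \<longrightarrow>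
        (\<exists>\<tau>. \<forall>\<xi>. (\<forall>k. \<xi> k \<in> C) \<and> \<xi> \<longlonglongrightarrow> x \<longrightarrow>
           subspaces_tendsto (\<lambda>k. tangent_space (regular_part \<T>) (\<xi> k)) \<tau>)) \<and>
     (\<forall>x\<in>singular_part \<T>. \<exists>W \<A>. local_pieces (\<Union>\<T>) x W \<A>)"

definition double :: "'a set \<Rightarrow> ('a \<Rightarrow> 'a set) \<Rightarrow> ('a \<times> 'a) set" where
  "double M U = (SIGMA x:M. U x)"

definition radial_flow :: "('a::real_vector \<times> 'a) \<times> real \<Rightarrow> 'a" where
  "radial_flow = (\<lambda>(p, t). fst p + t *\<^sub>R snd p)"

definition opposite_sides :: "'a::euclidean_space set \<Rightarrow> 'a \<Rightarrow> 'a \<Rightarrow> bool" where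
  "opposite_sides T v w \<longleftrightarrow> (\<exists>\<nu>. (\<forall>z\<in>T. z \<bullet> \<nu> = 0) \<and> v \<bullet> \<nu> > 0 \<and> w \<bullet> \<nu> < 0)"

definition local_complements ::
  "'a::euclidean_space set \<Rightarrow> 'a \<Rightarrow> real \<Rightarrow> 'a set set" where
  "local_complements M x \<epsilon> = {C \<in> components (ball x \<epsilon> - M). x \<in> closure C}"

definition points_into :: "'a::euclidean_space \<Rightarrow> 'a \<Rightarrow> 'a set \<Rightarrow> bool" where
  "points_into x v C \<longleftrightarrow> (\<forall>\<^sub>F t in at_right 0. x + t *\<^sub>R v \<in> C)"

text \<open>The conjuncts: behaviour at regular points; smooth extension from the local pieces at singular
  non-edge points; one value for each local complementary component there; continuity
  (values pointing into the same local complementary component are close); smoothness on strata;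
  behaviour at edge points; the local conditions on the radial flow.\<close>

definition radial_field :: "'a::euclidean_space set set \<Rightarrow> ('a \<Rightarrow> 'a set) \<Rightarrow> bool" where
  "radial_field \<T> U \<longleftrightarrow> (let M = \<Union>\<T>; R = regular_part \<T>; D = double M U in
     (\<forall>x\<in>M. 0 \<notin> U x) \<and>
     (\<forall>x\<in>R. \<exists>W F G. open W \<and> x \<in> W \<and> smooth_on (R \<inter> W) F \<and> smooth_on (R \<inter> W) G \<and>
        (\<forall>y\<in>R \<inter> W. U y = {F y, G y} \<and> opposite_sides (tangent_space R y) (F y) (G y))) \<and>
     (\<forall>x\<in>singular_part \<T> - edge M. \<exists>W \<A>. local_pieces M x W \<A> \<and>
        (\<forall>A\<in>\<A>. \<exists>F G. smooth_on (A - edge M) F \<and> smooth_on (A - edge M) G \<and>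
           (\<forall>y\<in>A \<inter> R. U y = {F y, G y}) \<and> (\<forall>y\<in>A - edge M. {F y, G y} \<subseteq> U y))) \<and>
     (\<forall>x\<in>singular_part \<T> - edge M. \<exists>\<epsilon>0>0. \<forall>\<epsilon>. 0 < \<epsilon> \<and> \<epsilon> < \<epsilon>0 \<longrightarrow>
        (\<forall>C\<in>local_complements M x \<epsilon>. \<exists>!v. v \<in> U x \<and> points_into x v C) \<and>
        (\<forall>v\<in>U x. \<exists>C\<in>local_complements M x \<epsilon>. points_into x v C)) \<and>
     (\<forall>x\<in>M. \<exists>\<epsilon>0>0. \<forall>\<epsilon>. 0 < \<epsilon> \<and> \<epsilon> < \<epsilon>0 \<longrightarrow>
        (\<forall>C\<in>local_complements M x \<epsilon>. \<forall>v\<in>U x. points_into x v C \<longrightarrow>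
           (\<forall>e>0. \<exists>d>0. \<forall>y\<in>M \<inter> ball x d. \<forall>w\<in>U y. points_into y w C \<longrightarrow> dist w v < e))) \<and>
     (\<forall>X\<in>\<T>. \<forall>x\<in>X. \<exists>W \<F>. open W \<and> x \<in> W \<and> finite \<F> \<and> (\<forall>F\<in>\<F>. smooth_on (X \<inter> W) F) \<and>
        (\<forall>y\<in>X \<inter> W. inj_on (\<lambda>F. F y) \<F> \<and> U y = (\<lambda>F. F y) ` \<F>)) \<and>
     (\<forall>x\<in>edge M. \<exists>v. U x = {v} \<and> v \<in> tangent_space M x - tangent_cone M x) \<and>
     (\<exists>\<epsilon>>0. inj_on radial_flow (D \<times> {0<..<\<epsilon>}) \<and>
        (\<forall>X\<in>\<T>. nonsingular_on (double X U \<times> {0<..<\<epsilon>}) radial_flow)))"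

definition skeletal_structure ::
  "'a::euclidean_space set \<Rightarrow> 'a set set \<Rightarrow> ('a \<Rightarrow> 'a set) \<Rightarrow> bool" where
  "skeletal_structure \<Omega> \<T> U \<longleftrightarrow> skeletal_set \<T> \<and> radial_field \<T> U \<and> \<Union>\<T> \<subseteq> \<Omega> \<and>
     (\<exists>\<psi>. homeomorphism (double (\<Union>\<T>) U \<times> {0<..1}) (\<Omega> - \<Union>\<T>) radial_flow \<psi>) \<and>
     (\<forall>X\<in>\<T>. diffeomorphism (double X U \<times> {0<..1})
        (radial_flow ` (double X U \<times> {0<..1})) radial_flow) \<and>
     (\<lambda>p. radial_flow (p, 1)) ` double (\<Union>\<T>) U = frontier \<Omega>"


section \<open>Skeletal linking structures\<close>

text \<open>The linking function is \<open>\<infinity>\<close> exactly where it is undefined in the original convention.\<close>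

definition unlinked_part :: "('p \<Rightarrow> ereal) \<Rightarrow> 'p set \<Rightarrow> 'p set" where
  "unlinked_part l D = {p\<in>D. l p = \<infinity>}"

definition linking_vector :: "('a::euclidean_space \<times> 'a \<Rightarrow> ereal) \<Rightarrow> 'a \<times> 'a \<Rightarrow> 'a" where
  "linking_vector l p = real_of_ereal (l p) *\<^sub>R sgn (snd p)"

definition linking_flow ::
  "('a::euclidean_space \<times> 'a \<Rightarrow> ereal) \<Rightarrow> ('a \<times> 'a) \<times> real \<Rightarrow> 'a" where
  "linking_flow l = (\<lambda>(p, t). let r = norm (snd p) in
     fst p + (if t \<le> 1/2 then 2 * t * r
              else 2 * (1 - t) * r + (2 * t - 1) * real_of_ereal (l p)) *\<^sub>R sgn (snd p))"

text \<open>The set swept out from \<open>A\<close> before the flow stops: the times \<open>0\<close> (where the two sides of \<open>M\<close>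
  start at the same point) and \<open>1\<close> (where linked points meet) are left out, as are the times
  \<open>\<ge> 1/2\<close> where the flow has already stopped on a shared boundary.\<close>

definition linking_sweep ::
  "('a::euclidean_space \<times> 'a \<Rightarrow> ereal) \<Rightarrow> ('a \<times> 'a) set \<Rightarrow> 'a set" where
  "linking_sweep l A = {linking_flow l (p, t) | p t. p \<in> A \<and> 0 < t \<and> t < 1 \<and>
     (ereal (norm (snd p)) < l p \<or> t < 1/2)}"

text \<open>The linking stratum \<open>W\<^sub>i\<^sub>j\<close> of a stratum \<open>S\<^sub>i\<^sub>j\<close>.\<close>

definition linking_stratum ::
  "('a::euclidean_space \<times> 'a \<Rightarrow> ereal) \<Rightarrow> ('a \<times> 'a) set \<Rightarrow> 'a set" where
  "linking_stratum l A = (\<lambda>p. fst p + linking_vector l p) ` A"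

text \<open>Linking flow on one stratum \<open>A\<close> of the double of region \<open>i\<close>: either it runs up to time 1, or
  \<open>l = r\<close> on \<open>A\<close>, the radial flow carries \<open>A\<close> to the boundary shared with other regions, and
  the linking flow is constant from time 1/2 on.\<close>

definition nonsingular_linking ::
  "'i set \<Rightarrow> ('i \<Rightarrow> 'a::euclidean_space set) \<Rightarrow> 'i \<Rightarrow> ('a \<times> 'a \<Rightarrow> ereal) \<Rightarrow> ('a \<times> 'a) set \<Rightarrow> bool" where
  "nonsingular_linking I \<Omega> i l A \<longleftrightarrow>
     nonsingular_on (A \<times> {0..1/2}) (linking_flow l) \<and>
     ((\<forall>p\<in>A. ereal (norm (snd p)) < l p) \<and>
        nonsingular_on (A \<times> {1/2..1}) (linking_flow l) \<and>
        (\<exists>\<psi>. homeomorphism (A \<times> {0<..1}) (linking_flow l ` (A \<times> {0<..1})) (linking_flow l) \<psi>)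
      \<or> (\<forall>p\<in>A. ereal (norm (snd p)) = l p \<and> (\<exists>k\<in>I - {i}. fst p + snd p \<in> \<Omega> k)) \<and>
        (\<exists>\<psi>. homeomorphism (A \<times> {0<..1/2}) (linking_flow l ` (A \<times> {0<..1/2}))
               (linking_flow l) \<psi>))"

text \<open>\<open>S i j\<close>, for labels \<open>j \<in> J i\<close>, is the labeled refinement of the stratification of the double
  of region \<open>i\<close>; the strata of the double itself are the sets \<open>double X (U i)\<close> for \<open>X \<in> \<T> i\<close>.
  In the last two conjuncts the points of the skeletal sets (\<open>c = 0\<close>) are removed, since there the radial flow
  identifies the points of the double lying over the same point, just as for \<open>skeletal_structure\<close>.\<close>

definition skeletal_linking_structure ::
  "'i set \<Rightarrow> ('i \<Rightarrow> 'a::euclidean_space set) \<Rightarrow> ('i \<Rightarrow> 'a set set) \<Rightarrow> ('i \<Rightarrow> 'a \<Rightarrow> 'a set) \<Rightarrow>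
   ('i \<Rightarrow> 'a \<times> 'a \<Rightarrow> ereal) \<Rightarrow> ('i \<Rightarrow> 'j set) \<Rightarrow> ('i \<Rightarrow> 'j \<Rightarrow> ('a \<times> 'a) set) \<Rightarrow> bool" where
  "skeletal_linking_structure I \<Omega> \<T> U l J S \<longleftrightarrow>
    (let M = (\<lambda>i. \<Union>(\<T> i));
         D = (\<lambda>i. double (M i) (U i));
         Dinf = (\<lambda>i. unlinked_part (l i) (D i));
         Minf = (\<Union>i\<in>I. Dinf i);
         labels = (SIGMA i:I. {j\<in>J i. S i j \<inter> Dinf i = {}});
         flow_image = (\<Union>(i, j)\<in>labels. linking_flow (l i) ` (S i j \<times> {0..1}))
     in
      (\<forall>i\<in>I. skeletal_structure (\<Omega> i) (\<T> i) (U i)) \<and>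
      (\<forall>i\<in>I. \<forall>p\<in>D i. ereal (norm (snd p)) \<le> l i p) \<and>
      (\<forall>i\<in>I. \<forall>j\<in>J i. S i j \<subseteq> Dinf i \<or> S i j \<inter> Dinf i = {}) \<and>
      (\<forall>i\<in>I. finite (J i) \<and> inj_on (S i) (J i) \<and> stratification (S i ` J i) (D i) \<and>
         (\<forall>j\<in>J i. \<exists>X\<in>\<T> i. S i j \<subseteq> double X (U i))) \<and>
      (\<forall>i\<in>I. continuous_on (D i - Dinf i) (\<lambda>p. real_of_ereal (l i p)) \<and>
         continuous_on (D i - Dinf i) (linking_vector (l i))) \<and>
      (\<forall>(i, j)\<in>labels. smooth_on (S i j) (\<lambda>p. real_of_ereal (l i p)) \<and>
         smooth_on (S i j) (linking_vector (l i))) \<and>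
      (\<forall>(i, j)\<in>labels. nonsingular_linking I \<Omega> i (l i) (S i j) \<and>
         (\<exists>k. submanifold k (linking_stratum (l i) (S i j)))) \<and>
      (\<forall>(i, j)\<in>labels. \<forall>(i', j')\<in>labels. (i, j) \<noteq> (i', j') \<longrightarrow>
         linking_sweep (l i) (S i j) \<inter> linking_sweep (l i') (S i' j') = {}) \<and>
      (\<forall>(i, j)\<in>labels. \<forall>(i', j')\<in>labels. i \<noteq> i' \<longrightarrow>
         linking_stratum (l i) (S i j) = linking_stratum (l i') (S i' j') \<or>
         linking_stratum (l i) (S i j) \<inter> linking_stratum (l i') (S i' j') = {}) \<and>
      (\<exists>M\<^sub>0. stratification {linking_stratum (l i) (S i j) | i j. (i, j) \<in> labels} M\<^sub>0) \<and>
      (\<exists>\<psi>. homeomorphism (Minf \<times> {0<..}) (- (flow_image \<union> (\<Union>i\<in>I. M i))) radial_flow \<psi>) \<and>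
      (\<forall>i\<in>I. \<forall>j\<in>J i. S i j \<subseteq> Dinf i \<longrightarrow>
         diffeomorphism (S i j \<times> {0<..}) (radial_flow ` (S i j \<times> {0<..})) radial_flow))"


section \<open>Radial shape operator\<close>

definition proj_along :: "'a::euclidean_space set \<Rightarrow> 'a \<Rightarrow> 'a \<Rightarrow> 'a" where
  "proj_along T v w = (THE z. z \<in> T \<and> w - z \<in> span {v})"

text \<open>A smooth ambient extension of the value \<open>snd p\<close> of \<open>U\<close> at the regular point \<open>fst p\<close>; on the
  regular part its germ at \<open>fst p\<close> is unique.\<close>

definition local_branch ::
  "'a::euclidean_space set set \<Rightarrow> ('a \<Rightarrow> 'a set) \<Rightarrow> 'a \<times> 'a \<Rightarrow> 'a \<Rightarrow> 'a" where
  "local_branch \<T> U p = (SOME F. F (fst p) = snd p \<and> (\<exists>W. open W \<and> fst p \<in> W \<and>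
     (\<forall>k. C_k_on k F W) \<and> (\<forall>y\<in>regular_part \<T> \<inter> W. F y \<in> U y)))"

definition radial_shape_operator ::
  "'a::euclidean_space set set \<Rightarrow> ('a \<Rightarrow> 'a set) \<Rightarrow> 'a \<times> 'a \<Rightarrow> 'a \<Rightarrow> 'a" where
  "radial_shape_operator \<T> U p w =
     - proj_along (tangent_space (regular_part \<T>) (fst p)) (snd p)
         (frechet_derivative (\<lambda>y. sgn (local_branch \<T> U p y)) (at (fst p)) w)"

text \<open>Determinant of an endomorphism \<open>f\<close> of the subspace \<open>T\<close>, as the determinant of \<open>f \<oplus> id\<close> on the
  sum of \<open>T\<close> and its orthogonal complement.\<close>

definition det_on :: "(real^'n) set \<Rightarrow> (real^'n \<Rightarrow> real^'n) \<Rightarrow> real" where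
  "det_on T f = det (matrix (\<lambda>w. f (closest_point T w) + (w - closest_point T w)))"


section \<open>Riemannian volume and the skeletal measure\<close>

text \<open>Lebesgue measure on the coordinate subspace \<open>span K\<close> for \<open>K \<subseteq> Basis\<close>, as a measure on the
  ambient space (in the same way as the library defines \<open>lborel\<close>).\<close>

definition coord_lborel :: "'a::euclidean_space set \<Rightarrow> 'a measure" where
  "coord_lborel K = distr (\<Pi>\<^sub>M b\<in>K. lborel) borel (\<lambda>f. \<Sum>b\<in>K. f b *\<^sub>R b)"

text \<open>Determinant of the \<open>K \<times> K\<close> Gram matrix of the vectors \<open>f b\<close> with \<open>b \<in> K \<subseteq> Basis\<close>,
  completed by an identity block.\<close>

definition gram_det :: "(real^'n) set \<Rightarrow> (real^'n \<Rightarrow> real^'n) \<Rightarrow> real" where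
  "gram_det K f = det (\<chi> i j. if axis i 1 \<in> K \<and> axis j 1 \<in> K
     then f (axis i 1) \<bullet> f (axis j 1) else if i = j then 1 else 0)"

definition is_riemannian_volume :: "nat \<Rightarrow> (real^'n) set \<Rightarrow> (real^'n) measure \<Rightarrow> bool" where
  "is_riemannian_volume k N \<mu> \<longleftrightarrow> sets \<mu> = sets borel \<and> emeasure \<mu> (- N) = 0 \<and>
     (\<forall>V W \<psi> K A. open V \<and> open W \<and> diffeomorphism V W \<psi> \<and> K \<subseteq> Basis \<and> card K = k \<and>
        \<psi> ` (V \<inter> span K) = N \<inter> W \<and> A \<in> sets borel \<and> A \<subseteq> N \<inter> W \<longrightarrow>
        emeasure \<mu> A = (\<integral>\<^sup>+y\<in>V \<inter> span K \<inter> \<psi> -` A.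
          ennreal (sqrt (gram_det K (frechet_derivative \<psi> (at y)))) \<partial>coord_lborel K))"

text \<open>For a \<open>k\<close>-dimensional submanifold \<open>N\<close> there is exactly one such measure.\<close>

definition riemannian_volume :: "nat \<Rightarrow> (real^'n) set \<Rightarrow> (real^'n) measure" where
  "riemannian_volume k N = (THE \<mu>. is_riemannian_volume k N \<mu>)"

definition unit_normal :: "'a::euclidean_space set \<Rightarrow> 'a \<Rightarrow> 'a" where
  "unit_normal T v = (THE \<nu>. norm \<nu> = 1 \<and> (\<forall>z\<in>T. z \<bullet> \<nu> = 0) \<and> 0 < v \<bullet> \<nu>)"

definition radial_density :: "'a::euclidean_space set set \<Rightarrow> 'a \<times> 'a \<Rightarrow> real" where
  "radial_density \<T> p =
     sgn (snd p) \<bullet> unit_normal (tangent_space (regular_part \<T>) (fst p)) (snd p)"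

text \<open>Over the regular part the double is locally two copies of \<open>M\<close>, one for each value of \<open>U\<close>, and
  the measure is \<open>\<rho> dV\<close> on each; the part over the singular strata is a null set.\<close>

definition skeletal_measure ::
  "(real^'n) set set \<Rightarrow> (real^'n \<Rightarrow> (real^'n) set) \<Rightarrow> ((real^'n) \<times> (real^'n)) measure" where
  "skeletal_measure \<T> U =
     measure_of (double (\<Union>\<T>) U) (sets (restrict_space borel (double (\<Union>\<T>) U)))
       (\<lambda>A. \<integral>\<^sup>+x\<in>regular_part \<T>. (\<Sum>v\<in>{v\<in>U x. (x, v) \<in> A}. ennreal (radial_density \<T> (x, v)))
          \<partial>riemannian_volume (CARD('n) - 1) (regular_part \<T>))"


section \<open>The integral along radial lines\<close>

definition radial_integrand ::
  "(real^'n) set set \<Rightarrow> (real^'n \<Rightarrow> (real^'n) set) \<Rightarrow> (real^'n \<Rightarrow> real) \<Rightarrow>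
   (real^'n) \<times> (real^'n) \<Rightarrow> real \<Rightarrow> real" where
  "radial_integrand \<T> U g p t = g (fst p + t *\<^sub>R sgn (snd p)) *
     det_on (tangent_space (regular_part \<T>) (fst p)) (\<lambda>w. w - t *\<^sub>R radial_shape_operator \<T> U p w)"

definition radial_integral_defined ::
  "(real^'n) set set \<Rightarrow> (real^'n \<Rightarrow> (real^'n) set) \<Rightarrow> ((real^'n) \<times> (real^'n) \<Rightarrow> ereal) \<Rightarrow>
   (real^'n \<Rightarrow> real) \<Rightarrow> (real^'n) \<times> (real^'n) \<Rightarrow> bool" where
  "radial_integral_defined \<T> U l g p \<longleftrightarrow> fst p \<in> regular_part \<T> \<and>
     interval_lebesgue_integrable lborel 0 (l p) (radial_integrand \<T> U g p)"

definition radial_integral ::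
  "(real^'n) set set \<Rightarrow> (real^'n \<Rightarrow> (real^'n) set) \<Rightarrow> ((real^'n) \<times> (real^'n) \<Rightarrow> ereal) \<Rightarrow>
   (real^'n \<Rightarrow> real) \<Rightarrow> (real^'n) \<times> (real^'n) \<Rightarrow> real" where
  "radial_integral \<T> U l g p = (if radial_integral_defined \<T> U l g p
     then (LBINT t=0..l p. radial_integrand \<T> U g p t) else 0)"

end

theory Submission imports Defs begin

text \<open>Over the regular part of a skeletal set, \<open>\<Theta>(y, t) = \<psi> y + t u(\<psi> y)\<close> with \<open>\<psi>\<close> a chart and \<open>u\<close> a
  branch of the unit radial field parametrizes a family of radial lines. The columns of its Jacobian
  matrix are \<open>\<partial>\<psi> + t \<partial>u\<close> and \<open>u\<close>; modulo \<open>u\<close> the former are \<open>(I - t S\<^sub>r\<^sub>a\<^sub>d) \<partial>\<psi>\<close>. So the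
  Jacobian determinant is \<open>det (I - t S\<^sub>r\<^sub>a\<^sub>d)\<close> times its value at \<open>t = 0\<close>, which up to sign is the
  Riemannian volume factor times \<open>\<rho>\<close>. By the linking structure, the radial segments \<open>0 < t < \<ell>\<close> of
  all regions are disjoint. They miss only null sets: the skeletal sets, the linking strata
  \<open>W\<^sub>i\<^sub>j\<close> (images of \<open>n\<close>-dimensional sets), and what is swept out by strata of the double
  of dimension less than \<open>n\<close>. Nonsingularity of the flow makes \<open>det (I - t S\<^sub>r\<^sub>a\<^sub>d)\<close> nonzero for
  \<open>0 < t < \<ell>\<close>, hence positive since it is \<open>1\<close> at \<open>t = 0\<close>. The change of variables formula then
  gives the identity for nonnegative functions, and it is applied to the positive and negative
  parts of \<open>g\<close>.\<close>

section \<open>Change of variables\<close>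

text \<open>Three obstacles lie behind the named steps. The Riemannian volume is a
  \<open>THE\<close>, so its existence and uniqueness rest on chart independence; giving every chart
  domain unit thickness in the omitted coordinate reduces this to the ordinary change of variables
  formula, and the same extra coordinate later serves as time along the radial lines. The branch of
  \<open>U\<close> inside the shape operator is an arbitrary extension chosen by
  \<open>SOME\<close>; only its derivatives along the regular part are determined, and only these
  enter the determinant on the tangent space. Finally, nonsingularity is assumed on strata of a
  refinement of the double, in terms of one-sided curves and with a speed that varies along the
  stratum. A full-dimensional stratum over the regular part is locally contained in the graph of one
  branch, so its tangent vectors project onto the whole tangent space of \<open>M\<close>, and the
  variation of the speed contributes only multiples of \<open>u\<close>, which the column
  \<open>u\<close> of the Jacobian absorbs.\<close>

text \<open>The change of variables formula of the library is stated for well-ordered index types; a copy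
  of the finite index type with an arbitrary enumeration as order removes this restriction.\<close>

typedef ('n::finite) idx = "{..<CARD('n)}"
  by (rule exI[of _ 0]) simp

instantiation idx :: (finite) wellorder
begin
definition "x \<le> y \<longleftrightarrow> Rep_idx x \<le> Rep_idx y"
definition "x < y \<longleftrightarrow> Rep_idx x < Rep_idx y"
instance
proof
  fix P :: "'a idx \<Rightarrow> bool" and a
  assume "\<And>x. (\<And>y. y < x \<Longrightarrow> P y) \<Longrightarrow> P x"
  then show "P a"
    unfolding less_idx_def by (rule measure_induct_rule[of Rep_idx])
qed (auto simp: less_eq_idx_def less_idx_def Rep_idx_inject)
end

lemma card_idx: "CARD(('n::finite) idx) = CARD('n)"
  using type_definition.card[OF type_definition_idx] by simp

instance idx :: (finite) finite
  by standard (subst type_definition.univ[OF type_definition_idx], simp)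

text \<open>Conjugation by \<open>h\<close> maps a product of transpositions on \<open>'m\<close> to
  a product of equally many transpositions on \<open>'n\<close>, so it preserves signs. It is a
  bijection between the permutations, and the Leibniz expansions agree term by term.\<close>

lemma det_reindex:
  fixes A :: "real^'n^'n" and h :: "'m::finite \<Rightarrow> 'n"
  assumes h: "bij h"
  shows "det (\<chi> i j. A $ h i $ h j) = det A"
proof -
  define c where "c = (\<lambda>p. h \<circ> p \<circ> inv h)"
  define d where "d = (\<lambda>p. inv h \<circ> p \<circ> h)"
  have [simp]: "h (inv h x) = x" "inv h (h y) = y" for x y
    using h by (simp_all add: bij_is_inj bij_is_surj surj_f_inv_f)
  have cb: "c p permutes UNIV" if "p permutes UNIV" for p
    using that h by (auto simp: c_def permutes_bij intro!: bij_imp_permutes bij_comp bij_imp_bij_inv)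
  have db: "d p permutes UNIV" if "p permutes UNIV" for p
    using that h by (auto simp: d_def permutes_bij intro!: bij_imp_permutes bij_comp bij_imp_bij_inv)
  have sw: "swapidseq n (c p)" if "swapidseq n p" for n p
    using that
  proof induction
    case id
    have "c id = id" by (auto simp: c_def)
    then show ?case by (metis swapidseq.id)
  next
    case (comp_Suc n p a b)
    have "c (Transposition.transpose a b \<circ> p) = Transposition.transpose (h a) (h b) \<circ> c p"
      by (auto simp: c_def fun_eq_iff Transposition.transpose_def bij_is_inj[OF h] inj_eq split: if_splits)
    moreover have "h a \<noteq> h b" using comp_Suc h by (auto simp: bij_is_inj inj_eq)
    ultimately show ?case using comp_Suc by (metis swapidseq.comp_Suc)
  qed
  have sgn: "sign (c p) = sign p" if p: "p permutes UNIV" for p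
  proof -
    obtain n where n: "swapidseq n p"
      using permutes_imp_permutation[OF finite p] unfolding permutation_def by blast
    show ?thesis using evenperm_unique[OF n refl] evenperm_unique[OF sw[OF n] refl]
      by (simp add: sign_def)
  qed
  have bij: "bij_betw c {p. p permutes UNIV} {p. p permutes UNIV}"
    by (rule bij_betw_byWitness[where f'=d]) (auto simp: cb db, auto simp: c_def d_def)
  show ?thesis
    unfolding det_def
  proof (subst sum.reindex_bij_betw[OF bij, symmetric], rule sum.cong[OF refl])
    fix p :: "'m \<Rightarrow> 'm" assume p: "p \<in> {p. p permutes UNIV}"
    have "(\<Prod>i\<in>UNIV. A $ i $ c p i) = (\<Prod>i\<in>UNIV. A $ h i $ c p (h i))"
      by (rule prod.reindex_bij_betw[OF h, symmetric])
    with sgn show "of_int (sign p) * (\<Prod>i\<in>UNIV. (\<chi> i j. A $ h i $ h j) $ i $ p i) =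
         of_int (sign (c p)) * (\<Prod>i\<in>UNIV. A $ i $ c p i)"
      using p sgn[of p] by (simp add: c_def)
  qed
qed

text \<open>Exhaust \<open>S\<close> by the pieces \<open>T k\<close>, bounded sets on which
  \<open>d \<le> k\<close>: there the integral is finite, so the formula for images of finite
  measure applies, and both sides pass to the increasing limit. The Borel function \<open>d\<close>
  stands in for the Jacobian, since nothing is said about \<open>\<Theta>'\<close> off
  \<open>S\<close>.\<close>

lemma emeasure_differentiable_image_wo:
  fixes \<Theta> :: "real^'m::{finite,wellorder} \<Rightarrow> real^'m::_"
  assumes S: "S \<in> sets borel"
    and der: "\<And>x. x \<in> S \<Longrightarrow> (\<Theta> has_derivative \<Theta>' x) (at x within S)"
    and inj: "inj_on \<Theta> S"
    and d[measurable]: "d \<in> borel_measurable borel"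
    and det: "\<And>x. x \<in> S \<Longrightarrow> d x = \<bar>det (matrix (\<Theta>' x))\<bar>"
  shows "emeasure lebesgue (\<Theta> ` S) = (\<integral>\<^sup>+x\<in>S. ennreal (d x) \<partial>lborel)"
proof -
  define T where "T k = S \<inter> cball 0 (real k) \<inter> {x. d x \<le> real k}" for k
  have [measurable]: "S \<in> sets borel" by (rule S)
  have TB[measurable]: "T k \<in> sets borel" for k unfolding T_def by measurable
  have TS: "T k \<subseteq> S" for k by (auto simp: T_def)
  have incT: "incseq T" by (rule incseq_SucI) (auto simp: T_def)
  have UT: "(\<Union>k. T k) = S"
  proof -
    have "\<exists>k. x \<in> T k" if "x \<in> S" for x
    proof -
      obtain k :: nat where "max (norm x) (d x) \<le> real k" using real_arch_simple by blast
      then show ?thesis using that by (auto simp: T_def)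
    qed
    then show ?thesis using TS by blast
  qed
  have *: "\<Theta> ` T k \<in> sets lebesgue \<and> emeasure lebesgue (\<Theta> ` T k) = (\<integral>\<^sup>+x\<in>T k. ennreal (d x) \<partial>lborel)" for k
  proof -
    let ?f = "\<lambda>x. if x \<in> T k then d x else 0"
    have nn: "0 \<le> ?f x" for x using TS[of k] det[of x] by (auto dest: subsetD)
    have "(\<integral>\<^sup>+x. ennreal (?f x) \<partial>lborel) \<le> (\<integral>\<^sup>+x. ennreal (real k) * indicator (cball (0::real^'m::_) (real k)) x \<partial>lborel)"
      by (intro nn_integral_mono) (auto simp: T_def indicator_def ennreal_leI)
    also have "\<dots> < \<infinity>"
      using emeasure_lborel_cball_finite[of "0::real^'m::_" "real k"]
      by (simp add: nn_integral_cmult_indicator ennreal_mult_less_top top.not_eq_extremum less_top)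
    finally have fin: "(\<integral>\<^sup>+x. ennreal (?f x) \<partial>lborel) < \<infinity>" .
    define m where "m = enn2real (\<integral>\<^sup>+x. ennreal (?f x) \<partial>lborel)"
    have m: "(\<integral>\<^sup>+x. ennreal (?f x) \<partial>lborel) = ennreal m" using fin by (simp add: m_def)
    have "(?f has_integral m) UNIV"
    proof (subst has_integral_iff_nn_integral_lebesgue[OF nn], intro conjI)
      show "?f \<in> borel_measurable lebesgue" by (rule measurable_completion) simp
      show "(\<integral>\<^sup>+x. ennreal (?f x) \<partial>lebesgue) = ennreal m" by (simp only: nn_integral_completion m)
      show "0 \<le> m" by (simp add: m_def)
    qed
    then have "(d has_integral m) (T k)" by (simp only: has_integral_restrict_UNIV)
    moreover have "d x = \<bar>det (matrix (\<Theta>' x))\<bar>" if "x \<in> T k" for x using that TS det by blast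
    ultimately have hi: "((\<lambda>x. \<bar>det (matrix (\<Theta>' x))\<bar>) has_integral m) (T k)"
      by (metis (no_types, lifting) has_integral_cong)
    have "\<Theta> ` T k \<in> lmeasurable \<and> measure lebesgue (\<Theta> ` T k) = m"
    proof (subst has_measure_differentiable_image)
      show "T k \<in> sets lebesgue" by simp
      show "\<And>x. x \<in> T k \<Longrightarrow> (\<Theta> has_derivative \<Theta>' x) (at x within T k)"
        using der TS has_derivative_subset by blast
      show "inj_on \<Theta> (T k)" using inj TS inj_on_subset by blast
      show "((\<lambda>x. \<bar>det (matrix (\<Theta>' x))\<bar>) has_integral m) (T k)" by (rule hi)
    qed
    then have "\<Theta> ` T k \<in> sets lebesgue" "emeasure lebesgue (\<Theta> ` T k) = ennreal m"
      by (auto simp: emeasure_eq_measure2 fmeasurableD)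
    moreover have "(\<integral>\<^sup>+x\<in>T k. ennreal (d x) \<partial>lborel) = ennreal m"
      unfolding m[symmetric] by (intro nn_integral_cong) (auto simp: indicator_def)
    ultimately show ?thesis by simp
  qed
  have "emeasure lebesgue (\<Theta> ` S) = emeasure lebesgue (\<Union>k. \<Theta> ` T k)"
    by (simp add: UT[symmetric] image_UN)
  also have "\<dots> = (SUP k. emeasure lebesgue (\<Theta> ` T k))"
    using * incT by (intro SUP_emeasure_incseq[symmetric]) (auto simp: incseq_def image_mono)
  also have "\<dots> = (SUP k. \<integral>\<^sup>+x\<in>T k. ennreal (d x) \<partial>lborel)" using * by simp
  also have "\<dots> = (\<integral>\<^sup>+x. (SUP k. ennreal (d x) * indicator (T k) x) \<partial>lborel)"
    using incT by (intro nn_integral_monotone_convergence_SUP[symmetric])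
      (auto simp: incseq_def le_fun_def indicator_def)
  also have "\<dots> = (\<integral>\<^sup>+x\<in>S. ennreal (d x) \<partial>lborel)"
  proof (intro nn_integral_cong)
    fix x
    show "(SUP k. ennreal (d x) * indicator (T k) x) = ennreal (d x) * indicator S x"
    proof (cases "x \<in> S")
      case True
      then obtain k where "x \<in> T k" using UT by blast
      then show ?thesis using True
        by (intro antisym SUP_least SUP_upper2[of k]) (auto simp: indicator_def)
    next
      case False
      then have "x \<notin> T k" for k using TS by blast
      then show ?thesis using False by simp
    qed
  qed
  finally show ?thesis .
qed

text \<open>Lebesgue measure is determined by its values on boxes, and relabelling the coordinates
  takes a box to one with the same side lengths in another order.\<close>

lemma lborel_reindex:
  fixes h :: "'m::finite \<Rightarrow> 'n::finite"
  assumes h: "bij h"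
  shows "distr lborel borel (\<lambda>x::real^'n. \<chi> i. x $ h i) = (lborel :: (real^'m) measure)"
proof (rule lborel_eqI[symmetric])
  have P: "linear (\<lambda>x::real^'n. (\<chi> i. x $ h i) :: real^'m)"
    by (rule linearI) (auto simp: vec_eq_iff)
  then have [measurable]: "(\<lambda>x::real^'n. (\<chi> i. x $ h i) :: real^'m) \<in> borel \<rightarrow>\<^sub>M borel"
    by (intro borel_measurable_continuous_onI linear_continuous_on) (simp add: linear_conv_bounded_linear)
  have [simp]: "h (inv h x) = x" "inv h (h y) = y" for x y
    using h by (simp_all add: bij_is_inj bij_is_surj surj_f_inv_f)
  fix l u :: "real^'m" assume lu: "\<And>b. b \<in> Basis \<Longrightarrow> l \<bullet> b \<le> u \<bullet> b"
  then have lu': "l $ i \<le> u $ i" for i by (metis axis_in_Basis_iff inner_axis' inner_commute inner_real_def mult_1 insertI1 Basis_real_def cart_eq_inner_axis)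
  let ?l = "\<chi> i. l $ inv h i" and ?u = "\<chi> i. u $ inv h i"
  have "(\<lambda>x. \<chi> i. x $ h i) -` box l u = box ?l ?u"
    unfolding mem_box_cart vimage_def set_eq_iff by (simp, metis \<open>\<And>y. inv h (h y) = y\<close> \<open>\<And>x. h (inv h x) = x\<close>)
  then have "emeasure (distr lborel borel (\<lambda>x. \<chi> i. x $ h i)) (box l u) = emeasure lborel (box ?l ?u)"
    by (subst emeasure_distr) auto
  also have "\<dots> = ennreal (\<Prod>i\<in>UNIV. u $ inv h i - l $ inv h i)"
    using lu' by (subst emeasure_lborel_box_eq)
      (auto simp: Basis_vec_def inner_axis prod.UNION_disjoint axis_eq_axis UNION_singleton_eq_range prod.reindex inj_on_def)
  also have "(\<Prod>i\<in>UNIV. u $ inv h i - l $ inv h i) = (\<Prod>i\<in>UNIV. u $ i - l $ i)"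
    by (rule prod.reindex_bij_betw[OF bij_imp_bij_inv[OF h]])
  also have "\<dots> = (\<Prod>b\<in>Basis. (u - l) \<bullet> b)"
    by (auto simp: Basis_vec_def inner_axis UNION_singleton_eq_range prod.reindex inj_on_def axis_eq_axis)
  finally show "emeasure (distr lborel borel (\<lambda>x. \<chi> i. x $ h i)) (box l u) = ennreal (prod ((\<bullet>) (u - l)) Basis)" .
qed simp

text \<open>A Lebesgue set is a Borel set together with a negligible one. The image of the Borel
  part is a preimage under the inverse relabelling \<open>Q\<close>, hence Borel and of the same
  measure; the image of the negligible part is negligible because the two spaces have equal
  dimension.\<close>

lemma emeasure_lebesgue_reindex:
  fixes h :: "'m::finite \<Rightarrow> 'n::finite" and B :: "(real^'n) set"
  assumes h: "bij h" and B: "B \<in> sets lebesgue"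
  shows "emeasure lebesgue ((\<lambda>x. (\<chi> i. x $ h i) :: real^'m) ` B) = emeasure lebesgue B"
proof -
  define P where "P = (\<lambda>x::real^'n. (\<chi> i. x $ h i) :: real^'m)"
  define Q where "Q = (\<lambda>x::real^'m. (\<chi> i. x $ inv h i) :: real^'n)"
  have [simp]: "h (inv h x) = x" "inv h (h y) = y" for x y
    using h by (simp_all add: bij_is_inj bij_is_surj surj_f_inv_f)
  have lin: "linear P" "linear Q"
    unfolding P_def Q_def by (rule linearI; simp add: vec_eq_iff)+
  have mP[measurable]: "P \<in> borel \<rightarrow>\<^sub>M borel" and mQ[measurable]: "Q \<in> borel \<rightarrow>\<^sub>M borel"
    using lin by (auto intro!: borel_measurable_continuous_onI linear_continuous_on simp: linear_conv_bounded_linear)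
  have QP: "Q (P x) = x" and PQ: "P (Q y) = y" for x y by (simp_all add: vec_eq_iff P_def Q_def)
  obtain C N where C: "C \<in> sets borel" and N: "negligible N" and CN: "C \<union> N = B"
    using sets_lebesgue_almost_borel[OF B] .
  have im: "P ` C = Q -` C"
  proof
    show "P ` C \<subseteq> Q -` C" using QP by auto
    show "Q -` C \<subseteq> P ` C" by (metis PQ imageI subsetI vimageE)
  qed
  have PC: "P ` C \<in> sets borel"
    unfolding im using measurable_sets[OF mQ C] by simp
  have dims: "DIM(real^'n) \<le> DIM(real^'m)"
    using bij_betw_same_card[OF h] by simp
  have PN: "negligible (P ` N)"
    by (rule negligible_differentiable_image_negligible[OF dims N])
      (auto intro!: linear_imp_differentiable_on lin)
  have "emeasure lebesgue (P ` B) = emeasure lebesgue (P ` C \<union> P ` N)"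
    by (simp add: CN[symmetric] image_Un)
  also have "\<dots> = emeasure lebesgue (P ` C)"
    using PC PN by (intro emeasure_Un_null_set) (auto simp: negligible_iff_null_sets)
  also have "\<dots> = emeasure lborel (P ` C)" using PC by simp
  also have "\<dots> = emeasure (distr lborel borel P) (P ` C)"
    by (simp only: lborel_reindex[OF h] P_def)
  also have "\<dots> = emeasure lborel (P -` (P ` C))" using PC by (simp add: emeasure_distr)
  also have "P -` (P ` C) = C" by (rule inj_vimage_image_eq) (metis QP injI)
  also have "emeasure lborel C = emeasure lebesgue (C \<union> N)"
    using C N by (subst emeasure_Un_null_set) (auto simp: negligible_iff_null_sets)
  finally show ?thesis by (simp add: CN P_def)
qed

lemma nn_integral_reindex:
  fixes h :: "'m::finite \<Rightarrow> 'n::finite"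
  assumes h: "bij h" and f: "f \<in> borel_measurable borel"
  shows "(\<integral>\<^sup>+x. f ((\<chi> i. x $ h i) :: real^'m) \<partial>lborel) = (\<integral>\<^sup>+x. f x \<partial>lborel)"
proof -
  let ?P = "\<lambda>x::real^'n. (\<chi> i. x $ h i) :: real^'m"
  have "linear ?P" by (rule linearI) (auto simp: vec_eq_iff)
  then have "?P \<in> borel \<rightarrow>\<^sub>M borel"
    by (intro borel_measurable_continuous_onI linear_continuous_on) (simp add: linear_conv_bounded_linear)
  then show ?thesis
    using f by (subst lborel_reindex[OF h, symmetric]) (simp add: nn_integral_distr)
qed

text \<open>Conjugation with the relabellings \<open>P\<close> and \<open>Q\<close> turns
  \<open>\<Theta>\<close> into a self-map \<open>\<Psi>\<close> over the well-ordered copy of the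
  index type. The derivatives are conjugated too, and \<open>det_reindex\<close> keeps their
  determinants.\<close>

lemma emeasure_differentiable_image:
  fixes \<Theta> :: "real^'n \<Rightarrow> real^'n"
  assumes S: "S \<in> sets borel"
    and der: "\<And>x. x \<in> S \<Longrightarrow> (\<Theta> has_derivative \<Theta>' x) (at x within S)"
    and inj: "inj_on \<Theta> S"
    and d[measurable]: "d \<in> borel_measurable borel"
    and det: "\<And>x. x \<in> S \<Longrightarrow> d x = \<bar>det (matrix (\<Theta>' x))\<bar>"
  shows "\<Theta> ` S \<in> sets lebesgue" "emeasure lebesgue (\<Theta> ` S) = (\<integral>\<^sup>+x\<in>S. ennreal (d x) \<partial>lborel)"
proof -
  show im: "\<Theta> ` S \<in> sets lebesgue"
    using S der by (intro differentiable_image_in_sets_lebesgue)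
      (auto simp: differentiable_on_def differentiable_def)
  obtain h :: "'n idx \<Rightarrow> 'n" where h: "bij h"
    using finite_same_card_bij[of "UNIV :: 'n idx set" "UNIV :: 'n set"] by (auto simp: card_idx)
  define P where "P = (\<lambda>x::real^'n. (\<chi> i. x $ h i) :: real^'n idx)"
  define Q where "Q = (\<lambda>x::real^'n idx. (\<chi> i. x $ inv h i) :: real^'n)"
  have hh[simp]: "h (inv h x) = x" "inv h (h y) = y" for x y
    using h by (simp_all add: bij_is_inj bij_is_surj surj_f_inv_f)
  have lin: "linear P" "linear Q"
    unfolding P_def Q_def by (rule linearI; simp add: vec_eq_iff)+
  then have bl: "bounded_linear P" "bounded_linear Q" by (simp_all add: linear_conv_bounded_linear)
  have mQ[measurable]: "Q \<in> borel \<rightarrow>\<^sub>M borel"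
    using bl by (auto intro!: borel_measurable_continuous_onI linear_continuous_on)
  have QP[simp]: "Q (P x) = x" and PQ[simp]: "P (Q y) = y" for x y
    by (simp_all add: P_def Q_def vec_eq_iff)
  define S' where "S' = Q -` S"
  have [measurable]: "S' \<in> sets borel" unfolding S'_def using measurable_sets[OF mQ S] by simp
  define \<Psi> where "\<Psi> = (\<lambda>x. P (\<Theta> (Q x)))"
  have QS: "Q ` S' = S" unfolding S'_def by (rule surj_image_vimage_eq) (metis QP surjI)
  have Qax: "Q (axis j 1) = axis (h j) 1" for j
    by (auto simp: Q_def vec_eq_iff axis_def)
  have dm: "det (matrix (\<lambda>v. P (L (Q v)))) = det (matrix L)" for L :: "real^'n \<Rightarrow> real^'n"
  proof -
    have "matrix (\<lambda>v. P (L (Q v))) = (\<chi> i j. matrix L $ h i $ h j)"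
      by (simp add: matrix_def vec_eq_iff Qax P_def)
    then show ?thesis by (simp add: det_reindex[OF h])
  qed
  have "\<Psi> ` S' = P ` (\<Theta> ` S)" by (auto simp: \<Psi>_def QS[symmetric])
  then have "emeasure lebesgue (\<Theta> ` S) = emeasure lebesgue (\<Psi> ` S')"
    using emeasure_lebesgue_reindex[OF h im] by (simp add: P_def)
  also have "\<dots> = (\<integral>\<^sup>+x\<in>S'. ennreal (d (Q x)) \<partial>lborel)"
  proof (rule emeasure_differentiable_image_wo[where \<Theta>' = "\<lambda>x v. P (\<Theta>' (Q x) (Q v))"])
    fix x assume x: "x \<in> S'"
    then have Qx: "Q x \<in> S" by (simp add: S'_def)
    have "(\<Theta> has_derivative \<Theta>' (Q x)) (at (Q x) within Q ` S')" using der[OF Qx] by (simp add: QS)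
    from diff_chain_within[OF bounded_linear_imp_has_derivative[OF bl(2)] this]
    have "((\<lambda>x. \<Theta> (Q x)) has_derivative (\<lambda>v. \<Theta>' (Q x) (Q v))) (at x within S')"
      by (simp add: o_def)
    then show "(\<Psi> has_derivative (\<lambda>v. P (\<Theta>' (Q x) (Q v)))) (at x within S')"
      unfolding \<Psi>_def by (rule bounded_linear.has_derivative[OF bl(1)])
    show "d (Q x) = \<bar>det (matrix (\<lambda>v. P (\<Theta>' (Q x) (Q v))))\<bar>"
      using det[OF Qx] by (simp add: dm)
  next
    show "inj_on \<Psi> S'"
    proof (rule inj_onI)
      fix x y assume "x \<in> S'" "y \<in> S'" "\<Psi> x = \<Psi> y"
      then have "\<Theta> (Q x) = \<Theta> (Q y)" by (metis \<Psi>_def QP)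
      then have "Q x = Q y" using inj \<open>x \<in> S'\<close> \<open>y \<in> S'\<close> by (auto simp: S'_def inj_on_def)
      then show "x = y" by (metis PQ)
    qed
  qed measurable
  also have "\<dots> = (\<integral>\<^sup>+x. ennreal (d (Q (P x))) * indicator S' (P x) \<partial>lborel)"
    unfolding P_def by (rule nn_integral_reindex[OF h, symmetric]) measurable
  also have "\<dots> = (\<integral>\<^sup>+x\<in>S. ennreal (d x) \<partial>lborel)"
    by (intro nn_integral_cong) (auto simp: S'_def indicator_def)
  finally show "emeasure lebesgue (\<Theta> ` S) = (\<integral>\<^sup>+x\<in>S. ennreal (d x) \<partial>lborel)" .
qed

text \<open>Two Borel measures are compared: the push-forward of \<open>d\<close> times Lebesgue
  measure on \<open>S\<close>, and Lebesgue measure restricted to the image of \<open>S\<close>. The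
  volume formula for the part of \<open>S\<close> that maps into a Borel set \<open>A\<close> makes
  them agree on \<open>A\<close>; integrating \<open>f\<close> against both gives the claim.\<close>

theorem nn_integral_change_of_variables:
  fixes \<Theta> :: "real^'n \<Rightarrow> real^'n" and f :: "real^'n \<Rightarrow> ennreal"
  assumes S[measurable]: "S \<in> sets borel"
    and der: "\<And>x. x \<in> S \<Longrightarrow> (\<Theta> has_derivative \<Theta>' x) (at x within S)"
    and inj: "inj_on \<Theta> S"
    and d[measurable]: "d \<in> borel_measurable borel"
    and det: "\<And>x. x \<in> S \<Longrightarrow> d x = \<bar>det (matrix (\<Theta>' x))\<bar>"
    and f[measurable]: "f \<in> borel_measurable borel"
  shows "(\<integral>\<^sup>+y\<in>\<Theta> ` S. f y \<partial>lebesgue) = (\<integral>\<^sup>+x\<in>S. f (\<Theta> x) * ennreal (d x) \<partial>lborel)"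
proof -
  have im: "\<Theta> ` S \<in> sets lebesgue"
    by (rule emeasure_differentiable_image(1)[OF S der inj d det])
  have cont: "continuous_on S \<Theta>"
    using der by (auto simp: continuous_on_eq_continuous_within intro: has_derivative_continuous)
  \<comment> \<open>\<open>\<Theta>\<close> is continuous only on \<open>S\<close>; its extension by
    zero is Borel on the whole space, as \<open>distr\<close> requires.\<close>
  define \<Theta>0 where "\<Theta>0 = (\<lambda>x. if x \<in> S then \<Theta> x else 0)"
  have \<Theta>0[measurable]: "\<Theta>0 \<in> borel \<rightarrow>\<^sub>M borel"
    unfolding \<Theta>0_def using borel_measurable_continuous_on_if[OF S cont, of "\<lambda>_. 0"] by simp
  let ?M1 = "distr (density lborel (\<lambda>x. indicator S x * ennreal (d x))) borel \<Theta>0"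
  let ?M2 = "distr (density lebesgue (indicator (\<Theta> ` S))) borel (\<lambda>x. x)"
  have [measurable]: "(\<lambda>x. x) \<in> lebesgue \<rightarrow>\<^sub>M borel"
    by (simp add: measurable_completion)
  have "?M1 = ?M2"
  proof (rule measure_eqI)
    fix A assume "A \<in> sets ?M1"
    then have A[measurable]: "A \<in> sets borel" by simp
    define T where "T = S \<inter> \<Theta>0 -` A"
    have [measurable]: "T \<in> sets borel"
      unfolding T_def by (rule sets.Int[OF S measurable_sets_borel[OF \<Theta>0 A]])
    have TS: "T \<subseteq> S" by (auto simp: T_def)
    have img: "\<Theta> ` S \<inter> A = \<Theta> ` T" by (auto simp: T_def \<Theta>0_def)
    have "emeasure ?M2 A = emeasure (density lebesgue (indicator (\<Theta> ` S))) A"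
      by (subst emeasure_distr) (auto simp: measurable_completion)
    also have "\<dots> = (\<integral>\<^sup>+x. indicator (\<Theta> ` S) x * indicator A x \<partial>lebesgue)"
      using im by (subst emeasure_density) auto
    also have "\<dots> = emeasure lebesgue (\<Theta> ` S \<inter> A)"
      using im by (subst indicator_inter_arith[symmetric]) auto
    also have "\<dots> = (\<integral>\<^sup>+x\<in>T. ennreal (d x) \<partial>lborel)"
      unfolding img using TS der det inj
      by (intro emeasure_differentiable_image(2)[where \<Theta>' = \<Theta>'])
         (auto intro: has_derivative_subset inj_on_subset)
    also have "\<dots> = emeasure ?M1 A"
      by (subst emeasure_distr, simp, simp, subst emeasure_density)
        (auto simp: T_def indicator_def measurable_sets_borel[OF \<Theta>0 A] intro!: nn_integral_cong)
    finally show "emeasure ?M1 A = emeasure ?M2 A" by simp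
  qed simp
  then have "integral\<^sup>N ?M1 f = integral\<^sup>N ?M2 f" by simp
  moreover have "integral\<^sup>N ?M2 f = (\<integral>\<^sup>+y\<in>\<Theta> ` S. f y \<partial>lebesgue)"
    using im by (subst nn_integral_distr)
      (auto simp: nn_integral_density measurable_completion mult.commute)
  moreover have "integral\<^sup>N ?M1 f = (\<integral>\<^sup>+x\<in>S. f (\<Theta> x) * ennreal (d x) \<partial>lborel)"
  proof -
    have f\<Theta>: "(\<lambda>x. f (\<Theta>0 x)) \<in> borel_measurable borel"
      by (rule measurable_compose[OF \<Theta>0 f])
    have "integral\<^sup>N ?M1 f = (\<integral>\<^sup>+x. f (\<Theta>0 x) \<partial>density lborel (\<lambda>x. indicator S x * ennreal (d x)))"
      by (rule nn_integral_distr) simp_all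
    also have "\<dots> = (\<integral>\<^sup>+x. (indicator S x * ennreal (d x)) * f (\<Theta>0 x) \<partial>lborel)"
      by (rule nn_integral_density) (simp_all add: f\<Theta>)
    also have "\<dots> = (\<integral>\<^sup>+x\<in>S. f (\<Theta> x) * ennreal (d x) \<partial>lborel)"
      by (intro nn_integral_cong) (simp add: indicator_def \<Theta>0_def mult.commute)
    finally show ?thesis .
  qed
  ultimately show ?thesis by simp
qed

section \<open>Smooth maps and diffeomorphisms\<close>

lemma has_derivative_imp_differentiable: "(f has_derivative f') F \<Longrightarrow> f differentiable F"
  by (auto simp: differentiable_def)

lemma has_derivative_frechet_derivative: "f differentiable F \<Longrightarrow> (f has_derivative frechet_derivative f F) F"
  by (simp add: frechet_derivative_works[symmetric])

lemma smooth_on_subset: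
  assumes "smooth_on S f" "T \<subseteq> S"
  shows "smooth_on T f"
  unfolding smooth_on_def
proof
  fix x assume "x \<in> T"
  then obtain W F where W: "open W" "x \<in> W" "\<forall>k. C_k_on k F W" "\<forall>y\<in>S \<inter> W. F y = f y"
    using assms unfolding smooth_on_def by (meson subsetD)
  have "\<forall>y\<in>T \<inter> W. F y = f y" using W(4) assms(2) by auto
  then show "\<exists>W F. open W \<and> x \<in> W \<and> (\<forall>k. C_k_on k F W) \<and> (\<forall>y\<in>T \<inter> W. F y = f y)"
    using W(1-3) by blast
qed

lemma smooth_on_cong:
  assumes "smooth_on S f" "\<And>x. x \<in> S \<Longrightarrow> f x = g x"
  shows "smooth_on S g"
  unfolding smooth_on_def
proof
  fix x assume "x \<in> S"
  then obtain W F where W: "open W" "x \<in> W" "\<forall>k. C_k_on k F W" "\<forall>y\<in>S \<inter> W. F y = f y"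
    using assms(1) unfolding smooth_on_def by meson
  have "\<forall>y\<in>S \<inter> W. F y = g y" using W(4) assms(2) by auto
  then show "\<exists>W F. open W \<and> x \<in> W \<and> (\<forall>k. C_k_on k F W) \<and> (\<forall>y\<in>S \<inter> W. F y = g y)"
    using W(1-3) by blast
qed

lemma smooth_on_extension:
  assumes "smooth_on S f" "x \<in> S"
  obtains W F where "open W" "x \<in> W" "\<And>k. C_k_on k F W" "\<And>y. y \<in> S \<Longrightarrow> y \<in> W \<Longrightarrow> F y = f y"
proof -
  obtain W F where W: "open W" "x \<in> W" "\<forall>k. C_k_on k F W" "\<forall>y\<in>S \<inter> W. F y = f y"
    using assms unfolding smooth_on_def by meson
  show ?thesis by (rule that[of W F]) (use W in auto)
qed

lemma C_k_on_subset: "C_k_on k F W \<Longrightarrow> W' \<subseteq> W \<Longrightarrow> C_k_on k F W'"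
  by (induction k arbitrary: F) (auto intro: continuous_on_subset)

lemma C_k_on_1D:
  assumes "C_k_on (Suc 0) F W"
  shows "x \<in> W \<Longrightarrow> F differentiable (at x)" "continuous_on W (\<lambda>x. frechet_derivative F (at x) v)"
  using assms by auto

lemma smooth_on_imp_has_derivative:
  assumes "smooth_on S f" "x \<in> S"
  obtains f' where "(f has_derivative f') (at x within S)"
proof -
  obtain W F where W: "open W" "x \<in> W" and F: "\<And>k. C_k_on k F W" and eq: "\<And>y. y \<in> S \<Longrightarrow> y \<in> W \<Longrightarrow> F y = f y"
    using smooth_on_extension[OF assms] by metis
  obtain e where e: "e > 0" "ball x e \<subseteq> W" using W openE by blast
  have "(F has_derivative frechet_derivative F (at x)) (at x within S)"
    using C_k_on_1D(1)[OF F W(2)] by (simp add: frechet_derivative_works has_derivative_at_withinI)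
  then have "(f has_derivative frechet_derivative F (at x)) (at x within S)"
    by (rule has_derivative_transform_within[OF _ e(1) assms(2)])
      (use e eq in \<open>auto simp: dist_commute subset_iff\<close>)
  then show ?thesis ..
qed

lemma smooth_on_imp_differentiable_on: "smooth_on S f \<Longrightarrow> f differentiable_on S"
  by (metis differentiable_on_def differentiable_def smooth_on_imp_has_derivative)

lemma smooth_on_imp_continuous_on: "smooth_on S f \<Longrightarrow> continuous_on S f"
  by (simp add: differentiable_imp_continuous_on smooth_on_imp_differentiable_on)

lemma frechet_derivative_cong_open:
  assumes "open W" "x \<in> W" "\<And>y. y \<in> W \<Longrightarrow> F y = f y" "F differentiable (at x)"
  shows "f differentiable (at x)" "frechet_derivative f (at x) = frechet_derivative F (at x)"
proof -
  have "(F has_derivative frechet_derivative F (at x)) (at x)"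
    using assms(4) by (rule has_derivative_frechet_derivative)
  then have "(f has_derivative frechet_derivative F (at x)) (at x)"
    by (rule has_derivative_transform_within_open[OF _ assms(1,2,3)])
  then show "f differentiable (at x)" "frechet_derivative f (at x) = frechet_derivative F (at x)"
    by (rule has_derivative_imp_differentiable, rule frechet_derivative_at[symmetric])
qed

text \<open>On an open set the local extension agrees with \<open>f\<close> near each point, so both
  have the same derivatives and the ambient Frechet derivative of \<open>f\<close> itself can be
  used.\<close>

lemma smooth_on_open:
  assumes "open S" "smooth_on S f"
  shows "x \<in> S \<Longrightarrow> f differentiable (at x)" "continuous_on S (\<lambda>x. frechet_derivative f (at x) v)"
proof -
  have *: "f differentiable (at x) \<and> continuous (at x) (\<lambda>x. frechet_derivative f (at x) v)" if x: "x \<in> S" for x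
  proof -
    obtain W F where W: "open W" "x \<in> W" and F: "\<And>k. C_k_on k F W" and eq: "\<And>y. y \<in> S \<Longrightarrow> y \<in> W \<Longrightarrow> F y = f y"
      using smooth_on_extension[OF assms(2) x] by metis
    have o: "open (S \<inter> W)" "x \<in> S \<inter> W" using assms W x by auto
    have F1: "C_k_on (Suc 0) F (S \<inter> W)" by (rule C_k_on_subset[OF F]) simp
    have d: "frechet_derivative f (at y) = frechet_derivative F (at y)" "f differentiable (at y)" if "y \<in> S \<inter> W" for y
      using frechet_derivative_cong_open[OF o(1) that _ C_k_on_1D(1)[OF F1 that], of f] eq by auto
    have "continuous_on (S \<inter> W) (\<lambda>x. frechet_derivative f (at x) v)"
      by (subst continuous_on_cong[OF refl]) (use d C_k_on_1D(2)[OF F1] in auto)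
    then show ?thesis using o d continuous_on_eq_continuous_at by blast
  qed
  then show "x \<in> S \<Longrightarrow> f differentiable (at x)" by blast
  show "continuous_on S (\<lambda>x. frechet_derivative f (at x) v)"
    using * assms by (simp add: continuous_on_eq_continuous_at)
qed

lemma C_k_on_cong:
  assumes "open W" "\<And>x. x \<in> W \<Longrightarrow> f x = g x" "C_k_on k f W"
  shows "C_k_on k g W"
  using assms(2,3)
proof (induction k arbitrary: f g)
  case 0
  then show ?case using continuous_on_cong by (metis C_k_on.simps(1))
next
  case (Suc k)
  have d: "g differentiable (at x) \<and> frechet_derivative g (at x) = frechet_derivative f (at x)" if x: "x \<in> W" for x
  proof -
    have "f differentiable (at x)" using Suc.prems x by auto
    then show ?thesis
      using frechet_derivative_cong_open[OF assms(1) x, of f g] Suc.prems(1) by blast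
  qed
  have "C_k_on k (\<lambda>x. frechet_derivative g (at x) v) W" for v
    by (rule Suc.IH[of "\<lambda>x. frechet_derivative f (at x) v"]) (use d Suc.prems in auto)
  then show ?case using d by auto
qed

lemma C_k_on_const: "C_k_on k (\<lambda>x. c) W"
  by (induction k arbitrary: c) auto

text \<open>The scalar \<open>c\<close> lets the induction close: differentiating the line in
  direction \<open>v\<close> multiplies \<open>c\<close> by \<open>v\<close> and replaces
  \<open>f\<close> by its derivative along \<open>e\<close>.\<close>

lemma C_k_on_line:
  fixes f :: "'a::euclidean_space \<Rightarrow> 'b::real_normed_vector"
  assumes "open W" "C_k_on k f W"
  shows "C_k_on k (\<lambda>t::real. c *\<^sub>R f (a + t *\<^sub>R e)) {t. a + t *\<^sub>R e \<in> W}"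
  using assms(2)
proof (induction k arbitrary: f c)
  case 0
  then show ?case by (auto intro!: continuous_intros continuous_on_compose2[of W f])
next
  case (Suc k)
  let ?W = "{t. a + t *\<^sub>R e \<in> W}"
  have oW: "open ?W"
  proof -
    have "continuous_on UNIV (\<lambda>t. a + t *\<^sub>R e)" by (intro continuous_intros)
    from open_vimage[OF \<open>open W\<close> this] show ?thesis by (simp add: vimage_def)
  qed
  have d: "((\<lambda>t. c *\<^sub>R f (a + t *\<^sub>R e)) has_derivative (\<lambda>v. (c * v) *\<^sub>R frechet_derivative f (at (a + t *\<^sub>R e)) e)) (at t)"
    if t: "t \<in> ?W" for t
  proof -
    have f: "(f has_derivative frechet_derivative f (at (a + t *\<^sub>R e))) (at (a + t *\<^sub>R e))"
      by (rule has_derivative_frechet_derivative) (use Suc.prems t in auto)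
    have "((\<lambda>t. f (a + t *\<^sub>R e)) has_derivative (\<lambda>v. frechet_derivative f (at (a + t *\<^sub>R e)) (v *\<^sub>R e))) (at t)"
      by (rule has_derivative_compose[where f = "\<lambda>t. a + t *\<^sub>R e" and f' = "\<lambda>v. v *\<^sub>R e" and g = f])
        (auto intro!: derivative_eq_intros f)
    then have "((\<lambda>t. c *\<^sub>R f (a + t *\<^sub>R e)) has_derivative (\<lambda>v. c *\<^sub>R frechet_derivative f (at (a + t *\<^sub>R e)) (v *\<^sub>R e))) (at t)"
      by (rule has_derivative_scaleR_right)
    moreover have "frechet_derivative f (at (a + t *\<^sub>R e)) (v *\<^sub>R e) = v *\<^sub>R frechet_derivative f (at (a + t *\<^sub>R e)) e" for v
      using has_derivative_linear[OF f] by (simp add: linear_cmul)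
    ultimately show ?thesis by simp
  qed
  show ?case
  proof (simp only: C_k_on.simps, intro conjI ballI allI)
    fix t assume "t \<in> ?W"
    then show "(\<lambda>t. c *\<^sub>R f (a + t *\<^sub>R e)) differentiable at t" using d differentiable_def by blast
  next
    fix v
    have "C_k_on k (\<lambda>t. (c * v) *\<^sub>R (\<lambda>x. frechet_derivative f (at x) e) (a + t *\<^sub>R e)) ?W"
      by (rule Suc.IH) (use Suc.prems in auto)
    then show "C_k_on k (\<lambda>x. frechet_derivative (\<lambda>t. c *\<^sub>R f (a + t *\<^sub>R e)) (at x) v) ?W"
      by (rule C_k_on_cong[OF oW, rotated]) (simp add: frechet_derivative_at[OF d, symmetric])
  qed
qed

lemma C_k_on_Pair:
  assumes "open W" "C_k_on k f W" "C_k_on k g W"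
  shows "C_k_on k (\<lambda>x. (f x, g x)) W"
  using assms(2,3)
proof (induction k arbitrary: f g)
  case 0
  then show ?case by (auto intro: continuous_on_Pair)
next
  case (Suc k)
  have d: "((\<lambda>x. (f x, g x)) has_derivative (\<lambda>v. (frechet_derivative f (at x) v, frechet_derivative g (at x) v))) (at x)"
    if "x \<in> W" for x
    using Suc.prems that by (intro has_derivative_Pair has_derivative_frechet_derivative) auto
  show ?case
  proof (simp only: C_k_on.simps, intro conjI ballI allI)
    fix t assume "t \<in> W"
    then show "(\<lambda>x. (f x, g x)) differentiable at t" using d differentiable_def by blast
  next
    fix v
    have "C_k_on k (\<lambda>x. (frechet_derivative f (at x) v, frechet_derivative g (at x) v)) W"
      by (rule Suc.IH) (use Suc.prems in auto)
    then show "C_k_on k (\<lambda>x. frechet_derivative (\<lambda>x. (f x, g x)) (at x) v) W"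
      by (rule C_k_on_cong[OF assms(1), rotated]) (simp add: frechet_derivative_at[OF d, symmetric])
  qed
qed

lemma C_k_on_affine: "C_k_on k (\<lambda>t::real. a + t *\<^sub>R b) W"
proof (cases k)
  case (Suc m)
  have "((\<lambda>t::real. a + t *\<^sub>R b) has_derivative (\<lambda>v. v *\<^sub>R b)) (at t)" for t
    by (auto intro!: derivative_eq_intros)
  then have "frechet_derivative (\<lambda>t::real. a + t *\<^sub>R b) (at t) = (\<lambda>v. v *\<^sub>R b)" "(\<lambda>t::real. a + t *\<^sub>R b) differentiable (at t)" for t
    by (metis frechet_derivative_at, metis has_derivative_imp_differentiable)
  then show ?thesis by (simp add: Suc C_k_on_const)
qed (auto intro!: continuous_intros)

text \<open>The chain rule for the two compositions, each the identity on an open set, makes the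
  Frechet derivatives at corresponding points mutually inverse. The facts form a record that is
  addressed by position later on.\<close>

lemma diffeomorphism_facts:
  fixes \<psi> :: "'a::euclidean_space \<Rightarrow> 'a"
  assumes "open V" "open W" "diffeomorphism V W \<psi>"
  defines "\<phi> \<equiv> the_inv_into V \<psi>"
  shows "inj_on \<psi> V" "\<psi> ` V = W" "\<phi> ` W = V"
    "\<And>y. y \<in> V \<Longrightarrow> \<phi> (\<psi> y) = y" "\<And>x. x \<in> W \<Longrightarrow> \<psi> (\<phi> x) = x"
    "\<And>y. y \<in> V \<Longrightarrow> \<psi> y \<in> W" "\<And>x. x \<in> W \<Longrightarrow> \<phi> x \<in> V"
    "\<And>y. y \<in> V \<Longrightarrow> (\<psi> has_derivative frechet_derivative \<psi> (at y)) (at y)"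
    "\<And>x. x \<in> W \<Longrightarrow> (\<phi> has_derivative frechet_derivative \<phi> (at x)) (at x)"
    "\<And>y v. y \<in> V \<Longrightarrow> frechet_derivative \<phi> (at (\<psi> y)) (frechet_derivative \<psi> (at y) v) = v"
    "\<And>y v. y \<in> V \<Longrightarrow> frechet_derivative \<psi> (at y) (frechet_derivative \<phi> (at (\<psi> y)) v) = v"
    "smooth_on V \<psi>" "smooth_on W \<phi>" "continuous_on V \<psi>" "continuous_on W \<phi>"
proof -
  have s: "smooth_on V \<psi>" "smooth_on W \<phi>" and b: "bij_betw \<psi> V W"
    using assms by (auto simp: diffeomorphism_def)
  show inj: "inj_on \<psi> V" and im: "\<psi> ` V = W" using b by (auto simp: bij_betw_def)
  show "smooth_on V \<psi>" "smooth_on W \<phi>" by fact+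
  show "continuous_on V \<psi>" "continuous_on W \<phi>" using s smooth_on_imp_continuous_on by auto
  show i1: "\<phi> (\<psi> y) = y" if "y \<in> V" for y using the_inv_into_f_f[OF inj that] by (simp add: \<phi>_def)
  show i2: "\<psi> (\<phi> x) = x" if "x \<in> W" for x
    using f_the_inv_into_f[OF inj, of x] im that by (simp add: \<phi>_def)
  show iW: "\<psi> y \<in> W" if "y \<in> V" for y using im that by auto
  show iV: "\<phi> x \<in> V" if "x \<in> W" for x using i1 im that by auto
  show "\<phi> ` W = V" using i1 iW iV by (force simp: image_iff)
  show d1: "(\<psi> has_derivative frechet_derivative \<psi> (at y)) (at y)" if "y \<in> V" for y
    using smooth_on_open(1)[OF assms(1) s(1) that] by (simp add: frechet_derivative_works)
  show d2: "(\<phi> has_derivative frechet_derivative \<phi> (at x)) (at x)" if "x \<in> W" for x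
    using smooth_on_open(1)[OF assms(2) s(2) that] by (simp add: frechet_derivative_works)
  show "frechet_derivative \<phi> (at (\<psi> y)) (frechet_derivative \<psi> (at y) v) = v" if y: "y \<in> V" for y v
  proof -
    have "((\<lambda>y. \<phi> (\<psi> y)) has_derivative (\<lambda>v. frechet_derivative \<phi> (at (\<psi> y)) (frechet_derivative \<psi> (at y) v))) (at y)"
      by (rule has_derivative_compose[OF d1[OF y] d2[OF iW[OF y]]])
    then have "((\<lambda>y. y) has_derivative (\<lambda>v. frechet_derivative \<phi> (at (\<psi> y)) (frechet_derivative \<psi> (at y) v))) (at y)"
      by (rule has_derivative_transform_within_open[OF _ assms(1) y]) (rule i1)
    from has_derivative_unique[OF this has_derivative_ident] show ?thesis by (rule fun_cong)
  qed
  show "frechet_derivative \<psi> (at y) (frechet_derivative \<phi> (at (\<psi> y)) v) = v" if y: "y \<in> V" for y v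
  proof -
    have "((\<lambda>x. \<psi> (\<phi> x)) has_derivative (\<lambda>v. frechet_derivative \<psi> (at y) (frechet_derivative \<phi> (at (\<psi> y)) v))) (at (\<psi> y))"
      by (rule has_derivative_compose[OF d2[OF iW[OF y]]]) (simp add: i1 d1 y)
    then have "((\<lambda>y. y) has_derivative (\<lambda>v. frechet_derivative \<psi> (at y) (frechet_derivative \<phi> (at (\<psi> y)) v))) (at (\<psi> y))"
      by (rule has_derivative_transform_within_open[OF _ assms(2) iW[OF y]]) (rule i2)
    from has_derivative_unique[OF this has_derivative_ident] show ?thesis by (rule fun_cong)
  qed
qed

lemma diffeomorphism_inverse:
  fixes \<psi> :: "'a::euclidean_space \<Rightarrow> 'a"
  assumes "open V" "open W" "diffeomorphism V W \<psi>"
  shows "diffeomorphism W V (the_inv_into V \<psi>)"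
proof -
  note f = diffeomorphism_facts[OF assms]
  have b: "bij_betw (the_inv_into V \<psi>) W V"
    using f(1,2) bij_betw_the_inv_into by (metis bij_betw_def)
  have "the_inv_into W (the_inv_into V \<psi>) y = \<psi> y" if "y \<in> V" for y
    using b f(4)[OF that] f(6)[OF that] by (metis bij_betw_def the_inv_into_f_f)
  then have "smooth_on V (the_inv_into W (the_inv_into V \<psi>))"
    by (intro smooth_on_cong[OF f(12)]) simp
  with b f(13) show ?thesis by (simp add: diffeomorphism_def)
qed

lemma diffeomorphism_restrict:
  assumes "diffeomorphism V W \<psi>" "W' \<subseteq> W"
  shows "diffeomorphism (V \<inter> \<psi> -` W') W' \<psi>"
proof -
  let ?V = "V \<inter> \<psi> -` W'"
  have b: "inj_on \<psi> V" "\<psi> ` V = W" "smooth_on V \<psi>" "smooth_on W (the_inv_into V \<psi>)"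
    using assms(1) by (auto simp: diffeomorphism_def bij_betw_def)
  have i': "inj_on \<psi> ?V" by (rule inj_on_subset[OF b(1)]) simp
  have im': "\<psi> ` ?V = W'" using b(2) assms(2) by fastforce
  then have b': "bij_betw \<psi> ?V W'" using i' by (simp add: bij_betw_def)
  have "the_inv_into V \<psi> x = the_inv_into ?V \<psi> x" if "x \<in> W'" for x
  proof -
    have "x \<in> \<psi> ` ?V" using im' that by simp
    then obtain y where y: "y \<in> ?V" "x = \<psi> y" by (rule imageE) simp
    then show ?thesis
      using the_inv_into_f_f[OF b(1), of y] the_inv_into_f_f[OF i' y(1)] by simp
  qed
  then have "smooth_on W' (the_inv_into ?V \<psi>)"
    by (intro smooth_on_cong[OF smooth_on_subset[OF b(4) assms(2)]]) simp
  then show ?thesis using b' smooth_on_subset[OF b(3)] by (simp add: diffeomorphism_def)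
qed

section \<open>Charts and thin sets\<close>

text \<open>The inverse of the charts in \<open>corner_points\<close>: \<open>\<psi>\<close> leads
  from the flat model into the space, like the parametrizations in
  \<open>is_riemannian_volume\<close>. No point is required to correspond to the origin, so a
  restriction to a smaller open set is again a chart.\<close>

definition chart :: "nat \<Rightarrow> 'a::euclidean_space set \<Rightarrow> 'a set \<Rightarrow> 'a set \<Rightarrow> ('a \<Rightarrow> 'a) \<Rightarrow> 'a set \<Rightarrow> bool" where
  "chart k N V W \<psi> K \<longleftrightarrow> open V \<and> open W \<and> diffeomorphism V W \<psi> \<and> K \<subseteq> Basis \<and> card K = k \<and>
     \<psi> ` (V \<inter> span K) = N \<inter> W"

lemma submanifold_chart:
  fixes N :: "'a::euclidean_space set"
  assumes "submanifold k N" "x \<in> N"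
  obtains V W \<psi> K where "chart k N V W \<psi> K" "x \<in> W"
proof -
  have "x \<in> corner_points k 0 N" using assms by (auto simp: submanifold_def)
  then obtain W V K C :: "'a set" and \<phi> :: "'a \<Rightarrow> 'a" where *: "open W" "open V" "x \<in> W" "diffeomorphism W V \<phi>"
     "K \<subseteq> Basis" "card K = k" "C \<subseteq> K" "card C = 0"
     "\<phi> ` (N \<inter> W) = V \<inter> {y \<in> span K. \<forall>b\<in>C. 0 \<le> b \<bullet> y}"
    unfolding corner_points_def by blast
  \<comment> \<open>\<open>card C = 0\<close> alone would admit an infinite \<open>C\<close>, but a
    subset of \<open>Basis\<close> is finite. With \<open>C\<close> empty the corner conditions
    disappear.\<close>
  have "C = {}" using *(5,7,8) by (metis card_eq_0_iff finite_Basis infinite_super)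
  then have im: "\<phi> ` (N \<inter> W) = V \<inter> span K" using * by auto
  define \<psi> where "\<psi> = the_inv_into W \<phi>"
  note f = diffeomorphism_facts[OF *(1,2,4), folded \<psi>_def]
  have "\<psi> ` (V \<inter> span K) = N \<inter> W"
    unfolding im[symmetric] image_image using f(4) by (simp cong: image_cong_simp)
  then have "chart k N V W \<psi> K"
    using * diffeomorphism_inverse[OF *(1,2,4)] by (simp add: chart_def \<psi>_def)
  then show ?thesis using that *(3) by blast
qed

lemma chart_restrict:
  assumes "chart k N V W \<psi> K" "open W'" "W' \<subseteq> W"
  shows "chart k N (V \<inter> \<psi> -` W') W' \<psi> K"
proof -
  have c: "open V" "open W" "diffeomorphism V W \<psi>" "K \<subseteq> Basis" "card K = k" "\<psi> ` (V \<inter> span K) = N \<inter> W"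
    using assms(1) by (auto simp: chart_def)
  have "open (V \<inter> \<psi> -` W')"
    by (rule continuous_open_preimage[OF diffeomorphism_facts(14)[OF c(1,2,3)] c(1) assms(2)])
  moreover have "\<psi> ` (V \<inter> \<psi> -` W' \<inter> span K) = N \<inter> W'"
  proof -
    have "\<psi> ` (V \<inter> \<psi> -` W' \<inter> span K) = \<psi> ` (V \<inter> span K) \<inter> W'" by auto
    then show ?thesis using c(6) assms(3) by auto
  qed
  ultimately show ?thesis
    using c diffeomorphism_restrict[OF c(3) assms(3)] assms(2) by (simp add: chart_def)
qed

lemma chart_cong:
  assumes "chart k N V W \<psi> K" "N \<inter> W = N' \<inter> W"
  shows "chart k N' V W \<psi> K"
  using assms by (simp add: chart_def)

lemma chart_mem:
  assumes c: "chart k N V W \<psi> K" and x: "x \<in> W"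
  shows "x \<in> N \<longleftrightarrow> the_inv_into V \<psi> x \<in> span K"
proof -
  have c': "open V" "open W" "diffeomorphism V W \<psi>" "\<psi> ` (V \<inter> span K) = N \<inter> W"
    using c by (auto simp: chart_def)
  note f = diffeomorphism_facts[OF c'(1-3)]
  show ?thesis
  proof
    assume "x \<in> N"
    then have "x \<in> \<psi> ` (V \<inter> span K)" using x c'(4) by simp
    then obtain y where "y \<in> V" "y \<in> span K" "x = \<psi> y" by blast
    then show "the_inv_into V \<psi> x \<in> span K" using f(4) by simp
  next
    assume a: "the_inv_into V \<psi> x \<in> span K"
    have "\<psi> (the_inv_into V \<psi> x) \<in> \<psi> ` (V \<inter> span K)" using a f(7)[OF x] by blast
    then show "x \<in> N" using f(5)[OF x] c'(4) by simp
  qed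
qed

section \<open>Countable covers and the passage from local to global\<close>

lemma countable_local_cover:
  fixes N :: "'a::second_countable_topology set"
  assumes "\<And>x. x \<in> N \<Longrightarrow> \<exists>W. open W \<and> x \<in> W \<and> P W"
  obtains \<W> where "countable \<W>" "\<And>W. W \<in> \<W> \<Longrightarrow> open W \<and> P W" "N \<subseteq> \<Union>\<W>"
proof -
  obtain \<W> where W: "\<W> \<subseteq> {W. open W \<and> P W}" "countable \<W>" "\<Union>\<W> = \<Union>{W. open W \<and> P W}"
    by (rule Lindelof[of "{W. open W \<and> P W}"]) auto
  have "N \<subseteq> \<Union>{W. open W \<and> P W}"
  proof
    fix x assume "x \<in> N"
    from assms[OF this] show "x \<in> \<Union>{W. open W \<and> P W}" by auto
  qed
  then show ?thesis using W by (intro that[of \<W>]) auto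
qed

text \<open>Like \<open>submanifold\<close>, without the requirement that the chart at \<open>x\<close> sends \<open>x\<close> to \<open>0\<close>.\<close>

definition charted :: "nat \<Rightarrow> 'a::euclidean_space set \<Rightarrow> bool" where
  "charted k N \<longleftrightarrow> (\<forall>x\<in>N. \<exists>V W \<psi> K. chart k N V W \<psi> K \<and> x \<in> W)"

lemma chartedE:
  assumes "charted k N" "x \<in> N"
  obtains V W \<psi> K where "chart k N V W \<psi> K" "x \<in> W"
  using assms unfolding charted_def by blast

lemma submanifold_charted: "submanifold k N \<Longrightarrow> charted k N"
  unfolding charted_def using submanifold_chart by metis

text \<open>In a chart, \<open>N\<close> is the preimage of the closed subspace
  \<open>span K\<close> under the continuous inverse chart, hence Borel; countably many charts cover
  \<open>N\<close>.\<close>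

lemma charted_borel:
  assumes "charted k N"
  shows "N \<in> sets borel"
proof -
  have "\<exists>W. open W \<and> x \<in> W \<and> N \<inter> W \<in> sets borel" if x: "x \<in> N" for x
  proof -
    obtain V W \<psi> K where c: "chart k N V W \<psi> K" "x \<in> W" by (rule chartedE[OF assms x]) (rule that)
    then have c': "open V" "open W" "diffeomorphism V W \<psi>" by (auto simp: chart_def)
    note f = diffeomorphism_facts[OF c']
    have "N \<inter> W = W \<inter> the_inv_into V \<psi> -` span K" using chart_mem[OF c(1)] by auto
    also have "\<dots> \<in> sets borel"
    proof -
      have "the_inv_into V \<psi> \<in> borel_measurable (restrict_space borel W)"
        by (rule borel_measurable_continuous_on_restrict[OF f(15)])
      then have "the_inv_into V \<psi> -` span K \<inter> space (restrict_space borel W) \<in> sets (restrict_space borel W)"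
        by (rule measurable_sets) (simp add: closed_subspace)
      then show ?thesis
        using c'(2) by (simp add: space_restrict_space sets_restrict_space_iff Int_commute)
    qed
    finally show ?thesis using c c' by blast
  qed
  from countable_local_cover[OF this] obtain \<W> where
    W: "countable \<W>" "\<And>W. W \<in> \<W> \<Longrightarrow> open W \<and> N \<inter> W \<in> sets borel" "N \<subseteq> \<Union>\<W>" by blast
  have "N = (\<Union>W\<in>\<W>. N \<inter> W)" using W(3) by auto
  also have "\<dots> \<in> sets borel" using W by (intro sets.countable_UN') auto
  finally show ?thesis .
qed

text \<open>A set of dimension at most \<open>k\<close>, in a sense that is stable under differentiable maps.\<close>

definition thin :: "nat \<Rightarrow> 'b::euclidean_space set \<Rightarrow> bool" where
  "thin k A \<longleftrightarrow> (\<exists>\<Z>::(('b \<Rightarrow> 'b) \<times> 'b set) set. countable \<Z> \<and>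
     (\<forall>(c, Z)\<in>\<Z>. c differentiable_on Z \<and> (\<exists>T. subspace T \<and> dim T \<le> k \<and> Z \<subseteq> T)) \<and>
     A \<subseteq> (\<Union>(c, Z)\<in>\<Z>. c ` Z))"

lemma thinE:
  assumes "thin k A"
  obtains \<Z> :: "(('b::euclidean_space \<Rightarrow> 'b) \<times> 'b set) set" where "countable \<Z>"
     "\<And>c Z. (c, Z) \<in> \<Z> \<Longrightarrow> c differentiable_on Z" "\<And>c Z. (c, Z) \<in> \<Z> \<Longrightarrow> \<exists>T. subspace T \<and> dim T \<le> k \<and> Z \<subseteq> T"
     "A \<subseteq> (\<Union>(c, Z)\<in>\<Z>. c ` Z)"
proof -
  from assms obtain \<Z> :: "(('b \<Rightarrow> 'b) \<times> 'b set) set" where Z: "countable \<Z>"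
     "\<forall>(c, Z)\<in>\<Z>. c differentiable_on Z \<and> (\<exists>T. subspace T \<and> dim T \<le> k \<and> Z \<subseteq> T)"
     "A \<subseteq> (\<Union>(c, Z)\<in>\<Z>. c ` Z)"
    unfolding thin_def by (elim exE conjE) (rule that)
  show ?thesis
    by (rule that[OF Z(1) _ _ Z(3)]) (use Z(2) in auto)
qed

lemma thin_subset: "thin k A \<Longrightarrow> B \<subseteq> A \<Longrightarrow> thin k B"
  unfolding thin_def by (meson order_trans)

lemma thin_UN:
  fixes A :: "'i \<Rightarrow> 'b::euclidean_space set"
  assumes "countable I" "\<And>i. i \<in> I \<Longrightarrow> thin k (A i)"
  shows "thin k (\<Union>i\<in>I. A i)"
proof -
  define P where "P i \<Z> \<longleftrightarrow> countable \<Z> \<and>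
     (\<forall>(c, Z)\<in>\<Z>. c differentiable_on Z \<and> (\<exists>T. subspace T \<and> dim T \<le> k \<and> Z \<subseteq> T)) \<and>
     A i \<subseteq> (\<Union>(c, Z)\<in>\<Z>. c ` Z)" for i and \<Z> :: "(('b \<Rightarrow> 'b) \<times> 'b set) set"
  have "\<forall>i\<in>I. \<exists>\<Z>. P i \<Z>"
    using assms(2) unfolding thin_def P_def by simp
  from bchoice[OF this] obtain \<Z> where "\<forall>i\<in>I. P i (\<Z> i)" ..
  then have Z: "\<And>i. i \<in> I \<Longrightarrow> countable (\<Z> i)"
     "\<And>i. i \<in> I \<Longrightarrow> \<forall>(c, Z)\<in>\<Z> i. c differentiable_on Z \<and> (\<exists>T. subspace T \<and> dim T \<le> k \<and> Z \<subseteq> T)"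
     "\<And>i. i \<in> I \<Longrightarrow> A i \<subseteq> (\<Union>(c, Z)\<in>\<Z> i. c ` Z)" by (simp_all add: P_def)
  have "countable (\<Union>i\<in>I. \<Z> i)" using assms(1) Z(1) by blast
  moreover have "\<forall>(c, Z)\<in>\<Union>i\<in>I. \<Z> i. c differentiable_on Z \<and> (\<exists>T. subspace T \<and> dim T \<le> k \<and> Z \<subseteq> T)"
    using Z(2) by blast
  moreover have "(\<Union>i\<in>I. A i) \<subseteq> (\<Union>(c, Z)\<in>\<Union>i\<in>I. \<Z> i. c ` Z)"
  proof
    fix x assume "x \<in> (\<Union>i\<in>I. A i)"
    then obtain i where i: "i \<in> I" "x \<in> A i" by blast
    then have "x \<in> (\<Union>(c, Z)\<in>\<Z> i. c ` Z)" using Z(3) by blast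
    then show "x \<in> (\<Union>(c, Z)\<in>\<Union>i\<in>I. \<Z> i. c ` Z)" using i(1) by blast
  qed
  ultimately show ?thesis unfolding thin_def by (intro exI[of _ "\<Union>i\<in>I. \<Z> i"] conjI)
qed

lemma thin_local:
  fixes A :: "'b::euclidean_space set"
  assumes "\<And>x. x \<in> A \<Longrightarrow> \<exists>W. open W \<and> x \<in> W \<and> thin k (A \<inter> W)"
  shows "thin k A"
proof -
  obtain \<W> where W: "countable \<W>" "\<And>W. W \<in> \<W> \<Longrightarrow> open W \<and> thin k (A \<inter> W)" "A \<subseteq> \<Union>\<W>"
    using countable_local_cover[of A "\<lambda>W. thin k (A \<inter> W)"] assms by blast
  have "thin k (\<Union>W\<in>\<W>. A \<inter> W)" using W by (intro thin_UN) auto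
  then show ?thesis by (rule thin_subset) (use W(3) in auto)
qed

text \<open>The pieces of a thin set are parametrized from the ambient type itself, so for the image
  they must move from a subspace \<open>T\<close> of \<open>'b\<close> into \<open>'d\<close>. A
  subspace of \<open>'d\<close> of the same dimension exists because \<open>k \<le> DIM('d)\<close>;
  the isometry \<open>a\<close> and its inverse \<open>b\<close> carry the piece there and
  back.\<close>

lemma thin_image:
  fixes f :: "'b::euclidean_space \<Rightarrow> 'd::euclidean_space"
  assumes "thin k A" "f differentiable_on A" "k \<le> DIM('d)"
  shows "thin k (f ` A)"
proof -
  obtain \<Z> :: "(('b \<Rightarrow> 'b) \<times> 'b set) set" where Z: "countable \<Z>"
     "\<And>c Z. (c, Z) \<in> \<Z> \<Longrightarrow> c differentiable_on Z" "\<And>c Z. (c, Z) \<in> \<Z> \<Longrightarrow> \<exists>T. subspace T \<and> dim T \<le> k \<and> Z \<subseteq> T"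
     "A \<subseteq> (\<Union>(c, Z)\<in>\<Z>. c ` Z)"
    by (rule thinE[OF assms(1)]) (rule that)
  have one: "thin k (f ` (A \<inter> c ` Z))" if cZ: "(c, Z) \<in> \<Z>" for c Z
  proof -
    obtain T where T: "subspace T" "dim T \<le> k" "Z \<subseteq> T" using Z(3)[OF cZ] by blast
    define Z' where "Z' = Z \<inter> c -` A"
    have img: "f ` (A \<inter> c ` Z) = (\<lambda>z. f (c z)) ` Z'" by (auto simp: Z'_def)
    have d: "(\<lambda>z. f (c z)) differentiable_on Z'"
    proof (rule differentiable_on_compose[where f = f and g = c])
      show "c differentiable_on Z'" using Z(2)[OF cZ] by (rule differentiable_on_subset) (auto simp: Z'_def)
      show "f differentiable_on c ` Z'" using assms(2) by (rule differentiable_on_subset) (auto simp: Z'_def)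
    qed
    have "dim T \<le> dim (UNIV :: 'd set)" using T(2) assms(3) by simp
    then obtain S :: "'d set" where S: "subspace S" "dim S = dim T"
      using choose_subspace_of_subspace[of "dim T" "UNIV :: 'd set"] by auto
    obtain a b where ab: "linear a" "linear b" "a ` T = S" "b ` S = T" "\<And>x. x \<in> T \<Longrightarrow> b (a x) = x"
      by (rule isometries_subspaces[OF T(1) S(1) S(2)[symmetric]]) blast
    have ba: "b ` a ` Z' = Z'" using ab(5) T(3) by (force simp: Z'_def image_image)
    have "(\<lambda>z. f (c (b z))) differentiable_on (a ` Z')"
      by (rule differentiable_on_compose[where f = "\<lambda>z. f (c z)" and g = b])
        (auto simp: ba d intro: linear_imp_differentiable_on ab)
    moreover have "a ` Z' \<subseteq> S" using T(3) ab(3) by (auto simp: Z'_def)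
    moreover have "(\<lambda>z. f (c (b z))) ` (a ` Z') = f ` (A \<inter> c ` Z)"
    proof -
      have "(\<lambda>z. f (c (b z))) ` (a ` Z') = (\<lambda>z. f (c z)) ` (b ` a ` Z')" by (simp only: image_image)
      then show ?thesis by (simp only: ba img)
    qed
    ultimately show ?thesis
      unfolding thin_def using S T(2)
      by (intro exI[of _ "{(\<lambda>z. f (c (b z)), a ` Z')}"]) auto
  qed
  have "thin k (\<Union>p\<in>\<Z>. f ` (A \<inter> fst p ` snd p))"
  proof (rule thin_UN[OF Z(1)])
    fix p assume "p \<in> \<Z>"
    then show "thin k (f ` (A \<inter> fst p ` snd p))" using one[of "fst p" "snd p"] by simp
  qed
  moreover have "A \<subseteq> (\<Union>p\<in>\<Z>. fst p ` snd p)" using Z(4) by (simp add: case_prod_beta)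
  then have "f ` A \<subseteq> (\<Union>p\<in>\<Z>. f ` (A \<inter> fst p ` snd p))" by blast
  ultimately show ?thesis by (rule thin_subset)
qed

text \<open>A subset of a proper subspace is negligible, and a differentiable self-map of the space
  keeps it negligible; there are only countably many pieces.\<close>

lemma thin_negligible:
  fixes A :: "'b::euclidean_space set"
  assumes "thin k A" "k < DIM('b)"
  shows "negligible A"
proof -
  obtain \<Z> :: "(('b \<Rightarrow> 'b) \<times> 'b set) set" where Z: "countable \<Z>"
     "\<And>c Z. (c, Z) \<in> \<Z> \<Longrightarrow> c differentiable_on Z" "\<And>c Z. (c, Z) \<in> \<Z> \<Longrightarrow> \<exists>T. subspace T \<and> dim T \<le> k \<and> Z \<subseteq> T"
     "A \<subseteq> (\<Union>(c, Z)\<in>\<Z>. c ` Z)"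
    by (rule thinE[OF assms(1)]) (rule that)
  have "negligible (c ` Z)" if cZ: "(c, Z) \<in> \<Z>" for c Z
  proof -
    obtain T where T: "subspace T" "dim T \<le> k" "Z \<subseteq> T" using Z(3)[OF cZ] by blast
    have "negligible Z"
      using negligible_subset[OF negligible_lowdim[of T]] T assms(2) by auto
    then show ?thesis
      by (rule negligible_differentiable_image_negligible[OF order_refl _ Z(2)[OF cZ]])
  qed
  then have "negligible (\<Union>((\<lambda>(c, Z). c ` Z) ` \<Z>))"
    using Z(1) by (intro negligible_countable_Union) auto
  then show ?thesis using Z(4) by (rule negligible_subset)
qed

lemma thin_submanifold:
  fixes N :: "'a::euclidean_space set"
  assumes "submanifold k N"
  shows "thin k N"
proof (rule thin_local)
  fix x assume x: "x \<in> N"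
  obtain V W \<psi> K where c: "chart k N V W \<psi> K" "x \<in> W" using submanifold_chart[OF assms x] .
  then have c': "open V" "open W" "diffeomorphism V W \<psi>" "K \<subseteq> Basis" "card K = k" "\<psi> ` (V \<inter> span K) = N \<inter> W"
    by (auto simp: chart_def)
  have d: "\<psi> differentiable_on (V \<inter> span K)"
    using smooth_on_imp_differentiable_on[OF diffeomorphism_facts(12)[OF c'(1-3)]]
    by (rule differentiable_on_subset) auto
  have "dim (span K) \<le> k"
    using c'(4,5) dim_le_card'[of K] by (simp add: finite_subset)
  then have "thin k (N \<inter> W)"
    unfolding thin_def using d c'(6)
    by (intro exI[of _ "{(\<psi>, V \<inter> span K)}"]) auto
  then show "\<exists>W. open W \<and> x \<in> W \<and> thin k (N \<inter> W)" using c c' by blast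
qed

lemma thin_Times_real:
  fixes A :: "'b::euclidean_space set"
  assumes "thin k A"
  shows "thin (Suc k) (A \<times> (UNIV :: real set))"
proof -
  obtain \<Z> :: "(('b \<Rightarrow> 'b) \<times> 'b set) set" where Z: "countable \<Z>"
     "\<And>c Z. (c, Z) \<in> \<Z> \<Longrightarrow> c differentiable_on Z" "\<And>c Z. (c, Z) \<in> \<Z> \<Longrightarrow> \<exists>T. subspace T \<and> dim T \<le> k \<and> Z \<subseteq> T"
     "A \<subseteq> (\<Union>(c, Z)\<in>\<Z>. c ` Z)"
    by (rule thinE[OF assms]) (rule that)
  have one: "thin (Suc k) (c ` Z \<times> (UNIV :: real set))" if cZ: "(c, Z) \<in> \<Z>" for c Z
  proof -
    obtain T where T: "subspace T" "dim T \<le> k" "Z \<subseteq> T" using Z(3)[OF cZ] by blast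
    let ?c = "\<lambda>p::'b \<times> real. (c (fst p), snd p)"
    have "?c differentiable_on (Z \<times> UNIV)"
    proof -
      have d: "(\<lambda>p::'b \<times> real. c (fst p)) differentiable_on (Z \<times> UNIV)"
        by (rule differentiable_on_compose[where f = c and g = fst])
          (use Z(2)[OF cZ] in \<open>auto intro!: linear_imp_differentiable_on linear_fst\<close>)
      show ?thesis
        unfolding differentiable_on_def
      proof
        fix p :: "'b \<times> real" assume p: "p \<in> Z \<times> UNIV"
        obtain D where "((\<lambda>p::'b \<times> real. c (fst p)) has_derivative D) (at p within Z \<times> UNIV)"
          using d p unfolding differentiable_on_def differentiable_def by blast
        from has_derivative_Pair[OF this has_derivative_snd[OF has_derivative_ident]]
        show "?c differentiable (at p within Z \<times> UNIV)" by (rule has_derivative_imp_differentiable)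
      qed
    qed
    moreover have "subspace (T \<times> (UNIV :: real set))" using T(1) by (intro subspace_Times) auto
    moreover have "dim (T \<times> (UNIV :: real set)) \<le> Suc k"
      using T by (subst dim_Times) auto
    moreover have "Z \<times> UNIV \<subseteq> T \<times> (UNIV :: real set)" using T(3) by auto
    moreover have "c ` Z \<times> UNIV \<subseteq> ?c ` (Z \<times> (UNIV :: real set))" by (auto simp: image_iff)
    ultimately show ?thesis
      unfolding thin_def by (intro exI[of _ "{(?c, Z \<times> UNIV)}"]) auto
  qed
  have "thin (Suc k) (\<Union>p\<in>\<Z>. fst p ` snd p \<times> (UNIV :: real set))"
  proof (rule thin_UN[OF Z(1)])
    fix p assume "p \<in> \<Z>"
    then show "thin (Suc k) (fst p ` snd p \<times> (UNIV :: real set))" using one[of "fst p" "snd p"] by simp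
  qed
  moreover have "A \<subseteq> (\<Union>p\<in>\<Z>. fst p ` snd p)" using Z(4) by (simp add: case_prod_beta)
  then have "A \<times> (UNIV :: real set) \<subseteq> (\<Union>p\<in>\<Z>. fst p ` snd p \<times> UNIV)" by blast
  ultimately show ?thesis by (rule thin_subset)
qed

section \<open>Determinants on hyperplanes\<close>

text \<open>The entry \<open>r k\<close> is irrelevant. In use, the other rows are tangent to a
  hypersurface and \<open>v\<close> is a direction transversal to it; the rows stand for the columns
  of a Jacobian matrix, with the same determinant.\<close>

definition row_det :: "'n::finite \<Rightarrow> ('n \<Rightarrow> real^'n) \<Rightarrow> real^'n \<Rightarrow> real" where
  "row_det k r v = det (\<chi> i. if i = k then v else r i)"

lemma row_det_cong: "(\<And>i. i \<noteq> k \<Longrightarrow> r i = r' i) \<Longrightarrow> row_det k r v = row_det k r' v"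
  unfolding row_det_def by (rule arg_cong[of _ _ det]) (simp add: vec_eq_iff)

lemma row_det_linear: "row_det k r (a *\<^sub>R v + b *\<^sub>R w) = a * row_det k r v + b * row_det k r w"
proof -
  have s: "c *\<^sub>R x = c *s x" for c and x :: "real^'a" by (simp add: vec_eq_iff)
  show ?thesis
  unfolding s
  using det_row_add[of k "\<lambda>_. a *s v" "\<lambda>_. b *s w" r] det_row_mul[of k a "\<lambda>_. v" r] det_row_mul[of k b "\<lambda>_. w" r]
  by (simp add: row_det_def)
qed

text \<open>All rows are orthogonal to \<open>\<nu>\<close>, so \<open>\<nu>\<close> is a nonzero
  vector in the kernel of the matrix.\<close>

lemma row_det_orthogonal_eq_0:
  assumes "\<nu> \<noteq> 0" "\<And>i. i \<noteq> k \<Longrightarrow> r i \<bullet> \<nu> = 0" "v \<bullet> \<nu> = 0"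
  shows "row_det k r v = 0"
proof -
  let ?A = "\<chi> i. if i = k then v else r i"
  have "?A *v \<nu> = 0"
    using assms(2,3) by (auto simp: vec_eq_iff matrix_vector_mult_def inner_vec_def mult.commute)
  then have "\<not> invertible ?A"
    using assms(1) by (metis invertible_def matrix_left_invertible_ker)
  then show ?thesis by (simp add: row_det_def invertible_det_nz)
qed

lemma row_det_normal:
  assumes "norm \<nu> = 1" "\<And>i. i \<noteq> k \<Longrightarrow> r i \<bullet> \<nu> = 0"
  shows "row_det k r v = (v \<bullet> \<nu>) * row_det k r \<nu>"
proof -
  have "\<nu> \<noteq> 0" "\<nu> \<bullet> \<nu> = 1" using assms(1) by (auto simp: norm_eq_1)
  then have "row_det k r (v - (v \<bullet> \<nu>) *\<^sub>R \<nu>) = 0"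
    using assms by (intro row_det_orthogonal_eq_0[of \<nu>]) (auto simp: inner_diff_left)
  then show ?thesis
    using row_det_linear[of k r 1 v "- (v \<bullet> \<nu>)" \<nu>] by (simp add: algebra_simps)
qed

text \<open>Let \<open>?A\<close> have \<open>\<nu>\<close> as row \<open>k\<close> and the vectors
  \<open>f (axis i 1)\<close> as its other rows. Since \<open>\<nu>\<close> is a unit vector
  orthogonal to these, the inner products of the rows form exactly the Gram matrix completed by the
  identity block, that is, \<open>?A ** transpose ?A\<close>.\<close>

lemma gram_det_row_det:
  fixes f :: "real^'n \<Rightarrow> real^'n"
  assumes "norm \<nu> = 1" "\<And>i. i \<noteq> k \<Longrightarrow> f (axis i 1) \<bullet> \<nu> = 0"
  shows "gram_det (Basis - {axis k 1}) f = (row_det k (\<lambda>i. f (axis i 1)) \<nu>)\<^sup>2"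
proof -
  let ?A = "\<chi> i. if i = k then \<nu> else f (axis i 1)"
  have nn: "\<nu> \<bullet> \<nu> = 1" using assms(1) by (simp add: norm_eq_1)
  have "gram_det (Basis - {axis k 1}) f = det (?A ** transpose ?A)"
  proof -
    have b: "axis i 1 \<in> Basis - {axis k 1 :: real^'n} \<longleftrightarrow> i \<noteq> k" for i
      by (auto simp: axis_in_Basis_iff axis_eq_axis)
    have e: "(?A ** transpose ?A) $ i $ j = ?A $ i \<bullet> ?A $ j" for i j
      by (simp add: matrix_matrix_mult_def transpose_def inner_vec_def)
    have "(if i \<noteq> k \<and> j \<noteq> k then f (axis i 1) \<bullet> f (axis j 1) else if i = j then 1 else 0) = ?A $ i \<bullet> ?A $ j" for i j
      using assms(2)[of i] assms(2)[of j] nn by (auto simp: inner_commute)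
    then show ?thesis
      unfolding gram_det_def b by (intro arg_cong[of _ _ det]) (simp add: vec_eq_iff[of "_ :: real^'n^'n"] vec_eq_iff[of "_ :: real^'n"] e del: vec_lambda_beta, simp)
  qed
  also have "\<dots> = (det ?A)\<^sup>2"
    by (simp add: det_mul power2_eq_square)
  finally show ?thesis by (simp add: row_det_def)
qed

text \<open>The shifted matrix is \<open>?C\<close> times the original one. The transpose of
  \<open>?C\<close> differs from the identity only in row \<open>k\<close>, by a combination of the
  other rows of the identity, so \<open>det ?C = 1\<close>.\<close>

lemma row_det_shift:
  fixes k :: "'n::finite"
  shows "row_det k (\<lambda>i. r i + c i *\<^sub>R v) v = row_det k r v"
proof -
  let ?C = "(\<chi> i j. if i = j then 1 else if j = k \<and> i \<noteq> k then c i else 0) :: real^'n^'n"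
  let ?A = "\<chi> i. if i = k then v else r i"
  let ?B = "\<chi> i. if i = k then v else r i + c i *\<^sub>R v"
  have "?B = ?C ** ?A"
  proof -
    have "(?C ** ?A) $ i = ?B $ i" for i
    proof -
      have "(?C ** ?A) $ i = (\<Sum>j\<in>UNIV. ?C $ i $ j *\<^sub>R ?A $ j)"
        by (simp add: vec_eq_iff matrix_matrix_mult_def)
      also have "\<dots> = ?A $ i + (if i = k then 0 else c i *\<^sub>R v)"
      proof (cases "i = k")
        case True
        then have "(\<Sum>j\<in>UNIV. ?C $ i $ j *\<^sub>R ?A $ j) = (\<Sum>j\<in>UNIV. if j = k then v else 0)"
          by (intro sum.cong) auto
        then show ?thesis using True by simp
      next
        case False
        then have "(\<Sum>j\<in>UNIV. ?C $ i $ j *\<^sub>R ?A $ j) = (\<Sum>j\<in>UNIV. (if j = i then r i else 0) + (if j = k then c i *\<^sub>R v else 0))"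
          by (intro sum.cong) auto
        then show ?thesis using False by (simp add: sum.distrib)
      qed
      finally show ?thesis by simp
    qed
    then show ?thesis by (simp add: vec_eq_iff)
  qed
  moreover have "det ?C = 1"
  proof -
    have "det (transpose ?C) = det (\<chi> l. if l = k then row k (mat 1) + (\<Sum>j\<in>UNIV - {k}. c j *s row j (mat 1)) else row l (mat 1 :: real^'n^'n))"
    proof (rule arg_cong[of _ _ det])
      show "transpose ?C = (\<chi> l. if l = k then row k (mat 1) + (\<Sum>j\<in>UNIV - {k}. c j *s row j (mat 1)) else row l (mat 1 :: real^'n^'n))"
      proof -
        have "(\<Sum>j\<in>UNIV - {k}. c j *s row j (mat 1 :: real^'n^'n)) $ m = (if m = k then 0 else c m)" for m
        proof -
          have "(\<Sum>j\<in>UNIV - {k}. c j *s row j (mat 1 :: real^'n^'n)) $ m = (\<Sum>j\<in>UNIV - {k}. if j = m then c m else 0)"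
            unfolding sum_component by (intro sum.cong) (auto simp: row_def mat_def)
          also have "\<dots> = (if m = k then 0 else c m)" by (subst sum.delta) auto
          finally show ?thesis .
        qed
        then show ?thesis
          by (simp only: vec_eq_iff transpose_def row_def mat_def vec_lambda_beta vector_add_component if_distrib[of "\<lambda>v. v $ _"]) auto
      qed
    qed
    also have "\<dots> = det (mat 1 :: real^'n^'n)"
    proof (rule det_row_span)
      show "(\<Sum>j\<in>UNIV - {k}. c j *s row j (mat 1)) \<in> vec.span {row j (mat 1 :: real^'n^'n) |j. j \<noteq> k}"
        by (intro vec.span_sum vec.span_scale vec.span_base) auto
    qed
    finally show ?thesis by simp
  qed
  ultimately have "det ?B = det ?A" by (simp add: det_mul)
  then show ?thesis by (simp add: row_det_def)
qed

lemma det_matrix_rows: "det (matrix L) = det (\<chi> i. L (axis i 1))"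
proof -
  have "matrix L = transpose (\<chi> i. L (axis i 1))" by (simp add: matrix_def transpose_def vec_eq_iff)
  then show ?thesis by simp
qed

lemma det_matrix_row_det:
  "det (matrix L) = row_det k (\<lambda>i. L (axis i 1)) (L (axis k 1))"
  unfolding det_matrix_rows row_det_def by (rule arg_cong[of _ _ det]) (simp add: vec_eq_iff)

section \<open>Oblique and orthogonal projection onto a hyperplane\<close>

lemma proj_along_unique:
  assumes "subspace T" "v \<notin> T" "z \<in> T" "w - z \<in> span {v}"
  shows "proj_along T v w = z"
  unfolding proj_along_def
proof (rule the_equality)
  fix z' assume z': "z' \<in> T \<and> w - z' \<in> span {v}"
  have "(w - z) - (w - z') \<in> span {v}" by (rule span_diff[OF assms(4) conjunct2[OF z']])
  then obtain c where c: "z' - z = c *\<^sub>R v" by (auto simp: span_singleton)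
  have "z' - z \<in> T" using z' assms by (intro subspace_diff) auto
  then have "c = 0 \<or> v \<in> T" using c assms(1) by (metis subspace_scale scaleR_scaleR left_inverse scaleR_one)
  then show "z' = z" using c assms(2) by auto
qed (use assms in auto)

lemma hyperplane_decomp:
  fixes T :: "'a::euclidean_space set"
  assumes T: "T = {z. z \<bullet> \<nu> = 0}" and v: "v \<bullet> \<nu> \<noteq> 0"
  shows "proj_along T v w = w - ((w \<bullet> \<nu>) / (v \<bullet> \<nu>)) *\<^sub>R v"
proof (rule proj_along_unique)
  show "subspace T" unfolding T using subspace_hyperplane[of \<nu>] by (simp add: inner_commute)
qed (use v in \<open>auto simp: T inner_diff_left span_singleton\<close>)

lemma closest_point_hyperplane:
  fixes T :: "'a::euclidean_space set"
  assumes T: "T = {z. z \<bullet> \<nu> = 0}" and n: "norm \<nu> = 1"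
  shows "closest_point T w = w - (w \<bullet> \<nu>) *\<^sub>R \<nu>"
proof (rule closest_point_unique[symmetric])
  have s: "subspace T" unfolding T using subspace_hyperplane[of \<nu>] by (simp add: inner_commute)
  then show "convex T" "closed T" by (simp_all add: subspace_imp_convex closed_subspace)
  have nn: "\<nu> \<bullet> \<nu> = 1" using n by (simp add: norm_eq_1)
  then show "w - (w \<bullet> \<nu>) *\<^sub>R \<nu> \<in> T" by (simp add: T inner_diff_left)
  show "\<forall>z\<in>T. dist w (w - (w \<bullet> \<nu>) *\<^sub>R \<nu>) \<le> dist w z"
  proof
    fix z assume "z \<in> T"
    then have "\<bar>(w - z) \<bullet> \<nu>\<bar> = \<bar>w \<bullet> \<nu>\<bar>" by (simp add: T inner_diff_left)
    moreover have "\<bar>(w - z) \<bullet> \<nu>\<bar> \<le> norm (w - z)" using Cauchy_Schwarz_ineq2[of "w - z" \<nu>] n by simp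
    ultimately show "dist w (w - (w \<bullet> \<nu>) *\<^sub>R \<nu>) \<le> dist w z" using n by (simp add: dist_norm)
  qed
qed

text \<open>Here \<open>f\<close> is the derivative of a parametrization of the hypersurface, composed with the
  projection that drops the \<open>k\<close>-th coordinate, and \<open>v\<close> is the radial direction.\<close>

lemma det_on_hyperplane:
  fixes f :: "real^'n \<Rightarrow> real^'n"
  assumes T: "T = {z. z \<bullet> \<nu> = 0}" and n: "norm \<nu> = 1" and v: "v \<bullet> \<nu> \<noteq> 0"
    and f: "\<And>i. i \<noteq> k \<Longrightarrow> f (axis i 1) \<in> T"
    and A: "linear A" "\<And>w. w \<in> T \<Longrightarrow> A w \<in> T"
    and g: "\<And>i. i \<noteq> k \<Longrightarrow> g i - A (f (axis i 1)) \<in> span {v}"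
  shows "det_on T A * row_det k (\<lambda>i. f (axis i 1)) v = row_det k g v"
proof -
  have nn: "\<nu> \<bullet> \<nu> = 1" using n by (simp add: norm_eq_1)
  let ?P = "closest_point T"
  have P: "?P w = w - (w \<bullet> \<nu>) *\<^sub>R \<nu>" for w by (rule closest_point_hyperplane[OF T n])
  \<comment> \<open>\<open>m\<close> is the endomorphism from the definition of
    \<open>det_on\<close>: it is \<open>A\<close> on \<open>T\<close> and the identity on the normal
    line.\<close>
  define m where "m = (\<lambda>w. A (?P w) + (w - ?P w))"
  have lin: "linear m"
    unfolding m_def P using A(1)
    by (intro linearI) (auto simp: linear_add linear_diff linear_cmul inner_add_left algebra_simps)
  have mT: "m w = A w" if "w \<in> T" for w using that unfolding m_def P by (simp add: T)
  have m\<nu>: "m \<nu> = \<nu>" using A(1) nn by (simp add: m_def P linear_0)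
  \<comment> \<open>\<open>L\<close> sends the \<open>k\<close>-th coordinate vector to
    \<open>\<nu>\<close> and the others to the \<open>f (axis i 1)\<close>. Multiplicativity of the
    determinant of \<open>m \<circ> L\<close> yields the claim with \<open>\<nu>\<close> as the
    transversal direction; passing from \<open>\<nu>\<close> to \<open>v\<close> multiplies both
    sides by \<open>v \<bullet> \<nu>\<close>.\<close>
  define L where "L = (\<lambda>w::real^'n. (\<Sum>i\<in>UNIV - {k}. (w $ i) *\<^sub>R f (axis i 1)) + (w $ k) *\<^sub>R \<nu>)"
  have Lax: "L (axis i 1) = (if i = k then \<nu> else f (axis i 1))" for i
  proof -
    have "(\<Sum>j\<in>UNIV - {k}. ((axis i 1 :: real^'n) $ j) *\<^sub>R f (axis j 1)) = (\<Sum>j\<in>UNIV - {k}. if j = i then f (axis i 1) else 0)"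
      by (intro sum.cong) (auto simp: axis_def)
    then show ?thesis by (auto simp: L_def axis_def sum.delta)
  qed
  have linL: "linear L"
    unfolding L_def by (intro linearI) (auto simp: algebra_simps sum.distrib scaleR_sum_right)
  have "row_det k (\<lambda>i. A (f (axis i 1))) \<nu> = det (matrix (m \<circ> L))"
    unfolding det_matrix_row_det[of _ k]
    using row_det_cong[of k "\<lambda>i. (m \<circ> L) (axis i 1)" "\<lambda>i. A (f (axis i 1))"] mT f m\<nu>
    by (simp add: Lax)
  also have "\<dots> = det (matrix m) * det (matrix L)"
    by (simp add: matrix_compose[OF linL lin] det_mul)
  also have "det (matrix L) = row_det k (\<lambda>i. f (axis i 1)) \<nu>"
    unfolding det_matrix_row_det[of _ k]
    using row_det_cong[of k "\<lambda>i. L (axis i 1)" "\<lambda>i. f (axis i 1)"]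
    by (simp add: Lax)
  also have "det (matrix m) = det_on T A" by (simp add: det_on_def m_def)
  finally have 1: "row_det k (\<lambda>i. A (f (axis i 1))) \<nu> = det_on T A * row_det k (\<lambda>i. f (axis i 1)) \<nu>" .
  have 2: "row_det k (\<lambda>i. f (axis i 1)) v = (v \<bullet> \<nu>) * row_det k (\<lambda>i. f (axis i 1)) \<nu>"
    using f by (intro row_det_normal[OF n]) (auto simp: T)
  have 3: "row_det k (\<lambda>i. A (f (axis i 1))) v = (v \<bullet> \<nu>) * row_det k (\<lambda>i. A (f (axis i 1))) \<nu>"
  proof (rule row_det_normal[OF n])
    fix i assume "i \<noteq> k"
    then have "A (f (axis i 1)) \<in> T" using f A(2) by blast
    then show "A (f (axis i 1)) \<bullet> \<nu> = 0" by (simp add: T)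
  qed
  have "\<forall>i. \<exists>c. i \<noteq> k \<longrightarrow> g i - A (f (axis i 1)) = c *\<^sub>R v"
    using g by (fastforce simp: span_singleton)
  then obtain c where c: "\<And>i. i \<noteq> k \<Longrightarrow> g i - A (f (axis i 1)) = c i *\<^sub>R v" by metis
  have "row_det k g v = row_det k (\<lambda>i. A (f (axis i 1)) + c i *\<^sub>R v) v"
    by (rule row_det_cong) (use c in \<open>simp add: algebra_simps\<close>)
  also have "\<dots> = row_det k (\<lambda>i. A (f (axis i 1))) v" by (rule row_det_shift)
  finally show ?thesis using 1 2 3 by simp
qed

section \<open>Coordinate hyperplanes and tangent spaces\<close>

abbreviation drop_coord :: "'n::finite \<Rightarrow> real^'n \<Rightarrow> real^'n" where
  "drop_coord k z \<equiv> z - (z $ k) *\<^sub>R axis k 1"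

lemma sets_coord_lborel[simp, measurable_cong]: "sets (coord_lborel K) = sets borel"
  by (simp add: coord_lborel_def)

lemma space_coord_lborel[simp]: "space (coord_lborel K) = UNIV"
  by (simp add: coord_lborel_def)

lemma span_Basis_minus:
  "span (Basis - {axis k 1 :: real^'n}) = {y. y $ k = 0}"
proof -
  have "span (Basis - {axis k 1 :: real^'n}) = {x. \<forall>i\<in>Basis. i \<notin> Basis - {axis k 1} \<longrightarrow> x \<bullet> i = 0}"
    by (rule span_substd_basis) auto
  also have "\<dots> = {x. x \<bullet> axis k 1 = 0}" by (auto simp: axis_in_Basis_iff)
  finally show ?thesis by (simp add: inner_axis)
qed

lemma drop_coord_in_span: "drop_coord k z \<in> span (Basis - {axis k 1})"
  by (simp add: span_Basis_minus)

lemma drop_coord_add: "y \<in> span (Basis - {axis k 1}) \<Longrightarrow> drop_coord k (y + s *\<^sub>R axis k 1) = y"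
  and coord_add: "y \<in> span (Basis - {axis k 1}) \<Longrightarrow> (y + s *\<^sub>R axis k 1) $ k = s"
  by (simp_all add: span_Basis_minus)

lemma linear_drop_coord: "linear (drop_coord k)"
  by (intro linearI) (auto simp: algebra_simps)

lemma measurable_drop_coord[measurable]: "drop_coord k \<in> borel \<rightarrow>\<^sub>M borel"
  by (intro borel_measurable_continuous_onI linear_continuous_on)
    (use linear_drop_coord in \<open>simp add: linear_conv_bounded_linear\<close>)

lemma codim1_coord_subset:
  assumes "K \<subseteq> (Basis :: (real^'n) set)" "card K = CARD('n) - 1"
  obtains k where "K = Basis - {axis k 1 :: real^'n}"
proof -
  have fin: "finite K" using assms(1) by (rule finite_subset) simp
  have "card ((Basis :: (real^'n) set) - K) = card (Basis :: (real^'n) set) - card K"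
    using fin assms(1) by (simp add: card_Diff_subset)
  also have "\<dots> = 1" using assms(2) zero_less_card_finite[where 'a='n] by (simp add: card_cart_basis)
  finally obtain b where b: "Basis - K = {b}" by (auto simp: card_1_singleton_iff)
  then have "b \<in> Basis" by auto
  then obtain k where "b = axis k 1" by (auto simp: Basis_vec_def)
  then have "K = Basis - {axis k 1 :: real^'n}" using b assms(1) by blast
  then show ?thesis by (rule that)
qed

lemma AE_coord_lborel:
  assumes "K \<subseteq> Basis"
  shows "AE y in coord_lborel K. y \<in> span K"
proof -
  have [measurable]: "(\<lambda>f. \<Sum>b\<in>K. f b *\<^sub>R b) \<in> (\<Pi>\<^sub>M b\<in>K. lborel) \<rightarrow>\<^sub>M borel" by measurable
  have "(\<Sum>b\<in>K. f b *\<^sub>R b) \<in> span K" for f by (intro span_sum span_scale span_base)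
  moreover have "{x \<in> space borel. x \<in> span K} \<in> sets borel" by (simp add: closed_subspace borel_closed)
  ultimately show ?thesis
    unfolding coord_lborel_def by (subst AE_distr_iff) auto
qed

text \<open>Lebesgue measure is a product over \<open>Basis\<close>; the factor of the coordinate
  \<open>k\<close> is split off as the inner integral.\<close>

lemma nn_integral_lborel_slices:
  fixes f :: "real^'n \<Rightarrow> ennreal"
  assumes f[measurable]: "f \<in> borel_measurable borel"
  shows "(\<integral>\<^sup>+z. f z \<partial>lborel) =
    (\<integral>\<^sup>+y. (\<integral>\<^sup>+s. f (y + s *\<^sub>R axis k 1) \<partial>lborel) \<partial>coord_lborel (Basis - {axis k 1}))"
proof -
  let ?b = "axis k 1 :: real^'n"
  let ?K = "Basis - {?b}"
  interpret product_sigma_finite "\<lambda>_::real^'n. lborel :: real measure" ..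
  have B: "Basis = insert ?b ?K" by (auto simp: axis_in_Basis_iff)
  have [measurable]: "(\<lambda>h. \<Sum>b\<in>?K. h b *\<^sub>R b) \<in> (\<Pi>\<^sub>M b\<in>?K. lborel) \<rightarrow>\<^sub>M borel" by measurable
  have [measurable]: "(\<lambda>h. \<Sum>b\<in>Basis. h b *\<^sub>R b) \<in> (\<Pi>\<^sub>M b\<in>Basis. lborel) \<rightarrow>\<^sub>M (borel :: (real^'n) measure)" by measurable
  have m2: "(\<lambda>h. f (\<Sum>b\<in>Basis. h b *\<^sub>R b)) \<in> borel_measurable (\<Pi>\<^sub>M b\<in>Basis. lborel)" by measurable
  have "(\<integral>\<^sup>+z. f z \<partial>lborel) = (\<integral>\<^sup>+h. f (\<Sum>b\<in>Basis. h b *\<^sub>R b) \<partial>(\<Pi>\<^sub>M b\<in>Basis. lborel))"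
    by (subst lborel_eq, subst nn_integral_distr) simp_all
  also have "\<dots> = (\<integral>\<^sup>+h. f (\<Sum>b\<in>Basis. h b *\<^sub>R b) \<partial>(\<Pi>\<^sub>M b\<in>insert ?b ?K. lborel))"
    by (simp only: B[symmetric])
  also have "\<dots> = (\<integral>\<^sup>+h. (\<integral>\<^sup>+s. f (\<Sum>b\<in>Basis. (h(?b := s)) b *\<^sub>R b) \<partial>lborel) \<partial>(\<Pi>\<^sub>M b\<in>?K. lborel))"
  proof (rule product_nn_integral_insert)
    show "(\<lambda>h. f (\<Sum>b\<in>Basis. h b *\<^sub>R b)) \<in> borel_measurable (\<Pi>\<^sub>M b\<in>insert ?b ?K. lborel)"
      using m2 by (simp only: B[symmetric])
  qed auto
  also have "\<dots> = (\<integral>\<^sup>+h. (\<integral>\<^sup>+s. f ((\<Sum>b\<in>?K. h b *\<^sub>R b) + s *\<^sub>R ?b) \<partial>lborel) \<partial>(\<Pi>\<^sub>M b\<in>?K. lborel))"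
  proof -
    have "(\<Sum>b\<in>Basis. (h(?b := s)) b *\<^sub>R b) = (\<Sum>b\<in>?K. h b *\<^sub>R b) + s *\<^sub>R ?b" for h :: "real^'n \<Rightarrow> real" and s
    proof -
      have "(\<Sum>b\<in>Basis. (h(?b := s)) b *\<^sub>R b) = (\<Sum>b\<in>insert ?b ?K. (h(?b := s)) b *\<^sub>R b)"
        by (simp only: B[symmetric])
      also have "\<dots> = s *\<^sub>R ?b + (\<Sum>b\<in>?K. (h(?b := s)) b *\<^sub>R b)"
        by (subst sum.insert) auto
      also have "(\<Sum>b\<in>?K. (h(?b := s)) b *\<^sub>R b) = (\<Sum>b\<in>?K. h b *\<^sub>R b)"
        by (intro sum.cong) auto
      finally show ?thesis by simp
    qed
    then show ?thesis by simp
  qed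
  also have "\<dots> = (\<integral>\<^sup>+y. (\<integral>\<^sup>+s. f (y + s *\<^sub>R ?b) \<partial>lborel) \<partial>coord_lborel ?K)"
    unfolding coord_lborel_def by (subst nn_integral_distr) simp_all
  finally show ?thesis .
qed

text \<open>Unit thickness: integrating over \<open>0 < s < 1\<close> in the omitted direction does
  not change the value. Integrals over a coordinate hyperplane thereby become integrals over the
  whole space, where the change of variables formula applies.\<close>

lemma nn_integral_coord_lborel:
  fixes g :: "real^'n \<Rightarrow> ennreal"
  assumes g[measurable]: "g \<in> borel_measurable borel"
  shows "(\<integral>\<^sup>+y. g y \<partial>coord_lborel (Basis - {axis k 1})) =
    (\<integral>\<^sup>+z. g (drop_coord k z) * indicator {0<..<1} (z $ k) \<partial>lborel)"
proof -
  let ?K = "Basis - {axis k 1 :: real^'n}"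
  have "(\<lambda>z. g (drop_coord k z)) \<in> borel_measurable borel"
    by (rule measurable_compose[OF measurable_drop_coord g])
  then have "(\<integral>\<^sup>+z. g (drop_coord k z) * indicator {0<..<1} (z $ k) \<partial>lborel) =
     (\<integral>\<^sup>+y. (\<integral>\<^sup>+s. g (drop_coord k (y + s *\<^sub>R axis k 1)) * indicator {0<..<1} ((y + s *\<^sub>R axis k 1) $ k) \<partial>lborel) \<partial>coord_lborel ?K)"
    by (intro nn_integral_lborel_slices) measurable
  also have "\<dots> = (\<integral>\<^sup>+y. (\<integral>\<^sup>+s. g y * indicator {0<..<1::real} s \<partial>lborel) \<partial>coord_lborel ?K)"
    by (intro nn_integral_cong_AE AE_mp[OF AE_coord_lborel AE_I2] impI)
      (auto simp: drop_coord_add coord_add simp del: vector_add_component vector_scaleR_component)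
  also have "\<dots> = (\<integral>\<^sup>+y. g y \<partial>coord_lborel ?K)"
    by (simp add: nn_integral_cmult_indicator)
  finally show ?thesis by simp
qed

section \<open>Curves and tangent spaces in charts\<close>

lemma smooth_on_line:
  fixes \<psi> :: "'a::euclidean_space \<Rightarrow> 'b::real_normed_vector"
  assumes "open V" "smooth_on V \<psi>" "\<And>t. t \<in> S \<Longrightarrow> a + t *\<^sub>R e \<in> V"
  shows "smooth_on S (\<lambda>t::real. \<psi> (a + t *\<^sub>R e))"
  unfolding smooth_on_def
proof
  fix t assume t: "t \<in> S"
  obtain W F where W: "open W" "a + t *\<^sub>R e \<in> W" and F: "\<And>k. C_k_on k F W" "\<And>y. y \<in> V \<Longrightarrow> y \<in> W \<Longrightarrow> F y = \<psi> y"
    using smooth_on_extension[OF assms(2) assms(3)[OF t]] by metis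
  let ?T = "{t. a + t *\<^sub>R e \<in> W}"
  have c: "continuous_on UNIV (\<lambda>t::real. a + t *\<^sub>R e)" by (intro continuous_intros)
  have "open ?T" using open_vimage[OF W(1) c] by (simp add: vimage_def)
  moreover have "C_k_on k (\<lambda>t. F (a + t *\<^sub>R e)) ?T" for k
    using C_k_on_line[OF W(1) F(1)[of k], of 1 a e] by simp
  ultimately show "\<exists>W F. open W \<and> t \<in> W \<and> (\<forall>k. C_k_on k F W) \<and> (\<forall>y\<in>S \<inter> W. F y = \<psi> (a + y *\<^sub>R e))"
    using W(2) F(2) assms(3) by (intro exI[of _ ?T] exI[of _ "\<lambda>t. F (a + t *\<^sub>R e)"]) simp
qed

lemma smooth_on_Pair:
  assumes "smooth_on S f" "smooth_on S g"
  shows "smooth_on S (\<lambda>x. (f x, g x))"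
  unfolding smooth_on_def
proof
  fix x assume x: "x \<in> S"
  obtain W F where W: "open W" "x \<in> W" and F: "\<And>k. C_k_on k F W" "\<And>y. y \<in> S \<Longrightarrow> y \<in> W \<Longrightarrow> F y = f y"
    using smooth_on_extension[OF assms(1) x] by metis
  obtain W' G where W': "open W'" "x \<in> W'" and G: "\<And>k. C_k_on k G W'" "\<And>y. y \<in> S \<Longrightarrow> y \<in> W' \<Longrightarrow> G y = g y"
    using smooth_on_extension[OF assms(2) x] by metis
  have o: "open (W \<inter> W')" by (rule open_Int[OF W(1) W'(1)])
  have "C_k_on k (\<lambda>x. (F x, G x)) (W \<inter> W')" for k
    by (rule C_k_on_Pair[OF o C_k_on_subset[OF F(1)] C_k_on_subset[OF G(1)]]) auto
  then show "\<exists>W H. open W \<and> x \<in> W \<and> (\<forall>k. C_k_on k H W) \<and> (\<forall>y\<in>S \<inter> W. H y = (f y, g y))"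
    using o W W' F(2) G(2) by (intro exI[of _ "W \<inter> W'"] exI[of _ "\<lambda>x. (F x, G x)"]) simp
qed

lemma smooth_on_affine: "smooth_on S (\<lambda>t::real. a + t *\<^sub>R b)"
  unfolding smooth_on_def
  by (intro ballI exI[of _ UNIV] exI[of _ "\<lambda>t::real. a + t *\<^sub>R b"]) (auto intro: C_k_on_affine)

text \<open>\<open>tangent_cone\<close> asks for curves on all of \<open>[0, 1)\<close>, so the
  straight line in the chart is slowed down by the factor \<open>e\<close> until it stays in
  \<open>V\<close>; its velocity is scaled by the same factor.\<close>

lemma chart_curve:
  assumes c: "chart k N V W \<psi> K" and y: "y \<in> V" "y \<in> span K" and v: "v \<in> span K"
  obtains e where "e > 0" "\<And>t. t \<in> {0..<1::real} \<Longrightarrow> y + t *\<^sub>R (e *\<^sub>R v) \<in> V"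
    "\<And>t. t \<in> {0..<1::real} \<Longrightarrow> \<psi> (y + t *\<^sub>R (e *\<^sub>R v)) \<in> N"
    "smooth_on {0..<1} (\<lambda>t. \<psi> (y + t *\<^sub>R (e *\<^sub>R v)))"
    "((\<lambda>t. \<psi> (y + t *\<^sub>R (e *\<^sub>R v))) has_vector_derivative e *\<^sub>R frechet_derivative \<psi> (at y) v) (at 0 within {0..<1})"
proof -
  have c': "open V" "open W" "diffeomorphism V W \<psi>" "\<psi> ` (V \<inter> span K) = N \<inter> W"
    using c by (auto simp: chart_def)
  note f = diffeomorphism_facts[OF c'(1-3)]
  obtain r where r: "r > 0" "ball y r \<subseteq> V" using c'(1) y(1) openE by blast
  \<comment> \<open>\<open>r\<close> is the radius of a ball around \<open>y\<close> inside
    \<open>V\<close>; the summand \<open>1\<close> keeps the denominator positive and makes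
    \<open>norm (e *\<^sub>R v) < r\<close> strict.\<close>
  define e where "e = r / (norm v + 1)"
  have e: "e > 0" using r(1) by (simp add: e_def add_nonneg_pos)
  have ev: "norm (e *\<^sub>R v) < r"
  proof -
    have "0 < norm v + 1" by (simp add: add_nonneg_pos)
    then show ?thesis using r(1) by (simp add: e_def pos_divide_less_eq algebra_simps)
  qed
  have V: "y + t *\<^sub>R (e *\<^sub>R v) \<in> V" if t: "t \<in> {0..<1}" for t :: real
  proof -
    have "norm (t *\<^sub>R (e *\<^sub>R v)) \<le> 1 * norm (e *\<^sub>R v)"
      unfolding norm_scaleR[of t] using t by (intro mult_right_mono) auto
    then have "y + t *\<^sub>R (e *\<^sub>R v) \<in> ball y r" using ev by (simp add: dist_norm)
    then show ?thesis using r(2) by blast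
  qed
  have N: "\<psi> (y + t *\<^sub>R (e *\<^sub>R v)) \<in> N" if t: "t \<in> {0..<1}" for t :: real
  proof -
    have "y + t *\<^sub>R (e *\<^sub>R v) \<in> V \<inter> span K" using V[OF t] y v by (simp add: span_add span_scale)
    then have "\<psi> (y + t *\<^sub>R (e *\<^sub>R v)) \<in> N \<inter> W" unfolding c'(4)[symmetric] by (rule imageI)
    then show ?thesis by simp
  qed
  have s: "smooth_on {0..<1} (\<lambda>t. \<psi> (y + t *\<^sub>R (e *\<^sub>R v)))"
    by (rule smooth_on_line[OF c'(1) f(12) V])
  have d: "((\<lambda>t. \<psi> (y + t *\<^sub>R (e *\<^sub>R v))) has_vector_derivative e *\<^sub>R frechet_derivative \<psi> (at y) v) (at 0 within {0..<1})"
  proof -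
    have d1: "((\<lambda>t::real. y + t *\<^sub>R (e *\<^sub>R v)) has_derivative (\<lambda>t. t *\<^sub>R (e *\<^sub>R v))) (at 0 within {0..<1})"
      by (auto intro!: derivative_eq_intros)
    have d2: "(\<psi> has_derivative frechet_derivative \<psi> (at y)) (at (y + 0 *\<^sub>R (e *\<^sub>R v)))"
      using f(8)[OF y(1)] by simp
    have "((\<lambda>t. \<psi> (y + t *\<^sub>R (e *\<^sub>R v))) has_derivative (\<lambda>t. frechet_derivative \<psi> (at y) (t *\<^sub>R (e *\<^sub>R v)))) (at 0 within {0..<1})"
      by (rule has_derivative_compose[where g = \<psi>, OF d1 d2])
    moreover have "frechet_derivative \<psi> (at y) (t *\<^sub>R (e *\<^sub>R v)) = t *\<^sub>R (e *\<^sub>R frechet_derivative \<psi> (at y) v)" for t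
      using has_derivative_linear[OF f(8)[OF y(1)]] by (simp add: linear_cmul)
    ultimately show ?thesis by (simp add: has_vector_derivative_def)
  qed
  show ?thesis by (rule that[OF e V N s d])
qed

text \<open>A curve in \<open>N\<close>, read through the inverse chart, has vanishing coordinates
  off \<open>K\<close> for small times, so its initial velocity there lies in \<open>span K\<close>.
  Conversely each vector of \<open>span K\<close> gives, up to a positive factor, the velocity of a
  curve from \<open>chart_curve\<close>.\<close>

lemma tangent_space_chart:
  fixes N :: "'a::euclidean_space set"
  assumes c: "chart k N V W \<psi> K" and y: "y \<in> V" "y \<in> span K"
  shows "tangent_space N (\<psi> y) = frechet_derivative \<psi> (at y) ` span K"
proof -
  have c': "open V" "open W" "diffeomorphism V W \<psi>" "K \<subseteq> Basis" "\<psi> ` (V \<inter> span K) = N \<inter> W"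
    using c by (auto simp: chart_def)
  note f = diffeomorphism_facts[OF c'(1-3)]
  let ?D = "frechet_derivative \<psi> (at y)"
  let ?\<phi> = "the_inv_into V \<psi>"
  have lin: "linear ?D" using has_derivative_linear[OF f(8)[OF y(1)]] .
  show ?thesis
  proof
    have "tangent_cone N (\<psi> y) \<subseteq> ?D ` span K"
    proof
      fix v assume "v \<in> tangent_cone N (\<psi> y)"
      then obtain \<gamma> where \<gamma>: "\<gamma> 0 = \<psi> y" "\<gamma> ` {0..<1} \<subseteq> N" "(\<gamma> has_vector_derivative v) (at (0::real) within {0..<1})"
        by (auto simp: tangent_cone_def)
      let ?D' = "frechet_derivative ?\<phi> (at (\<psi> y))"
      have d\<phi>: "(?\<phi> has_derivative ?D') (at (\<gamma> 0))" using f(9)[OF f(6)[OF y(1)]] \<gamma>(1) by simp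
      have cont: "continuous (at 0 within {0..<1}) \<gamma>"
        using \<gamma>(3) has_vector_derivative_continuous by blast
      have "\<gamma> 0 \<in> W" using \<gamma>(1) f(6)[OF y(1)] by simp
      then have ev: "\<forall>\<^sub>F t in at 0 within {0..<1}. \<gamma> t \<in> W"
        using cont c'(2) unfolding continuous_within by (simp add: topological_tendstoD)
      then obtain \<delta> where \<delta>: "\<delta> > 0" "\<And>t. t \<in> {0..<1} \<Longrightarrow> t \<noteq> 0 \<Longrightarrow> dist t 0 < \<delta> \<Longrightarrow> \<gamma> t \<in> W"
        by (auto simp: eventually_at)
      have inK: "?\<phi> (\<gamma> t) \<in> span K" if "t \<in> {0..<1}" "dist t 0 < \<delta>" for t
      proof -
        have "\<gamma> t \<in> W" using that \<delta>(2) \<open>\<gamma> 0 \<in> W\<close> by (cases "t = 0") auto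
        moreover have "\<gamma> t \<in> N" using \<gamma>(2) that(1) by blast
        ultimately show ?thesis using chart_mem[OF c] by blast
      qed
      have "((\<lambda>t. ?\<phi> (\<gamma> t)) has_derivative (\<lambda>t. ?D' (t *\<^sub>R v))) (at 0 within {0..<1})"
        using \<gamma>(3) unfolding has_vector_derivative_def
        by (rule has_derivative_compose[where f = \<gamma> and g = ?\<phi>, OF _ d\<phi>])
      then have dd: "((\<lambda>t. ?\<phi> (\<gamma> t)) has_vector_derivative ?D' v) (at 0 within {0..<1})"
        using has_derivative_linear[OF d\<phi>] by (simp add: has_vector_derivative_def linear_cmul)
      have "?D' v \<bullet> b = 0" if b: "b \<in> Basis" "b \<notin> K" for b
      proof -
        have z: "?\<phi> (\<gamma> t) \<bullet> b = 0" if "t \<in> {0..<1}" "dist t 0 < \<delta>" for t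
          using inK[OF that] b span_substd_basis[OF c'(4)] by auto
        have "((\<lambda>t. ?\<phi> (\<gamma> t) \<bullet> b) has_vector_derivative (?D' v \<bullet> b)) (at 0 within {0..<1})"
          by (rule bounded_linear.has_vector_derivative[OF bounded_linear_inner_left dd])
        then have "((\<lambda>t. 0::real) has_vector_derivative (?D' v \<bullet> b)) (at 0 within {0..<1})"
          unfolding has_vector_derivative_def
          by (rule has_derivative_transform_within[OF _ \<delta>(1)]) (use z in auto)
        moreover have "((\<lambda>t. 0::real) has_vector_derivative 0) (at 0 within {0..<1})" by simp
        moreover have "at (0::real) within {0..<1} \<noteq> bot"
        proof -
          have "{0..<1} - {0::real} = {0<..<1}" by auto
          then show ?thesis by (simp add: trivial_limit_within islimpt_in_closure)
        qed
        ultimately show ?thesis using vector_derivative_unique_within by blast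
      qed
      then have "?D' v \<in> span K" using span_substd_basis[OF c'(4)] by auto
      moreover have "v = ?D (?D' v)" using f(11)[OF y(1)] by simp
      ultimately show "v \<in> ?D ` span K" by blast
    qed
    then show "tangent_space N (\<psi> y) \<subseteq> ?D ` span K"
      unfolding tangent_space_def by (rule span_minimal) (intro linear_subspace_image lin subspace_span)
    show "?D ` span K \<subseteq> tangent_space N (\<psi> y)"
    proof
      fix w assume "w \<in> ?D ` span K"
      then obtain v where v: "v \<in> span K" "w = ?D v" by blast
      obtain e where e: "e > 0" "\<And>t. t \<in> {0..<1::real} \<Longrightarrow> \<psi> (y + t *\<^sub>R (e *\<^sub>R v)) \<in> N"
        "smooth_on {0..<1} (\<lambda>t. \<psi> (y + t *\<^sub>R (e *\<^sub>R v)))"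
        "((\<lambda>t. \<psi> (y + t *\<^sub>R (e *\<^sub>R v))) has_vector_derivative e *\<^sub>R ?D v) (at 0 within {0..<1})"
        using chart_curve[OF c y v(1)] by metis
      have "e *\<^sub>R w \<in> tangent_cone N (\<psi> y)"
        unfolding tangent_cone_def using e v(2)
        by (intro CollectI exI[of _ "\<lambda>t. \<psi> (y + t *\<^sub>R (e *\<^sub>R v))"]) auto
      then have "(1/e) *\<^sub>R (e *\<^sub>R w) \<in> tangent_space N (\<psi> y)"
        unfolding tangent_space_def by (intro span_scale span_base)
      then show "w \<in> tangent_space N (\<psi> y)" using e(1) by simp
    qed
  qed
qed

lemma tangent_cone_Times_space:
  fixes A :: "'b::euclidean_space set" and T :: "real set"
  assumes c: "chart k A V W \<psi> K" and y: "y \<in> V" "y \<in> span K" and v: "v \<in> span K" and t: "t \<in> T"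
  shows "(frechet_derivative \<psi> (at y) v, 0) \<in> tangent_space (A \<times> T) (\<psi> y, t)"
proof -
  let ?D = "frechet_derivative \<psi> (at y)"
  obtain e where e: "e > 0" "\<And>t. t \<in> {0..<1::real} \<Longrightarrow> \<psi> (y + t *\<^sub>R (e *\<^sub>R v)) \<in> A"
    "smooth_on {0..<1} (\<lambda>t. \<psi> (y + t *\<^sub>R (e *\<^sub>R v)))"
    "((\<lambda>t. \<psi> (y + t *\<^sub>R (e *\<^sub>R v))) has_vector_derivative e *\<^sub>R ?D v) (at 0 within {0..<1})"
    using chart_curve[OF c y v] by metis
  have "smooth_on {0..<1} (\<lambda>s. (\<psi> (y + s *\<^sub>R (e *\<^sub>R v)), t))"
    using smooth_on_Pair[OF e(3) smooth_on_affine[of _ t 0]] by simp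
  moreover have "((\<lambda>s. (\<psi> (y + s *\<^sub>R (e *\<^sub>R v)), t)) has_vector_derivative (e *\<^sub>R ?D v, 0)) (at 0 within {0..<1})"
    by (rule has_vector_derivative_Pair[OF e(4)]) simp
  ultimately have "(e *\<^sub>R ?D v, 0) \<in> tangent_cone (A \<times> T) (\<psi> y, t)"
    unfolding tangent_cone_def using e(2) t
    by (intro CollectI exI[of _ "\<lambda>s. (\<psi> (y + s *\<^sub>R (e *\<^sub>R v)), t)"]) auto
  then have "(1/e) *\<^sub>R (e *\<^sub>R ?D v, 0::real) \<in> tangent_space (A \<times> T) (\<psi> y, t)"
    unfolding tangent_space_def by (intro span_scale span_base)
  then show ?thesis using e(1) by simp
qed

text \<open>\<open>\<delta>\<close> may be negative: at the right end of a closed time interval only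
  backward curves stay in \<open>T\<close>, and passing to the span removes the sign.\<close>

lemma tangent_cone_Times_time:
  fixes A :: "'b::euclidean_space set" and T :: "real set"
  assumes p: "p \<in> A" and \<delta>: "\<delta> \<noteq> 0" and T: "\<And>s. s \<in> {0..<1} \<Longrightarrow> t + s * \<delta> \<in> T"
  shows "(0, 1) \<in> tangent_space (A \<times> T) (p, t)"
proof -
  have "smooth_on {0..<1} (\<lambda>s. (p, t + s * \<delta>))"
    using smooth_on_affine[of "{0..<1}" "(p, t)" "(0, \<delta>)"] by simp
  moreover have "((\<lambda>s. (p, t + s * \<delta>)) has_vector_derivative (0, \<delta>)) (at 0 within {0..<1})"
    by (rule has_vector_derivative_Pair) (auto intro!: derivative_eq_intros simp: has_vector_derivative_def)
  ultimately have "(0, \<delta>) \<in> tangent_cone (A \<times> T) (p, t)"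
    unfolding tangent_cone_def using p T
    by (intro CollectI exI[of _ "\<lambda>s. (p, t + s * \<delta>)"]) auto
  then have "(1/\<delta>) *\<^sub>R (0::'b, \<delta>) \<in> tangent_space (A \<times> T) (p, t)"
    unfolding tangent_space_def by (intro span_scale span_base)
  then show ?thesis using \<delta> by simp
qed

section \<open>Riemannian volume of hypersurfaces\<close>

text \<open>The factor \<open>sqrt (gram_det \<dots>)\<close> of the Riemannian volume, extended by zero outside \<open>V\<close>.\<close>

definition vol_factor :: "(real^'n) set \<Rightarrow> (real^'n \<Rightarrow> real^'n) \<Rightarrow> (real^'n) set \<Rightarrow> real^'n \<Rightarrow> real" where
  "vol_factor V \<psi> K y = (if y \<in> V then sqrt (gram_det K (frechet_derivative \<psi> (at y))) else 0)"

abbreviation hyper_chart :: "(real^'n) set \<Rightarrow> (real^'n) set \<Rightarrow> (real^'n) set \<Rightarrow> (real^'n \<Rightarrow> real^'n) \<Rightarrow> 'n \<Rightarrow> bool" where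
  "hyper_chart N V W \<psi> k \<equiv> chart (CARD('n) - 1) N V W \<psi> (Basis - {axis k 1})"

lemma hyper_chartI:
  fixes N :: "(real^'n) set"
  assumes "chart (CARD('n) - 1) N V W \<psi> K"
  obtains k where "K = Basis - {axis k 1}" "hyper_chart N V W \<psi> k"
proof -
  have "K \<subseteq> Basis" "card K = CARD('n) - 1" using assms by (auto simp: chart_def)
  then obtain k where "K = Basis - {axis k 1 :: real^'n}" by (rule codim1_coord_subset)
  then show ?thesis using assms that by blast
qed

lemma hyper_chartD:
  assumes "hyper_chart N V W \<psi> k"
  shows "open V" "open W" "diffeomorphism V W \<psi>" "\<psi> ` (V \<inter> {y. y $ k = 0}) = N \<inter> W"
  using assms by (auto simp: chart_def span_Basis_minus)

lemma continuous_on_matrix_det: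
  fixes f :: "'a::topological_space \<Rightarrow> real^'n^'n"
  assumes "\<And>i j. continuous_on S (\<lambda>x. f x $ i $ j)"
  shows "continuous_on S (\<lambda>x. det (f x))"
  unfolding det_def by (intro continuous_intros assms)

lemma borel_vimage_open:
  assumes "open V" "continuous_on V \<psi>" "A \<in> sets borel"
  shows "V \<inter> \<psi> -` A \<in> sets borel"
proof -
  have "\<psi> \<in> borel_measurable (restrict_space borel V)"
    by (rule borel_measurable_continuous_on_restrict[OF assms(2)])
  then have "\<psi> -` A \<inter> space (restrict_space borel V) \<in> sets (restrict_space borel V)"
    by (rule measurable_sets[OF _ assms(3)])
  then show ?thesis
    using assms(1) by (simp add: space_restrict_space sets_restrict_space_iff Int_commute)
qed

lemma measurable_vol_factor:
  fixes \<psi> :: "real^'n \<Rightarrow> real^'n"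
  assumes "open V" "smooth_on V \<psi>"
  shows "vol_factor V \<psi> K \<in> borel_measurable borel"
proof -
  have c: "continuous_on V (\<lambda>y. frechet_derivative \<psi> (at y) v)" for v
    by (rule smooth_on_open(2)[OF assms])
  have "continuous_on V (\<lambda>y. sqrt (gram_det K (frechet_derivative \<psi> (at y))))"
  proof -
    have "continuous_on V (\<lambda>x. if axis i 1 \<in> K \<and> axis j 1 \<in> K
             then frechet_derivative \<psi> (at x) (axis i 1) \<bullet> frechet_derivative \<psi> (at x) (axis j 1)
             else if i = j then 1 else 0)" for i j
    proof (cases "axis i 1 \<in> K \<and> axis j 1 \<in> K")
      case True
      then show ?thesis by (simp add: continuous_on_inner[OF c c])
    next
      case False
      show ?thesis unfolding if_not_P[OF False] by (rule continuous_on_const)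
    qed
    then show ?thesis
      unfolding gram_det_def
      by (intro continuous_on_real_sqrt continuous_on_matrix_det) (simp only: vec_lambda_beta)
  qed
  then have "(\<lambda>y. if y \<in> V then sqrt (gram_det K (frechet_derivative \<psi> (at y))) else 0) \<in> borel_measurable borel"
    using assms(1) by (intro borel_measurable_continuous_on_if) auto
  then show ?thesis by (simp add: vol_factor_def[abs_def])
qed

lemma row_det_cong_full: "(\<And>i. i \<noteq> k \<Longrightarrow> r i = r' i) \<Longrightarrow> v = v' \<Longrightarrow> row_det k r v = row_det k r' v'"
  using row_det_cong by metis

lemma axis_in_span: "i \<noteq> k \<Longrightarrow> axis i 1 \<in> span (Basis - {axis k 1 :: real^'n})"
  by (rule span_base) (simp add: axis_in_Basis_iff axis_eq_axis)

text \<open>The derivative of \<open>\<psi>\<close> is injective, so the tangent space is an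
  isomorphic image of a coordinate hyperplane and has codimension one.\<close>

lemma tangent_normal:
  fixes N :: "(real^'n) set"
  assumes c: "hyper_chart N V W \<psi> k" and y: "y \<in> V" "y $ k = 0"
  obtains \<nu> where "norm \<nu> = 1" "tangent_space N (\<psi> y) = {z. z \<bullet> \<nu> = 0}"
    "\<And>i. i \<noteq> k \<Longrightarrow> frechet_derivative \<psi> (at y) (axis i 1) \<bullet> \<nu> = 0"
proof -
  note h = hyper_chartD[OF c]
  note f = diffeomorphism_facts[OF h(1-3)]
  let ?D = "frechet_derivative \<psi> (at y)"
  let ?K = "Basis - {axis k 1 :: real^'n}"
  have lin: "linear ?D" using has_derivative_linear[OF f(8)[OF y(1)]] .
  have inj: "inj ?D" by (rule inj_on_inverseI[where g = "frechet_derivative (the_inv_into V \<psi>) (at (\<psi> y))"]) (rule f(10)[OF y(1)])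
  have T: "tangent_space N (\<psi> y) = ?D ` span ?K"
    by (rule tangent_space_chart[OF c y(1)]) (simp add: span_Basis_minus y)
  have "dim (span ?K) = card ?K"
    by (simp add: dim_eq_card_independent independent_mono[OF independent_Basis])
  also have "\<dots> = CARD('n) - 1" using c by (simp add: chart_def)
  finally have dT: "dim (?D ` span ?K) = CARD('n) - 1"
    using dim_image_eq[OF lin, of "span ?K"] inj inj_on_subset by (metis (no_types, lifting) span_span subset_UNIV)
  have "dim (?D ` span ?K) < DIM(real^'n)"
    unfolding dT using zero_less_card_finite[where 'a='n] by simp
  from lowdim_subset_hyperplane[OF this]
  obtain a where a: "a \<noteq> 0" "span (?D ` span ?K) \<subseteq> {x. a \<bullet> x = 0}" by blast
  have s: "subspace (?D ` span ?K)" by (intro linear_subspace_image lin subspace_span)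
  have eq: "?D ` span ?K = {x. a \<bullet> x = 0}"
  proof (rule subspace_dim_equal[OF s subspace_hyperplane])
    show "?D ` span ?K \<subseteq> {x. a \<bullet> x = 0}" using a(2) s by (simp add: span_eq_iff[THEN iffD2])
    show "dim {x. a \<bullet> x = 0} \<le> dim (?D ` span ?K)" using a(1) dT by (simp add: dim_hyperplane)
  qed
  define \<nu> where "\<nu> = a /\<^sub>R norm a"
  have n: "norm \<nu> = 1" using a(1) by (simp add: \<nu>_def)
  have T': "tangent_space N (\<psi> y) = {z. z \<bullet> \<nu> = 0}"
    using a(1) unfolding T eq by (auto simp: \<nu>_def inner_commute)
  have "?D (axis i 1) \<bullet> \<nu> = 0" if "i \<noteq> k" for i
  proof -
    have "axis i 1 \<in> span ?K" using that by (rule axis_in_span)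
    then have "?D (axis i 1) \<in> tangent_space N (\<psi> y)" unfolding T by (rule imageI)
    then show ?thesis by (simp add: T')
  qed
  then show ?thesis using that n T' by blast
qed

lemma vol_factor_normal:
  assumes "hyper_chart N V W \<psi> k" "y \<in> V" "norm \<nu> = 1"
    "\<And>i. i \<noteq> k \<Longrightarrow> frechet_derivative \<psi> (at y) (axis i 1) \<bullet> \<nu> = 0"
  shows "vol_factor V \<psi> (Basis - {axis k 1}) y = \<bar>row_det k (\<lambda>i. frechet_derivative \<psi> (at y) (axis i 1)) \<nu>\<bar>"
  using assms(2) gram_det_row_det[where f = "frechet_derivative \<psi> (at y)", OF assms(3,4)] by (simp add: vol_factor_def)

lemma sum_axis: "(\<Sum>i\<in>UNIV. (z $ i) *\<^sub>R axis i 1) = (z :: real^'n)"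
  by (simp add: vec_eq_iff axis_def if_distrib sum.delta cong: if_cong)

text \<open>Both chart domains get unit thickness in their omitted coordinates. The transition map,
  with the extra coordinate carried along, then relates full-dimensional sets, and its Jacobian is
  compared with the two volume factors through a common unit normal \<open>\<nu>\<close> at the
  point of \<open>N\<close>.\<close>

lemma chart_independence:
  fixes N :: "(real^'n) set"
  assumes c1: "hyper_chart N V1 W1 \<psi>1 k1" and c2: "hyper_chart N V2 W2 \<psi>2 k2"
    and A: "A \<in> sets borel" "A \<subseteq> N \<inter> W1" "A \<subseteq> W2"
  defines "K1 \<equiv> Basis - {axis k1 1 :: real^'n}" and "K2 \<equiv> Basis - {axis k2 1 :: real^'n}"
  shows "(\<integral>\<^sup>+y\<in>V1 \<inter> \<psi>1 -` A. vol_factor V1 \<psi>1 K1 y \<partial>coord_lborel K1) =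
    (\<integral>\<^sup>+y\<in>V2 \<inter> \<psi>2 -` A. vol_factor V2 \<psi>2 K2 y \<partial>coord_lborel K2)"
proof -
  note h1 = hyper_chartD[OF c1] and h2 = hyper_chartD[OF c2]
  note f1 = diffeomorphism_facts[OF h1(1-3)] and f2 = diffeomorphism_facts[OF h2(1-3)]
  let ?\<phi>1 = "the_inv_into V1 \<psi>1" and ?\<phi>2 = "the_inv_into V2 \<psi>2"
  have B1[measurable]: "V1 \<inter> \<psi>1 -` A \<in> sets borel" by (rule borel_vimage_open[OF h1(1) f1(14) A(1)])
  have B2[measurable]: "V2 \<inter> \<psi>2 -` A \<in> sets borel" by (rule borel_vimage_open[OF h2(1) f2(14) A(1)])
  have G1[measurable]: "vol_factor V1 \<psi>1 K1 \<in> borel_measurable borel" by (rule measurable_vol_factor[OF h1(1) f1(12)])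
  have G2[measurable]: "vol_factor V2 \<psi>2 K2 \<in> borel_measurable borel" by (rule measurable_vol_factor[OF h2(1) f2(12)])
  define S1 where "S1 = drop_coord k1 -` (V1 \<inter> \<psi>1 -` A) \<inter> {z. z $ k1 \<in> {0<..<1}}"
  define S2 where "S2 = drop_coord k2 -` (V2 \<inter> \<psi>2 -` A) \<inter> {z. z $ k2 \<in> {0<..<1}}"
  have meas: "drop_coord k -` B \<inter> {z. z $ k \<in> {0<..<1}} \<in> sets borel" if "B \<in> sets borel" for k and B :: "(real^'n) set"
  proof (rule sets.Int[OF measurable_sets_borel[OF measurable_drop_coord that]])
    show "{z::real^'n. z $ k \<in> {0<..<1}} \<in> sets borel" by measurable
  qed
  have S1B[measurable]: "S1 \<in> sets borel" unfolding S1_def by (rule meas[OF B1])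
  have S2B[measurable]: "S2 \<in> sets borel" unfolding S2_def by (rule meas[OF B2])
  \<comment> \<open>The transition map acts on the hyperplane coordinates, while the thickness
    coordinate moves unchanged from slot \<open>k1\<close> to slot \<open>k2\<close>.\<close>
  define \<Theta> where "\<Theta> = (\<lambda>z. ?\<phi>2 (\<psi>1 (drop_coord k1 z)) + (z $ k1) *\<^sub>R axis k2 1)"
  define \<Theta>' where "\<Theta>' = (\<lambda>z v. frechet_derivative ?\<phi>2 (at (\<psi>1 (drop_coord k1 z)))
      (frechet_derivative \<psi>1 (at (drop_coord k1 z)) (drop_coord k1 v)) + (v $ k1) *\<^sub>R axis k2 1)"
  have z1: "(drop_coord k1 z) $ k1 = 0" for z by simp
  have K2: "?\<phi>2 x \<in> V2" "?\<phi>2 x $ k2 = 0" if "x \<in> A" for x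
    using that A f2(7) chart_mem[OF c2, of x] by (auto simp: span_Basis_minus)
  have K1: "?\<phi>1 x \<in> V1" "?\<phi>1 x $ k1 = 0" if "x \<in> A" for x
    using that A f1(7) chart_mem[OF c1, of x] by (auto simp: span_Basis_minus)
  have \<Theta>d: "drop_coord k2 (\<Theta> z) = ?\<phi>2 (\<psi>1 (drop_coord k1 z))" "\<Theta> z $ k2 = z $ k1" if "z \<in> S1" for z
    using K2[of "\<psi>1 (drop_coord k1 z)"] that by (simp_all add: \<Theta>_def S1_def)
  have im: "\<Theta> ` S1 = S2"
  proof
    show "\<Theta> ` S1 \<subseteq> S2"
    proof
      fix w assume "w \<in> \<Theta> ` S1"
      then obtain z where z: "z \<in> S1" "w = \<Theta> z" by blast
      then have "\<psi>1 (drop_coord k1 z) \<in> A" by (simp add: S1_def)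
      then show "w \<in> S2" using z \<Theta>d[OF z(1)] K2 f2(5) A(3) by (auto simp: S2_def S1_def)
    qed
    show "S2 \<subseteq> \<Theta> ` S1"
    proof
      fix w assume w: "w \<in> S2"
      let ?y = "?\<phi>1 (\<psi>2 (drop_coord k2 w))"
      have a: "\<psi>2 (drop_coord k2 w) \<in> A" and v2: "drop_coord k2 w \<in> V2" using w by (auto simp: S2_def)
      let ?z = "?y + (w $ k2) *\<^sub>R axis k1 1"
      have d: "drop_coord k1 ?z = ?y" "?z $ k1 = w $ k2" using K1(2)[OF a] by simp_all
      have p: "\<psi>1 ?y = \<psi>2 (drop_coord k2 w)" using a A(2) f1(5) by blast
      have "?z \<in> S1" unfolding S1_def using w d K1(1)[OF a] p a by (simp add: S2_def)
      moreover have "\<Theta> ?z = w"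
      proof -
        have "\<Theta> ?z = ?\<phi>2 (\<psi>1 (drop_coord k1 ?z)) + (?z $ k1) *\<^sub>R axis k2 1" by (simp only: \<Theta>_def)
        also have "\<dots> = ?\<phi>2 (\<psi>1 ?y) + (w $ k2) *\<^sub>R axis k2 1"
          by (rule arg_cong2[where f = "(+)"], simp only: d(1), simp only: d(2))
        also have "\<dots> = w" unfolding p f2(4)[OF v2] by simp
        finally show ?thesis .
      qed
      ultimately show "w \<in> \<Theta> ` S1" by (metis imageI)
    qed
  qed
  have inj: "inj_on \<Theta> S1"
  proof (rule inj_onI)
    fix z z' assume z: "z \<in> S1" "z' \<in> S1" "\<Theta> z = \<Theta> z'"
    then have k: "z $ k1 = z' $ k1" and e: "?\<phi>2 (\<psi>1 (drop_coord k1 z)) = ?\<phi>2 (\<psi>1 (drop_coord k1 z'))"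
      using \<Theta>d[OF z(1)] \<Theta>d[OF z(2)] by simp_all
    have "\<psi>1 (drop_coord k1 z) \<in> W2" "\<psi>1 (drop_coord k1 z') \<in> W2" using z A(3) by (auto simp: S1_def)
    then have "\<psi>1 (drop_coord k1 z) = \<psi>1 (drop_coord k1 z')" using e f2(5) by metis
    then have "drop_coord k1 z = drop_coord k1 z'" using z f1(1) by (auto simp: S1_def inj_on_def)
    then show "z = z'" using k by simp
  qed
  have der: "(\<Theta> has_derivative \<Theta>' z) (at z within S1)" if z: "z \<in> S1" for z
  proof -
    have v: "drop_coord k1 z \<in> V1" and w: "\<psi>1 (drop_coord k1 z) \<in> W2" using z A(3) by (auto simp: S1_def)
    have d0: "(drop_coord k1 has_derivative drop_coord k1) (at z within S1)"
      using linear_drop_coord[of k1] by (intro bounded_linear_imp_has_derivative) (simp add: linear_conv_bounded_linear)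
    note d1 = has_derivative_compose[where g = \<psi>1, OF d0 f1(8)[OF v]]
    note d2 = has_derivative_compose[where g = ?\<phi>2 and f = "\<lambda>z. \<psi>1 (drop_coord k1 z)", OF d1 f2(9)[OF w]]
    have d3: "((\<lambda>z. (z $ k1) *\<^sub>R axis k2 (1::real)) has_derivative (\<lambda>v. (v $ k1) *\<^sub>R axis k2 1)) (at z within S1)"
      by (intro bounded_linear_imp_has_derivative bounded_linear_scaleR_const bounded_linear_vec_nth)
    show ?thesis unfolding \<Theta>_def \<Theta>'_def by (rule has_derivative_add[OF d2 d3])
  qed
  define D where "D = (\<lambda>z. \<bar>det (\<chi> i j. (if drop_coord k1 z \<in> V1 \<inter> \<psi>1 -` W2 then \<Theta>' z (axis j 1) $ i else 0))\<bar>)"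
  have D: "D z = \<bar>det (matrix (\<Theta>' z))\<bar>" if "z \<in> S1" for z
    using that A(3) by (auto simp: D_def matrix_def S1_def)
  have Dm: "D \<in> borel_measurable borel"
  proof -
    define Vo where "Vo = drop_coord k1 -` (V1 \<inter> \<psi>1 -` W2)"
    have cd: "continuous_on UNIV (drop_coord k1)" by (intro continuous_intros)
    have o': "open (V1 \<inter> \<psi>1 -` W2)" by (rule continuous_open_preimage[OF f1(14) h1(1) h2(2)])
    have o: "open Vo" unfolding Vo_def by (rule open_vimage[OF o' cd])
    have c\<psi>: "continuous_on Vo (\<lambda>z. \<psi>1 (drop_coord k1 z))"
      by (rule continuous_on_compose2[OF f1(14)]) (auto simp: Vo_def intro!: continuous_intros)
    have cD1: "continuous_on Vo (\<lambda>z. frechet_derivative \<psi>1 (at (drop_coord k1 z)) v)" for v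
      by (rule continuous_on_compose2[OF smooth_on_open(2)[OF h1(1) f1(12)]]) (auto simp: Vo_def intro!: continuous_intros)
    have cD2: "continuous_on Vo (\<lambda>z. frechet_derivative ?\<phi>2 (at (\<psi>1 (drop_coord k1 z))) v)" for v
      by (rule continuous_on_compose2[OF smooth_on_open(2)[OF h2(2) f2(13)] c\<psi>]) (auto simp: Vo_def)
    \<comment> \<open>Continuity of the derivative is known for fixed directions only; expanding the
      moving direction \<open>u\<close> in coordinates reduces to these.\<close>
    have lin: "frechet_derivative ?\<phi>2 (at (\<psi>1 (drop_coord k1 z))) u =
       (\<Sum>i\<in>UNIV. (u $ i) *\<^sub>R frechet_derivative ?\<phi>2 (at (\<psi>1 (drop_coord k1 z))) (axis i 1))" if z: "z \<in> Vo" for u z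
    proof -
      have l: "linear (frechet_derivative ?\<phi>2 (at (\<psi>1 (drop_coord k1 z))))"
        using z f2(9) by (intro has_derivative_linear) (auto simp: Vo_def)
      show ?thesis using linear_sum[OF l, of "\<lambda>i. (u $ i) *\<^sub>R axis i 1" UNIV] linear_cmul[OF l]
        by (simp add: sum_axis)
    qed
    have cj: "continuous_on Vo (\<lambda>z. \<Theta>' z v $ i)" for v i
    proof -
      have "continuous_on Vo (\<lambda>z. ((\<Sum>i\<in>UNIV. (frechet_derivative \<psi>1 (at (drop_coord k1 z)) (drop_coord k1 v) $ i) *\<^sub>R
          frechet_derivative ?\<phi>2 (at (\<psi>1 (drop_coord k1 z))) (axis i 1)) + (v $ k1) *\<^sub>R axis k2 1) $ i)"
        by (intro continuous_intros cD1 cD2)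
      then show ?thesis
        by (rule continuous_on_eq) (simp add: \<Theta>'_def lin del: vector_minus_component vector_scaleR_component)
    qed
    have "(\<lambda>z. if z \<in> Vo then \<Theta>' z v $ i else 0) \<in> borel_measurable borel" for v i
      using o cj by (intro borel_measurable_continuous_on_if) auto
    then have m: "(\<lambda>z. if drop_coord k1 z \<in> V1 \<inter> \<psi>1 -` W2 then \<Theta>' z v $ i else 0) \<in> borel_measurable borel" for v i
      by (simp add: Vo_def)
    show ?thesis unfolding D_def det_def
      by (intro borel_measurable_abs borel_measurable_sum borel_measurable_times borel_measurable_prod borel_measurable_const)
        (simp only: vec_lambda_beta m)
  qed
  have fac: "ennreal (vol_factor V2 \<psi>2 K2 (drop_coord k2 (\<Theta> z))) * ennreal (D z) = ennreal (vol_factor V1 \<psi>1 K1 (drop_coord k1 z))"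
    if z: "z \<in> S1" for z
  proof -
    let ?y1 = "drop_coord k1 z"
    let ?x = "\<psi>1 ?y1"
    let ?y2 = "?\<phi>2 ?x"
    have xA: "?x \<in> A" and v1: "?y1 \<in> V1" using z by (auto simp: S1_def)
    have v2: "?y2 \<in> V2" "?y2 $ k2 = 0" using K2[OF xA] by auto
    have xx: "\<psi>2 ?y2 = ?x" using xA A(3) f2(5) by blast
    obtain \<nu> where \<nu>: "norm \<nu> = 1" "tangent_space N ?x = {z. z \<bullet> \<nu> = 0}"
      "\<And>i. i \<noteq> k1 \<Longrightarrow> frechet_derivative \<psi>1 (at ?y1) (axis i 1) \<bullet> \<nu> = 0"
      using tangent_normal[OF c1 v1 z1] by blast
    let ?D1 = "frechet_derivative \<psi>1 (at ?y1)" and ?D2 = "frechet_derivative \<psi>2 (at ?y2)"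
    let ?E2 = "frechet_derivative ?\<phi>2 (at ?x)"
    have lin1: "linear ?D1" using has_derivative_linear[OF f1(8)[OF v1]] .
    have lin2: "linear ?D2" using has_derivative_linear[OF f2(8)[OF v2(1)]] .
    have linE: "linear ?E2" using has_derivative_linear[OF f2(9)] xA A(3) by blast
    have T1: "tangent_space N ?x = ?D1 ` span K1"
      unfolding K1_def by (rule tangent_space_chart[OF c1 v1]) (simp add: span_Basis_minus)
    have T2: "tangent_space N ?x = ?D2 ` span K2"
      using tangent_space_chart[OF c2 v2(1)] v2(2) by (simp add: K2_def span_Basis_minus xx)
    have n2: "?D2 (axis i 1) \<bullet> \<nu> = 0" if "i \<noteq> k2" for i
    proof -
      have "axis i 1 \<in> span K2" using axis_in_span[OF that] by (simp add: K2_def)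
      then have "?D2 (axis i 1) \<in> tangent_space N ?x" unfolding T2 by (rule imageI)
      then show ?thesis by (simp add: \<nu>(2))
    qed
    have DE: "?D2 (?E2 v) = v" for v using f2(11)[OF v2(1)] by (simp add: xx)
    have ED: "?E2 (?D2 v) = v" for v using f2(10)[OF v2(1)] by (simp add: xx)
    have Espan: "?E2 (?D1 (drop_coord k1 v)) $ k2 = 0" for v
    proof -
      have "?D1 (drop_coord k1 v) \<in> tangent_space N ?x"
        unfolding T1 K1_def by (rule imageI[OF drop_coord_in_span])
      then obtain w where "w \<in> span K2" "?D1 (drop_coord k1 v) = ?D2 w" unfolding T2 by blast
      then show ?thesis using ED by (simp add: K2_def span_Basis_minus)
    qed
    \<comment> \<open>\<open>L2\<close> extends the derivative of \<open>\<psi>2\<close> by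
      \<open>\<nu>\<close> in the thickness direction. Composed with \<open>\<Theta>' z\<close> it
      becomes the same extension of the derivative of \<open>\<psi>1\<close>, and taking
      determinants relates the two volume factors by \<open>D z\<close>.\<close>
    define L2 where "L2 = (\<lambda>w. ?D2 (drop_coord k2 w) + (w $ k2) *\<^sub>R \<nu>)"
    have linL2: "linear L2" unfolding L2_def
      using lin2 by (intro linearI) (auto simp: linear_add linear_diff linear_cmul algebra_simps)
    have lin\<Theta>: "linear (\<Theta>' z)" by (rule has_derivative_linear[OF der[OF z]])
    have comp: "L2 (\<Theta>' z v) = ?D1 (drop_coord k1 v) + (v $ k1) *\<^sub>R \<nu>" for v
    proof -
      have "(\<Theta>' z v) $ k2 = v $ k1" using Espan by (simp add: \<Theta>'_def)
      moreover have "drop_coord k2 (\<Theta>' z v) = ?E2 (?D1 (drop_coord k1 v))"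
        using Espan by (simp add: \<Theta>'_def)
      ultimately show ?thesis by (simp only: L2_def DE)
    qed
    have dL2: "det (matrix L2) = row_det k2 (\<lambda>i. ?D2 (axis i 1)) \<nu>"
    proof -
      have "L2 (axis k2 1) = \<nu>" using linear_0[OF lin2] by (simp add: L2_def)
      moreover have "L2 (axis i 1) = ?D2 (axis i 1)" if "i \<noteq> k2" for i using that by (simp add: L2_def axis_def)
      ultimately show ?thesis unfolding det_matrix_row_det[of L2 k2] by (intro row_det_cong_full) auto
    qed
    have dL1: "det (matrix (L2 \<circ> \<Theta>' z)) = row_det k1 (\<lambda>i. ?D1 (axis i 1)) \<nu>"
    proof -
      have "(L2 \<circ> \<Theta>' z) (axis k1 1) = \<nu>" using linear_0[OF lin1] by (simp add: comp)
      moreover have "(L2 \<circ> \<Theta>' z) (axis i 1) = ?D1 (axis i 1)" if "i \<noteq> k1" for i using that by (simp add: comp axis_def)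
      ultimately show ?thesis unfolding det_matrix_row_det[of "L2 \<circ> \<Theta>' z" k1] by (intro row_det_cong_full) auto
    qed
    have "det (matrix (L2 \<circ> \<Theta>' z)) = det (matrix L2) * det (matrix (\<Theta>' z))"
      by (simp add: matrix_compose[OF lin\<Theta> linL2] det_mul)
    then have "\<bar>row_det k1 (\<lambda>i. ?D1 (axis i 1)) \<nu>\<bar> = \<bar>row_det k2 (\<lambda>i. ?D2 (axis i 1)) \<nu>\<bar> * D z"
      unfolding dL1 dL2 D[OF z] by (simp add: abs_mult)
    then have "vol_factor V1 \<psi>1 K1 ?y1 = vol_factor V2 \<psi>2 K2 ?y2 * D z"
      unfolding K1_def K2_def using vol_factor_normal[OF c1 v1 \<nu>(1,3)] vol_factor_normal[OF c2 v2(1) \<nu>(1) n2] by simp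
    then show ?thesis
      using \<Theta>d(1)[OF z] by (simp add: ennreal_mult'' D_def)
  qed
  have m2: "(\<lambda>z. ennreal (vol_factor V2 \<psi>2 K2 (drop_coord k2 z))) \<in> borel_measurable borel"
    by (rule measurable_compose[OF measurable_drop_coord]) measurable
  have "(\<integral>\<^sup>+y\<in>V2 \<inter> \<psi>2 -` A. vol_factor V2 \<psi>2 K2 y \<partial>coord_lborel K2) =
     (\<integral>\<^sup>+z. ennreal (vol_factor V2 \<psi>2 K2 (drop_coord k2 z)) * indicator (V2 \<inter> \<psi>2 -` A) (drop_coord k2 z) * indicator {0<..<1} (z $ k2) \<partial>lborel)"
    unfolding K2_def by (rule nn_integral_coord_lborel) (use G2 in \<open>simp add: K2_def\<close>)
  also have "\<dots> = (\<integral>\<^sup>+z\<in>S2. ennreal (vol_factor V2 \<psi>2 K2 (drop_coord k2 z)) \<partial>lborel)"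
    by (intro nn_integral_cong) (simp add: S2_def indicator_def)
  also have "\<dots> = (\<integral>\<^sup>+z\<in>\<Theta> ` S1. ennreal (vol_factor V2 \<psi>2 K2 (drop_coord k2 z)) \<partial>lebesgue)"
    by (simp add: im nn_integral_completion)
  also have "\<dots> = (\<integral>\<^sup>+z\<in>S1. ennreal (vol_factor V2 \<psi>2 K2 (drop_coord k2 (\<Theta> z))) * ennreal (D z) \<partial>lborel)"
    by (rule nn_integral_change_of_variables[OF S1B der inj Dm D m2])
  also have "\<dots> = (\<integral>\<^sup>+z\<in>S1. ennreal (vol_factor V1 \<psi>1 K1 (drop_coord k1 z)) \<partial>lborel)"
    by (intro nn_integral_cong) (simp add: fac indicator_def)
  also have "\<dots> = (\<integral>\<^sup>+z. ennreal (vol_factor V1 \<psi>1 K1 (drop_coord k1 z)) * indicator (V1 \<inter> \<psi>1 -` A) (drop_coord k1 z) * indicator {0<..<1} (z $ k1) \<partial>lborel)"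
    by (intro nn_integral_cong) (simp add: S1_def indicator_def)
  also have "\<dots> = (\<integral>\<^sup>+y\<in>V1 \<inter> \<psi>1 -` A. vol_factor V1 \<psi>1 K1 y \<partial>coord_lborel K1)"
    unfolding K1_def by (rule nn_integral_coord_lborel[symmetric]) (use G1 in \<open>simp add: K1_def\<close>)
  finally show ?thesis by simp
qed

lemma empty_hyper_chart: "hyper_chart N {} {} id k"
  by (simp add: chart_def diffeomorphism_def bij_betw_def smooth_on_def card_Diff_subset axis_in_Basis_iff)

text \<open>\<open>P\<close> is a local property that passes to subsets. It has to hold for the
  empty set because the countable cover, possibly empty itself, is enumerated with \<open>{}\<close>
  added. The \<open>B m\<close> cut \<open>N\<close> into disjoint Borel pieces, so that integrals
  can be summed over the charts.\<close>

lemma hyper_atlas: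
  fixes N :: "(real^'n) set"
  assumes N: "charted (CARD('n) - 1) N"
    and P: "\<And>x. x \<in> N \<Longrightarrow> \<exists>G. open G \<and> x \<in> G \<and> P G" "\<And>G G'. P G \<Longrightarrow> G' \<subseteq> G \<Longrightarrow> P G'" "P {}"
  obtains V W :: "nat \<Rightarrow> (real^'n) set" and \<psi> :: "nat \<Rightarrow> real^'n \<Rightarrow> real^'n" and k :: "nat \<Rightarrow> 'n" and B :: "nat \<Rightarrow> (real^'n) set"
  where "\<And>m. hyper_chart N (V m) (W m) (\<psi> m) (k m)" "\<And>m. P (W m)"
    "\<And>m. B m \<in> sets borel" "\<And>m. B m \<subseteq> N \<inter> W m" "disjoint_family B" "(\<Union>m. B m) = N"
proof -
  define Q where "Q W \<longleftrightarrow> P W \<and> (\<exists>V \<psi> k. hyper_chart N V W \<psi> k)" for W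
  have "\<exists>W. open W \<and> x \<in> W \<and> Q W" if x: "x \<in> N" for x
  proof -
    obtain V W \<psi> K where c: "chart (CARD('n) - 1) N V W \<psi> K" "x \<in> W" by (rule chartedE[OF N x]) (rule that)
    obtain k where k: "hyper_chart N V W \<psi> k" using hyper_chartI[OF c(1)] by blast
    obtain G where G: "open G" "x \<in> G" "P G" using P(1)[OF x] by blast
    have o: "open (W \<inter> G)" by (rule open_Int[OF hyper_chartD(2)[OF k] G(1)])
    have "hyper_chart N (V \<inter> \<psi> -` (W \<inter> G)) (W \<inter> G) \<psi> k" by (rule chart_restrict[OF k o]) simp
    moreover have "P (W \<inter> G)" using P(2)[OF G(3)] by simp
    ultimately have "Q (W \<inter> G)" unfolding Q_def by blast
    then show ?thesis using o c(2) G(2) by blast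
  qed
  then obtain \<W> where \<W>: "countable \<W>" "\<And>W. W \<in> \<W> \<Longrightarrow> open W \<and> Q W" "N \<subseteq> \<Union>\<W>"
    using countable_local_cover[of N Q] by blast
  define W where "W = from_nat_into (insert {} \<W>)"
  have Q0: "Q {}" using empty_hyper_chart P(3) unfolding Q_def by blast
  have rW: "range W = insert {} \<W>"
    unfolding W_def using \<W>(1) by (intro range_from_nat_into) auto
  have QW: "Q (W m)" for m
  proof -
    have "W m \<in> insert {} \<W>" using rW by blast
    then consider "W m = {}" | "W m \<in> \<W>" by blast
    then show ?thesis
    proof cases
      case 1
      show ?thesis unfolding 1 by (rule Q0)
    next
      case 2
      then show ?thesis using \<W>(2) by simp
    qed
  qed
  have "\<forall>m. \<exists>p. hyper_chart N (fst p) (W m) (fst (snd p)) (snd (snd p))"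
    using QW by (simp add: Q_def)
  from choice[OF this] obtain p where p: "\<And>m. hyper_chart N (fst (p m)) (W m) (fst (snd (p m))) (snd (snd (p m)))"
    by blast
  define B where "B = disjointed (\<lambda>m. N \<inter> W m)"
  have oW: "open (W m)" for m using hyper_chartD(2)[OF p] .
  have "range (\<lambda>m. N \<inter> W m) \<subseteq> sets borel" using charted_borel[OF N] oW by auto
  then have rB: "range B \<subseteq> sets borel" unfolding B_def by (rule sets.range_disjointed_sets)
  have UB: "(\<Union>m. B m) = N"
  proof -
    have "(\<Union>m. B m) = (\<Union>m. N \<inter> W m)" unfolding B_def by (rule UN_disjointed_eq)
    also have "\<dots> = N" 
    proof -
      have "(\<Union>m. N \<inter> W m) = N \<inter> \<Union>(range W)" by blast
      then show ?thesis using \<W>(3) by (simp add: rW Int_absorb2)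
    qed
    finally show ?thesis .
  qed
  show ?thesis
  proof (rule that[of "\<lambda>m. fst (p m)" W "\<lambda>m. fst (snd (p m))" "\<lambda>m. snd (snd (p m))" B])
    show "hyper_chart N (fst (p m)) (W m) (fst (snd (p m))) (snd (snd (p m)))" for m by (rule p)
    show "P (W m)" for m using QW by (simp add: Q_def)
    show "B m \<in> sets borel" for m using rB by blast
    show "B m \<subseteq> N \<inter> W m" for m unfolding B_def by (rule disjointed_subset)
    show "disjoint_family B" unfolding B_def by (rule disjoint_family_disjointed)
    show "(\<Union>m. B m) = N" by (rule UB)
  qed
qed

lemma nn_integral_span_coord:
  assumes "K \<subseteq> Basis"
  shows "(\<integral>\<^sup>+y\<in>V \<inter> span K \<inter> \<psi> -` A. ennreal (sqrt (gram_det K (frechet_derivative \<psi> (at y)))) \<partial>coord_lborel K) =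
    (\<integral>\<^sup>+y\<in>V \<inter> \<psi> -` A. vol_factor V \<psi> K y \<partial>coord_lborel K)"
  by (rule nn_integral_cong_AE, rule AE_mp[OF AE_coord_lborel[OF assms] AE_I2])
    (auto simp: indicator_def vol_factor_def)

lemma riemannian_volume_chart:
  fixes N :: "(real^'n) set"
  assumes "is_riemannian_volume (CARD('n) - 1) N \<mu>" "hyper_chart N V W \<psi> k" "A \<in> sets borel" "A \<subseteq> N \<inter> W"
  shows "emeasure \<mu> A = (\<integral>\<^sup>+y\<in>V \<inter> \<psi> -` A. vol_factor V \<psi> (Basis - {axis k 1}) y \<partial>coord_lborel (Basis - {axis k 1}))"
proof -
  have "emeasure \<mu> A = (\<integral>\<^sup>+y\<in>V \<inter> span (Basis - {axis k 1}) \<inter> \<psi> -` A.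
     ennreal (sqrt (gram_det (Basis - {axis k 1}) (frechet_derivative \<psi> (at y)))) \<partial>coord_lborel (Basis - {axis k 1}))"
    using assms unfolding is_riemannian_volume_def chart_def by blast
  also have "\<dots> = (\<integral>\<^sup>+y\<in>V \<inter> \<psi> -` A. vol_factor V \<psi> (Basis - {axis k 1}) y \<partial>coord_lborel (Basis - {axis k 1}))"
    by (rule nn_integral_span_coord) auto
  finally show ?thesis .
qed

text \<open>The push-forwards of the volume factors on the disjoint pieces \<open>B m\<close> are
  added up. For an arbitrary chart, \<open>chart_independence\<close> evaluates each summand in that
  chart, and countable additivity reassembles the pieces.\<close>

lemma riemannian_volume_exists:
  fixes N :: "(real^'n) set"
  assumes N: "charted (CARD('n) - 1) N"
  shows "\<exists>\<mu>. is_riemannian_volume (CARD('n) - 1) N \<mu>"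
proof -
  obtain V W :: "nat \<Rightarrow> (real^'n) set" and \<psi> k and B :: "nat \<Rightarrow> (real^'n) set"
    where c: "\<And>m. hyper_chart N (V m) (W m) (\<psi> m) (k m)"
    and B: "\<And>m. B m \<in> sets borel" "\<And>m. B m \<subseteq> N \<inter> W m" "disjoint_family B" "(\<Union>m. B m) = N"
    by (rule hyper_atlas[OF N, of "\<lambda>_. True"]) (blast, simp, simp, rule that)
  define K where "K m = Basis - {axis (k m) 1 :: real^'n}" for m
  define G where "G m = vol_factor (V m) (\<psi> m) (K m)" for m
  note h = hyper_chartD[OF c]
  note f = diffeomorphism_facts[OF h(1-3)]
  have G[measurable]: "G m \<in> borel_measurable borel" for m
    unfolding G_def by (rule measurable_vol_factor[OF h(1) f(12)])
  have VB: "V m \<inter> \<psi> m -` A \<in> sets borel" if "A \<in> sets borel" for m A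
    by (rule borel_vimage_open[OF h(1) f(14) that])
  define \<psi>0 where "\<psi>0 m = (\<lambda>y. if y \<in> V m then \<psi> m y else 0)" for m
  have \<psi>0[measurable]: "\<psi>0 m \<in> borel \<rightarrow>\<^sub>M borel" for m
    unfolding \<psi>0_def using h(1) f(14) by (intro borel_measurable_continuous_on_if) auto
  define M where "M m = distr (density (coord_lborel (K m)) (\<lambda>y. indicator (V m \<inter> \<psi> m -` B m) y * ennreal (G m y))) borel (\<psi>0 m)" for m
  have M: "emeasure (M m) A = (\<integral>\<^sup>+y\<in>V m \<inter> \<psi> m -` (B m \<inter> A). G m y \<partial>coord_lborel (K m))"
    if A[measurable]: "A \<in> sets borel" for m A
  proof -
    have [measurable]: "V m \<inter> \<psi> m -` B m \<in> sets borel" by (rule VB[OF B(1)])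
    have [measurable]: "\<psi>0 m -` A \<in> sets borel" by (rule measurable_sets_borel[OF \<psi>0 A])
    have "emeasure (M m) A = emeasure (density (coord_lborel (K m)) (\<lambda>y. indicator (V m \<inter> \<psi> m -` B m) y * ennreal (G m y))) (\<psi>0 m -` A)"
      unfolding M_def by (subst emeasure_distr) simp_all
    also have "\<dots> = (\<integral>\<^sup>+y. indicator (V m \<inter> \<psi> m -` B m) y * ennreal (G m y) * indicator (\<psi>0 m -` A) y \<partial>coord_lborel (K m))"
      by (rule emeasure_density) simp_all
    also have "\<dots> = (\<integral>\<^sup>+y\<in>V m \<inter> \<psi> m -` (B m \<inter> A). G m y \<partial>coord_lborel (K m))"
      by (intro nn_integral_cong) (auto simp: indicator_def \<psi>0_def)
    finally show ?thesis .
  qed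
  have setsM: "sets (M m) = sets borel" for m by (simp add: M_def)
  define \<mu> where "\<mu> = measure_of UNIV (sets borel) (\<lambda>A. \<Sum>m. emeasure (M m) A)"
  have sets\<mu>: "sets \<mu> = sets (borel :: (real^'n) measure)"
    unfolding \<mu>_def using sets.sets_measure_of_eq[of "borel :: (real^'n) measure"] by simp
  have em: "emeasure \<mu> A = (\<Sum>m. emeasure (M m) A)" if "A \<in> sets borel" for A
  proof (rule emeasure_measure_of[OF \<mu>_def])
    show "positive (sets \<mu>) (\<lambda>A. \<Sum>m. emeasure (M m) A)" by (simp add: positive_def)
    show "countably_additive (sets \<mu>) (\<lambda>A. \<Sum>m. emeasure (M m) A)"
    proof (rule countably_additiveI)
      fix A :: "nat \<Rightarrow> (real^'n) set" assume A: "range A \<subseteq> sets \<mu>" "disjoint_family A"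
      \<comment> \<open>The two series are interchanged by writing one of them as an integral over
        counting measure.\<close>
      have "(\<Sum>i. \<Sum>m. emeasure (M m) (A i)) = (\<Sum>i. \<integral>\<^sup>+m. emeasure (M m) (A i) \<partial>count_space UNIV)"
        by (simp add: nn_integral_count_space_nat)
      also have "\<dots> = (\<integral>\<^sup>+m. (\<Sum>i. emeasure (M m) (A i)) \<partial>count_space UNIV)"
        by (rule nn_integral_suminf[symmetric]) simp
      also have "\<dots> = (\<integral>\<^sup>+m. emeasure (M m) (\<Union>i. A i) \<partial>count_space UNIV)"
        using A by (intro nn_integral_cong suminf_emeasure) (auto simp: setsM sets\<mu>)
      finally show "(\<Sum>i. \<Sum>m. emeasure (M m) (A i)) = (\<Sum>m. emeasure (M m) (\<Union>i. A i))"
        by (simp add: nn_integral_count_space_nat)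
    qed
  qed (use that sets\<mu> in auto)
  have "is_riemannian_volume (CARD('n) - 1) N \<mu>"
    unfolding is_riemannian_volume_def
  proof (intro conjI allI impI)
    show "sets \<mu> = sets borel" by (rule sets\<mu>)
    have "N \<in> sets borel" by (rule charted_borel[OF N])
    then have nN: "- N \<in> sets borel" by (simp add: borel_comp)
    have "emeasure (M m) (- N) = 0" for m
    proof -
      have "V m \<inter> \<psi> m -` (B m \<inter> - N) = {}" using B(2) by blast
      then show ?thesis unfolding M[OF nN] by simp
    qed
    then show "emeasure \<mu> (- N) = 0" unfolding em[OF nN] by simp
  next
    fix V' W' K' A :: "(real^'n) set" and \<psi>' :: "real^'n \<Rightarrow> real^'n"
    assume a: "open V' \<and> open W' \<and> diffeomorphism V' W' \<psi>' \<and> K' \<subseteq> Basis \<and> card K' = CARD('n) - 1 \<and>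
      \<psi>' ` (V' \<inter> span K') = N \<inter> W' \<and> A \<in> sets borel \<and> A \<subseteq> N \<inter> W'"
    then have ch: "chart (CARD('n) - 1) N V' W' \<psi>' K'" and A: "A \<in> sets borel" "A \<subseteq> N \<inter> W'" by (auto simp: chart_def)
    obtain k' where k': "K' = Basis - {axis k' 1}" "hyper_chart N V' W' \<psi>' k'" by (rule hyper_chartI[OF ch])
    note h' = hyper_chartD[OF k'(2)]
    note f' = diffeomorphism_facts[OF h'(1-3)]
    have G': "vol_factor V' \<psi>' K' \<in> borel_measurable borel" by (rule measurable_vol_factor[OF h'(1) f'(12)])
    have BA: "B m \<inter> A \<in> sets borel" for m using B(1) A(1) by blast
    have VB': "V' \<inter> \<psi>' -` (B m \<inter> A) \<in> sets borel" for m by (rule borel_vimage_open[OF h'(1) f'(14) BA])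
    let ?\<nu> = "density (coord_lborel K') (\<lambda>y. ennreal (vol_factor V' \<psi>' K' y))"
    have \<nu>: "emeasure ?\<nu> X = (\<integral>\<^sup>+y\<in>X. vol_factor V' \<psi>' K' y \<partial>coord_lborel K')" if "X \<in> sets borel" for X
      using G' that by (intro emeasure_density) auto
    have "emeasure \<mu> A = (\<Sum>m. emeasure (M m) A)" by (rule em[OF A(1)])
    also have "\<dots> = (\<Sum>m. emeasure ?\<nu> (V' \<inter> \<psi>' -` (B m \<inter> A)))"
    proof (rule suminf_cong)
      fix m
      have "emeasure (M m) A = (\<integral>\<^sup>+y\<in>V' \<inter> \<psi>' -` (B m \<inter> A). vol_factor V' \<psi>' K' y \<partial>coord_lborel K')"
        unfolding M[OF A(1)] G_def K_def k'(1)
        by (rule chart_independence[OF c k'(2) BA]) (use B(2) A(2) in auto)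
      then show "emeasure (M m) A = emeasure ?\<nu> (V' \<inter> \<psi>' -` (B m \<inter> A))" using \<nu>[OF VB'] by simp
    qed
    also have "\<dots> = emeasure ?\<nu> (\<Union>m. V' \<inter> \<psi>' -` (B m \<inter> A))"
      using VB' B(3) by (intro suminf_emeasure) (auto simp: disjoint_family_on_def)
    also have "(\<Union>m. V' \<inter> \<psi>' -` (B m \<inter> A)) = V' \<inter> \<psi>' -` A"
    proof -
      have "A \<subseteq> (\<Union>m. B m)" using A(2) B(4) by simp
      then show ?thesis by blast
    qed
    also have "emeasure ?\<nu> (V' \<inter> \<psi>' -` A) = (\<integral>\<^sup>+y\<in>V' \<inter> \<psi>' -` A. vol_factor V' \<psi>' K' y \<partial>coord_lborel K')"
      by (rule \<nu>[OF borel_vimage_open[OF h'(1) f'(14) A(1)]])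
    also have "\<dots> = (\<integral>\<^sup>+y\<in>V' \<inter> span K' \<inter> \<psi>' -` A. ennreal (sqrt (gram_det K' (frechet_derivative \<psi>' (at y)))) \<partial>coord_lborel K')"
      using a by (intro nn_integral_span_coord[symmetric]) blast
    finally show "emeasure \<mu> A = (\<integral>\<^sup>+y\<in>V' \<inter> span K' \<inter> \<psi>' -` A. ennreal (sqrt (gram_det K' (frechet_derivative \<psi>' (at y)))) \<partial>coord_lborel K')" .
  qed
  then show ?thesis by blast
qed

lemma emeasure_pieces:
  fixes N :: "'a::topological_space set"
  assumes s: "sets \<mu> = sets borel" and n: "emeasure \<mu> (- N) = 0" and N: "N \<in> sets borel"
    and B: "\<And>m::nat. B m \<in> sets borel" "disjoint_family B" "(\<Union>m. B m) = N" and A: "A \<in> sets borel"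
  shows "emeasure \<mu> A = (\<Sum>m. emeasure \<mu> (A \<inter> B m))"
proof -
  have nul: "- N \<in> null_sets \<mu>" using n N s by (auto simp: null_sets_def borel_comp)
  have "(\<Sum>m. emeasure \<mu> (A \<inter> B m)) = emeasure \<mu> (\<Union>m. A \<inter> B m)"
    using B A s by (intro suminf_emeasure) (auto simp: disjoint_family_on_def)
  also have "(\<Union>m. A \<inter> B m) = A - (- N)" using B(3) by auto
  also have "emeasure \<mu> (A - (- N)) = emeasure \<mu> A"
    by (rule emeasure_Diff_null_set[OF nul]) (use A s in simp)
  finally show ?thesis by simp
qed

text \<open>The chart formula determines such a measure on subsets of each piece \<open>B m\<close>,
  and the complement of \<open>N\<close> is null, so there is at most one; with existence this
  justifies the \<open>THE\<close>.\<close>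

lemma is_riemannian_volume_riemannian_volume:
  fixes N :: "(real^'n) set"
  assumes N: "charted (CARD('n) - 1) N"
  shows "is_riemannian_volume (CARD('n) - 1) N (riemannian_volume (CARD('n) - 1) N)"
  unfolding riemannian_volume_def
proof (rule theI')
  obtain V W :: "nat \<Rightarrow> (real^'n) set" and \<psi> k and B :: "nat \<Rightarrow> (real^'n) set"
    where c: "\<And>m. hyper_chart N (V m) (W m) (\<psi> m) (k m)"
    and B: "\<And>m. B m \<in> sets borel" "\<And>m. B m \<subseteq> N \<inter> W m" "disjoint_family B" "(\<Union>m. B m) = N"
    by (rule hyper_atlas[OF N, of "\<lambda>_. True"]) (blast, simp, simp, rule that)
  have un: "\<mu> = \<mu>'" if r: "is_riemannian_volume (CARD('n) - 1) N \<mu>" "is_riemannian_volume (CARD('n) - 1) N \<mu>'" for \<mu> \<mu>'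
  proof (rule measure_eqI)
    have s: "sets \<mu> = sets borel" "sets \<mu>' = sets borel" "emeasure \<mu> (- N) = 0" "emeasure \<mu>' (- N) = 0"
      using r by (auto simp: is_riemannian_volume_def)
    then show "sets \<mu> = sets \<mu>'" by simp
    fix A assume "A \<in> sets \<mu>"
    then have A: "A \<in> sets borel" using s by simp
    have "emeasure \<mu> (A \<inter> B m) = emeasure \<mu>' (A \<inter> B m)" for m
    proof -
      have AB: "A \<inter> B m \<in> sets borel" "A \<inter> B m \<subseteq> N \<inter> W m" using A B by auto
      show ?thesis using riemannian_volume_chart[OF r(1) c AB] riemannian_volume_chart[OF r(2) c AB] by simp
    qed
    then show "emeasure \<mu> A = emeasure \<mu>' A"
      using emeasure_pieces[OF s(1,3) charted_borel[OF N] B(1,3,4) A]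
        emeasure_pieces[OF s(2,4) charted_borel[OF N] B(1,3,4) A] by simp
  qed
  show "\<exists>!\<mu>. is_riemannian_volume (CARD('n) - 1) N \<mu>"
    by (rule ex_ex1I[OF riemannian_volume_exists[OF N] un])
qed

text \<open>The chart formula for Borel subsets of \<open>B\<close> says that \<open>\<mu>\<close>
  restricted to \<open>B\<close> is the push-forward of the volume factor; equality of measures
  carries over to integrals.\<close>

lemma nn_integral_riemannian_volume_chart:
  fixes N :: "(real^'n) set"
  assumes r: "is_riemannian_volume (CARD('n) - 1) N \<mu>" and c: "hyper_chart N V W \<psi> k"
    and B: "B \<in> sets borel" "B \<subseteq> N \<inter> W" and q[measurable]: "q \<in> borel_measurable borel"
  shows "(\<integral>\<^sup>+x\<in>B. q x \<partial>\<mu>) =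
    (\<integral>\<^sup>+y\<in>V \<inter> \<psi> -` B. q (\<psi> y) * ennreal (vol_factor V \<psi> (Basis - {axis k 1}) y) \<partial>coord_lborel (Basis - {axis k 1}))"
proof -
  note h = hyper_chartD[OF c]
  note f = diffeomorphism_facts[OF h(1-3)]
  let ?K = "Basis - {axis k 1 :: real^'n}"
  let ?G = "vol_factor V \<psi> ?K"
  have G[measurable]: "?G \<in> borel_measurable borel" by (rule measurable_vol_factor[OF h(1) f(12)])
  have VB[measurable]: "V \<inter> \<psi> -` B \<in> sets borel" by (rule borel_vimage_open[OF h(1) f(14) B(1)])
  define \<psi>0 where "\<psi>0 = (\<lambda>y. if y \<in> V then \<psi> y else 0)"
  have \<psi>0[measurable]: "\<psi>0 \<in> borel \<rightarrow>\<^sub>M borel"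
    unfolding \<psi>0_def using h(1) f(14) by (intro borel_measurable_continuous_on_if) auto
  let ?M = "distr (density (coord_lborel ?K) (\<lambda>y. indicator (V \<inter> \<psi> -` B) y * ennreal (?G y))) borel \<psi>0"
  have s[measurable_cong]: "sets \<mu> = sets borel" using r by (simp add: is_riemannian_volume_def)
  have [measurable]: "B \<in> sets borel" by (rule B(1))
  have "density \<mu> (indicator B) = ?M"
  proof (rule measure_eqI)
    show "sets (density \<mu> (indicator B)) = sets ?M" by (simp add: s)
    fix A assume "A \<in> sets (density \<mu> (indicator B))"
    then have A[measurable]: "A \<in> sets borel" by (simp add: s)
    have [measurable]: "\<psi>0 -` A \<in> sets borel" by (rule measurable_sets_borel[OF \<psi>0 A])
    have AB: "B \<inter> A \<in> sets borel" "B \<inter> A \<subseteq> N \<inter> W" using B A by auto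
    have "emeasure (density \<mu> (indicator B)) A = (\<integral>\<^sup>+x. indicator B x * indicator A x \<partial>\<mu>)"
      by (rule emeasure_density) simp_all
    also have "\<dots> = emeasure \<mu> (B \<inter> A)"
      using AB(1) s by (subst indicator_inter_arith[symmetric]) simp
    also have "\<dots> = (\<integral>\<^sup>+y\<in>V \<inter> \<psi> -` (B \<inter> A). ?G y \<partial>coord_lborel ?K)"
      by (rule riemannian_volume_chart[OF r c AB])
    also have "\<dots> = (\<integral>\<^sup>+y. indicator (V \<inter> \<psi> -` B) y * ennreal (?G y) * indicator (\<psi>0 -` A) y \<partial>coord_lborel ?K)"
      by (intro nn_integral_cong) (auto simp: indicator_def \<psi>0_def)
    also have "\<dots> = emeasure (density (coord_lborel ?K) (\<lambda>y. indicator (V \<inter> \<psi> -` B) y * ennreal (?G y))) (\<psi>0 -` A)"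
      by (rule emeasure_density[symmetric]) simp_all
    also have "\<dots> = emeasure ?M A" by (subst emeasure_distr) simp_all
    finally show "emeasure (density \<mu> (indicator B)) A = emeasure ?M A" .
  qed
  then have eq: "integral\<^sup>N (density \<mu> (indicator B)) q = integral\<^sup>N ?M q" by simp
  have q\<psi>: "(\<lambda>y. q (\<psi>0 y)) \<in> borel_measurable borel" by (rule measurable_compose[OF \<psi>0 q])
  have "(\<integral>\<^sup>+x\<in>B. q x \<partial>\<mu>) = (\<integral>\<^sup>+x. indicator B x * q x \<partial>\<mu>)" by (simp add: mult.commute)
  also have "\<dots> = integral\<^sup>N (density \<mu> (indicator B)) q"
    by (rule nn_integral_density[symmetric]) simp_all
  also have "\<dots> = (\<integral>\<^sup>+y. q (\<psi>0 y) \<partial>density (coord_lborel ?K) (\<lambda>y. indicator (V \<inter> \<psi> -` B) y * ennreal (?G y)))"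
    unfolding eq by (rule nn_integral_distr) simp_all
  also have "\<dots> = (\<integral>\<^sup>+y. (indicator (V \<inter> \<psi> -` B) y * ennreal (?G y)) * q (\<psi>0 y) \<partial>coord_lborel ?K)"
    by (rule nn_integral_density) (simp_all add: q\<psi>)
  also have "\<dots> = (\<integral>\<^sup>+y\<in>V \<inter> \<psi> -` B. q (\<psi> y) * ennreal (?G y) \<partial>coord_lborel ?K)"
    by (intro nn_integral_cong) (auto simp: indicator_def \<psi>0_def mult.commute)
  finally show ?thesis .
qed

section \<open>Radial charts\<close>

lemma has_derivative_sgn_compose:
  fixes f :: "'a::real_normed_vector \<Rightarrow> 'b::real_inner"
  assumes f: "(f has_derivative f') (at x)" and nz: "f x \<noteq> 0"
  shows "((\<lambda>x. sgn (f x)) has_derivative (\<lambda>h. f' h /\<^sub>R norm (f x) - ((f' h \<bullet> f x) / norm (f x) ^ 3) *\<^sub>R f x)) (at x)"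
proof -
  have n: "((\<lambda>x. norm (f x)) has_derivative (\<lambda>h. f' h \<bullet> sgn (f x))) (at x)"
    by (rule has_derivative_compose[where g = norm, OF f has_derivative_norm[OF nz]])
  have "((\<lambda>x. inverse (norm (f x))) has_derivative (\<lambda>h. - (inverse (norm (f x)) * (f' h \<bullet> sgn (f x)) * inverse (norm (f x))))) (at x)"
    by (rule Deriv.has_derivative_inverse[OF _ n]) (simp add: nz)
  note d = has_derivative_scaleR[OF this f]
  have e: "(\<lambda>h. inverse (norm (f x)) *\<^sub>R f' h + (- (inverse (norm (f x)) * (f' h \<bullet> sgn (f x)) * inverse (norm (f x)))) *\<^sub>R f x) =
     (\<lambda>h. f' h /\<^sub>R norm (f x) - ((f' h \<bullet> f x) / norm (f x) ^ 3) *\<^sub>R f x)"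
    by (rule ext) (simp add: sgn_div_norm divide_inverse power3_eq_cube mult_ac)
  have s: "(\<lambda>x. sgn (f x)) = (\<lambda>x. inverse (norm (f x)) *\<^sub>R f x)" by (simp add: sgn_div_norm)
  show ?thesis unfolding s by (rule d[unfolded e])
qed

section \<open>Isolation of the top-dimensional strata\<close>

lemma stratificationD:
  assumes "stratification \<X> N"
  shows "\<Union>\<X> = N" "disjoint \<X>" "\<And>X. X \<in> \<X> \<Longrightarrow> \<exists>k. submanifold k X"
    "\<And>x. x \<in> N \<Longrightarrow> \<exists>W. open W \<and> x \<in> W \<and> finite {X\<in>\<X>. X \<inter> W \<noteq> {}}"
    "\<And>X Y k k'. X \<in> \<X> \<Longrightarrow> Y \<in> \<X> \<Longrightarrow> X \<noteq> Y \<Longrightarrow> X \<inter> closure Y \<noteq> {} \<Longrightarrow>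
       submanifold k X \<Longrightarrow> submanifold k' Y \<Longrightarrow> k < k'"
proof -
  show "\<Union>\<X> = N" "disjoint \<X>" using assms by (simp_all add: stratification_def)
  note a = assms[unfolded stratification_def]
  have 1: "\<forall>X\<in>\<X>. X \<noteq> {} \<and> (\<exists>k. submanifold k X)"
    and 2: "\<forall>x\<in>N. \<exists>W. open W \<and> x \<in> W \<and> finite {X\<in>\<X>. X \<inter> W \<noteq> {}}"
    and 3: "\<forall>X\<in>\<X>. \<forall>Y\<in>\<X>. X \<noteq> Y \<and> X \<inter> closure Y \<noteq> {} \<longrightarrow>
        X \<subseteq> closure Y \<and> (\<forall>k k'. submanifold k X \<and> submanifold k' Y \<longrightarrow> k < k')"
    using conjunct1[OF conjunct2[OF conjunct2[OF a]]] conjunct1[OF conjunct2[OF conjunct2[OF conjunct2[OF a]]]]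
      conjunct2[OF conjunct2[OF conjunct2[OF conjunct2[OF a]]]] by fast+
  show "\<exists>k. submanifold k X" if "X \<in> \<X>" for X using bspec[OF 1 that] by simp
  show "\<exists>W. open W \<and> x \<in> W \<and> finite {X\<in>\<X>. X \<inter> W \<noteq> {}}" if "x \<in> N" for x by (rule bspec[OF 2 that])
  show "k < k'" if "X \<in> \<X>" "Y \<in> \<X>" "X \<noteq> Y" "X \<inter> closure Y \<noteq> {}" "submanifold k X" "submanifold k' Y" for X Y k k'
    using bspec[OF bspec[OF 3 that(1)] that(2)] that(3-6) by simp
qed

text \<open>The frontier condition makes the dimension strictly larger for any other stratum whose
  closure meets \<open>X\<close>. Another stratum of the same dimension therefore does not have
  \<open>x\<close> in its closure, and by local finiteness only finitely many closures have to be
  removed.\<close>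

lemma stratum_isolated:
  fixes \<X> :: "'a::euclidean_space set set"
  assumes s: "stratification \<X> N" and X: "X \<in> \<X>" "submanifold k X" "x \<in> X"
  obtains W where "open W" "x \<in> W" "\<And>Y. Y \<in> \<X> \<Longrightarrow> submanifold k Y \<Longrightarrow> Y \<inter> W \<noteq> {} \<Longrightarrow> Y = X"
proof -
  have "x \<in> N" using stratificationD(1)[OF s] X by blast
  from stratificationD(4)[OF s this]
  obtain W0 where W0: "open W0" "x \<in> W0" "finite {Y\<in>\<X>. Y \<inter> W0 \<noteq> {}}" by (elim exE conjE)
  define \<Y> where "\<Y> = {Y\<in>\<X>. Y \<inter> W0 \<noteq> {} \<and> Y \<noteq> X \<and> submanifold k Y}"
  have fin: "finite \<Y>" by (rule finite_subset[OF _ W0(3)]) (auto simp: \<Y>_def)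
  have notin: "x \<notin> closure Y" if Y: "Y \<in> \<Y>" for Y
  proof
    assume "x \<in> closure Y"
    then have i: "X \<inter> closure Y \<noteq> {}" using X(3) by blast
    have y: "Y \<in> \<X>" "X \<noteq> Y" "submanifold k Y" using Y by (auto simp: \<Y>_def)
    have "k < k" by (rule stratificationD(5)[OF s X(1) y(1,2) i X(2) y(3)])
    then show False by simp
  qed
  define W where "W = W0 - (\<Union>Y\<in>\<Y>. closure Y)"
  have o: "open W" unfolding W_def using fin W0(1) by (intro open_Diff closed_UN) auto
  have xW: "x \<in> W" unfolding W_def using W0(2) notin by blast
  have "Y = X" if Y: "Y \<in> \<X>" "submanifold k Y" "Y \<inter> W \<noteq> {}" for Y
  proof (rule ccontr)
    assume "Y \<noteq> X"
    moreover have "Y \<inter> W0 \<noteq> {}" using Y(3) by (auto simp: W_def)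
    ultimately have "Y \<in> \<Y>" using Y by (simp add: \<Y>_def)
    then have "Y \<inter> W = {}" using closure_subset[of Y] by (auto simp: W_def)
    then show False using Y(3) by blast
  qed
  then show ?thesis by (rule that[OF o xW])
qed

text \<open>Near a point of a stratum of dimension \<open>DIM('a) - 1\<close> the regular part
  consists of that stratum alone, so suitably restricted charts of the stratum are charts of the
  regular part.\<close>

lemma regular_part_charted:
  fixes \<T> :: "'a::euclidean_space set set"
  assumes s: "stratification \<T> N"
  shows "charted (DIM('a) - 1) (regular_part \<T>)"
  unfolding charted_def
proof
  fix x assume "x \<in> regular_part \<T>"
  then obtain X where X: "X \<in> \<T>" "submanifold (DIM('a) - 1) X" "x \<in> X" by (auto simp: regular_part_def)
  obtain W1 where W1: "open W1" "x \<in> W1" "\<And>Y. Y \<in> \<T> \<Longrightarrow> submanifold (DIM('a) - 1) Y \<Longrightarrow> Y \<inter> W1 \<noteq> {} \<Longrightarrow> Y = X"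
    by (rule stratum_isolated[OF s X]) (rule that)
  obtain V W \<psi> K where c: "chart (DIM('a) - 1) X V W \<psi> K" "x \<in> W" using submanifold_chart[OF X(2,3)] .
  have "open (W \<inter> W1)" using c W1 by (auto simp: chart_def)
  then have "chart (DIM('a) - 1) X (V \<inter> \<psi> -` (W \<inter> W1)) (W \<inter> W1) \<psi> K" by (rule chart_restrict[OF c(1)]) simp
  moreover have "X \<inter> (W \<inter> W1) = regular_part \<T> \<inter> (W \<inter> W1)"
  proof
    show "X \<inter> (W \<inter> W1) \<subseteq> regular_part \<T> \<inter> (W \<inter> W1)" using X by (auto simp: regular_part_def)
    show "regular_part \<T> \<inter> (W \<inter> W1) \<subseteq> X \<inter> (W \<inter> W1)"
    proof
      fix z assume z: "z \<in> regular_part \<T> \<inter> (W \<inter> W1)"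
      then obtain Y where Y: "Y \<in> \<T>" "submanifold (DIM('a) - 1) Y" "z \<in> Y" by (auto simp: regular_part_def)
      have "Y = X" by (rule W1(3)[OF Y(1,2)]) (use Y(3) z in blast)
      then show "z \<in> X \<inter> (W \<inter> W1)" using Y z by blast
    qed
  qed
  ultimately have "chart (DIM('a) - 1) (regular_part \<T>) (V \<inter> \<psi> -` (W \<inter> W1)) (W \<inter> W1) \<psi> K"
    by (rule chart_cong)
  then show "\<exists>V W \<psi> K. chart (DIM('a) - 1) (regular_part \<T>) V W \<psi> K \<and> x \<in> W" using c(2) W1(2) by blast
qed

lemma opposite_sides_commute: "opposite_sides T v w \<Longrightarrow> opposite_sides T w v"
  unfolding opposite_sides_def by (elim exE conjE, rule_tac x = "- \<nu>" in exI) auto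

text \<open>The unit normals of the hyperplane are \<open>\<nu>\<close> and \<open>- \<nu>\<close>;
  the sign condition in \<open>unit_normal\<close> selects the one on the side of
  \<open>v\<close>.\<close>

lemma unit_normal_hyperplane:
  assumes T: "T = {z. z \<bullet> \<nu> = 0}" and n: "norm \<nu> = 1" and v: "v \<bullet> \<nu> \<noteq> 0"
  shows "v \<bullet> unit_normal T v = \<bar>v \<bullet> \<nu>\<bar>"
proof -
  have nn: "\<nu> \<bullet> \<nu> = 1" using n by (simp add: norm_eq_1)
  define s where "s = sgn (v \<bullet> \<nu>)"
  have s: "s * s = 1" "s * (v \<bullet> \<nu>) = \<bar>v \<bullet> \<nu>\<bar>" "\<bar>s\<bar> = 1" using v by (auto simp: s_def sgn_if)
  have "unit_normal T v = s *\<^sub>R \<nu>"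
    unfolding unit_normal_def
  proof (rule the_equality)
    show "norm (s *\<^sub>R \<nu>) = 1 \<and> (\<forall>z\<in>T. z \<bullet> s *\<^sub>R \<nu> = 0) \<and> 0 < v \<bullet> s *\<^sub>R \<nu>"
      using s n v by (auto simp: T)
    fix \<mu> assume \<mu>: "norm \<mu> = 1 \<and> (\<forall>z\<in>T. z \<bullet> \<mu> = 0) \<and> 0 < v \<bullet> \<mu>"
    define c where "c = \<mu> \<bullet> \<nu>"
    have "\<mu> - c *\<^sub>R \<nu> \<in> T" using nn by (simp add: T c_def inner_diff_left)
    then have "(\<mu> - c *\<^sub>R \<nu>) \<bullet> \<mu> = 0" "(\<mu> - c *\<^sub>R \<nu>) \<bullet> \<nu> = 0" using \<mu> by (auto simp: T)
    then have "(\<mu> - c *\<^sub>R \<nu>) \<bullet> (\<mu> - c *\<^sub>R \<nu>) = 0" by (simp add: inner_diff_right)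
    then have e: "\<mu> = c *\<^sub>R \<nu>" by simp
    then have "\<bar>c\<bar> = 1" using \<mu> n by simp
    moreover have "0 < c * (v \<bullet> \<nu>)" using \<mu> e by simp
    ultimately have "c = s" using v by (auto simp: s_def sgn_if abs_if zero_less_mult_iff split: if_splits)
    then show "\<mu> = s *\<^sub>R \<nu>" using e by simp
  qed
  then show ?thesis using s by simp
qed

text \<open>A chart \<open>\<psi>\<close> of the regular part, together with the two smooth branches \<open>H\<close>, \<open>H'\<close> of \<open>U\<close>.
  The radial lines of the branch \<open>H\<close> are parametrized by \<open>\<Theta>\<close>, with the \<open>k\<close>-th coordinate as time.\<close>

locale branch_chart =
  fixes \<T> :: "(real^'n) set set" and U :: "real^'n \<Rightarrow> (real^'n) set"
    and V W :: "(real^'n) set" and \<psi> :: "real^'n \<Rightarrow> real^'n" and k :: 'n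
    and H H' :: "real^'n \<Rightarrow> real^'n"
  assumes chart: "hyper_chart (regular_part \<T>) V W \<psi> k"
    and smooth: "smooth_on W H" "smooth_on W H'"
    and nz: "\<And>x. x \<in> W \<Longrightarrow> H x \<noteq> 0"
    and U: "\<And>x. x \<in> regular_part \<T> \<Longrightarrow> x \<in> W \<Longrightarrow> U x = {H x, H' x}"
    and sides: "\<And>x. x \<in> regular_part \<T> \<Longrightarrow> x \<in> W \<Longrightarrow> opposite_sides (tangent_space (regular_part \<T>) x) (H x) (H' x)"
begin

abbreviation R where "R \<equiv> regular_part \<T>"

lemmas oV = hyper_chartD(1)[OF chart] and oW = hyper_chartD(2)[OF chart]
  and diffeo = hyper_chartD(3)[OF chart]

lemmas dfacts = diffeomorphism_facts[OF oV oW diffeo]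

definition u where "u x = sgn (H x)"

text \<open>The quotient rule for \<open>sgn \<circ> H\<close>: the second summand removes the
  component of the variation along \<open>H x\<close>, since the length stays equal to one.\<close>

definition Du where "Du x h = frechet_derivative H (at x) h /\<^sub>R norm (H x) -
  ((frechet_derivative H (at x) h \<bullet> H x) / norm (H x) ^ 3) *\<^sub>R H x"

definition \<Theta> where "\<Theta> z = \<psi> (drop_coord k z) + (z $ k) *\<^sub>R u (\<psi> (drop_coord k z))"

definition \<Theta>' where "\<Theta>' z v = frechet_derivative \<psi> (at (drop_coord k z)) (drop_coord k v) +
   ((z $ k) *\<^sub>R Du (\<psi> (drop_coord k z)) (frechet_derivative \<psi> (at (drop_coord k z)) (drop_coord k v)) +
    (v $ k) *\<^sub>R u (\<psi> (drop_coord k z)))"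

lemma has_derivative_H: "x \<in> W \<Longrightarrow> (H has_derivative frechet_derivative H (at x)) (at x)"
  by (rule has_derivative_frechet_derivative) (rule smooth_on_open(1)[OF oW smooth(1)])

lemma has_derivative_u: "x \<in> W \<Longrightarrow> (u has_derivative Du x) (at x)"
  using has_derivative_sgn_compose[OF has_derivative_H nz] by (simp add: u_def[abs_def] Du_def[abs_def])

lemma in_R: "y \<in> V \<Longrightarrow> y $ k = 0 \<Longrightarrow> \<psi> y \<in> R \<and> \<psi> y \<in> W"
proof -
  assume "y \<in> V" "y $ k = 0"
  then have "\<psi> y \<in> \<psi> ` (V \<inter> {y. y $ k = 0})" by blast
  then show ?thesis unfolding hyper_chartD(4)[OF chart] by simp
qed

lemma has_derivative_\<Theta>:
  assumes z: "drop_coord k z \<in> V"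
  shows "(\<Theta> has_derivative \<Theta>' z) (at z)"
proof -
  have w: "\<psi> (drop_coord k z) \<in> W" using dfacts(6)[OF z] .
  have d0: "(drop_coord k has_derivative drop_coord k) (at z)"
    using linear_drop_coord[of k] by (intro bounded_linear_imp_has_derivative) (simp add: linear_conv_bounded_linear)
  note d1 = has_derivative_compose[where g = \<psi>, OF d0 dfacts(8)[OF z]]
  note d2 = has_derivative_compose[where g = u and f = "\<lambda>z. \<psi> (drop_coord k z)", OF d1 has_derivative_u[OF w]]
  have d3: "((\<lambda>z::real^'n. z $ k) has_derivative (\<lambda>v. v $ k)) (at z)"
    by (intro bounded_linear_imp_has_derivative bounded_linear_vec_nth)
  show ?thesis
    unfolding \<Theta>_def \<Theta>'_def by (rule has_derivative_add[OF d1 has_derivative_scaleR[OF d3 d2]])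
qed

lemma continuous_det_\<Theta>': "continuous_on {z. drop_coord k z \<in> V} (\<lambda>z. det (matrix (\<Theta>' z)))"
proof -
  let ?Vo = "{z. drop_coord k z \<in> V}"
  have c\<psi>: "continuous_on ?Vo (\<lambda>z. \<psi> (drop_coord k z))"
    by (rule continuous_on_compose2[OF dfacts(14)]) (auto intro!: continuous_intros)
  have cH: "continuous_on ?Vo (\<lambda>z. H (\<psi> (drop_coord k z)))"
    by (rule continuous_on_compose2[OF smooth_on_imp_continuous_on[OF smooth(1)] c\<psi>]) (use dfacts(6) in auto)
  have cD1: "continuous_on ?Vo (\<lambda>z. frechet_derivative \<psi> (at (drop_coord k z)) v)" for v
    by (rule continuous_on_compose2[OF smooth_on_open(2)[OF oV dfacts(12)]]) (auto intro!: continuous_intros)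
  have cD2: "continuous_on ?Vo (\<lambda>z. frechet_derivative H (at (\<psi> (drop_coord k z))) v)" for v
    by (rule continuous_on_compose2[OF smooth_on_open(2)[OF oW smooth(1)] c\<psi>]) (use dfacts(6) in auto)
  \<comment> \<open>As above, the moving direction is expanded in coordinates, because continuity is
    known for fixed directions.\<close>
  have lin: "frechet_derivative H (at (\<psi> (drop_coord k z))) a =
     (\<Sum>i\<in>UNIV. (a $ i) *\<^sub>R frechet_derivative H (at (\<psi> (drop_coord k z))) (axis i 1))" if z: "z \<in> ?Vo" for a z
  proof -
    have l: "linear (frechet_derivative H (at (\<psi> (drop_coord k z))))"
      using z dfacts(6) by (intro has_derivative_linear[OF has_derivative_H]) auto
    show ?thesis using linear_sum[OF l, of "\<lambda>i. (a $ i) *\<^sub>R axis i 1" UNIV] linear_cmul[OF l]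
      by (simp add: sum_axis)
  qed
  have cHD: "continuous_on ?Vo (\<lambda>z. frechet_derivative H (at (\<psi> (drop_coord k z))) (frechet_derivative \<psi> (at (drop_coord k z)) v))" for v
  proof -
    have "continuous_on ?Vo (\<lambda>z. \<Sum>i\<in>UNIV. (frechet_derivative \<psi> (at (drop_coord k z)) v $ i) *\<^sub>R frechet_derivative H (at (\<psi> (drop_coord k z))) (axis i 1))"
      by (intro continuous_intros cD1 cD2)
    then show ?thesis by (rule continuous_on_eq) (rule lin[symmetric])
  qed
  have nH: "norm (H (\<psi> (drop_coord k z))) \<noteq> 0" if "z \<in> ?Vo" for z using nz dfacts(6) that by auto
  have "continuous_on ?Vo (\<lambda>z. \<Theta>' z v)" for v
    unfolding \<Theta>'_def Du_def u_def sgn_div_norm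
    by (intro continuous_intros cH cHD cD1) (use nH in auto)
  then show ?thesis
    by (intro continuous_on_matrix_det) (auto simp: matrix_def intro!: continuous_intros)
qed

context
  fixes y x \<nu>
  assumes y: "y \<in> V" "y $ k = 0" and x: "x = \<psi> y" and n: "norm \<nu> = 1"
    and T: "tangent_space R x = {z. z \<bullet> \<nu> = 0}"
    and D\<nu>: "\<And>i. i \<noteq> k \<Longrightarrow> frechet_derivative \<psi> (at y) (axis i 1) \<bullet> \<nu> = 0"
begin

lemma xR: "x \<in> R" "x \<in> W" using in_R[OF y] x by auto

lemma u_normal: "u x \<bullet> \<nu> \<noteq> 0" "H x \<bullet> \<nu> \<noteq> 0"
proof -
  obtain \<mu> where \<mu>: "\<forall>z\<in>tangent_space R x. z \<bullet> \<mu> = 0" "H x \<bullet> \<mu> > 0"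
    using sides[OF xR] by (auto simp: opposite_sides_def)
  \<comment> \<open>If this product vanished, \<open>H x\<close> would be a tangent vector and hence
    orthogonal to \<open>\<mu>\<close>.\<close>
  then show "H x \<bullet> \<nu> \<noteq> 0" by (auto simp: T)
  then show "u x \<bullet> \<nu> \<noteq> 0" using nz[OF xR(2)] by (simp add: u_def sgn_div_norm)
qed

lemma row_det_u: "row_det k (\<lambda>i. frechet_derivative \<psi> (at y) (axis i 1)) (u x) =
    (u x \<bullet> \<nu>) * row_det k (\<lambda>i. frechet_derivative \<psi> (at y) (axis i 1)) \<nu>"
  by (rule row_det_normal[OF n]) (rule D\<nu>)

text \<open>The extension \<open>L\<close> of the derivative of \<open>\<psi>\<close> by
  \<open>\<nu>\<close> is injective: the component along \<open>\<nu>\<close> recovers the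
  \<open>k\<close>-th coordinate, and the derivative of \<open>\<psi>\<close> is itself
  injective.\<close>

lemma row_det_nonzero: "row_det k (\<lambda>i. frechet_derivative \<psi> (at y) (axis i 1)) \<nu> \<noteq> 0"
proof -
  let ?D = "frechet_derivative \<psi> (at y)"
  have lin: "linear ?D" using has_derivative_linear[OF dfacts(8)[OF y(1)]] .
  have nn: "\<nu> \<bullet> \<nu> = 1" using n by (simp add: norm_eq_1)
  define L where "L = (\<lambda>w. ?D (drop_coord k w) + (w $ k) *\<^sub>R \<nu>)"
  have linL: "linear L" unfolding L_def
    using lin by (intro linearI) (auto simp: linear_add linear_diff linear_cmul algebra_simps)
  have TD: "tangent_space R x = ?D ` span (Basis - {axis k 1})"
    unfolding x by (rule tangent_space_chart[OF chart y(1)]) (simp add: span_Basis_minus y)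
  have "inj L"
  proof (subst linear_injective_0[OF linL], intro allI impI)
    fix w assume w: "L w = 0"
    have "?D (drop_coord k w) \<in> tangent_space R x" unfolding TD by (rule imageI[OF drop_coord_in_span])
    then have "?D (drop_coord k w) \<bullet> \<nu> = 0" by (simp add: T)
    then have "L w \<bullet> \<nu> = w $ k" by (simp add: L_def inner_add_left nn)
    then have wk: "w $ k = 0" using w by simp
    then have "?D w = 0" using w by (simp add: L_def)
    then show "w = 0" using dfacts(10)[OF y(1), of w] has_derivative_linear[OF dfacts(9)[OF dfacts(6)[OF y(1)]]]
      by (simp add: linear_0)
  qed
  then have "det (matrix L) \<noteq> 0" using det_nz_iff_inj[OF linL] by simp
  moreover have "det (matrix L) = row_det k (\<lambda>i. ?D (axis i 1)) \<nu>"
  proof -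
    have "L (axis k 1) = \<nu>" using linear_0[OF lin] by (simp add: L_def)
    moreover have "L (axis i 1) = ?D (axis i 1)" if "i \<noteq> k" for i using that by (simp add: L_def axis_def)
    ultimately show ?thesis unfolding det_matrix_row_det[of L k] by (intro row_det_cong_full) auto
  qed
  ultimately show ?thesis by simp
qed

text \<open>The volume factor is the absolute row determinant with the unit normal
  \<open>\<nu>\<close> in place \<open>k\<close>, and
  \<open>\<rho> = \<bar>u \<bullet> \<nu>\<bar>\<close>. In the product \<open>\<nu>\<close> is
  replaced by \<open>u\<close>, which is why \<open>dM\<close> carries the weight
  \<open>\<rho>\<close>.\<close>

lemma density_factor:
  "vol_factor V \<psi> (Basis - {axis k 1}) y * radial_density \<T> (x, H x) =
     \<bar>row_det k (\<lambda>i. frechet_derivative \<psi> (at y) (axis i 1)) (u x)\<bar>"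
  "radial_density \<T> (x, H x) > 0"
proof -
  have e: "H x = norm (H x) *\<^sub>R u x" by (simp add: u_def sgn_div_norm nz[OF xR(2)])
  have "H x \<bullet> unit_normal (tangent_space R x) (H x) = \<bar>H x \<bullet> \<nu>\<bar>"
    by (rule unit_normal_hyperplane[OF T n u_normal(2)])
  then have r: "radial_density \<T> (x, H x) = \<bar>u x \<bullet> \<nu>\<bar>"
    using nz[OF xR(2)] by (simp add: radial_density_def u_def sgn_div_norm abs_mult)
  show "radial_density \<T> (x, H x) > 0" using r u_normal(1) by simp
  have "vol_factor V \<psi> (Basis - {axis k 1}) y = \<bar>row_det k (\<lambda>i. frechet_derivative \<psi> (at y) (axis i 1)) \<nu>\<bar>"
    by (rule vol_factor_normal[OF chart y(1) n]) (rule D\<nu>)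
  then show "vol_factor V \<psi> (Basis - {axis k 1}) y * radial_density \<T> (x, H x) =
     \<bar>row_det k (\<lambda>i. frechet_derivative \<psi> (at y) (axis i 1)) (u x)\<bar>"
    by (simp add: r row_det_u abs_mult)
qed

text \<open>\<open>local_branch\<close> is an unspecified extension \<open>L\<close>. By continuity
  it differs from \<open>H'\<close> near \<open>x\<close>, so at nearby points of the regular part
  its only possible value is that of \<open>H\<close>. Hence \<open>L\<close> and \<open>H\<close>
  agree along the chart lines through \<open>x\<close>, and the derivatives of their directions
  agree on tangent vectors.\<close>

lemma local_branch_derivative:
  defines "L \<equiv> local_branch \<T> U (x, H x)"
  shows "(\<lambda>z. sgn (L z)) differentiable (at x)"
    "y' $ k = 0 \<Longrightarrow> frechet_derivative (\<lambda>z. sgn (L z)) (at x) (frechet_derivative \<psi> (at y) y') =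
       Du x (frechet_derivative \<psi> (at y) y')"
proof -
  let ?P = "\<lambda>F. F (fst (x, H x)) = snd (x, H x) \<and> (\<exists>W. open W \<and> fst (x, H x) \<in> W \<and>
     (\<forall>k. C_k_on k F W) \<and> (\<forall>y\<in>R \<inter> W. F y \<in> U y))"
  have "\<exists>F. ?P F"
  proof -
    obtain W1 F where F: "open W1" "x \<in> W1" "\<And>j. C_k_on j F W1" "\<And>y. y \<in> W \<Longrightarrow> y \<in> W1 \<Longrightarrow> F y = H y"
      using smooth_on_extension[OF smooth(1) xR(2)] by metis
    have "open (W1 \<inter> W)" using F(1) oW by (rule open_Int)
    moreover have "C_k_on j F (W1 \<inter> W)" for j by (rule C_k_on_subset[OF F(3)]) simp
    moreover have "\<forall>y\<in>R \<inter> (W1 \<inter> W). F y \<in> U y" using F(4) U by auto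
    ultimately show ?thesis using F(2,4) xR(2) by (intro exI[of _ F]) auto
  qed
  then have "?P L" unfolding L_def local_branch_def by (rule someI_ex)
  then obtain W1 where L: "L x = H x" "open W1" "x \<in> W1" "\<And>j. C_k_on j L W1" "\<And>y. y \<in> R \<Longrightarrow> y \<in> W1 \<Longrightarrow> L y \<in> U y"
    by auto
  have "L differentiable (at x)" using C_k_on_1D(1)[OF L(4,3)] .
  then have dL: "(L has_derivative frechet_derivative L (at x)) (at x)" by (rule has_derivative_frechet_derivative)
  have "L x \<noteq> 0" using L(1) nz[OF xR(2)] by simp
  from has_derivative_sgn_compose[OF dL this]
  show dd: "(\<lambda>z. sgn (L z)) differentiable (at x)" by (rule has_derivative_imp_differentiable)
  then have ds: "((\<lambda>z. sgn (L z)) has_derivative frechet_derivative (\<lambda>z. sgn (L z)) (at x)) (at x)"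
    by (rule has_derivative_frechet_derivative)
  have "H x \<noteq> H' x" using sides[OF xR] by (auto simp: opposite_sides_def)
  then have ne: "L x - H' x \<noteq> 0" using L(1) by simp
  have "isCont (\<lambda>z. L z - H' z) x"
    using has_derivative_continuous[OF dL] smooth_on_imp_continuous_on[OF smooth(2)] oW xR(2)
    by (intro continuous_intros) (auto simp: continuous_on_eq_continuous_at)
  then have "\<forall>\<^sub>F z in at x. L z - H' z \<noteq> 0"
    using ne unfolding isCont_def by (rule tendsto_imp_eventually_ne)
  then have "\<forall>\<^sub>F z in nhds x. L z - H' z \<noteq> 0" using ne by (simp add: eventually_nhds_conv_at)
  moreover have "\<forall>\<^sub>F z in nhds x. z \<in> W1" "\<forall>\<^sub>F z in nhds x. z \<in> W"
    using L(2,3) oW xR(2) by (auto simp: eventually_nhds_in_open)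
  ultimately have "\<forall>\<^sub>F z in nhds x. z \<in> R \<longrightarrow> L z = H z"
  proof eventually_elim
    case (elim z)
    show ?case
    proof
      assume "z \<in> R"
      then have "L z \<in> {H z, H' z}" using L(5) U elim by auto
      then show "L z = H z" using elim by auto
    qed
  qed
  then obtain G where G: "open G" "x \<in> G" "\<And>z. z \<in> G \<Longrightarrow> z \<in> R \<Longrightarrow> L z = H z"
    by (auto simp: eventually_nhds)
  show "frechet_derivative (\<lambda>z. sgn (L z)) (at x) (frechet_derivative \<psi> (at y) y') =
       Du x (frechet_derivative \<psi> (at y) y')" if y': "y' $ k = 0"
  proof -
    let ?D = "frechet_derivative \<psi> (at y)"
    have l1: "((\<lambda>t::real. y + t *\<^sub>R y') has_derivative (\<lambda>t. t *\<^sub>R y')) (at 0)"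
      by (auto intro!: derivative_eq_intros)
    have l2: "((\<lambda>t::real. \<psi> (y + t *\<^sub>R y')) has_derivative (\<lambda>t. ?D (t *\<^sub>R y'))) (at 0)"
      by (rule has_derivative_compose[where g = \<psi>, OF l1]) (simp add: dfacts(8)[OF y(1)])
    have linD: "linear ?D" using has_derivative_linear[OF dfacts(8)[OF y(1)]] .
    have g1: "((\<lambda>t::real. sgn (L (\<psi> (y + t *\<^sub>R y')))) has_derivative (\<lambda>t. frechet_derivative (\<lambda>z. sgn (L z)) (at x) (?D (t *\<^sub>R y')))) (at 0)"
      by (rule has_derivative_compose[where g = "\<lambda>z. sgn (L z)", OF l2]) (use ds x in simp)
    have g2: "((\<lambda>t::real. u (\<psi> (y + t *\<^sub>R y'))) has_derivative (\<lambda>t. Du x (?D (t *\<^sub>R y')))) (at 0)"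
      by (rule has_derivative_compose[where g = u, OF l2]) (use has_derivative_u[OF xR(2)] x in simp)
    define Z where "Z = {t::real. y + t *\<^sub>R y' \<in> V \<inter> \<psi> -` G}"
    have "open (V \<inter> \<psi> -` G)" by (rule continuous_open_preimage[OF dfacts(14) oV G(1)])
    moreover have "continuous_on UNIV (\<lambda>t::real. y + t *\<^sub>R y')" by (intro continuous_intros)
    ultimately have oZ: "open Z" unfolding Z_def using open_vimage[of "V \<inter> \<psi> -` G" "\<lambda>t. y + t *\<^sub>R y'"] by (simp add: vimage_def)
    have "0 \<in> Z" using y(1) G(2) x by (simp add: Z_def)
    have "((\<lambda>t::real. u (\<psi> (y + t *\<^sub>R y'))) has_derivative (\<lambda>t. frechet_derivative (\<lambda>z. sgn (L z)) (at x) (?D (t *\<^sub>R y')))) (at 0)"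
    proof (rule has_derivative_transform_within_open[OF g1 oZ \<open>0 \<in> Z\<close>])
      fix t assume t: "t \<in> Z"
      then have "\<psi> (y + t *\<^sub>R y') \<in> R" using in_R[of "y + t *\<^sub>R y'"] y(2) y' by (simp add: Z_def)
      then show "sgn (L (\<psi> (y + t *\<^sub>R y'))) = u (\<psi> (y + t *\<^sub>R y'))" using G(3) t by (simp add: Z_def u_def)
    qed
    from has_derivative_unique[OF this g2]
    have "frechet_derivative (\<lambda>z. sgn (L z)) (at x) (?D (1 *\<^sub>R y')) = Du x (?D (1 *\<^sub>R y'))" by (rule fun_cong)
    then show ?thesis by simp
  qed
qed

lemma det_on_shape:
  "det_on (tangent_space R x) (\<lambda>w. w - t *\<^sub>R radial_shape_operator \<T> U (x, H x) w) *
     row_det k (\<lambda>i. frechet_derivative \<psi> (at y) (axis i 1)) (u x) = det (matrix (\<Theta>' (y + t *\<^sub>R axis k 1)))"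
proof -
  define L where "L = local_branch \<T> U (x, H x)"
  define B where "B = frechet_derivative (\<lambda>z. sgn (L z)) (at x)"
  let ?D = "frechet_derivative \<psi> (at y)"
  let ?T = "tangent_space R x"
  have linD: "linear ?D" using has_derivative_linear[OF dfacts(8)[OF y(1)]] .
  have linB: "linear B"
    unfolding B_def L_def by (rule has_derivative_linear[OF has_derivative_frechet_derivative[OF local_branch_derivative(1)]])
  have eB: "B (?D (axis i 1)) = Du x (?D (axis i 1))" if "i \<noteq> k" for i
    unfolding B_def L_def by (rule local_branch_derivative(2)) (use that in \<open>simp add: axis_def\<close>)
  have proj: "proj_along ?T (H x) w = w - ((w \<bullet> \<nu>) / (H x \<bullet> \<nu>)) *\<^sub>R H x" for w
    by (rule hyperplane_decomp[OF T u_normal(2)])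
  define A where "A = (\<lambda>w. w - t *\<^sub>R radial_shape_operator \<T> U (x, H x) w)"
  have A: "A w = w + t *\<^sub>R proj_along ?T (H x) (B w)" for w
    by (simp add: A_def radial_shape_operator_def B_def L_def)
  have linA: "linear A"
    unfolding A proj using linB
    by (intro linearI) (auto simp: linear_add linear_cmul algebra_simps inner_add_left add_divide_distrib)
  have projT: "proj_along ?T (H x) w \<in> ?T" for w
    unfolding proj using u_normal(2) by (simp add: T inner_diff_left)
  have "det_on ?T A * row_det k (\<lambda>i. ?D (axis i 1)) (u x) = row_det k (\<lambda>i. ?D (axis i 1) + t *\<^sub>R Du x (?D (axis i 1))) (u x)"
  proof (rule det_on_hyperplane[OF T n u_normal(1) _ linA])
    show "?D (axis i 1) \<in> ?T" if "i \<noteq> k" for i using D\<nu>[OF that] by (simp add: T)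
    show "A w \<in> ?T" if "w \<in> ?T" for w
      using that projT[of "B w"] unfolding A by (simp add: T inner_add_left)
    show "?D (axis i 1) + t *\<^sub>R Du x (?D (axis i 1)) - A (?D (axis i 1)) \<in> span {u x}" if i: "i \<noteq> k" for i
    proof -
      have "?D (axis i 1) + t *\<^sub>R Du x (?D (axis i 1)) - A (?D (axis i 1)) =
        t *\<^sub>R (B (?D (axis i 1)) - proj_along ?T (H x) (B (?D (axis i 1))))"
        unfolding A eB[OF i] by (simp add: algebra_simps)
      also have "\<dots> = (t * ((B (?D (axis i 1)) \<bullet> \<nu>) / (H x \<bullet> \<nu>))) *\<^sub>R H x" by (simp add: proj)
      also have "H x = norm (H x) *\<^sub>R u x" by (simp add: u_def sgn_div_norm nz[OF xR(2)])
      finally show ?thesis by (simp add: span_scale span_base)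
    qed
  qed
  also have "\<dots> = det (matrix (\<Theta>' (y + t *\<^sub>R axis k 1)))"
  proof -
    let ?z = "y + t *\<^sub>R axis k 1"
    have d: "drop_coord k ?z = y" "?z $ k = t" using y(2) by simp_all
    have e: "\<Theta>' ?z v = ?D (drop_coord k v) + (t *\<^sub>R Du x (?D (drop_coord k v)) + (v $ k) *\<^sub>R u x)" for v
      unfolding \<Theta>'_def d(1) x[symmetric] unfolding d(2) ..
    have Du0: "Du x 0 = 0" using has_derivative_linear[OF has_derivative_u[OF xR(2)]] by (rule linear_0)
    have ax: "(axis i 1 :: real^'n) $ k = (if i = k then 1 else 0)" for i by (simp add: axis_def)
    have "\<Theta>' ?z (axis k 1) = u x" unfolding e by (simp add: ax Du0 linear_0[OF linD])
    moreover have "\<Theta>' ?z (axis i 1) = ?D (axis i 1) + t *\<^sub>R Du x (?D (axis i 1))" if "i \<noteq> k" for i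
      unfolding e using that by (simp add: ax)
    ultimately show ?thesis
      unfolding det_matrix_row_det[of "\<Theta>' ?z" k] by (intro row_det_cong_full) (simp_all del: vector_add_component)
  qed
  finally show ?thesis unfolding A_def .
qed

end

end

section \<open>The skeletal measure\<close>

lemma C_k_all_smooth_on:
  assumes "open W" "\<And>k. C_k_on k F W" "S \<subseteq> W"
  shows "smooth_on S F"
  unfolding smooth_on_def using assms by (intro ballI exI[of _ W] exI[of _ F]) auto

text \<open>The branches are smooth and nonvanishing on all of \<open>W\<close>, not just on the
  regular part, so that ordinary Frechet derivatives of \<open>H\<close> and of
  \<open>sgn \<circ> H\<close> are available.\<close>

definition has_branches :: "'a::euclidean_space set set \<Rightarrow> ('a \<Rightarrow> 'a set) \<Rightarrow> 'a set \<Rightarrow> bool" where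
  "has_branches \<T> U W \<longleftrightarrow> (\<exists>F G. smooth_on W F \<and> smooth_on W G \<and> (\<forall>x\<in>W. F x \<noteq> 0 \<and> G x \<noteq> 0) \<and>
     (\<forall>x\<in>regular_part \<T> \<inter> W. U x = {F x, G x} \<and> opposite_sides (tangent_space (regular_part \<T>) x) (F x) (G x)))"

lemma radial_fieldD:
  assumes "radial_field \<T> U"
  shows "\<And>x. x \<in> \<Union>\<T> \<Longrightarrow> 0 \<notin> U x"
    "\<And>x. x \<in> regular_part \<T> \<Longrightarrow> \<exists>W F G. open W \<and> x \<in> W \<and> smooth_on (regular_part \<T> \<inter> W) F \<and> smooth_on (regular_part \<T> \<inter> W) G \<and>
        (\<forall>y\<in>regular_part \<T> \<inter> W. U y = {F y, G y} \<and> opposite_sides (tangent_space (regular_part \<T>) y) (F y) (G y))"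
    "\<And>X x. X \<in> \<T> \<Longrightarrow> x \<in> X \<Longrightarrow> \<exists>W \<F>. open W \<and> x \<in> W \<and> finite \<F> \<and> (\<forall>F\<in>\<F>. smooth_on (X \<inter> W) F) \<and>
        (\<forall>y\<in>X \<inter> W. inj_on (\<lambda>F. F y) \<F> \<and> U y = (\<lambda>F. F y) ` \<F>)"
proof -
  note a = assms[unfolded radial_field_def Let_def]
  show "\<And>x. x \<in> \<Union>\<T> \<Longrightarrow> 0 \<notin> U x" using conjunct1[OF a] by blast
  show "\<And>x. x \<in> regular_part \<T> \<Longrightarrow> \<exists>W F G. open W \<and> x \<in> W \<and> smooth_on (regular_part \<T> \<inter> W) F \<and> smooth_on (regular_part \<T> \<inter> W) G \<and>
        (\<forall>y\<in>regular_part \<T> \<inter> W. U y = {F y, G y} \<and> opposite_sides (tangent_space (regular_part \<T>) y) (F y) (G y))"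
    by (rule bspec[OF conjunct1[OF conjunct2[OF a]]])
  show "\<And>X x. X \<in> \<T> \<Longrightarrow> x \<in> X \<Longrightarrow> \<exists>W \<F>. open W \<and> x \<in> W \<and> finite \<F> \<and> (\<forall>F\<in>\<F>. smooth_on (X \<inter> W) F) \<and>
        (\<forall>y\<in>X \<inter> W. inj_on (\<lambda>F. F y) \<F> \<and> U y = (\<lambda>F. F y) ` \<F>)"
    by (rule bspec[OF bspec[OF conjunct1[OF conjunct2[OF conjunct2[OF conjunct2[OF conjunct2[OF conjunct2[OF a]]]]]]]])
qed

lemma nonzero_extension:
  assumes "smooth_on (R \<inter> W) F" "x \<in> R" "x \<in> W" "F x \<noteq> 0"
  obtains G F' where "open G" "x \<in> G" "smooth_on G F'" "\<And>y. y \<in> G \<Longrightarrow> F' y \<noteq> 0" "\<And>y. y \<in> R \<inter> W \<inter> G \<Longrightarrow> F' y = F y"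
proof -
  obtain W1 F' where F: "open W1" "x \<in> W1" "\<And>j. C_k_on j F' W1" "\<And>y. y \<in> R \<inter> W \<Longrightarrow> y \<in> W1 \<Longrightarrow> F' y = F y"
    using smooth_on_extension[OF assms(1), of x] assms(2,3) by (metis IntI)
  have c: "continuous_on W1 F'" using F(3)[of 0] by simp
  define G where "G = W1 \<inter> F' -` (- {0})"
  have "open G" unfolding G_def by (rule continuous_open_preimage[OF c F(1)]) auto
  moreover have "x \<in> G" using F(2) F(4)[of x] assms by (simp add: G_def)
  moreover have "smooth_on G F'" by (rule C_k_all_smooth_on[OF F(1,3)]) (auto simp: G_def)
  ultimately show ?thesis using F(4) by (intro that[of G F']) (auto simp: G_def)
qed

lemma radial_field_branches:
  assumes rf: "radial_field \<T> U" and x: "x \<in> regular_part \<T>"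
  shows "\<exists>W. open W \<and> x \<in> W \<and> has_branches \<T> U W"
proof -
  let ?R = "regular_part \<T>"
  obtain W F G where W: "open W" "x \<in> W" and s: "smooth_on (?R \<inter> W) F" "smooth_on (?R \<inter> W) G"
    and U: "\<forall>y\<in>?R \<inter> W. U y = {F y, G y} \<and> opposite_sides (tangent_space ?R y) (F y) (G y)"
    using radial_fieldD(2)[OF rf x] by (elim exE conjE)
  have "x \<in> \<Union>\<T>" using x by (auto simp: regular_part_def)
  then have "0 \<notin> U x" by (rule radial_fieldD(1)[OF rf])
  then have nz: "F x \<noteq> 0" "G x \<noteq> 0" using U x W(2) by auto
  obtain W1 F' where 1: "open W1" "x \<in> W1" "smooth_on W1 F'" "\<And>y. y \<in> W1 \<Longrightarrow> F' y \<noteq> 0" "\<And>y. y \<in> ?R \<inter> W \<inter> W1 \<Longrightarrow> F' y = F y"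
    by (rule nonzero_extension[OF s(1) x W(2) nz(1)]) (rule that)
  obtain W2 G' where 2: "open W2" "x \<in> W2" "smooth_on W2 G'" "\<And>y. y \<in> W2 \<Longrightarrow> G' y \<noteq> 0" "\<And>y. y \<in> ?R \<inter> W \<inter> W2 \<Longrightarrow> G' y = G y"
    by (rule nonzero_extension[OF s(2) x W(2) nz(2)]) (rule that)
  let ?W = "W \<inter> (W1 \<inter> W2)"
  have "has_branches \<T> U ?W"
    unfolding has_branches_def
  proof (intro exI conjI)
    show "smooth_on ?W F'" by (rule smooth_on_subset[OF 1(3)]) auto
    show "smooth_on ?W G'" by (rule smooth_on_subset[OF 2(3)]) auto
    show "\<forall>x\<in>?W. F' x \<noteq> 0 \<and> G' x \<noteq> 0" using 1(4) 2(4) by simp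
    show "\<forall>x\<in>?R \<inter> ?W. U x = {F' x, G' x} \<and> opposite_sides (tangent_space ?R x) (F' x) (G' x)"
      using U 1(5) 2(5) by simp
  qed
  moreover have "open ?W" using W(1) 1(1) 2(1) by (intro open_Int)
  ultimately show ?thesis using W(2) 1(2) 2(2) by blast
qed

lemma has_branches_subset:
  assumes "has_branches \<T> U W" "W' \<subseteq> W"
  shows "has_branches \<T> U W'"
proof -
  obtain F G where *: "smooth_on W F" "smooth_on W G" "\<forall>x\<in>W. F x \<noteq> 0 \<and> G x \<noteq> 0"
     "\<forall>x\<in>regular_part \<T> \<inter> W. U x = {F x, G x} \<and> opposite_sides (tangent_space (regular_part \<T>) x) (F x) (G x)"
    using assms(1) unfolding has_branches_def by (elim exE conjE)
  show ?thesis
    unfolding has_branches_def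
  proof (intro exI conjI)
    show "smooth_on W' F" "smooth_on W' G" by (rule smooth_on_subset[OF _ assms(2)], fact)+
    show "\<forall>x\<in>W'. F x \<noteq> 0 \<and> G x \<noteq> 0" using *(3) assms(2) by auto
    show "\<forall>x\<in>regular_part \<T> \<inter> W'. U x = {F x, G x} \<and> opposite_sides (tangent_space (regular_part \<T>) x) (F x) (G x)"
      using *(4) assms(2) by auto
  qed
qed

context branch_chart
begin

text \<open>Extended by zero, so that it is Borel on the whole space; \<open>\<phi>0\<close>,
  \<open>H0\<close> and \<open>\<psi>0\<close> below serve the same purpose.\<close>

definition det0 where "det0 z = (if drop_coord k z \<in> V then det (matrix (\<Theta>' z)) else 0)"

lemma measurable_det0[measurable]: "det0 \<in> borel_measurable borel"
proof -
  have cd: "continuous_on UNIV (drop_coord k)" by (intro continuous_intros)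
  have "open {z. drop_coord k z \<in> V}" using open_vimage[OF oV cd] by (simp add: vimage_def)
  then have "(\<lambda>z. if z \<in> {z. drop_coord k z \<in> V} then det (matrix (\<Theta>' z)) else 0) \<in> borel_measurable borel"
    by (intro borel_measurable_continuous_on_if continuous_det_\<Theta>') auto
  then show ?thesis by (simp add: det0_def[abs_def])
qed

abbreviation \<phi> where "\<phi> \<equiv> the_inv_into V \<psi>"

definition \<phi>0 where "\<phi>0 x = (if x \<in> W then \<phi> x else 0)"
definition H0 where "H0 x = (if x \<in> W then H x else 0)"
definition \<psi>0 where "\<psi>0 y = (if y \<in> V then \<psi> y else 0)"

lemma measurable_\<phi>0[measurable]: "\<phi>0 \<in> borel \<rightarrow>\<^sub>M borel"
  unfolding \<phi>0_def[abs_def] using oW dfacts(15) by (intro borel_measurable_continuous_on_if) auto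

lemma measurable_H0[measurable]: "H0 \<in> borel \<rightarrow>\<^sub>M borel"
  unfolding H0_def[abs_def] using oW smooth_on_imp_continuous_on[OF smooth(1)]
  by (intro borel_measurable_continuous_on_if) auto

lemma measurable_\<psi>0[measurable]: "\<psi>0 \<in> borel \<rightarrow>\<^sub>M borel"
  unfolding \<psi>0_def[abs_def] using oV dfacts(14) by (intro borel_measurable_continuous_on_if) auto

lemma chart_point:
  assumes "x \<in> R" "x \<in> W"
  shows "\<phi> x \<in> V" "\<phi> x $ k = 0" "\<psi> (\<phi> x) = x"
  using assms dfacts(5,7) chart_mem[OF chart assms(2)] by (auto simp: span_Basis_minus)

lemma normal_at:
  assumes x: "x \<in> R" "x \<in> W"
  obtains \<nu> where "norm \<nu> = 1" "tangent_space R x = {z. z \<bullet> \<nu> = 0}"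
    "\<And>i. i \<noteq> k \<Longrightarrow> frechet_derivative \<psi> (at (\<phi> x)) (axis i 1) \<bullet> \<nu> = 0"
  using tangent_normal[OF chart chart_point(1,2)[OF x]] unfolding chart_point(3)[OF x] by blast

lemma drop_shift: "y $ k = 0 \<Longrightarrow> drop_coord k (y + t *\<^sub>R axis k 1) = y"
  by simp

text \<open>At \<open>t = 0\<close> the determinant on the tangent space is that of the identity, so
  \<open>det_on_shape\<close> identifies the row determinant with \<open>det0\<close> at
  \<open>\<phi> x\<close>, a point with \<open>k\<close>-th coordinate zero. The shape determinant
  thus becomes a quotient of two values of the Jacobian.\<close>

lemma shape_det:
  assumes x: "x \<in> R" "x \<in> W"
  shows "det0 (\<phi> x) \<noteq> 0"
    "det_on (tangent_space R x) (\<lambda>w. w - t *\<^sub>R radial_shape_operator \<T> U (x, H x) w) =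
      det0 (\<phi> x + t *\<^sub>R axis k 1) / det0 (\<phi> x)"
    "vol_factor V \<psi> (Basis - {axis k 1}) (\<phi> x) * radial_density \<T> (x, H x) = \<bar>det0 (\<phi> x)\<bar>"
    "radial_density \<T> (x, H x) > 0"
proof -
  let ?y = "\<phi> x"
  note y = chart_point[OF x]
  obtain \<nu> where \<nu>: "norm \<nu> = 1" "tangent_space R x = {z. z \<bullet> \<nu> = 0}"
    "\<And>i. i \<noteq> k \<Longrightarrow> frechet_derivative \<psi> (at ?y) (axis i 1) \<bullet> \<nu> = 0"
    by (rule normal_at[OF x]) (rule that)
  note ctx = y(1,2) y(3)[symmetric] \<nu>
  let ?r = "row_det k (\<lambda>i. frechet_derivative \<psi> (at ?y) (axis i 1)) (u x)"
  have r: "?r \<noteq> 0" using row_det_u[OF ctx] row_det_nonzero[OF ctx] u_normal(1)[OF ctx] by simp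
  have d: "det0 (?y + t *\<^sub>R axis k 1) = det (matrix (\<Theta>' (?y + t *\<^sub>R axis k 1)))" for t
    unfolding det0_def drop_shift[OF y(2)] using y(1) by simp
  have s: "det_on (tangent_space R x) (\<lambda>w. w - t *\<^sub>R radial_shape_operator \<T> U (x, H x) w) * ?r =
      det0 (?y + t *\<^sub>R axis k 1)" for t
    unfolding d by (rule det_on_shape[OF ctx])
  have "det_on T (\<lambda>w. w) = 1" for T :: "(real^'n) set"
  proof -
    have "(\<lambda>w. closest_point T w + (w - closest_point T w)) = id" by auto
    then show ?thesis by (simp add: det_on_def)
  qed
  then have r0: "?r = det0 ?y" using s[of 0] by simp
  show "det0 ?y \<noteq> 0" using r r0 by simp
  show "det_on (tangent_space R x) (\<lambda>w. w - t *\<^sub>R radial_shape_operator \<T> U (x, H x) w) =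
      det0 (?y + t *\<^sub>R axis k 1) / det0 ?y" using s[of t] r unfolding r0 by (simp add: field_simps)
  show "vol_factor V \<psi> (Basis - {axis k 1}) ?y * radial_density \<T> (x, H x) = \<bar>det0 ?y\<bar>"
    using density_factor(1)[OF ctx] unfolding r0 .
  show "radial_density \<T> (x, H x) > 0" by (rule density_factor(2)[OF ctx])
qed

text \<open>\<open>radial_density\<close> is given by a description operator; solving the third part
  of \<open>shape_det\<close> for it yields a Borel function with the same values on the
  chart.\<close>

definition \<rho>0 where "\<rho>0 x = \<bar>det0 (\<phi>0 x)\<bar> / vol_factor V \<psi> (Basis - {axis k 1}) (\<phi>0 x)"

lemma measurable_\<rho>0[measurable]: "\<rho>0 \<in> borel_measurable borel"
proof -
  have m: "vol_factor V \<psi> (Basis - {axis k 1}) \<in> borel_measurable borel" by (rule measurable_vol_factor[OF oV dfacts(12)])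
  show ?thesis
    unfolding \<rho>0_def[abs_def]
    by (intro borel_measurable_divide borel_measurable_abs measurable_compose[OF measurable_\<phi>0 measurable_det0]
        measurable_compose[OF measurable_\<phi>0 m])
qed

lemma \<rho>0: "x \<in> R \<Longrightarrow> x \<in> W \<Longrightarrow> \<rho>0 x = radial_density \<T> (x, H x)"
proof -
  assume x: "x \<in> R" "x \<in> W"
  have "vol_factor V \<psi> (Basis - {axis k 1}) (\<phi> x) \<noteq> 0" using shape_det(1,3)[OF x] by auto
  then show ?thesis unfolding \<rho>0_def \<phi>0_def using shape_det(3)[OF x] x by (simp add: field_simps)
qed

lemma graph_borel:
  assumes "B \<in> sets borel" "B \<subseteq> W"
  shows "{p. fst p \<in> B \<and> snd p = H (fst p)} \<in> sets borel"
proof -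
  have "{p. fst p \<in> B \<and> snd p = H (fst p)} = {p \<in> space borel. fst p \<in> B \<and> snd p = H0 (fst p)}"
    using assms(2) by (auto simp: H0_def)
  also have "\<dots> \<in> sets borel" using assms(1) by (simp add: borel_prod[symmetric])
  finally show ?thesis .
qed

end

text \<open>The Boolean argument of \<open>H\<close> selects one of the two values of
  \<open>U\<close>. Requiring \<open>branch_chart\<close> for \<open>b\<close> with partner
  \<open>\<not> b\<close> treats both alike: each value in turn is the branch along which one
  integrates, the other one the branch to be kept apart from it.\<close>

locale skeletal_atlas =
  fixes \<T> :: "(real^'n) set set" and U :: "real^'n \<Rightarrow> (real^'n) set"
    and V W :: "nat \<Rightarrow> (real^'n) set" and \<psi> :: "nat \<Rightarrow> real^'n \<Rightarrow> real^'n" and k :: "nat \<Rightarrow> 'n"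
    and B :: "nat \<Rightarrow> (real^'n) set" and H :: "nat \<Rightarrow> bool \<Rightarrow> real^'n \<Rightarrow> real^'n"
  assumes bc: "\<And>m b. branch_chart \<T> U (V m) (W m) (\<psi> m) (k m) (H m b) (H m (\<not> b))"
    and charted: "charted (CARD('n) - 1) (regular_part \<T>)"
    and B: "\<And>m. B m \<in> sets borel" "\<And>m. B m \<subseteq> regular_part \<T> \<inter> W m" "disjoint_family B" "(\<Union>m. B m) = regular_part \<T>"

lemma skeletal_atlas_exists:
  fixes \<T> :: "(real^'n) set set"
  assumes s: "stratification \<T> N" and rf: "radial_field \<T> U"
  obtains V W \<psi> k B H where "skeletal_atlas \<T> U V W \<psi> k B H"
proof -
  let ?R = "regular_part \<T>"
  have ch: "charted (CARD('n) - 1) ?R" using regular_part_charted[OF s] by simp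
  have e: "has_branches \<T> U {}" by (simp add: has_branches_def smooth_on_def)
  obtain V W :: "nat \<Rightarrow> (real^'n) set" and \<psi> k and B :: "nat \<Rightarrow> (real^'n) set"
    where c: "\<And>m. hyper_chart ?R (V m) (W m) (\<psi> m) (k m)" and hb: "\<And>m. has_branches \<T> U (W m)"
    and B: "\<And>m. B m \<in> sets borel" "\<And>m. B m \<subseteq> ?R \<inter> W m" "disjoint_family B" "(\<Union>m. B m) = ?R"
    by (rule hyper_atlas[OF ch, of "has_branches \<T> U"])
      (erule radial_field_branches[OF rf], erule (1) has_branches_subset, rule e, rule that)
  define P where "P m p \<longleftrightarrow> smooth_on (W m) (fst p) \<and> smooth_on (W m) (snd p) \<and> (\<forall>x\<in>W m. fst p x \<noteq> 0 \<and> snd p x \<noteq> 0) \<and>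
     (\<forall>x\<in>?R \<inter> W m. U x = {fst p x, snd p x} \<and> opposite_sides (tangent_space ?R x) (fst p x) (snd p x))"
    for m and p :: "(real^'n \<Rightarrow> real^'n) \<times> (real^'n \<Rightarrow> real^'n)"
  have "\<forall>m. \<exists>p. P m p" using hb unfolding P_def has_branches_def by simp
  from choice[OF this] obtain p where p: "\<And>m. P m (p m)" by blast
  define H where "H m b = (if b then fst (p m) else snd (p m))" for m b
  have "branch_chart \<T> U (V m) (W m) (\<psi> m) (k m) (H m b) (H m (\<not> b))" for m b
    using p[of m] c[of m] unfolding P_def
    by unfold_locales (auto simp: H_def opposite_sides_commute)
  then have "skeletal_atlas \<T> U V W \<psi> k B H"
    using ch B by (simp add: skeletal_atlas_def)
  then show ?thesis by (rule that)
qed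

lemma measurable_pieces:
  fixes f :: "'a \<Rightarrow> 'b"
  assumes "countable C" "\<And>X. X \<in> C \<Longrightarrow> X \<in> sets M" "space M \<subseteq> \<Union>C"
    "\<And>X. X \<in> C \<Longrightarrow> \<exists>g\<in>measurable M N. \<forall>x\<in>X. f x = g x"
  shows "f \<in> measurable M N"
proof (rule measurable_piecewise_restrict[OF assms(1)])
  fix X assume X: "X \<in> C"
  show "X \<inter> space M \<in> sets M" using assms(2)[OF X] by simp
  obtain g where g: "g \<in> measurable M N" "\<forall>x\<in>X. f x = g x" using assms(4)[OF X] by blast
  show "f \<in> measurable (restrict_space M X) N"
    using measurable_restrict_space1[OF g(1), of X] g(2)
    by (subst measurable_cong[of _ _ g]) (auto simp: space_restrict_space)
qed (rule assms(3))

lemma suminf_indicator_pieces: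
  fixes q :: "nat \<Rightarrow> ennreal"
  assumes "disjoint_family B" "x \<in> B m"
  shows "(\<Sum>i. indicator (B i) x * q i) = q m"
proof -
  have "(\<Sum>i. indicator (B i) x * q i) = (\<Sum>i\<in>{m}. indicator (B i) x * q i)"
    using assms by (intro suminf_finite) (auto simp: disjoint_family_on_def indicator_def)
  then show ?thesis using assms(2) by simp
qed

context skeletal_atlas
begin

abbreviation R where "R \<equiv> regular_part \<T>"
abbreviation K where "K m \<equiv> Basis - {axis (k m) 1 :: real^'n}"
abbreviation \<mu> where "\<mu> \<equiv> riemannian_volume (CARD('n) - 1) R"
abbreviation det0 where "det0 m b \<equiv> branch_chart.det0 (V m) (\<psi> m) (k m) (H m b)"

definition graph where "graph m b = {p. fst p \<in> B m \<and> snd p = H m b (fst p)}"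

lemma riem: "is_riemannian_volume (CARD('n) - 1) R \<mu>"
  by (rule is_riemannian_volume_riemannian_volume[OF charted])

lemma sets_\<mu>[measurable_cong, simp]: "sets \<mu> = sets borel"
  using riem by (simp add: is_riemannian_volume_def)

lemma measurable_\<mu>: "f \<in> borel_measurable \<mu> \<longleftrightarrow> f \<in> borel_measurable borel"
  unfolding measurable_cong_sets[OF sets_\<mu> refl] ..

lemma R_borel[measurable]: "R \<in> sets borel" by (rule charted_borel[OF charted])

lemma B_borel[measurable]: "B m \<in> sets borel" by (rule B(1))

lemma U_eq: "x \<in> B m \<Longrightarrow> U x = {H m True x, H m False x}" "x \<in> B m \<Longrightarrow> H m True x \<noteq> H m False x"
proof -
  assume "x \<in> B m"
  then have x: "x \<in> R" "x \<in> W m" using B(2) by auto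
  show "U x = {H m True x, H m False x}" using branch_chart.U[OF bc[of m True] x] by simp
  show "H m True x \<noteq> H m False x"
    using branch_chart.sides[OF bc[of m True] x] by (auto simp: opposite_sides_def)
qed

lemma graph_borel: "graph m b \<in> sets borel"
  unfolding graph_def by (rule branch_chart.graph_borel[OF bc B(1)]) (use B(2) in blast)

lemma UN_graph: "(\<Union>m. \<Union>b. graph m b) = {p. fst p \<in> R \<and> snd p \<in> U (fst p)}"
proof (intro equalityI subsetI)
  fix p assume "p \<in> (\<Union>m. \<Union>b. graph m b)"
  then obtain m b where p: "fst p \<in> B m" "snd p = H m b (fst p)" by (auto simp: graph_def)
  then show "p \<in> {p. fst p \<in> R \<and> snd p \<in> U (fst p)}"
    using U_eq(1)[OF p(1)] B(2) by (cases b) auto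
next
  fix p assume p: "p \<in> {p. fst p \<in> R \<and> snd p \<in> U (fst p)}"
  then obtain m where m: "fst p \<in> B m" using B(4) by blast
  then have "snd p = H m True (fst p) \<or> snd p = H m False (fst p)" using U_eq(1)[OF m] p by auto
  then show "p \<in> (\<Union>m. \<Union>b. graph m b)" using m by (auto simp: graph_def)
qed

lemma sum_U: "x \<in> B m \<Longrightarrow> (\<Sum>v\<in>U x. (f v :: ennreal)) = (\<Sum>b\<in>UNIV. f (H m b x))"
  using U_eq[of x m] by (simp add: UNIV_bool add.commute)

text \<open>On \<open>B m\<close> the sum over \<open>U x\<close> runs over the two Boolean
  branches, and there \<open>\<rho>0\<close> and \<open>H0\<close> are Borel functions with the
  values of the density and of the branch. Countably many pieces suffice.\<close>

lemma measurable_sum_U: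
  assumes f[measurable]: "f \<in> borel_measurable borel"
  shows "(\<lambda>x. indicator R x * (\<Sum>v\<in>U x. ennreal (radial_density \<T> (x, v)) * f (x, v))) \<in> borel_measurable borel"
proof (rule measurable_pieces[of "insert (- R) (range B)"])
  fix X assume X: "X \<in> insert (- R) (range B)"
  then show "X \<in> sets borel" by (auto simp: borel_comp)
  show "\<exists>g\<in>borel_measurable borel. \<forall>x\<in>X. indicator R x * (\<Sum>v\<in>U x. ennreal (radial_density \<T> (x, v)) * f (x, v)) = g x"
  proof (cases "X = - R")
    case True
    then show ?thesis by (intro bexI[of _ "\<lambda>_. 0"]) auto
  next
    case False
    then obtain m where m: "X = B m" using X by blast
    let ?r = "\<lambda>b. branch_chart.\<rho>0 (V m) (W m) (\<psi> m) (k m) (H m b)"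
    let ?h = "\<lambda>b. branch_chart.H0 (W m) (H m b)"
    have [measurable]: "?r b \<in> borel_measurable borel" "?h b \<in> borel \<rightarrow>\<^sub>M borel" for b
      by (rule branch_chart.measurable_\<rho>0[OF bc] branch_chart.measurable_H0[OF bc])+
    have "(\<lambda>x. \<Sum>b\<in>UNIV. ennreal (?r b x) * f (x, ?h b x)) \<in> borel_measurable borel"
      by measurable
    moreover have "indicator R x * (\<Sum>v\<in>U x. ennreal (radial_density \<T> (x, v)) * f (x, v)) =
       (\<Sum>b\<in>UNIV. ennreal (?r b x) * f (x, ?h b x))" if "x \<in> B m" for x
    proof -
      have x: "x \<in> R" "x \<in> W m" using that B(2) by auto
      show ?thesis unfolding sum_U[OF that]
        using x branch_chart.\<rho>0[OF bc x] by (simp add: branch_chart.H0_def[OF bc])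
    qed
    ultimately show ?thesis unfolding m by (intro bexI[of _ "\<lambda>x. \<Sum>b\<in>UNIV. ennreal (?r b x) * f (x, ?h b x)"]) auto
  qed
qed (use B(4) in auto)

abbreviation D where "D \<equiv> double (\<Union>\<T>) U"

abbreviation skel where "skel \<equiv> skeletal_measure \<T> U"

section \<open>Integration over the double\<close>

lemma sets_skel: "sets skel = sets (restrict_space borel D)" and space_skel: "space skel = D"
proof -
  have sp: "space (restrict_space borel D) = D" by (simp add: space_restrict_space)
  show "sets skel = sets (restrict_space borel D)" "space skel = D"
    unfolding skeletal_measure_def
    using sets.sets_measure_of_eq[of "restrict_space borel D"] sets.space_measure_of_eq[of "restrict_space borel D"]
    unfolding sp by simp_all
qed

lemma measurable_skel: "f \<in> borel_measurable borel \<Longrightarrow> f \<in> borel_measurable skel"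
  unfolding measurable_cong_sets[OF sets_skel refl] by (rule measurable_restrict_space1)

text \<open>\<open>measure_of\<close> takes the intended values only once countable additivity is
  known. The measurable sets are traces of Borel sets \<open>C i\<close> on \<open>D\<close>; over
  the regular part the trace makes no difference, so the integrands are measurable by
  \<open>measurable_sum_U\<close>.\<close>

lemma emeasure_skel:
  assumes A: "A \<in> sets skel"
  shows "emeasure skel A = (\<integral>\<^sup>+x\<in>R. (\<Sum>v\<in>U x. ennreal (radial_density \<T> (x, v)) * indicator A (x, v)) \<partial>\<mu>)"
proof -
  have fin: "finite (U x)" if "x \<in> R" for x
  proof -
    have "x \<in> (\<Union>m. B m)" using that by (simp only: B(4))
    then obtain m where "x \<in> B m" by (elim UN_E)
    from U_eq(1)[OF this] show ?thesis by simp
  qed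
  let ?E = "\<lambda>A. \<integral>\<^sup>+x\<in>R. (\<Sum>v\<in>{v\<in>U x. (x, v) \<in> A}. ennreal (radial_density \<T> (x, v))) \<partial>\<mu>"
  have E: "?E A = (\<integral>\<^sup>+x\<in>R. (\<Sum>v\<in>U x. ennreal (radial_density \<T> (x, v)) * indicator A (x, v)) \<partial>\<mu>)" for A
  proof (intro nn_integral_cong)
    fix x
    show "(\<Sum>v\<in>{v\<in>U x. (x, v) \<in> A}. ennreal (radial_density \<T> (x, v))) * indicator R x =
       (\<Sum>v\<in>U x. ennreal (radial_density \<T> (x, v)) * indicator A (x, v)) * indicator R x"
    proof (cases "x \<in> R")
      case True
      have "(\<Sum>v\<in>{v\<in>U x. (x, v) \<in> A}. ennreal (radial_density \<T> (x, v))) =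
         (\<Sum>v\<in>U x. if (x, v) \<in> A then ennreal (radial_density \<T> (x, v)) else 0)"
        using fin[OF True] by (simp add: sum.inter_filter)
      also have "\<dots> = (\<Sum>v\<in>U x. ennreal (radial_density \<T> (x, v)) * indicator A (x, v))"
        by (intro sum.cong) auto
      finally show ?thesis by simp
    qed simp
  qed
  have "emeasure skel A = ?E A"
  proof (rule emeasure_measure_of[OF skeletal_measure_def])
    show "sets (restrict_space borel D) \<subseteq> Pow D" using sets.sets_into_space[of _ "restrict_space borel D"] by (auto simp: space_restrict_space)
    show "A \<in> sets skel" by (rule A)
    show "positive (sets skel) ?E" by (simp add: positive_def)
    show "countably_additive (sets skel) ?E"
    proof (rule countably_additiveI)
      fix A :: "nat \<Rightarrow> ((real^'n) \<times> (real^'n)) set"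
      assume A: "range A \<subseteq> sets skel" "disjoint_family A"
      have "\<forall>i. \<exists>C. C \<in> sets borel \<and> A i = C \<inter> D"
      proof
        fix i
        have "A i \<in> sets (restrict_space borel D)" using A(1) unfolding sets_skel by blast
        then show "\<exists>C. C \<in> sets borel \<and> A i = C \<inter> D"
          unfolding sets_restrict_space by (auto simp: Int_commute)
      qed
      from choice[OF this] obtain C where C: "\<And>i. C i \<in> sets borel" "\<And>i. A i = C i \<inter> D" by blast
      have RD: "(x, v) \<in> D" if "x \<in> R" "v \<in> U x" for x v
        using that by (auto simp: double_def regular_part_def)
      have m: "(\<lambda>x. (\<Sum>v\<in>U x. ennreal (radial_density \<T> (x, v)) * indicator (A i) (x, v)) * indicator R x) \<in> borel_measurable borel" for i
      proof -
        have "(\<lambda>x. indicator R x * (\<Sum>v\<in>U x. ennreal (radial_density \<T> (x, v)) * indicator (C i) (x, v))) \<in> borel_measurable borel"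
          using C(1) by (intro measurable_sum_U) simp
        moreover have "(\<Sum>v\<in>U x. ennreal (radial_density \<T> (x, v)) * indicator (A i) (x, v)) * indicator R x =
          indicator R x * (\<Sum>v\<in>U x. ennreal (radial_density \<T> (x, v)) * indicator (C i) (x, v))" for x
          using RD[of x] C(2) by (auto simp: indicator_def intro!: sum.cong)
        ultimately show ?thesis by simp
      qed
      have "(\<Sum>i. ?E (A i)) = (\<integral>\<^sup>+x. (\<Sum>i. (\<Sum>v\<in>U x. ennreal (radial_density \<T> (x, v)) * indicator (A i) (x, v)) * indicator R x) \<partial>\<mu>)"
        unfolding E by (intro nn_integral_suminf[symmetric]) (unfold measurable_\<mu>, rule m)
      also have "\<dots> = ?E (\<Union>i. A i)"
        unfolding E
      proof (intro nn_integral_cong)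
        fix x
        have "(\<Sum>i. (\<Sum>v\<in>U x. ennreal (radial_density \<T> (x, v)) * indicator (A i) (x, v)) * indicator R x) =
          (\<Sum>i. \<Sum>v\<in>U x. ennreal (radial_density \<T> (x, v)) * indicator (A i) (x, v)) * indicator R x"
          by (rule ennreal_suminf_multc)
        also have "(\<Sum>i. \<Sum>v\<in>U x. ennreal (radial_density \<T> (x, v)) * indicator (A i) (x, v)) =
          (\<Sum>v\<in>U x. \<Sum>i. ennreal (radial_density \<T> (x, v)) * indicator (A i) (x, v))"
          by (rule suminf_sum) auto
        also have "\<dots> = (\<Sum>v\<in>U x. ennreal (radial_density \<T> (x, v)) * indicator (\<Union>i. A i) (x, v))"
          using A(2) by (simp add: ennreal_suminf_cmult suminf_indicator)
        finally show "(\<Sum>i. (\<Sum>v\<in>U x. ennreal (radial_density \<T> (x, v)) * indicator (A i) (x, v)) * indicator R x) =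
          (\<Sum>v\<in>U x. ennreal (radial_density \<T> (x, v)) * indicator (\<Union>i. A i) (x, v)) * indicator R x" .
      qed
      finally show "(\<Sum>i. ?E (A i)) = ?E (\<Union>i. A i)" .
    qed
  qed
  then show ?thesis unfolding E .
qed

lemma nn_integral_skel:
  fixes f :: "(real^'n) \<times> (real^'n) \<Rightarrow> ennreal"
  assumes f: "f \<in> borel_measurable borel"
  shows "(\<integral>\<^sup>+p. f p \<partial>skel) = (\<integral>\<^sup>+x\<in>R. (\<Sum>v\<in>U x. ennreal (radial_density \<T> (x, v)) * f (x, v)) \<partial>\<mu>)"
proof -
  let ?I = "\<lambda>f x. (\<Sum>v\<in>U x. ennreal (radial_density \<T> (x, v)) * f (x, v)) * indicator R x"
  have mI: "?I f \<in> borel_measurable borel" if "f \<in> borel_measurable borel" for f :: "(real^'n) \<times> (real^'n) \<Rightarrow> ennreal"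
    using measurable_sum_U[OF that] by (simp add: mult.commute)
  have RD: "(x, v) \<in> D" if "x \<in> R" "v \<in> U x" for x v
    using that by (auto simp: double_def regular_part_def)
  show ?thesis using f
  proof (induction rule: borel_measurable_induct)
    case (cong f g)
    then have "f = g" by (simp add: fun_eq_iff)
    then show ?case using cong by simp
  next
    case (set A)
    \<comment> \<open>\<open>A\<close> is Borel in the product space, but only its trace on
      \<open>D\<close> is a set of the measure space.\<close>
    have A: "A \<inter> D \<in> sets skel"
      unfolding sets_skel sets_restrict_space using set by (auto simp: Int_commute)
    have "(\<integral>\<^sup>+p. indicator A p \<partial>skel) = (\<integral>\<^sup>+p. indicator (A \<inter> D) p \<partial>skel)"
      by (intro nn_integral_cong) (simp add: space_skel indicator_def)
    also have "\<dots> = emeasure skel (A \<inter> D)" using A by simp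
    also have "\<dots> = (\<integral>\<^sup>+x. ?I (indicator (A \<inter> D)) x \<partial>\<mu>)" by (rule emeasure_skel[OF A])
    also have "\<dots> = (\<integral>\<^sup>+x. ?I (indicator A) x \<partial>\<mu>)"
    proof (intro nn_integral_cong)
      fix x
      show "?I (indicator (A \<inter> D)) x = ?I (indicator A) x"
      proof (cases "x \<in> R")
        case True
        have "(\<Sum>v\<in>U x. ennreal (radial_density \<T> (x, v)) * indicator (A \<inter> D) (x, v)) =
          (\<Sum>v\<in>U x. ennreal (radial_density \<T> (x, v)) * indicator A (x, v))"
          using RD[OF True] by (intro sum.cong) (simp_all add: indicator_def)
        then show ?thesis by simp
      qed simp
    qed
    finally show ?case .
  next
    case (mult g c)
    have "(\<integral>\<^sup>+p. c * g p \<partial>skel) = c * (\<integral>\<^sup>+p. g p \<partial>skel)"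
      by (rule nn_integral_cmult[OF measurable_skel[OF mult(2)]])
    also have "\<dots> = (\<integral>\<^sup>+x. c * ?I g x \<partial>\<mu>)"
      unfolding mult by (rule nn_integral_cmult[symmetric]) (unfold measurable_\<mu>, rule mI[OF mult(2)])
    also have "\<dots> = (\<integral>\<^sup>+x. ?I (\<lambda>p. c * g p) x \<partial>\<mu>)"
      by (intro nn_integral_cong) (simp add: sum_distrib_left mult_ac)
    finally show ?case .
  next
    case (add g h)
    have "(\<integral>\<^sup>+p. h p + g p \<partial>skel) = (\<integral>\<^sup>+p. h p \<partial>skel) + (\<integral>\<^sup>+p. g p \<partial>skel)"
      by (rule nn_integral_add[OF measurable_skel measurable_skel]) (use add in auto)
    also have "\<dots> = (\<integral>\<^sup>+x. ?I h x \<partial>\<mu>) + (\<integral>\<^sup>+x. ?I g x \<partial>\<mu>)" using add by simp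
    also have "\<dots> = (\<integral>\<^sup>+x. ?I h x + ?I g x \<partial>\<mu>)"
      by (rule nn_integral_add[symmetric]) (unfold measurable_\<mu>, (rule mI, use add in simp)+)
    also have "\<dots> = (\<integral>\<^sup>+x. ?I (\<lambda>p. h p + g p) x \<partial>\<mu>)"
      by (intro nn_integral_cong) (simp add: sum.distrib distrib_left distrib_right)
    finally show ?case .
  next
    case (seq F)
    have F: "F i \<in> borel_measurable borel" for i using seq by simp
    have incF: "incseq F" by fact
    have mono: "F i p \<le> F j p" if "i \<le> j" for i j p
      by (rule le_funD[OF incseqD[OF incF that]])
    have "(\<integral>\<^sup>+p. (SUP i. F i) p \<partial>skel) = (SUP i. \<integral>\<^sup>+p. F i p \<partial>skel)"
      unfolding SUP_apply by (rule nn_integral_monotone_convergence_SUP[OF incF measurable_skel[OF F]])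
    also have "\<dots> = (SUP i. \<integral>\<^sup>+x. ?I (F i) x \<partial>\<mu>)" using seq by simp
    also have "\<dots> = (\<integral>\<^sup>+x. (SUP i. ?I (F i) x) \<partial>\<mu>)"
    proof (rule nn_integral_monotone_convergence_SUP[symmetric])
      show "incseq (\<lambda>i. ?I (F i))"
        by (auto simp: incseq_def le_fun_def intro!: mult_right_mono sum_mono mult_left_mono mono)
      show "?I (F i) \<in> borel_measurable \<mu>" for i unfolding measurable_\<mu> by (rule mI[OF F])
    qed
    also have "\<dots> = (\<integral>\<^sup>+x. ?I (SUP i. F i) x \<partial>\<mu>)"
    proof (intro nn_integral_cong)
      fix x
      have inc: "incseq (\<lambda>i. ennreal (radial_density \<T> (x, v)) * F i (x, v))" for v
        by (auto simp: incseq_def intro!: mult_left_mono mono)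
      have "(SUP i. ?I (F i) x) = (SUP i. \<Sum>v\<in>U x. ennreal (radial_density \<T> (x, v)) * F i (x, v)) * indicator R x"
        by (rule SUP_mult_right_ennreal[symmetric])
      also have "(SUP i. \<Sum>v\<in>U x. ennreal (radial_density \<T> (x, v)) * F i (x, v)) =
         (\<Sum>v\<in>U x. SUP i. ennreal (radial_density \<T> (x, v)) * F i (x, v))"
        by (rule ennreal_SUP_sum[OF inc])
      finally show "(SUP i. ?I (F i) x) = ?I (SUP i. F i) x"
        by (simp only: SUP_mult_left_ennreal SUP_apply)
    qed
    finally show ?case .
  qed
qed

text \<open>The regular part is cut into the pieces \<open>B m\<close>, and each piece is pulled
  back by its chart. The volume factor and the density combine to \<open>\<bar>det0\<bar>\<close> at
  time zero, by \<open>shape_det\<close>.\<close>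

lemma nn_integral_skel_charts:
  fixes f :: "(real^'n) \<times> (real^'n) \<Rightarrow> ennreal"
  assumes f[measurable]: "f \<in> borel_measurable borel"
  shows "(\<integral>\<^sup>+p. f p \<partial>skel) = (\<Sum>m. \<Sum>b\<in>UNIV. \<integral>\<^sup>+y\<in>V m \<inter> \<psi> m -` B m.
     f (\<psi> m y, H m b (\<psi> m y)) * ennreal \<bar>det0 m b y\<bar> \<partial>coord_lborel (K m))"
proof -
  let ?Q = "\<lambda>x. \<Sum>v\<in>U x. ennreal (radial_density \<T> (x, v)) * f (x, v)"
  let ?r = "\<lambda>m b. branch_chart.\<rho>0 (V m) (W m) (\<psi> m) (k m) (H m b)"
  let ?h = "\<lambda>m b. branch_chart.H0 (W m) (H m b)"
  have mr[measurable]: "?r m b \<in> borel_measurable borel" "?h m b \<in> borel \<rightarrow>\<^sub>M borel" for m b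
    by (rule branch_chart.measurable_\<rho>0[OF bc] branch_chart.measurable_H0[OF bc])+
  have mq: "(\<lambda>x. ennreal (?r m b x) * f (x, ?h m b x)) \<in> borel_measurable borel" for m b by measurable
  have "(\<integral>\<^sup>+p. f p \<partial>skel) = (\<integral>\<^sup>+x. indicator R x * ?Q x \<partial>\<mu>)"
    by (simp add: nn_integral_skel[OF f] mult.commute)
  also have "\<dots> = (\<integral>\<^sup>+x. (\<Sum>m. indicator (B m) x * (indicator R x * ?Q x)) \<partial>\<mu>)"
  proof (intro nn_integral_cong)
    fix x
    show "indicator R x * ?Q x = (\<Sum>m. indicator (B m) x * (indicator R x * ?Q x))"
    proof (cases "x \<in> R")
      case True
      then have "x \<in> (\<Union>m. B m)" by (simp only: B(4))
      then obtain m where "x \<in> B m" by (elim UN_E)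
      from suminf_indicator_pieces[OF B(3) this, of "\<lambda>_. indicator R x * ?Q x"] show ?thesis by simp
    qed simp
  qed
  also have "\<dots> = (\<Sum>m. \<integral>\<^sup>+x. indicator (B m) x * (indicator R x * ?Q x) \<partial>\<mu>)"
    by (rule nn_integral_suminf) (unfold measurable_\<mu>, intro borel_measurable_times_ennreal borel_measurable_indicator B_borel measurable_sum_U f)
  also have "\<dots> = (\<Sum>m. \<Sum>b\<in>UNIV. \<integral>\<^sup>+y\<in>V m \<inter> \<psi> m -` B m.
     f (\<psi> m y, H m b (\<psi> m y)) * ennreal \<bar>det0 m b y\<bar> \<partial>coord_lborel (K m))"
  proof (rule suminf_cong)
    fix m
    have BR: "x \<in> R" "x \<in> W m" if "x \<in> B m" for x using that B(2) by auto
    have "(\<integral>\<^sup>+x. indicator (B m) x * (indicator R x * ?Q x) \<partial>\<mu>) =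
       (\<integral>\<^sup>+x. (\<Sum>b\<in>UNIV. (ennreal (?r m b x) * f (x, ?h m b x)) * indicator (B m) x) \<partial>\<mu>)"
    proof (intro nn_integral_cong)
      fix x
      show "indicator (B m) x * (indicator R x * ?Q x) = (\<Sum>b\<in>UNIV. (ennreal (?r m b x) * f (x, ?h m b x)) * indicator (B m) x)"
      proof (cases "x \<in> B m")
        case True
        show ?thesis
          unfolding sum_U[OF True] using BR[OF True] True branch_chart.\<rho>0[OF bc BR[OF True]]
          by (simp add: branch_chart.H0_def[OF bc])
      qed simp
    qed
    also have "\<dots> = (\<Sum>b\<in>UNIV. \<integral>\<^sup>+x\<in>B m. (ennreal (?r m b x) * f (x, ?h m b x)) \<partial>\<mu>)"
      by (rule nn_integral_sum)
        (unfold measurable_\<mu>, rule borel_measurable_times_ennreal[OF mq borel_measurable_indicator[OF B_borel]])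
    also have "\<dots> = (\<Sum>b\<in>UNIV. \<integral>\<^sup>+y\<in>V m \<inter> \<psi> m -` B m.
     f (\<psi> m y, H m b (\<psi> m y)) * ennreal \<bar>det0 m b y\<bar> \<partial>coord_lborel (K m))"
    proof (rule sum.cong[OF refl])
      fix b
      note c = branch_chart.chart[OF bc[of m b]]
      have "(\<integral>\<^sup>+x\<in>B m. (ennreal (?r m b x) * f (x, ?h m b x)) \<partial>\<mu>) =
        (\<integral>\<^sup>+y\<in>V m \<inter> \<psi> m -` B m. (ennreal (?r m b (\<psi> m y)) * f (\<psi> m y, ?h m b (\<psi> m y))) * ennreal (vol_factor (V m) (\<psi> m) (K m) y) \<partial>coord_lborel (K m))"
        by (rule nn_integral_riemannian_volume_chart[OF riem c B(1,2) mq])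
      also have "\<dots> = (\<integral>\<^sup>+y\<in>V m \<inter> \<psi> m -` B m. f (\<psi> m y, H m b (\<psi> m y)) * ennreal \<bar>det0 m b y\<bar> \<partial>coord_lborel (K m))"
      proof (rule nn_integral_cong_AE, rule AE_mp[OF AE_coord_lborel AE_I2], blast, intro impI)
        fix y assume "y \<in> span (K m)"
        then have yk: "y $ k m = 0" by (simp add: span_Basis_minus)
        show "(ennreal (?r m b (\<psi> m y)) * f (\<psi> m y, ?h m b (\<psi> m y))) * ennreal (vol_factor (V m) (\<psi> m) (K m) y) * indicator (V m \<inter> \<psi> m -` B m) y =
          f (\<psi> m y, H m b (\<psi> m y)) * ennreal \<bar>det0 m b y\<bar> * indicator (V m \<inter> \<psi> m -` B m) y"
        proof (cases "y \<in> V m \<inter> \<psi> m -` B m")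
          case True
          then have y: "y \<in> V m" "\<psi> m y \<in> B m" by auto
          note x = BR[OF y(2)]
          have inv: "the_inv_into (V m) (\<psi> m) (\<psi> m y) = y" by (rule branch_chart.dfacts(4)[OF bc y(1)])
          note s = branch_chart.shape_det[OF bc[of m b] x, unfolded inv]
          have "ennreal (?r m b (\<psi> m y)) * ennreal (vol_factor (V m) (\<psi> m) (K m) y) = ennreal \<bar>det0 m b y\<bar>"
            using s(3) s(4) branch_chart.\<rho>0[OF bc[of m b] x] by (simp add: ennreal_mult'[symmetric] mult.commute)
          then show ?thesis using x by (simp add: branch_chart.H0_def[OF bc] mult_ac)
        qed simp
      qed
      finally show "(\<integral>\<^sup>+x\<in>B m. (ennreal (?r m b x) * f (x, ?h m b x)) \<partial>\<mu>) =
        (\<integral>\<^sup>+y\<in>V m \<inter> \<psi> m -` B m. f (\<psi> m y, H m b (\<psi> m y)) * ennreal \<bar>det0 m b y\<bar> \<partial>coord_lborel (K m))" .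
    qed
    finally show "(\<integral>\<^sup>+x. indicator (B m) x * (indicator R x * ?Q x) \<partial>\<mu>) =
      (\<Sum>b\<in>UNIV. \<integral>\<^sup>+y\<in>V m \<inter> \<psi> m -` B m. f (\<psi> m y, H m b (\<psi> m y)) * ennreal \<bar>det0 m b y\<bar> \<partial>coord_lborel (K m))" .
  qed
  finally show ?thesis .
qed

text \<open>The cylinder over the part of the chart domain lying over \<open>B m\<close>, unbounded
  in the coordinate \<open>k m\<close>, which now stands for time.\<close>

definition slab where "slab m = {z. drop_coord (k m) z \<in> V m \<inter> \<psi> m -` B m}"

definition point where "point m b z = (\<psi> m (drop_coord (k m) z), H m b (\<psi> m (drop_coord (k m) z)))"

lemma VB_borel: "V m \<inter> \<psi> m -` B m \<in> sets borel"
  by (rule borel_vimage_open[OF branch_chart.oV[OF bc] branch_chart.dfacts(14)[OF bc] B(1)])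

lemma slab_borel[measurable]: "slab m \<in> sets borel"
proof -
  have "slab m = drop_coord (k m) -` (V m \<inter> \<psi> m -` B m)" by (auto simp: slab_def)
  also have "\<dots> \<in> sets borel" by (rule measurable_sets_borel[OF measurable_drop_coord VB_borel])
  finally show ?thesis .
qed

definition point0 where "point0 m b z = (branch_chart.\<psi>0 (V m) (\<psi> m) (drop_coord (k m) z),
    branch_chart.H0 (W m) (H m b) (branch_chart.\<psi>0 (V m) (\<psi> m) (drop_coord (k m) z)))"

lemma point0_measurable[measurable]: "point0 m b \<in> borel \<rightarrow>\<^sub>M borel"
proof -
  have 1: "(\<lambda>z. branch_chart.\<psi>0 (V m) (\<psi> m) (drop_coord (k m) z)) \<in> borel \<rightarrow>\<^sub>M borel"
    by (rule measurable_compose[OF measurable_drop_coord branch_chart.measurable_\<psi>0[OF bc]])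
  have 2: "(\<lambda>z. branch_chart.H0 (W m) (H m b) (branch_chart.\<psi>0 (V m) (\<psi> m) (drop_coord (k m) z))) \<in> borel \<rightarrow>\<^sub>M borel"
    by (rule measurable_compose[OF 1 branch_chart.measurable_H0[OF bc]])
  show ?thesis unfolding point0_def[abs_def] by (rule borel_measurable_Pair[OF 1 2])
qed

lemma point0: "z \<in> slab m \<Longrightarrow> point0 m b z = point m b z"
  using B(2) by (auto simp: slab_def point0_def point_def branch_chart.\<psi>0_def[OF bc] branch_chart.H0_def[OF bc])

text \<open>\<open>nn_integral_lborel_slices\<close> read backwards: integration over the hyperplane
  of the chart and over the time \<open>s\<close> merges into one integral over a full-dimensional
  slab.\<close>

lemma nn_integral_skel_slab:
  fixes q :: "((real^'n) \<times> (real^'n)) \<times> real \<Rightarrow> ennreal"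
  assumes q[measurable]: "q \<in> borel_measurable borel"
  shows "(\<integral>\<^sup>+p. (\<integral>\<^sup>+s. q (p, s) \<partial>lborel) \<partial>skel) = (\<Sum>m. \<Sum>b\<in>UNIV. \<integral>\<^sup>+z\<in>slab m.
     q (point m b z, z $ k m) * ennreal \<bar>det0 m b (drop_coord (k m) z)\<bar> \<partial>lborel)"
proof -
  have q'[measurable]: "q \<in> borel_measurable (borel \<Otimes>\<^sub>M lborel)"
    using q by (simp add: borel_prod[symmetric] cong: measurable_cong_sets sets_pair_measure_cong)
  have mf: "(\<lambda>p. \<integral>\<^sup>+s. q (p, s) \<partial>lborel) \<in> borel_measurable borel" by measurable
  have "(\<integral>\<^sup>+y\<in>V m \<inter> \<psi> m -` B m. (\<integral>\<^sup>+s. q ((\<psi> m y, H m b (\<psi> m y)), s) \<partial>lborel) * ennreal \<bar>det0 m b y\<bar> \<partial>coord_lborel (K m)) =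
    (\<integral>\<^sup>+z\<in>slab m. q (point m b z, z $ k m) * ennreal \<bar>det0 m b (drop_coord (k m) z)\<bar> \<partial>lborel)" for m b
  proof -
    let ?d = "\<lambda>z. ennreal \<bar>det0 m b (drop_coord (k m) z)\<bar>"
    have md[measurable]: "(\<lambda>z. det0 m b (drop_coord (k m) z)) \<in> borel_measurable borel"
      by (rule measurable_compose[OF measurable_drop_coord branch_chart.measurable_det0[OF bc]])
    have mdd: "?d \<in> borel_measurable borel" by (rule measurable_compose[OF borel_measurable_abs[OF md] measurable_ennreal])
    have mp: "(\<lambda>z. q (point0 m b z, z $ k m)) \<in> borel_measurable borel" by measurable
    have "(\<integral>\<^sup>+z\<in>slab m. q (point m b z, z $ k m) * ?d z \<partial>lborel) = (\<integral>\<^sup>+z\<in>slab m. q (point0 m b z, z $ k m) * ?d z \<partial>lborel)"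
      by (intro nn_integral_cong) (auto simp: indicator_def point0)
    also have "\<dots> = (\<integral>\<^sup>+y. (\<integral>\<^sup>+s. q (point0 m b (y + s *\<^sub>R axis (k m) 1), (y + s *\<^sub>R axis (k m) 1) $ k m) * ?d (y + s *\<^sub>R axis (k m) 1) *
       indicator (slab m) (y + s *\<^sub>R axis (k m) 1) \<partial>lborel) \<partial>coord_lborel (K m))"
      by (rule nn_integral_lborel_slices) (rule borel_measurable_times_ennreal[OF borel_measurable_times_ennreal[OF mp mdd] borel_measurable_indicator[OF slab_borel]])
    also have "\<dots> = (\<integral>\<^sup>+y. (\<integral>\<^sup>+s. q ((\<psi> m y, H m b (\<psi> m y)), s) * (ennreal \<bar>det0 m b y\<bar> * indicator (V m \<inter> \<psi> m -` B m) y) \<partial>lborel) \<partial>coord_lborel (K m))"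
    proof (rule nn_integral_cong_AE, rule AE_mp[OF AE_coord_lborel AE_I2], blast, intro impI nn_integral_cong)
      fix y s assume y: "y \<in> span (K m)"
      note d = drop_coord_add[OF y, of s] coord_add[OF y, of s]
      have sl: "y + s *\<^sub>R axis (k m) 1 \<in> slab m \<longleftrightarrow> y \<in> V m \<inter> \<psi> m -` B m" unfolding slab_def mem_Collect_eq d(1) ..
      show "q (point0 m b (y + s *\<^sub>R axis (k m) 1), (y + s *\<^sub>R axis (k m) 1) $ k m) * ?d (y + s *\<^sub>R axis (k m) 1) *
         indicator (slab m) (y + s *\<^sub>R axis (k m) 1) = q ((\<psi> m y, H m b (\<psi> m y)), s) * (ennreal \<bar>det0 m b y\<bar> * indicator (V m \<inter> \<psi> m -` B m) y)"
      proof (cases "y \<in> V m \<inter> \<psi> m -` B m")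
        case True
        then have z: "y + s *\<^sub>R axis (k m) 1 \<in> slab m" using sl by blast
        have "point0 m b (y + s *\<^sub>R axis (k m) 1) = (\<psi> m y, H m b (\<psi> m y))"
          unfolding point0[OF z] point_def d(1) ..
        note pt = this
        have dd: "?d (y + s *\<^sub>R axis (k m) 1) = ennreal \<bar>det0 m b y\<bar>" unfolding d(1) ..
        show ?thesis unfolding dd unfolding pt unfolding d(2) using True z by simp
      next
        case False
        then show ?thesis using sl by simp
      qed
    qed
    also have "\<dots> = (\<integral>\<^sup>+y\<in>V m \<inter> \<psi> m -` B m. (\<integral>\<^sup>+s. q ((\<psi> m y, H m b (\<psi> m y)), s) \<partial>lborel) * ennreal \<bar>det0 m b y\<bar> \<partial>coord_lborel (K m))"
    proof (rule nn_integral_cong)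
      fix y
      have "(\<lambda>s. q ((\<psi> m y, H m b (\<psi> m y)), s)) \<in> borel_measurable lborel" by measurable
      then show "(\<integral>\<^sup>+s. q ((\<psi> m y, H m b (\<psi> m y)), s) * (ennreal \<bar>det0 m b y\<bar> * indicator (V m \<inter> \<psi> m -` B m) y) \<partial>lborel) =
        (\<integral>\<^sup>+s. q ((\<psi> m y, H m b (\<psi> m y)), s) \<partial>lborel) * ennreal \<bar>det0 m b y\<bar> * indicator (V m \<inter> \<psi> m -` B m) y"
        by (simp add: nn_integral_multc mult.assoc)
    qed
    finally show ?thesis by simp
  qed
  then show ?thesis using nn_integral_skel_charts[OF mf] by simp
qed

end

section \<open>Nonsingularity of the flow\<close>

text \<open>The inverse of \<open>f\<close> undoes the derivative of \<open>f\<close> on every velocity of a curve in \<open>S\<close>,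
  hence on their span.\<close>

lemma diffeomorphism_nonsingular_on:
  fixes S :: "'a::euclidean_space set" and f :: "'a \<Rightarrow> 'b::euclidean_space"
  assumes "diffeomorphism S T f"
  shows "nonsingular_on S f"
  unfolding nonsingular_on_def
proof (intro conjI ballI allI impI)
  have b: "bij_betw f S T" and s: "smooth_on S f" "smooth_on T (the_inv_into S f)"
    using assms by (auto simp: diffeomorphism_def)
  show "smooth_on S f" by (rule s(1))
  fix x f' assume x: "x \<in> S" and f': "(f has_derivative f') (at x within S)"
  let ?g = "the_inv_into S f"
  have inj: "inj_on f S" and im: "f ` S = T" using b by (auto simp: bij_betw_def)
  have "f x \<in> T" using x im by blast
  then obtain g' where g': "(?g has_derivative g') (at (f x) within T)" by (rule smooth_on_imp_has_derivative[OF s(2)]) (rule that)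
  have lin: "linear f'" "linear g'" using f' g' has_derivative_linear by auto
  have cone: "g' (f' v) = v" if v: "v \<in> tangent_cone S x" for v
  proof -
    obtain \<gamma> where \<gamma>: "\<gamma> 0 = x" "\<gamma> ` {0..<1} \<subseteq> S" "(\<gamma> has_vector_derivative v) (at (0::real) within {0..<1})"
      using v by (auto simp: tangent_cone_def)
    have d1: "(\<gamma> has_derivative (\<lambda>t. t *\<^sub>R v)) (at 0 within {0..<1})" using \<gamma>(3) by (simp add: has_vector_derivative_def)
    have f'1: "(f has_derivative f') (at (\<gamma> 0) within \<gamma> ` {0..<1})" using has_derivative_subset[OF f' \<gamma>(2)] \<gamma>(1) by simp
    have d2: "((\<lambda>t. f (\<gamma> t)) has_derivative (\<lambda>t. f' (t *\<^sub>R v))) (at 0 within {0..<1})"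
      using diff_chain_within[OF d1 f'1] by (simp add: o_def)
    have "(\<lambda>t. f (\<gamma> t)) ` {0..<1} \<subseteq> T" using \<gamma>(2) im by auto
    then have g'1: "(?g has_derivative g') (at (f (\<gamma> 0)) within (\<lambda>t. f (\<gamma> t)) ` {0..<1})"
      using has_derivative_subset[OF g'] \<gamma>(1) by simp
    have "((\<lambda>t. ?g (f (\<gamma> t))) has_derivative (\<lambda>t. g' (f' (t *\<^sub>R v)))) (at 0 within {0..<1})"
      using diff_chain_within[OF d2 g'1] by (simp add: o_def)
    then have "(\<gamma> has_derivative (\<lambda>t. g' (f' (t *\<^sub>R v)))) (at 0 within {0..<1})"
    proof (rule has_derivative_transform[rotated 2])
      fix t :: real assume "t \<in> {0..<1}"
      then have "\<gamma> t \<in> S" using \<gamma>(2) by blast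
      then show "\<gamma> t = ?g (f (\<gamma> t))" using the_inv_into_f_f[OF inj] by simp
    qed simp
    then have "(\<gamma> has_vector_derivative g' (f' v)) (at 0 within {0..<1})"
      by (simp add: has_vector_derivative_def linear_cmul[OF lin(1)] linear_cmul[OF lin(2)])
    moreover have "at (0::real) within {0..<1} \<noteq> bot"
    proof -
      have "{0..<1} - {0::real} = {0<..<1}" by auto
      then show ?thesis by (simp add: trivial_limit_within islimpt_in_closure)
    qed
    ultimately show ?thesis using \<gamma>(3) vector_derivative_unique_within by blast
  qed
  have "g' (f' v) = v" if "v \<in> tangent_space S x" for v
    using that unfolding tangent_space_def
  proof (induction rule: span_induct)
    case base
    have "linear (\<lambda>v. g' (f' v) - v)"
      using linear_compose[OF lin] by (intro linear_compose_sub linear_ident) (simp add: o_def)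
    from linear_subspace_kernel[OF this] show ?case by simp
  next
    case (step v)
    then show ?case by (rule cone)
  qed
  then show "inj_on f' (tangent_space S x)" by (rule inj_on_inverseI)
qed

context branch_chart
begin

text \<open>A kernel vector \<open>w\<close> of the Jacobian has a tangential part \<open>v\<close>,
  the image of \<open>drop_coord k w\<close>, for which \<open>v + s Du v\<close> is a multiple of
  \<open>u\<close>. The assumption forces \<open>v = 0\<close>, and then the time component of
  \<open>w\<close> vanishes as well.\<close>

lemma det0_nonzero:
  assumes x: "x \<in> R" "x \<in> W"
    and ns: "\<And>v. v \<in> tangent_space R x \<Longrightarrow> v \<noteq> 0 \<Longrightarrow> v + s *\<^sub>R Du x v \<notin> span {u x}"
  shows "det (matrix (\<Theta>' (the_inv_into V \<psi> x + s *\<^sub>R axis k 1))) \<noteq> 0"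
proof
  let ?y = "the_inv_into V \<psi> x"
  let ?z = "?y + s *\<^sub>R axis k 1"
  let ?D = "frechet_derivative \<psi> (at ?y)"
  have y: "?y \<in> V" "?y $ k = 0" "\<psi> ?y = x"
    using x dfacts(5,7) chart_mem[OF chart x(2)] by (auto simp: span_Basis_minus)
  have d: "drop_coord k ?z = ?y" "?z $ k = s" using y(2) by simp_all
  have e: "\<Theta>' ?z w = ?D (drop_coord k w) + (s *\<^sub>R Du x (?D (drop_coord k w)) + (w $ k) *\<^sub>R u x)" for w
    unfolding \<Theta>'_def d(1) y(3) unfolding d(2) ..
  have lin: "linear (\<Theta>' ?z)" by (rule has_derivative_linear[OF has_derivative_\<Theta>]) (simp only: d(1) y(1))
  assume "det (matrix (\<Theta>' ?z)) = 0"
  then have "\<not> inj (\<Theta>' ?z)" using det_nz_iff_inj[OF lin] by blast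
  then obtain w where w: "\<Theta>' ?z w = 0" "w \<noteq> 0" using linear_injective_0[OF lin] by blast
  have T: "tangent_space R x = ?D ` span (Basis - {axis k 1})"
    using tangent_space_chart[OF chart y(1)] y(2,3) by (simp add: span_Basis_minus)
  have v: "?D (drop_coord k w) \<in> tangent_space R x" unfolding T by (rule imageI[OF drop_coord_in_span])
  have "?D (drop_coord k w) + s *\<^sub>R Du x (?D (drop_coord k w)) = - (w $ k) *\<^sub>R u x"
    using w(1) unfolding e by (simp add: algebra_simps eq_neg_iff_add_eq_0)
  then have "?D (drop_coord k w) + s *\<^sub>R Du x (?D (drop_coord k w)) \<in> span {u x}"
    by (simp add: span_neg span_scale span_base)
  then have z: "?D (drop_coord k w) = 0" using ns[OF v] by blast
  have "drop_coord k w = 0"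
    using dfacts(10)[OF y(1), of "drop_coord k w"] z has_derivative_linear[OF dfacts(9)[OF dfacts(6)[OF y(1)]]]
    by (simp add: linear_0)
  moreover have "(w $ k) *\<^sub>R u x = 0"
    using w(1) z has_derivative_linear[OF has_derivative_u[OF x(2)]] unfolding e by (simp add: linear_0)
  moreover have "u x \<noteq> 0" using nz[OF x(2)] by (simp add: u_def sgn_div_norm)
  ultimately show False using w(2) by simp
qed

text \<open>A stratum \<open>A\<close> of the double of full dimension is tangent to the graph of the branch \<open>H\<close>, so
  its tangent vectors project onto the tangent space of the regular part.\<close>

lemma graph_tangent:
  fixes A :: "((real^'n) \<times> (real^'n)) set"
  assumes x: "x \<in> R" "x \<in> W"
    and A: "\<And>q. q \<in> A \<Longrightarrow> fst q \<in> R \<and> snd q \<in> U (fst q)"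
    and c: "chart j A V' W' \<xi> K'" and j: "CARD('n) - 1 \<le> j"
    and y': "y' \<in> V'" "y' \<in> span K'" "\<xi> y' = (x, H x)"
  shows "\<kappa> \<in> span K' \<Longrightarrow> \<forall>\<^sub>F \<epsilon> in nhds (0::real). \<xi> (y' + \<epsilon> *\<^sub>R \<kappa>) \<in> A \<and>
        snd (\<xi> (y' + \<epsilon> *\<^sub>R \<kappa>)) = H (fst (\<xi> (y' + \<epsilon> *\<^sub>R \<kappa>)))"
    "v \<in> tangent_space R x \<Longrightarrow> \<exists>\<kappa>\<in>span K'. fst (frechet_derivative \<xi> (at y') \<kappa>) = v"
proof -
  have c': "open V'" "open W'" "diffeomorphism V' W' \<xi>" "K' \<subseteq> Basis" "card K' = j" "\<xi> ` (V' \<inter> span K') = A \<inter> W'"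
    using c by (auto simp: chart_def)
  note f = diffeomorphism_facts[OF c'(1-3)]
  let ?E = "frechet_derivative \<xi> (at y')"
  have linE: "linear ?E" by (rule has_derivative_linear[OF f(8)[OF y'(1)]])
  have line: "((\<lambda>\<epsilon>::real. \<xi> (y' + \<epsilon> *\<^sub>R \<kappa>)) has_derivative (\<lambda>\<epsilon>. \<epsilon> *\<^sub>R ?E \<kappa>)) (at 0)" for \<kappa>
  proof -
    have l1: "((\<lambda>\<epsilon>::real. y' + \<epsilon> *\<^sub>R \<kappa>) has_derivative (\<lambda>\<epsilon>. \<epsilon> *\<^sub>R \<kappa>)) (at 0)" by (auto intro!: derivative_eq_intros)
    have "((\<lambda>\<epsilon>::real. \<xi> (y' + \<epsilon> *\<^sub>R \<kappa>)) has_derivative (\<lambda>\<epsilon>. ?E (\<epsilon> *\<^sub>R \<kappa>))) (at 0)"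
      by (rule has_derivative_compose[where g = \<xi>, OF l1]) (simp add: f(8)[OF y'(1)])
    then show ?thesis by (simp add: linear_cmul[OF linE])
  qed
  have ne: "H x \<noteq> H' x" using sides[OF x] by (auto simp: opposite_sides_def)
  show ev: "\<forall>\<^sub>F \<epsilon> in nhds (0::real). \<xi> (y' + \<epsilon> *\<^sub>R \<kappa>) \<in> A \<and> snd (\<xi> (y' + \<epsilon> *\<^sub>R \<kappa>)) = H (fst (\<xi> (y' + \<epsilon> *\<^sub>R \<kappa>)))"
    if \<kappa>: "\<kappa> \<in> span K'" for \<kappa>
  proof -
    have cont: "isCont (\<lambda>\<epsilon>::real. \<xi> (y' + \<epsilon> *\<^sub>R \<kappa>)) 0" by (rule has_derivative_continuous[OF line])
    have lim: "((\<lambda>\<epsilon>::real. \<xi> (y' + \<epsilon> *\<^sub>R \<kappa>)) \<longlongrightarrow> (x, H x)) (nhds 0)"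
      using isCont_tendsto_compose[OF cont filterlim_ident] y'(3) by simp
    have "((\<lambda>\<epsilon>::real. y' + \<epsilon> *\<^sub>R \<kappa>) \<longlongrightarrow> y' + 0 *\<^sub>R \<kappa>) (nhds 0)"
      by (intro tendsto_intros filterlim_ident)
    then have 1: "\<forall>\<^sub>F \<epsilon> in nhds (0::real). y' + \<epsilon> *\<^sub>R \<kappa> \<in> V'"
      using c'(1) y'(1) by (auto dest: topological_tendstoD)
    have lim1: "((\<lambda>\<epsilon>::real. fst (\<xi> (y' + \<epsilon> *\<^sub>R \<kappa>))) \<longlongrightarrow> x) (nhds 0)" using tendsto_fst[OF lim] by simp
    have lim2: "((\<lambda>\<epsilon>::real. snd (\<xi> (y' + \<epsilon> *\<^sub>R \<kappa>))) \<longlongrightarrow> H x) (nhds 0)" using tendsto_snd[OF lim] by simp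
    have 2: "\<forall>\<^sub>F \<epsilon> in nhds (0::real). fst (\<xi> (y' + \<epsilon> *\<^sub>R \<kappa>)) \<in> W"
      by (rule topological_tendstoD[OF lim1 oW x(2)])
    have "isCont H' x" using smooth_on_imp_continuous_on[OF smooth(2)] oW x(2) by (simp add: continuous_on_eq_continuous_at)
    then have "((\<lambda>\<epsilon>::real. H' (fst (\<xi> (y' + \<epsilon> *\<^sub>R \<kappa>)))) \<longlongrightarrow> H' x) (nhds 0)"
      by (rule isCont_tendsto_compose[OF _ lim1])
    from tendsto_diff[OF lim2 this]
    \<comment> \<open>The second components stay away from the other branch \<open>H'\<close>, so
      points of \<open>A\<close> on the curve can only carry the value \<open>H\<close>.\<close>
    have 3: "\<forall>\<^sub>F \<epsilon> in nhds (0::real). snd (\<xi> (y' + \<epsilon> *\<^sub>R \<kappa>)) - H' (fst (\<xi> (y' + \<epsilon> *\<^sub>R \<kappa>))) \<noteq> 0"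
      by (rule tendsto_imp_eventually_ne) (use ne in simp)
    show ?thesis
      using 1 2 3
    proof eventually_elim
      case (elim \<epsilon>)
      have "y' + \<epsilon> *\<^sub>R \<kappa> \<in> V' \<inter> span K'" using elim(1) y'(2) \<kappa> by (simp add: span_add span_scale)
      then have "\<xi> (y' + \<epsilon> *\<^sub>R \<kappa>) \<in> A \<inter> W'" unfolding c'(6)[symmetric] by (rule imageI)
      then have a: "\<xi> (y' + \<epsilon> *\<^sub>R \<kappa>) \<in> A" by simp
      have "snd (\<xi> (y' + \<epsilon> *\<^sub>R \<kappa>)) \<in> {H (fst (\<xi> (y' + \<epsilon> *\<^sub>R \<kappa>))), H' (fst (\<xi> (y' + \<epsilon> *\<^sub>R \<kappa>)))}"
        using A[OF a] U[of "fst (\<xi> (y' + \<epsilon> *\<^sub>R \<kappa>))"] elim(2) by simp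
      then show ?case using a elim(3) by auto
    qed
  qed
  have line1: "((\<lambda>\<epsilon>::real. fst (\<xi> (y' + \<epsilon> *\<^sub>R \<kappa>))) has_derivative (\<lambda>\<epsilon>. \<epsilon> *\<^sub>R fst (?E \<kappa>))) (at 0)" for \<kappa>
    using has_derivative_fst[OF line[of \<kappa>]] by simp
  have line2: "((\<lambda>\<epsilon>::real. snd (\<xi> (y' + \<epsilon> *\<^sub>R \<kappa>))) has_derivative (\<lambda>\<epsilon>. \<epsilon> *\<^sub>R snd (?E \<kappa>))) (at 0)" for \<kappa>
    using has_derivative_snd[OF line[of \<kappa>]] by simp
  have unique: "a = b" if gd: "((\<lambda>\<epsilon>::real. g \<epsilon>) has_derivative (\<lambda>\<epsilon>. \<epsilon> *\<^sub>R a)) (at 0)"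
      and hd: "((\<lambda>\<epsilon>::real. h \<epsilon>) has_derivative (\<lambda>\<epsilon>. \<epsilon> *\<^sub>R b)) (at 0)" and gh: "\<forall>\<^sub>F \<epsilon> in nhds 0. g \<epsilon> = h \<epsilon>"
    for a b :: "real^'n" and g h
  proof -
    obtain G where G: "open G" "0 \<in> G" "\<And>\<epsilon>. \<epsilon> \<in> G \<Longrightarrow> g \<epsilon> = h \<epsilon>" using gh by (auto simp: eventually_nhds)
    have "(h has_derivative (\<lambda>\<epsilon>. \<epsilon> *\<^sub>R a)) (at 0)"
      by (rule has_derivative_transform_within_open[OF gd G])
    from has_derivative_unique[OF this hd] have "1 *\<^sub>R a = 1 *\<^sub>R b" by (rule fun_cong)
    then show ?thesis by simp
  qed
  \<comment> \<open>The curve stays in the graph of \<open>H\<close>, so the second component of its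
    velocity is the derivative of \<open>H\<close> applied to the first.\<close>
  have snd: "snd (?E \<kappa>) = frechet_derivative H (at x) (fst (?E \<kappa>))" if \<kappa>: "\<kappa> \<in> span K'" for \<kappa>
  proof -
    have "((\<lambda>\<epsilon>::real. H (fst (\<xi> (y' + \<epsilon> *\<^sub>R \<kappa>)))) has_derivative (\<lambda>\<epsilon>. frechet_derivative H (at x) (\<epsilon> *\<^sub>R fst (?E \<kappa>)))) (at 0)"
      by (rule has_derivative_compose[where g = H, OF line1]) (simp add: y'(3) has_derivative_H[OF x(2)])
    then have "((\<lambda>\<epsilon>::real. H (fst (\<xi> (y' + \<epsilon> *\<^sub>R \<kappa>)))) has_derivative (\<lambda>\<epsilon>. \<epsilon> *\<^sub>R frechet_derivative H (at x) (fst (?E \<kappa>)))) (at 0)"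
      by (simp add: linear_cmul[OF has_derivative_linear[OF has_derivative_H[OF x(2)]]])
    then show ?thesis
      by (rule unique[OF line2[of \<kappa>]]) (rule eventually_mono[OF ev[OF \<kappa>]], simp)
  qed
  have inT: "fst (?E \<kappa>) \<in> tangent_space R x" if \<kappa>: "\<kappa> \<in> span K'" for \<kappa>
  proof -
    let ?y = "the_inv_into V \<psi> x"
    let ?F = "frechet_derivative (the_inv_into V \<psi>) (at x)"
    have y: "?y \<in> V" "?y $ k = 0" "\<psi> ?y = x"
      using x dfacts(5,7) chart_mem[OF chart x(2)] by (auto simp: span_Basis_minus)
    have "((\<lambda>\<epsilon>::real. the_inv_into V \<psi> (fst (\<xi> (y' + \<epsilon> *\<^sub>R \<kappa>)))) has_derivative (\<lambda>\<epsilon>. ?F (\<epsilon> *\<^sub>R fst (?E \<kappa>)))) (at 0)"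
      by (rule has_derivative_compose[where g = "the_inv_into V \<psi>", OF line1]) (simp add: y'(3) dfacts(9)[OF x(2)])
    then have "((\<lambda>\<epsilon>::real. the_inv_into V \<psi> (fst (\<xi> (y' + \<epsilon> *\<^sub>R \<kappa>)))) has_derivative (\<lambda>\<epsilon>. \<epsilon> *\<^sub>R ?F (fst (?E \<kappa>)))) (at 0)"
      by (simp add: linear_cmul[OF has_derivative_linear[OF dfacts(9)[OF x(2)]]])
    from bounded_linear.has_derivative[OF bounded_linear_vec_nth this, of k]
    have d1: "((\<lambda>\<epsilon>::real. the_inv_into V \<psi> (fst (\<xi> (y' + \<epsilon> *\<^sub>R \<kappa>))) $ k) has_derivative (\<lambda>\<epsilon>. \<epsilon> * (?F (fst (?E \<kappa>)) $ k))) (at 0)" by simp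
    have lim1: "((\<lambda>\<epsilon>::real. fst (\<xi> (y' + \<epsilon> *\<^sub>R \<kappa>))) \<longlongrightarrow> x) (nhds 0)"
      using isCont_tendsto_compose[OF has_derivative_continuous[OF line1[of \<kappa>]] filterlim_ident] y'(3) by simp
    have 2: "\<forall>\<^sub>F \<epsilon> in nhds (0::real). fst (\<xi> (y' + \<epsilon> *\<^sub>R \<kappa>)) \<in> W"
      by (rule topological_tendstoD[OF lim1 oW x(2)])
    have "\<forall>\<^sub>F \<epsilon> in nhds (0::real). the_inv_into V \<psi> (fst (\<xi> (y' + \<epsilon> *\<^sub>R \<kappa>))) $ k = 0"
      using 2 ev[OF \<kappa>]
    proof eventually_elim
      case (elim \<epsilon>)
      then have "fst (\<xi> (y' + \<epsilon> *\<^sub>R \<kappa>)) \<in> R" using A by blast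
      then show ?case using chart_mem[OF chart elim(1)] by (simp add: span_Basis_minus)
    qed
    then obtain G where G: "open G" "0 \<in> G" "\<And>\<epsilon>. \<epsilon> \<in> G \<Longrightarrow> the_inv_into V \<psi> (fst (\<xi> (y' + \<epsilon> *\<^sub>R \<kappa>))) $ k = 0"
      by (auto simp: eventually_nhds)
    have "((\<lambda>\<epsilon>::real. 0) has_derivative (\<lambda>\<epsilon>. \<epsilon> * (?F (fst (?E \<kappa>)) $ k))) (at 0)"
      by (rule has_derivative_transform_within_open[OF d1 G(1,2)]) (rule G(3))
    from has_derivative_unique[OF this has_derivative_const]
    have "1 * (?F (fst (?E \<kappa>)) $ k) = 0" by (rule fun_cong)
    then have "?F (fst (?E \<kappa>)) \<in> span (Basis - {axis k 1})" by (simp add: span_Basis_minus)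
    moreover have "fst (?E \<kappa>) = frechet_derivative \<psi> (at ?y) (?F (fst (?E \<kappa>)))"
      using dfacts(11)[OF y(1)] unfolding y(3) by simp
    moreover have "tangent_space R x = frechet_derivative \<psi> (at ?y) ` span (Basis - {axis k 1})"
      using tangent_space_chart[OF chart y(1)] y(2,3) by (simp add: span_Basis_minus)
    ultimately show ?thesis by blast
  qed
  show "\<exists>\<kappa>\<in>span K'. fst (?E \<kappa>) = v" if v: "v \<in> tangent_space R x"
  proof -
    let ?L = "\<lambda>\<kappa>. fst (?E \<kappa>)"
    have linL: "linear ?L" using linear_compose[OF linE linear_fst] by (simp add: o_def)
    \<comment> \<open>By \<open>snd\<close>, a tangent vector of the stratum is determined by its
      base component.\<close>
    have inj: "inj_on ?L (span K')"
    proof (rule inj_onI)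
      fix a b assume ab: "a \<in> span K'" "b \<in> span K'" "?L a = ?L b"
      have "snd (?E a) = snd (?E b)" using snd[OF ab(1)] snd[OF ab(2)] ab(3) by simp
      then have "?E a = ?E b" using ab(3) by (simp add: prod_eq_iff)
      then show "a = b" using f(10)[OF y'(1)] by metis
    qed
    have sub: "subspace (?L ` span K')" by (intro linear_subspace_image linL subspace_span)
    have "dim (?L ` span K') = dim (span K')" by (rule dim_image_eq[OF linL]) (subst span_span, rule inj)
    also have "\<dots> = j"
      using c'(4,5) by (simp add: dim_eq_card_independent independent_mono[OF independent_Basis])
    finally have dL: "dim (?L ` span K') = j" .
    let ?y = "the_inv_into V \<psi> x"
    have y: "?y \<in> V" "?y $ k = 0" "\<psi> ?y = x"
      using x dfacts(5,7) chart_mem[OF chart x(2)] by (auto simp: span_Basis_minus)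
    have T: "tangent_space R x = frechet_derivative \<psi> (at ?y) ` span (Basis - {axis k 1})"
      using tangent_space_chart[OF chart y(1)] y(2,3) by (simp add: span_Basis_minus)
    have "dim (tangent_space R x) \<le> dim (span (Basis - {axis k 1 :: real^'n}))"
      unfolding T by (rule dim_image_le[OF has_derivative_linear[OF dfacts(8)[OF y(1)]]])
    also have "\<dots> \<le> card (Basis - {axis k 1 :: real^'n})" using dim_le_card'[of "Basis - {axis k 1 :: real^'n}"] by simp
    also have "\<dots> = CARD('n) - 1" using chart by (simp add: chart_def)
    finally have dT: "dim (tangent_space R x) \<le> CARD('n) - 1" .
    \<comment> \<open>The image lies in the tangent space, and its dimension \<open>j\<close> is at
      least \<open>CARD('n) - 1\<close>, so it is the whole tangent space.\<close>
    have "?L ` span K' = tangent_space R x"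
    proof (rule subspace_dim_equal[OF sub])
      show "subspace (tangent_space R x)" by (simp add: tangent_space_def)
      show "?L ` span K' \<subseteq> tangent_space R x" using inT by blast
      show "dim (tangent_space R x) \<le> dim (?L ` span K')" using dT dL j by simp
    qed
    then show ?thesis using v by force
  qed
qed

text \<open>Both the linking flow and the radial flow have the form \<open>q + \<sigma> u\<close>, with a speed that does not
  vanish. Only the component transversal to \<open>u\<close> of the derivative matters, so no regularity of
  \<open>\<sigma>\<close> along the stratum is needed.\<close>

lemma flow_nonsingular:
  fixes A :: "((real^'n) \<times> (real^'n)) set" and f :: "((real^'n) \<times> (real^'n)) \<times> real \<Rightarrow> real^'n"
  assumes x: "x \<in> R" "x \<in> W"
    and A: "\<And>q. q \<in> A \<Longrightarrow> fst q \<in> R \<and> snd q \<in> U (fst q)"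
    and sub: "submanifold j A" "CARD('n) - 1 \<le> j" and p: "(x, H x) \<in> A"
    and ns: "nonsingular_on (A \<times> T) f" and t: "t \<in> T"
    and \<delta>: "\<delta> \<noteq> 0" "\<And>s. s \<in> {0..<1} \<Longrightarrow> t + s * \<delta> \<in> T"
    and f: "\<And>q \<tau>. q \<in> A \<Longrightarrow> \<tau> \<in> T \<Longrightarrow> f (q, \<tau>) = fst q + \<sigma> q \<tau> *\<^sub>R sgn (snd q)"
    and \<sigma>: "\<And>\<tau>. \<tau> \<in> T \<Longrightarrow> \<sigma> (x, H x) \<tau> = \<alpha> + \<beta> * \<tau>" "\<beta> \<noteq> 0"
  shows "det (matrix (\<Theta>' (the_inv_into V \<psi> x + \<sigma> (x, H x) t *\<^sub>R axis k 1))) \<noteq> 0"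
proof (rule det0_nonzero[OF x])
  fix v assume v: "v \<in> tangent_space R x" "v \<noteq> 0"
  let ?p = "(x, H x)"
  let ?s = "\<sigma> ?p t"
  obtain V' W' \<xi> K' where c: "chart j A V' W' \<xi> K'" "?p \<in> W'" using submanifold_chart[OF sub(1) p] .
  have c': "open V'" "open W'" "diffeomorphism V' W' \<xi>" using c(1) by (auto simp: chart_def)
  note g = diffeomorphism_facts[OF c']
  define y' where "y' = the_inv_into V' \<xi> ?p"
  have y': "y' \<in> V'" "y' \<in> span K'" "\<xi> y' = ?p"
    using g(5,7)[OF c(2)] chart_mem[OF c] p by (auto simp: y'_def)
  let ?E = "frechet_derivative \<xi> (at y')"
  obtain \<kappa> where \<kappa>: "\<kappa> \<in> span K'" "fst (?E \<kappa>) = v"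
    using graph_tangent(2)[OF x A c(1) sub(2) y' v(1)] by blast
  have ev: "\<forall>\<^sub>F \<epsilon> in nhds (0::real). \<xi> (y' + \<epsilon> *\<^sub>R \<kappa>) \<in> A \<and> snd (\<xi> (y' + \<epsilon> *\<^sub>R \<kappa>)) = H (fst (\<xi> (y' + \<epsilon> *\<^sub>R \<kappa>)))"
    by (rule graph_tangent(1)[OF x A c(1) sub(2) y' \<kappa>(1)])
  then obtain G where G: "open G" "0 \<in> G" "\<And>\<epsilon>. \<epsilon> \<in> G \<Longrightarrow> \<xi> (y' + \<epsilon> *\<^sub>R \<kappa>) \<in> A"
     "\<And>\<epsilon>. \<epsilon> \<in> G \<Longrightarrow> snd (\<xi> (y' + \<epsilon> *\<^sub>R \<kappa>)) = H (fst (\<xi> (y' + \<epsilon> *\<^sub>R \<kappa>)))"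
    by (auto simp: eventually_nhds)
  have linE: "linear ?E" by (rule has_derivative_linear[OF g(8)[OF y'(1)]])
  have xy: "fst (\<xi> (y' + 0 *\<^sub>R \<kappa>)) = x" by (simp add: y'(3))
  have line: "((\<lambda>\<epsilon>::real. \<xi> (y' + \<epsilon> *\<^sub>R \<kappa>)) has_derivative (\<lambda>\<epsilon>. \<epsilon> *\<^sub>R ?E \<kappa>)) (at 0)"
  proof -
    have l1: "((\<lambda>\<epsilon>::real. y' + \<epsilon> *\<^sub>R \<kappa>) has_derivative (\<lambda>\<epsilon>. \<epsilon> *\<^sub>R \<kappa>)) (at 0)" by (auto intro!: derivative_eq_intros)
    have "((\<lambda>\<epsilon>::real. \<xi> (y' + \<epsilon> *\<^sub>R \<kappa>)) has_derivative (\<lambda>\<epsilon>. ?E (\<epsilon> *\<^sub>R \<kappa>))) (at 0)"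
      by (rule has_derivative_compose[where g = \<xi>, OF l1]) (simp add: g(8)[OF y'(1)])
    then show ?thesis by (simp add: linear_cmul[OF linE])
  qed
  have line1: "((\<lambda>\<epsilon>::real. fst (\<xi> (y' + \<epsilon> *\<^sub>R \<kappa>))) has_derivative (\<lambda>\<epsilon>. \<epsilon> *\<^sub>R v)) (at 0)"
    using has_derivative_fst[OF line] \<kappa>(2) by simp
  have lineu: "((\<lambda>\<epsilon>::real. u (fst (\<xi> (y' + \<epsilon> *\<^sub>R \<kappa>)))) has_derivative (\<lambda>\<epsilon>. \<epsilon> *\<^sub>R Du x v)) (at 0)"
  proof -
    have "((\<lambda>\<epsilon>::real. u (fst (\<xi> (y' + \<epsilon> *\<^sub>R \<kappa>)))) has_derivative (\<lambda>\<epsilon>. Du x (\<epsilon> *\<^sub>R v))) (at 0)"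
      by (rule has_derivative_compose[where g = u, OF line1]) (simp only: xy has_derivative_u[OF x(2)])
    then show ?thesis by (simp add: linear_cmul[OF has_derivative_linear[OF has_derivative_u[OF x(2)]]])
  qed
  have smf: "smooth_on (A \<times> T) f" using ns by (simp add: nonsingular_on_def)
  have pt: "(?p, t) \<in> A \<times> T" using p t by simp
  obtain f' where f': "(f has_derivative f') (at (?p, t) within A \<times> T)"
    by (rule smooth_on_imp_has_derivative[OF smf pt]) (rule that)
  have inj: "inj_on f' (tangent_space (A \<times> T) (?p, t))"
    using ns pt f' unfolding nonsingular_on_def by blast
  have linf: "linear f'" by (rule has_derivative_linear[OF f'])
  have tan1: "(?E \<kappa>, 0) \<in> tangent_space (A \<times> T) (?p, t)"
    using tangent_cone_Times_space[OF c(1) y'(1,2) \<kappa>(1) t] unfolding y'(3) .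
  have tan2: "(0, 1) \<in> tangent_space (A \<times> T) (?p, t)"
    by (rule tangent_cone_Times_time[OF p \<delta>])
  define F where "F = (\<lambda>\<epsilon>::real. f (\<xi> (y' + \<epsilon> *\<^sub>R \<kappa>), t))"
  have dF: "(F has_derivative (\<lambda>\<epsilon>. \<epsilon> *\<^sub>R f' (?E \<kappa>, 0))) (at 0)"
  proof -
    have p1: "((\<lambda>\<epsilon>::real. (\<xi> (y' + \<epsilon> *\<^sub>R \<kappa>), t)) has_derivative (\<lambda>\<epsilon>. (\<epsilon> *\<^sub>R ?E \<kappa>, 0))) (at 0 within G)"
      by (rule has_derivative_Pair[OF has_derivative_at_withinI[OF line] has_derivative_const])
    have "(\<lambda>\<epsilon>::real. (\<xi> (y' + \<epsilon> *\<^sub>R \<kappa>), t)) ` G \<subseteq> A \<times> T" using G(3) t by auto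
    then have p2: "(f has_derivative f') (at ((\<lambda>\<epsilon>::real. (\<xi> (y' + \<epsilon> *\<^sub>R \<kappa>), t)) 0) within (\<lambda>\<epsilon>::real. (\<xi> (y' + \<epsilon> *\<^sub>R \<kappa>), t)) ` G)"
      using has_derivative_subset[OF f'] by (simp add: y'(3))
    have "(F has_derivative (\<lambda>\<epsilon>. f' (\<epsilon> *\<^sub>R ?E \<kappa>, 0))) (at 0 within G)"
      using diff_chain_within[OF p1 p2] by (simp add: o_def F_def)
    moreover have "f' (\<epsilon> *\<^sub>R ?E \<kappa>, 0) = \<epsilon> *\<^sub>R f' (?E \<kappa>, 0)" for \<epsilon>
      using linear_cmul[OF linf, of \<epsilon> "(?E \<kappa>, 0)"] by simp
    ultimately show ?thesis using at_within_open[OF G(2,1)] by simp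
  qed
  \<comment> \<open>The speed along the curve, recovered as the component of the displacement in the
    direction of the unit vector \<open>u\<close>. It is differentiable because \<open>F\<close>,
    the base curve and \<open>u\<close> are.\<close>
  define \<sigma>' where "\<sigma>' = (\<lambda>\<epsilon>::real. (F \<epsilon> - fst (\<xi> (y' + \<epsilon> *\<^sub>R \<kappa>))) \<bullet> u (fst (\<xi> (y' + \<epsilon> *\<^sub>R \<kappa>))))"
  have u1: "norm (u x) = 1" using nz[OF x(2)] by (simp add: u_def norm_sgn)
  have F0: "F 0 = x + ?s *\<^sub>R u x" unfolding F_def using f[OF p t] by (simp add: y'(3) u_def)
  obtain d where d\<sigma>: "(\<sigma>' has_derivative (\<lambda>\<epsilon>. \<epsilon> * d)) (at 0)"
  proof -
    have "(\<sigma>' has_derivative (\<lambda>\<epsilon>. (F 0 - fst (\<xi> (y' + 0 *\<^sub>R \<kappa>))) \<bullet> (\<epsilon> *\<^sub>R Du x v) +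
        (\<epsilon> *\<^sub>R f' (?E \<kappa>, 0) - \<epsilon> *\<^sub>R v) \<bullet> u (fst (\<xi> (y' + 0 *\<^sub>R \<kappa>))))) (at 0)"
      unfolding \<sigma>'_def by (rule has_derivative_inner[OF has_derivative_diff[OF dF line1] lineu])
    then have "(\<sigma>' has_derivative (\<lambda>\<epsilon>. \<epsilon> * ((F 0 - x) \<bullet> Du x v + (f' (?E \<kappa>, 0) - v) \<bullet> u x))) (at 0)"
      unfolding xy by (simp add: algebra_simps inner_diff_left)
    then show ?thesis by (rule that)
  qed
  have FG: "fst (\<xi> (y' + \<epsilon> *\<^sub>R \<kappa>)) + \<sigma>' \<epsilon> *\<^sub>R u (fst (\<xi> (y' + \<epsilon> *\<^sub>R \<kappa>))) = F \<epsilon>" if \<epsilon>: "\<epsilon> \<in> G" for \<epsilon>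
  proof -
    let ?q = "\<xi> (y' + \<epsilon> *\<^sub>R \<kappa>)"
    have F: "F \<epsilon> = fst ?q + \<sigma> ?q t *\<^sub>R u (fst ?q)"
      unfolding F_def using f[OF G(3)[OF \<epsilon>] t] G(4)[OF \<epsilon>] by (simp add: u_def)
    \<comment> \<open>The curve may leave \<open>W\<close>, where \<open>H\<close> could vanish;
      then \<open>sgn\<close> is zero and so is the displacement.\<close>
    have "snd ?q \<noteq> 0 \<or> \<sigma> ?q t *\<^sub>R u (fst ?q) = 0" using G(4)[OF \<epsilon>] by (auto simp: u_def)
    then have "\<sigma>' \<epsilon> *\<^sub>R u (fst ?q) = \<sigma> ?q t *\<^sub>R u (fst ?q)"
    proof
      assume "snd ?q \<noteq> 0"
      then have "norm (u (fst ?q)) = 1" using G(4)[OF \<epsilon>] by (simp add: u_def norm_sgn)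
      then have "u (fst ?q) \<bullet> u (fst ?q) = 1" by (simp add: norm_eq_1)
      then show ?thesis by (simp add: \<sigma>'_def F)
    next
      assume "\<sigma> ?q t *\<^sub>R u (fst ?q) = 0"
      then show ?thesis by (auto simp: \<sigma>'_def F)
    qed
    then show ?thesis using F by simp
  qed
  have \<sigma>0: "\<sigma>' 0 = ?s" unfolding \<sigma>'_def xy F0 using u1 by (simp add: norm_eq_1)
  have "((\<lambda>\<epsilon>. fst (\<xi> (y' + \<epsilon> *\<^sub>R \<kappa>)) + \<sigma>' \<epsilon> *\<^sub>R u (fst (\<xi> (y' + \<epsilon> *\<^sub>R \<kappa>)))) has_derivative
      (\<lambda>\<epsilon>. \<epsilon> *\<^sub>R v + (\<sigma>' 0 *\<^sub>R (\<epsilon> *\<^sub>R Du x v) + (\<epsilon> * d) *\<^sub>R u (fst (\<xi> (y' + 0 *\<^sub>R \<kappa>)))))) (at 0)"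
    by (rule has_derivative_add[OF line1 has_derivative_scaleR[OF d\<sigma> lineu]])
  then have "(F has_derivative (\<lambda>\<epsilon>. \<epsilon> *\<^sub>R v + (\<sigma>' 0 *\<^sub>R (\<epsilon> *\<^sub>R Du x v) + (\<epsilon> * d) *\<^sub>R u (fst (\<xi> (y' + 0 *\<^sub>R \<kappa>)))))) (at 0)"
    by (rule has_derivative_transform_within_open[OF _ G(1,2)]) (rule FG)
  from has_derivative_unique[OF dF this]
  have "1 *\<^sub>R f' (?E \<kappa>, 0) = 1 *\<^sub>R v + (\<sigma>' 0 *\<^sub>R (1 *\<^sub>R Du x v) + (1 * d) *\<^sub>R u (fst (\<xi> (y' + 0 *\<^sub>R \<kappa>))))" by (rule fun_cong)
  then have e1: "f' (?E \<kappa>, 0) = v + ?s *\<^sub>R Du x v + d *\<^sub>R u x" unfolding xy \<sigma>0 by simp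
  have e2: "f' (0, 1) = \<beta> *\<^sub>R u x"
  proof -
    have p1: "((\<lambda>s::real. (?p, t + s * \<delta>)) has_derivative (\<lambda>s. (0, s * \<delta>))) (at 0 within {0..<1})"
      by (rule has_derivative_Pair) (auto intro!: derivative_eq_intros)
    have "(\<lambda>s::real. (?p, t + s * \<delta>)) ` {0..<1} \<subseteq> A \<times> T" using p \<delta>(2) by auto
    then have p2: "(f has_derivative f') (at ((\<lambda>s::real. (?p, t + s * \<delta>)) 0) within (\<lambda>s::real. (?p, t + s * \<delta>)) ` {0..<1})"
      using has_derivative_subset[OF f'] by simp
    have d1: "((\<lambda>s. f (?p, t + s * \<delta>)) has_derivative (\<lambda>s. f' (0, s * \<delta>))) (at 0 within {0..<1})"
      using diff_chain_within[OF p1 p2] by (simp add: o_def)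
    have "((\<lambda>s. x + (\<alpha> + \<beta> * (t + s * \<delta>)) *\<^sub>R u x) has_derivative (\<lambda>s. f' (0, s * \<delta>))) (at 0 within {0..<1})"
    proof (rule has_derivative_transform[OF _ _ d1])
      fix s :: real assume "s \<in> {0..<1}"
      then show "x + (\<alpha> + \<beta> * (t + s * \<delta>)) *\<^sub>R u x = f (?p, t + s * \<delta>)"
        using f[OF p \<delta>(2)] \<sigma>(1)[OF \<delta>(2)] by (simp add: u_def)
    qed simp
    moreover have "f' (0, s * \<delta>) = s *\<^sub>R (\<delta> *\<^sub>R f' (0, 1))" for s
      using linear_cmul[OF linf, of "s * \<delta>" "(0, 1)"] by simp
    ultimately have v1: "((\<lambda>s. x + (\<alpha> + \<beta> * (t + s * \<delta>)) *\<^sub>R u x) has_vector_derivative \<delta> *\<^sub>R f' (0, 1)) (at 0 within {0..<1})"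
      by (simp add: has_vector_derivative_def)
    have v2: "((\<lambda>s. x + (\<alpha> + \<beta> * (t + s * \<delta>)) *\<^sub>R u x) has_vector_derivative (\<beta> * \<delta>) *\<^sub>R u x) (at 0 within {0..<1})"
      unfolding has_vector_derivative_def by (auto intro!: derivative_eq_intros simp: algebra_simps)
    have "at (0::real) within {0..<1} \<noteq> bot"
    proof -
      have "{0..<1} - {0::real} = {0<..<1}" by auto
      then show ?thesis by (simp add: trivial_limit_within islimpt_in_closure)
    qed
    from vector_derivative_unique_within[OF this v1 v2] have "\<delta> *\<^sub>R f' (0, 1) = \<delta> *\<^sub>R (\<beta> *\<^sub>R u x)" by (simp add: mult.commute)
    then show ?thesis using \<delta>(1) by (metis scaleR_left_imp_eq)
  qed
  show "v + ?s *\<^sub>R Du x v \<notin> span {u x}"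
  proof
    assume "v + ?s *\<^sub>R Du x v \<in> span {u x}"
    then obtain a where a: "v + ?s *\<^sub>R Du x v = a *\<^sub>R u x" by (auto simp: span_singleton)
    \<comment> \<open>The combination of the two tangent vectors in which the multiples of
      \<open>u\<close> cancel: the first contributes \<open>a + d\<close> by \<open>e1\<close>, the
      time direction \<open>\<beta>\<close> by \<open>e2\<close>. It is a kernel vector, and it is
      nonzero because \<open>fst (?E \<kappa>) = v\<close> is.\<close>
    let ?w = "(?E \<kappa>, 0) - ((a + d) / \<beta>) *\<^sub>R (0, 1::real)"
    have "f' ?w = f' (?E \<kappa>, 0) - ((a + d) / \<beta>) *\<^sub>R f' (0, 1)"
      by (simp only: linear_diff[OF linf] linear_cmul[OF linf])
    also have "((a + d) / \<beta>) *\<^sub>R f' (0, 1) = (a + d) *\<^sub>R u x" unfolding e2 using \<sigma>(2) by simp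
    also have "f' (?E \<kappa>, 0) - (a + d) *\<^sub>R u x = 0" unfolding e1 a by (simp add: scaleR_add_left)
    finally have "f' ?w = f' 0" using linear_0[OF linf] by simp
    moreover have "?w \<in> tangent_space (A \<times> T) (?p, t)"
      using tan1 tan2 unfolding tangent_space_def by (intro span_diff span_scale)
    moreover have "0 \<in> tangent_space (A \<times> T) (?p, t)" unfolding tangent_space_def by (rule span_zero)
    ultimately have "?w = 0" by (rule inj_onD[OF inj])
    then have "fst ?w = fst (0 :: ((real^'n) \<times> (real^'n)) \<times> real)" by (rule arg_cong[where f = fst])
    then have "?E \<kappa> = 0" by (simp only: fst_diff fst_scaleR fst_conv scaleR_zero_right diff_zero fst_zero)
    then show False using \<kappa>(2) v(2) by simp
  qed
qed

end

section \<open>Dimension of sweeps and disjointness of the doubles\<close>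

lemma smooth_on_sweep_point:
  fixes A :: "('a::euclidean_space \<times> 'a) set"
  assumes "\<And>p. p \<in> A \<Longrightarrow> snd p \<noteq> 0"
  shows "(\<lambda>(p, s). fst p + s *\<^sub>R sgn (snd p)) differentiable_on (A \<times> (UNIV :: real set))"
  unfolding differentiable_on_def
proof
  fix q :: "('a \<times> 'a) \<times> real" assume q: "q \<in> A \<times> UNIV"
  have d1: "((\<lambda>q::('a \<times> 'a) \<times> real. fst (fst q)) has_derivative (\<lambda>h. fst (fst h))) (at q)"
    and d2: "((\<lambda>q::('a \<times> 'a) \<times> real. snd (fst q)) has_derivative (\<lambda>h. snd (fst h))) (at q)"
    and d3: "((\<lambda>q::('a \<times> 'a) \<times> real. snd q) has_derivative (\<lambda>h. snd h)) (at q)"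
    by (auto intro!: derivative_eq_intros)
  have "snd (fst q) \<noteq> 0" using assms[of "fst q"] q by (simp add: mem_Times_iff)
  from has_derivative_sgn_compose[OF d2 this]
  have d4: "((\<lambda>q::('a \<times> 'a) \<times> real. sgn (snd (fst q))) has_derivative
     (\<lambda>h. snd (fst h) /\<^sub>R norm (snd (fst q)) - ((snd (fst h) \<bullet> snd (fst q)) / norm (snd (fst q)) ^ 3) *\<^sub>R snd (fst q))) (at q)" .
  from has_derivative_at_withinI[OF has_derivative_add[OF d1 has_derivative_scaleR[OF d3 d4]]]
  show "(\<lambda>(p, s). fst p + s *\<^sub>R sgn (snd p)) differentiable at q within A \<times> UNIV"
    unfolding case_prod_beta by (rule has_derivative_imp_differentiable)
qed

text \<open>Locally the double over a stratum is a finite union of graphs of smooth values of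
  \<open>U\<close>, and each graph is a differentiable image of the stratum.\<close>

lemma thin_double:
  fixes \<T> :: "'a::euclidean_space set set"
  assumes rf: "radial_field \<T> U" and X: "X \<in> \<T>" "submanifold j X" "j \<le> DIM('a)"
  shows "thin j (double X U)"
proof (rule thin_local)
  fix p assume p: "p \<in> double X U"
  then have "fst p \<in> X" by (auto simp: double_def)
  from radial_fieldD(3)[OF rf X(1) this]
  obtain W \<F> where W: "open W" "fst p \<in> W" "finite \<F>" "\<forall>F\<in>\<F>. smooth_on (X \<inter> W) F"
    "\<forall>y\<in>X \<inter> W. inj_on (\<lambda>F. F y) \<F> \<and> U y = (\<lambda>F. F y) ` \<F>"
    by (elim exE conjE)
  have "thin j (\<Union>F\<in>\<F>. (\<lambda>x. (x, F x)) ` (X \<inter> W))"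
  proof (rule thin_UN)
    show "countable \<F>" using W(3) by (rule countable_finite)
    fix F assume F: "F \<in> \<F>"
    have "smooth_on (X \<inter> W) F" using W(4) F by blast
    then have d: "F differentiable_on (X \<inter> W)" by (rule smooth_on_imp_differentiable_on)
    have "(\<lambda>x. (x, F x)) differentiable_on (X \<inter> W)"
      unfolding differentiable_on_def
    proof
      fix x assume "x \<in> X \<inter> W"
      then obtain D where "(F has_derivative D) (at x within X \<inter> W)"
        using d unfolding differentiable_on_def differentiable_def by blast
      from has_derivative_Pair[OF has_derivative_ident this]
      show "(\<lambda>x. (x, F x)) differentiable at x within X \<inter> W" by (rule has_derivative_imp_differentiable)
    qed
    moreover have "thin j (X \<inter> W)" using thin_submanifold[OF X(2)] by (rule thin_subset) auto
    ultimately show "thin j ((\<lambda>x. (x, F x)) ` (X \<inter> W))"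
      using X(3) by (intro thin_image) auto
  qed
  moreover have "double X U \<inter> (W \<times> UNIV) \<subseteq> (\<Union>F\<in>\<F>. (\<lambda>x. (x, F x)) ` (X \<inter> W))"
  proof
    fix q assume q: "q \<in> double X U \<inter> (W \<times> UNIV)"
    then have x: "fst q \<in> X \<inter> W" "snd q \<in> U (fst q)" by (auto simp: double_def)
    then have "snd q \<in> (\<lambda>F. F (fst q)) ` \<F>" using W(5) by auto
    then obtain F where "F \<in> \<F>" "snd q = F (fst q)" by blast
    then have "q = (\<lambda>x. (x, F x)) (fst q)" by (simp add: prod_eq_iff)
    then show "q \<in> (\<Union>F\<in>\<F>. (\<lambda>x. (x, F x)) ` (X \<inter> W))" using x \<open>F \<in> \<F>\<close> by blast
  qed
  ultimately have "thin j (double X U \<inter> (W \<times> UNIV))" by (rule thin_subset)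
  moreover have "open (W \<times> (UNIV :: 'a set))" using W(1) by (intro open_Times) auto
  moreover have "p \<in> W \<times> UNIV" using W(2) by (simp add: mem_Times_iff)
  ultimately show "\<exists>W. open W \<and> p \<in> W \<and> thin j (double X U \<inter> W)" by blast
qed

lemma thin_mono:
  assumes "thin j A" "j \<le> j'"
  shows "thin j' A"
proof -
  obtain \<Z> :: "(('a \<Rightarrow> 'a) \<times> 'a set) set" where Z: "countable \<Z>"
     "\<And>c Z. (c, Z) \<in> \<Z> \<Longrightarrow> c differentiable_on Z" "\<And>c Z. (c, Z) \<in> \<Z> \<Longrightarrow> \<exists>T. subspace T \<and> dim T \<le> j \<and> Z \<subseteq> T"
     "A \<subseteq> (\<Union>(c, Z)\<in>\<Z>. c ` Z)"
    by (rule thinE[OF assms(1)]) (rule that)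
  have "\<exists>T. subspace T \<and> dim T \<le> j' \<and> Z \<subseteq> T" if "(c, Z) \<in> \<Z>" for c Z
    using Z(3)[OF that] assms(2) by (elim exE conjE) (intro exI conjI, assumption, rule order_trans)
  then show ?thesis
    unfolding thin_def using Z(1,2,4) by (intro exI[of _ \<Z>]) auto
qed

lemma thin_Union_strata:
  fixes \<T> :: "'a::euclidean_space set set"
  assumes s: "stratification \<T> N" and X: "\<And>X. X \<in> \<T> \<Longrightarrow> \<exists>j\<le>d. submanifold j X"
  shows "thin d N"
proof (rule thin_local)
  fix x assume "x \<in> N"
  from stratificationD(4)[OF s this]
  obtain W where W: "open W" "x \<in> W" "finite {X\<in>\<T>. X \<inter> W \<noteq> {}}" by (elim exE conjE)
  have "thin d (\<Union>X\<in>{X\<in>\<T>. X \<inter> W \<noteq> {}}. X)"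
  proof (rule thin_UN[OF countable_finite[OF W(3)]])
    fix X' assume "X' \<in> {X\<in>\<T>. X \<inter> W \<noteq> {}}"
    then obtain j where "j \<le> d" "submanifold j X'" using X by blast
    then show "thin d X'" using thin_mono[OF thin_submanifold] by blast
  qed
  then have "thin d (N \<inter> W)" by (rule thin_subset) (use stratificationD(1)[OF s] in blast)
  then show "\<exists>W. open W \<and> x \<in> W \<and> thin d (N \<inter> W)" using W(1,2) by blast
qed

text \<open>A common point of two doubles would flow at time \<open>1/2\<close> into both regions,
  hence into the frontier of \<open>\<Omega> i\<close>. The frontier is the image of time
  \<open>1\<close>, which contradicts injectivity of the radial flow. This separates unlinked rays
  of different regions, whose doubles enter the radial flow on the unlinked part only as a plain
  union.\<close>

lemma radial_sweep_disjoint: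
  fixes \<Omega> :: "'i \<Rightarrow> 'a::euclidean_space set"
  assumes configuration: "multi_region_configuration I \<Omega>" and ij: "i \<in> I" "j \<in> I" "i \<noteq> j"
    and ss: "skeletal_structure (\<Omega> i) (\<T> i) (U i)" "skeletal_structure (\<Omega> j) (\<T> j) (U j)"
  shows "double (\<Union>(\<T> i)) (U i) \<inter> double (\<Union>(\<T> j)) (U j) = {}"
proof (rule ccontr)
  assume "\<not> ?thesis"
  then obtain p where p: "p \<in> double (\<Union>(\<T> i)) (U i)" "p \<in> double (\<Union>(\<T> j)) (U j)" by blast
  let ?y = "radial_flow (p, 1/2 :: real)"
  have img: "?y \<in> \<Omega> l" if sl: "skeletal_structure (\<Omega> l) (\<T> l) (U l)" and pl: "p \<in> double (\<Union>(\<T> l)) (U l)" for l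
  proof -
    obtain \<psi> where "homeomorphism (double (\<Union>(\<T> l)) (U l) \<times> {0<..1}) (\<Omega> l - \<Union>(\<T> l)) radial_flow \<psi>"
      using sl unfolding skeletal_structure_def by blast
    then have "radial_flow ` (double (\<Union>(\<T> l)) (U l) \<times> {0<..1::real}) = \<Omega> l - \<Union>(\<T> l)" by (rule homeomorphism_image1)
    moreover have "(p, 1/2) \<in> double (\<Union>(\<T> l)) (U l) \<times> {0<..1::real}" using pl by simp
    ultimately show ?thesis by blast
  qed
  have "?y \<in> \<Omega> i \<inter> \<Omega> j" using img[OF ss(1) p(1)] img[OF ss(2) p(2)] by blast
  moreover have "\<Omega> i \<inter> \<Omega> j \<subseteq> frontier (\<Omega> i)"
  proof -
    obtain \<B> where B: "\<forall>i\<in>I. whitney_stratification (\<B> i) (frontier (\<Omega> i)) \<and>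
              (\<forall>X\<in>\<B> i. \<exists>d\<ge>1. X \<subseteq> corner_points DIM('a) d (\<Omega> i))"
      "\<forall>i\<in>I. \<forall>j\<in>I. i \<noteq> j \<longrightarrow> (\<exists>\<C>. \<C> \<subseteq> \<B> i \<inter> \<B> j \<and> \<Omega> i \<inter> \<Omega> j = \<Union>\<C>)"
      using conjunct1[OF conjunct2[OF conjunct2[OF configuration[unfolded multi_region_configuration_def]]]] by (elim exE conjE)
    have "\<exists>\<C>. \<C> \<subseteq> \<B> i \<inter> \<B> j \<and> \<Omega> i \<inter> \<Omega> j = \<Union>\<C>" using bspec[OF bspec[OF B(2) ij(1)] ij(2)] ij(3) by simp
    then obtain \<C> where "\<C> \<subseteq> \<B> i \<inter> \<B> j" "\<Omega> i \<inter> \<Omega> j = \<Union>\<C>" by (elim exE conjE)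
    moreover have "\<Union>(\<B> i) = frontier (\<Omega> i)"
      using bspec[OF B(1) ij(1)] stratificationD(1) unfolding whitney_stratification_def by blast
    ultimately show ?thesis by blast
  qed
  ultimately have "?y \<in> frontier (\<Omega> i)" by blast
  also have "frontier (\<Omega> i) = (\<lambda>p. radial_flow (p, 1)) ` double (\<Union>(\<T> i)) (U i)"
    using ss(1) unfolding skeletal_structure_def by simp
  finally obtain q where q: "q \<in> double (\<Union>(\<T> i)) (U i)" "?y = radial_flow (q, 1)" by blast
  obtain \<psi> where "homeomorphism (double (\<Union>(\<T> i)) (U i) \<times> {0<..1}) (\<Omega> i - \<Union>(\<T> i)) radial_flow \<psi>"
    using ss(1) unfolding skeletal_structure_def by blast
  note inv = homeomorphism_apply1[OF this]
  from inv[of "(p, 1/2)"] inv[of "(q, 1)"] have "(p, 1/2) = (q, 1::real)" using p(1) q by simp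
  then show False by simp
qed

section \<open>The linking flow\<close>

locale linking =
  fixes I :: "'i set" and \<Omega> :: "'i \<Rightarrow> (real^'n) set" and \<T> :: "'i \<Rightarrow> (real^'n) set set"
    and U :: "'i \<Rightarrow> real^'n \<Rightarrow> (real^'n) set" and l :: "'i \<Rightarrow> (real^'n) \<times> (real^'n) \<Rightarrow> ereal"
    and J :: "'i \<Rightarrow> 'j set" and S :: "'i \<Rightarrow> 'j \<Rightarrow> ((real^'n) \<times> (real^'n)) set"
  assumes configuration: "multi_region_configuration I \<Omega>" and linking_structure: "skeletal_linking_structure I \<Omega> \<T> U l J S"
begin

abbreviation M where "M i \<equiv> \<Union>(\<T> i)"
abbreviation D where "D i \<equiv> double (M i) (U i)"
abbreviation Dinf where "Dinf i \<equiv> unlinked_part (l i) (D i)"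
abbreviation labels where "labels \<equiv> SIGMA i:I. {j\<in>J i. S i j \<inter> Dinf i = {}}"
abbreviation flow_image where "flow_image \<equiv> \<Union>(i, j)\<in>labels. linking_flow (l i) ` (S i j \<times> {0..1})"

lemma finite_I: "finite I"
  using conjunct1[OF configuration[unfolded multi_region_configuration_def]] .

lemmas structure_conjs0 = linking_structure[unfolded skeletal_linking_structure_def Let_def]
lemmas structure_conjs1 = conjunct2[OF structure_conjs0]
lemmas structure_conjs2 = conjunct2[OF structure_conjs1]
lemmas structure_conjs3 = conjunct2[OF structure_conjs2]
lemmas structure_conjs4 = conjunct2[OF structure_conjs3]
lemmas structure_conjs5 = conjunct2[OF structure_conjs4]
lemmas structure_conjs6 = conjunct2[OF structure_conjs5]
lemmas structure_conjs7 = conjunct2[OF structure_conjs6]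
lemmas structure_conjs8 = conjunct2[OF structure_conjs7]
lemmas structure_conjs9 = conjunct2[OF structure_conjs8]
lemmas structure_conjs10 = conjunct2[OF structure_conjs9]

lemma skeletal: "i \<in> I \<Longrightarrow> skeletal_structure (\<Omega> i) (\<T> i) (U i)"
  by (rule bspec[OF conjunct1[OF structure_conjs0]])

lemma l_ge: "i \<in> I \<Longrightarrow> p \<in> D i \<Longrightarrow> ereal (norm (snd p)) \<le> l i p"
  by (rule bspec[OF bspec[OF conjunct1[OF structure_conjs1]]])

lemma S_unlinked: "i \<in> I \<Longrightarrow> j \<in> J i \<Longrightarrow> S i j \<subseteq> Dinf i \<or> S i j \<inter> Dinf i = {}"
  by (rule bspec[OF bspec[OF conjunct1[OF structure_conjs2]]])

lemma S_strat: "i \<in> I \<Longrightarrow> finite (J i)" "i \<in> I \<Longrightarrow> stratification (S i ` J i) (D i)"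
    "i \<in> I \<Longrightarrow> j \<in> J i \<Longrightarrow> \<exists>X\<in>\<T> i. S i j \<subseteq> double X (U i)"
  using bspec[OF conjunct1[OF structure_conjs3]] by blast+

lemma l_cont: "i \<in> I \<Longrightarrow> continuous_on (D i - Dinf i) (\<lambda>p. real_of_ereal (l i p))"
  using bspec[OF conjunct1[OF structure_conjs4]] by blast

lemma vec_smooth: "(i, j) \<in> labels \<Longrightarrow> smooth_on (S i j) (linking_vector (l i))"
  using bspec[OF conjunct1[OF structure_conjs5]] by (fastforce simp only: prod.case)

lemma nonsing: "(i, j) \<in> labels \<Longrightarrow> nonsingular_linking I \<Omega> i (l i) (S i j)"
  using bspec[OF conjunct1[OF structure_conjs6]] by (fastforce simp only: prod.case)

lemma sweep_disjoint: "(i, j) \<in> labels \<Longrightarrow> (i', j') \<in> labels \<Longrightarrow> (i, j) \<noteq> (i', j') \<Longrightarrow>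
    linking_sweep (l i) (S i j) \<inter> linking_sweep (l i') (S i' j') = {}"
  using conjunct1[OF structure_conjs7] by (fastforce simp only: prod.case)

lemma radial_homeo: "\<exists>\<psi>. homeomorphism ((\<Union>i\<in>I. Dinf i) \<times> {0<..}) (- (flow_image \<union> (\<Union>i\<in>I. M i))) radial_flow \<psi>"
  by (rule conjunct1[OF structure_conjs10])

lemma radial_diffeo: "i \<in> I \<Longrightarrow> j \<in> J i \<Longrightarrow> S i j \<subseteq> Dinf i \<Longrightarrow>
    diffeomorphism (S i j \<times> {0<..}) (radial_flow ` (S i j \<times> {0<..})) radial_flow"
  using bspec[OF bspec[OF conjunct2[OF structure_conjs10]]] by blast

lemma skel_facts:
  assumes "i \<in> I"
  shows "skeletal_set (\<T> i)" "radial_field (\<T> i) (U i)" "stratification (\<T> i) (M i)"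
    "\<And>X. X \<in> \<T> i \<Longrightarrow> \<exists>k\<le>CARD('n) - 1. submanifold k X"
proof -
  note a = skeletal[OF assms, unfolded skeletal_structure_def]
  show s: "skeletal_set (\<T> i)" by (rule conjunct1[OF a])
  show "radial_field (\<T> i) (U i)" by (rule conjunct1[OF conjunct2[OF a]])
  note b = s[unfolded skeletal_set_def]
  show "stratification (\<T> i) (M i)" using conjunct1[OF b] unfolding whitney_stratification_def by (rule conjunct1)
  show "\<exists>k\<le>CARD('n) - 1. submanifold k X" if "X \<in> \<T> i" for X
    using bspec[OF conjunct1[OF conjunct2[OF b]] that] by simp
qed

lemma snd_nonzero: "i \<in> I \<Longrightarrow> p \<in> D i \<Longrightarrow> snd p \<noteq> 0"
  using radial_fieldD(1)[OF skel_facts(2)] by (force simp: double_def)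

lemma S_sub_D: "i \<in> I \<Longrightarrow> j \<in> J i \<Longrightarrow> S i j \<subseteq> D i"
  using stratificationD(1)[OF S_strat(2)] by blast

section \<open>Disjointness of the radial segments\<close>

lemma D_cases:
  assumes "i \<in> I" "p \<in> D i"
  obtains j where "j \<in> J i" "p \<in> S i j" "(i, j) \<in> labels" "l i p \<noteq> \<infinity>"
  | j where "j \<in> J i" "p \<in> S i j" "S i j \<subseteq> Dinf i" "l i p = \<infinity>"
proof -
  have "p \<in> \<Union>(S i ` J i)" using assms(2) by (simp only: stratificationD(1)[OF S_strat(2)[OF assms(1)]])
  then obtain j where j: "j \<in> J i" "p \<in> S i j" by blast
  show ?thesis
  proof (cases "S i j \<inter> Dinf i = {}")
    case True
    then have "l i p \<noteq> \<infinity>" using j assms(2) by (auto simp: unlinked_part_def)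
    then show ?thesis using True j assms(1) by (intro that(1)[of j]) auto
  next
    case False
    then have s: "S i j \<subseteq> Dinf i" using S_unlinked[OF assms(1) j(1)] by blast
    then have "l i p = \<infinity>" using j(2) by (auto simp: unlinked_part_def)
    then show ?thesis using s j by (intro that(2)[of j])
  qed
qed

text \<open>The parameter is arc length along the ray, which suits the linking flow and the radial
  flow alike. Both ends are left out: at \<open>0\<close> the sides of \<open>M\<close> meet, at
  \<open>l\<close> the linked points.\<close>

definition E where "E i = {q. fst q \<in> D i \<and> 0 < snd q \<and> ereal (snd q) < l i (fst q)}"

definition \<Phi> :: "((real^'n) \<times> (real^'n)) \<times> real \<Rightarrow> real^'n" where
  "\<Phi> q = fst (fst q) + snd q *\<^sub>R sgn (snd (fst q))"

lemma \<Phi>_inj: "\<Phi> (p, s) = \<Phi> (p, s') \<Longrightarrow> snd p \<noteq> 0 \<Longrightarrow> s = s'"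
  by (simp add: \<Phi>_def sgn_zero_iff)

lemma radial_\<Phi>: "snd p \<noteq> 0 \<Longrightarrow> radial_flow (p, s / norm (snd p)) = \<Phi> (p, s)"
  by (simp add: radial_flow_def \<Phi>_def sgn_div_norm divide_inverse)

text \<open>Inverts the piecewise linear time change: up to arc length \<open>r\<close> the flow has
  speed \<open>2 * r\<close>, beyond it the length grows linearly from \<open>r\<close> to the value
  of \<open>l\<close>. The last two conclusions record which half the time belongs to.\<close>

lemma linking_time:
  assumes i: "i \<in> I" and p: "p \<in> D i" "l i p \<noteq> \<infinity>" and E: "(p, s) \<in> E i"
  obtains t where "0 < t" "t < 1" "ereal (norm (snd p)) < l i p \<or> t < 1/2" "linking_flow (l i) (p, t) = \<Phi> (p, s)"
    "t \<le> 1/2 \<Longrightarrow> s = 2 * t * norm (snd p)"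
    "t > 1/2 \<Longrightarrow> s = 2 * (1 - t) * norm (snd p) + (2 * t - 1) * real_of_ereal (l i p) \<and> ereal (norm (snd p)) < l i p"
proof -
  define r where "r = norm (snd p)"
  have r: "r > 0" using snd_nonzero[OF i p(1)] by (simp add: r_def)
  obtain L where L: "l i p = ereal L" using p(2) l_ge[OF i p(1)] by (cases "l i p") auto
  have rL: "r \<le> L" using l_ge[OF i p(1)] by (simp add: L r_def)
  have s: "0 < s" "s < L" using E by (auto simp: E_def L)
  show ?thesis
  proof (cases "s \<le> r")
    case True
    define t where "t = s / (2 * r)"
    have t: "0 < t" "t \<le> 1/2" "2 * t * r = s" using s r True by (auto simp: t_def field_simps)
    \<comment> \<open>If \<open>r = L\<close>, the flow stops at arc length \<open>r\<close>; then
      \<open>s < L = r\<close>, and the time lies below \<open>1/2\<close>.\<close>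
    have "ereal (norm (snd p)) < l i p \<or> t < 1/2"
    proof (cases "r < L")
      case False
      then have "s < r" using s rL by simp
      then show ?thesis using r by (simp add: t_def field_simps)
    qed (simp add: L r_def)
    moreover have "linking_flow (l i) (p, t) = \<Phi> (p, s)"
      using t by (simp add: linking_flow_def \<Phi>_def Let_def r_def)
    ultimately show ?thesis using t by (intro that[of t]) (auto simp: r_def)
  next
    case False
    then have sr: "r < s" by simp
    then have rL': "r < L" using s by simp
    \<comment> \<open>The fraction of the way from \<open>r\<close> to \<open>L\<close> that is
      covered at arc length \<open>s\<close>; the second half of the time interval is rescaled to
      it.\<close>
    define w where "w = (s - r) / (L - r)"
    have w: "0 < w" "w < 1" "w * (L - r) = s - r" using sr rL' s(2) by (simp_all add: w_def)
    define t where "t = 1/2 + w/2"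
    have t1: "1/2 < t" "t < 1" using w by (simp_all add: t_def)
    have "2 * (1 - t) * r + (2 * t - 1) * L = r + w * (L - r)" by (simp add: t_def algebra_simps)
    then have ts: "2 * (1 - t) * r + (2 * t - 1) * L = s" by (simp add: w(3))
    have "linking_flow (l i) (p, t) = \<Phi> (p, s)"
      using t1 ts by (simp add: linking_flow_def \<Phi>_def Let_def r_def L)
    then show ?thesis using t1 ts rL' by (intro that[of t]) (auto simp: L r_def)
  qed
qed

lemma linked_in_sweep:
  assumes i: "i \<in> I" and p: "p \<in> D i" "l i p \<noteq> \<infinity>" and E: "(p, s) \<in> E i" and j: "p \<in> S i j" "(i, j) \<in> labels"
  shows "\<Phi> (p, s) \<in> linking_sweep (l i) (S i j)" "\<Phi> (p, s) \<in> flow_image"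
proof -
  obtain t where t: "0 < t" "t < 1" "ereal (norm (snd p)) < l i p \<or> t < 1/2" "linking_flow (l i) (p, t) = \<Phi> (p, s)"
    by (rule linking_time[OF i p E]) (rule that)
  show "\<Phi> (p, s) \<in> linking_sweep (l i) (S i j)"
    unfolding linking_sweep_def t(4)[symmetric] using t(1-3) j(1) by blast
  have "linking_flow (l i) (p, t) \<in> linking_flow (l i) ` (S i j \<times> {0..1})"
    using t(1,2) j(1) by (intro imageI) auto
  then show "\<Phi> (p, s) \<in> flow_image" unfolding t(4) using j(2) by blast
qed

text \<open>On one stratum the flow is a homeomorphism onto its image, for all positive times if it
  runs on, and for \<open>0 < t \<le> 1/2\<close> if it stops. In the stopped case the times from
  \<open>linking_time\<close> lie below \<open>1/2\<close>, so they are covered.\<close>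

lemma sweep_inj_label:
  assumes i: "i \<in> I" and p: "p \<in> D i" "l i p \<noteq> \<infinity>" "(p, s) \<in> E i" "p \<in> S i j"
    and p': "p' \<in> D i" "l i p' \<noteq> \<infinity>" "(p', s') \<in> E i" "p' \<in> S i j"
    and j: "(i, j) \<in> labels" and eq: "\<Phi> (p, s) = \<Phi> (p', s')"
  shows "p = p'"
proof -
  obtain t where t: "0 < t" "t < 1" "ereal (norm (snd p)) < l i p \<or> t < 1/2" "linking_flow (l i) (p, t) = \<Phi> (p, s)"
    by (rule linking_time[OF i p(1-3)]) (rule that)
  obtain t' where t': "0 < t'" "t' < 1" "ereal (norm (snd p')) < l i p' \<or> t' < 1/2" "linking_flow (l i) (p', t') = \<Phi> (p', s')"
    by (rule linking_time[OF i p'(1-3)]) (rule that)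
  have e: "linking_flow (l i) (p, t) = linking_flow (l i) (p', t')" using t(4) t'(4) eq by simp
  from nonsing[OF j] consider
      (run) \<psi> where "homeomorphism (S i j \<times> {0<..1}) (linking_flow (l i) ` (S i j \<times> {0<..1})) (linking_flow (l i)) \<psi>"
    | (stop) \<psi> where "\<forall>p\<in>S i j. ereal (norm (snd p)) = l i p"
       "homeomorphism (S i j \<times> {0<..1/2}) (linking_flow (l i) ` (S i j \<times> {0<..1/2})) (linking_flow (l i)) \<psi>"
    unfolding nonsingular_linking_def by blast
  then have "(p, t) = (p', t')"
  proof cases
    case run
    have "(p, t) \<in> S i j \<times> {0<..1}" "(p', t') \<in> S i j \<times> {0<..1}" using p p' t t' by auto
    then show ?thesis using homeomorphism_apply1[OF run] e by metis
  next
    case stop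
    have "ereal (norm (snd p)) = l i p" "ereal (norm (snd p')) = l i p'" using stop(1) p(4) p'(4) by auto
    then have "t < 1/2" "t' < 1/2" using t(3) t'(3) by auto
    then have "(p, t) \<in> S i j \<times> {0<..1/2}" "(p', t') \<in> S i j \<times> {0<..1/2}" using p p' t t' by auto
    then show ?thesis using homeomorphism_apply1[OF stop(2)] e by metis
  qed
  then show ?thesis by simp
qed

text \<open>The radial flow moves by multiples of \<open>U\<close>, so arc length \<open>s\<close>
  corresponds to the parameter \<open>s / norm (snd p)\<close>. Over the unlinked part its image is
  disjoint from that of the linking flow.\<close>

lemma unlinked_image:
  assumes i: "i \<in> I" and p: "p \<in> D i" "l i p = \<infinity>" "s > 0"
  shows "(p, s / norm (snd p)) \<in> (\<Union>i\<in>I. Dinf i) \<times> {0<..}" "\<Phi> (p, s) \<notin> flow_image"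
proof -
  have n: "snd p \<noteq> 0" by (rule snd_nonzero[OF i p(1)])
  have "p \<in> Dinf i" using p by (simp add: unlinked_part_def)
  then show m: "(p, s / norm (snd p)) \<in> (\<Union>i\<in>I. Dinf i) \<times> {0<..}" using i n p(3) by auto
  obtain \<psi> where "homeomorphism ((\<Union>i\<in>I. Dinf i) \<times> {0<..}) (- (flow_image \<union> (\<Union>i\<in>I. M i))) radial_flow \<psi>"
    using radial_homeo by (elim exE)
  from homeomorphism_image1[OF this] m have "radial_flow (p, s / norm (snd p)) \<in> - (flow_image \<union> (\<Union>i\<in>I. M i))" by blast
  then show "\<Phi> (p, s) \<notin> flow_image" unfolding radial_\<Phi>[OF n] by blast
qed

text \<open>Two linked points have the same label because sweeps of different labels are disjoint,
  and then \<open>sweep_inj_label\<close> applies. A linked and an unlinked point never collide,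
  since unlinked rays avoid \<open>flow_image\<close>. For two unlinked points the radial
  homeomorphism gives \<open>p = p'\<close>, and \<open>radial_sweep_disjoint\<close> gives
  \<open>i = i'\<close>.\<close>

lemma sweep_injective:
  assumes i: "i \<in> I" "i' \<in> I" and E: "(p, s) \<in> E i" "(p', s') \<in> E i'" and eq: "\<Phi> (p, s) = \<Phi> (p', s')"
  shows "i = i' \<and> p = p' \<and> s = s'"
proof -
  have p: "p \<in> D i" "s > 0" and p': "p' \<in> D i'" "s' > 0" using E by (auto simp: E_def)
  have n: "snd p \<noteq> 0" "snd p' \<noteq> 0" using snd_nonzero[OF i(1) p(1)] snd_nonzero[OF i(2) p'(1)] by auto
  have "i = i' \<and> p = p'"
  proof (cases rule: D_cases[OF i(1) p(1), case_names linked unlinked])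
    case (linked j)
    note a = linked_in_sweep[OF i(1) p(1) linked(4) E(1) linked(2,3)]
    show ?thesis
    proof (cases rule: D_cases[OF i(2) p'(1), case_names linked' unlinked'])
      case (linked' j')
      note b = linked_in_sweep[OF i(2) p'(1) linked'(4) E(2) linked'(2,3)]
      have ij: "(i, j) = (i', j')"
      proof (rule ccontr)
        assume "(i, j) \<noteq> (i', j')"
        from sweep_disjoint[OF linked(3) linked'(3) this] show False using a(1) b(1) eq by auto
      qed
      then have ii: "i' = i" "j' = j" by auto
      have "p = p'"
        by (rule sweep_inj_label[OF i(1) p(1) linked(4) E(1) linked(2) p'(1)[unfolded ii] linked'(4)[unfolded ii]
            E(2)[unfolded ii] linked'(2)[unfolded ii] linked(3) eq])
      then show ?thesis using ii by simp
    next
      case (unlinked' j')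
      then show ?thesis using unlinked_image(2)[OF i(2) p'(1) unlinked'(4) p'(2)] a(2) eq by simp
    qed
  next
    case (unlinked j)
    note a = unlinked_image[OF i(1) p(1) unlinked(4) p(2)]
    show ?thesis
    proof (cases rule: D_cases[OF i(2) p'(1), case_names linked' unlinked'])
      case (linked' j')
      then show ?thesis using linked_in_sweep(2)[OF i(2) p'(1) linked'(4) E(2) linked'(2,3)] a(2) eq by simp
    next
      case (unlinked' j')
      note b = unlinked_image[OF i(2) p'(1) unlinked'(4) p'(2)]
      obtain \<psi> where "homeomorphism ((\<Union>i\<in>I. Dinf i) \<times> {0<..}) (- (flow_image \<union> (\<Union>i\<in>I. M i))) radial_flow \<psi>"
        using radial_homeo by (elim exE)
      note h = homeomorphism_apply1[OF this]
      have "radial_flow (p, s / norm (snd p)) = radial_flow (p', s' / norm (snd p'))"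
        unfolding radial_\<Phi>[OF n(1)] radial_\<Phi>[OF n(2)] by (rule eq)
      then have "(p, s / norm (snd p)) = (p', s' / norm (snd p'))" using h[OF a(1)] h[OF b(1)] by metis
      then have pp: "p = p'" by simp
      have "i = i'"
      proof (rule ccontr)
        assume "i \<noteq> i'"
        from radial_sweep_disjoint[OF configuration i this skeletal[OF i(1)] skeletal[OF i(2)]]
        show False using p(1) p'(1) pp by blast
      qed
      then show ?thesis using pp by simp
    qed
  qed
  then show ?thesis using \<Phi>_inj[of p s s'] eq n(1) by auto
qed

text \<open>The strata that carry the integral: over the regular part and of full dimension. With
  \<open>\<ge>\<close> in place of equality, the negation directly yields a dimension below
  \<open>CARD('n) - 1\<close>.\<close>

definition good where "good i j \<longleftrightarrow> j \<in> J i \<and> (\<exists>X\<in>\<T> i. submanifold (CARD('n) - 1) X \<and> S i j \<subseteq> double X (U i)) \<and>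
   (\<exists>k\<ge>CARD('n) - 1. submanifold k (S i j))"

definition Good where "Good i = (\<Union>j\<in>{j. good i j}. S i j)"

lemma good_regular:
  assumes "good i j" "p \<in> S i j"
  shows "fst p \<in> regular_part (\<T> i) \<and> snd p \<in> U i (fst p)"
proof -
  obtain X where X: "X \<in> \<T> i" "submanifold (CARD('n) - 1) X" "S i j \<subseteq> double X (U i)"
    using assms(1) unfolding good_def by blast
  then have "fst p \<in> X" "snd p \<in> U i (fst p)" using assms(2) by (auto simp: double_def)
  then show ?thesis using X(1,2) by (auto simp: regular_part_def)
qed

lemma S_submanifold: "i \<in> I \<Longrightarrow> j \<in> J i \<Longrightarrow> \<exists>k. submanifold k (S i j)"
  using stratificationD(3)[OF S_strat(2)] by blast

text \<open>Either the skeletal stratum below has dimension less than \<open>CARD('n) - 1\<close>,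
  and then so does its double, or the stratum of the refinement is itself too small.\<close>

lemma bad_thin:
  assumes i: "i \<in> I" "j \<in> J i" "\<not> good i j"
  shows "\<exists>k<CARD('n) - 1. thin k (S i j)"
proof -
  obtain X where X: "X \<in> \<T> i" "S i j \<subseteq> double X (U i)" using S_strat(3)[OF i(1,2)] by blast
  obtain k where k: "k \<le> CARD('n) - 1" "submanifold k X" using skel_facts(4)[OF i(1) X(1)] by blast
  show ?thesis
  proof (cases "k < CARD('n) - 1")
    case True
    have "thin k (double X (U i))"
      by (rule thin_double[OF skel_facts(2)[OF i(1)] X(1) k(2)]) (use k(1) in simp)
    then show ?thesis using thin_subset[OF _ X(2)] True by blast
  next
    case False
    then have "k = CARD('n) - 1" using k(1) by simp
    then have "submanifold (CARD('n) - 1) X" using k(2) by simp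
    then have "\<not> (\<exists>k\<ge>CARD('n) - 1. submanifold k (S i j))" using i X unfolding good_def by blast
    moreover obtain k' where k': "submanifold k' (S i j)" using S_submanifold[OF i(1,2)] by blast
    ultimately have "k' < CARD('n) - 1" by (meson not_le)
    then show ?thesis using thin_submanifold[OF k'] by blast
  qed
qed

lemma thin_S: "i \<in> I \<Longrightarrow> j \<in> J i \<Longrightarrow> thin (CARD('n) - 1) (S i j)"
proof -
  assume i: "i \<in> I" "j \<in> J i"
  obtain X where X: "X \<in> \<T> i" "S i j \<subseteq> double X (U i)" using S_strat(3)[OF i] by blast
  obtain k where k: "k \<le> CARD('n) - 1" "submanifold k X" using skel_facts(4)[OF i(1) X(1)] by blast
  have "thin k (double X (U i))"
    by (rule thin_double[OF skel_facts(2)[OF i(1)] X(1) k(2)]) (use k(1) in simp)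
  then show ?thesis using thin_mono[OF thin_subset[OF _ X(2)] k(1)] by blast
qed

section \<open>Null sets missed by the segments\<close>

lemma card_minus: "CARD('n) - 1 < DIM(real^'n)"
  using zero_less_card_finite[where 'a='n] by simp

lemma negligible_M: "i \<in> I \<Longrightarrow> negligible (M i)"
proof -
  assume i: "i \<in> I"
  have "thin (CARD('n) - 1) (M i)" by (rule thin_Union_strata[OF skel_facts(3)[OF i] skel_facts(4)[OF i]])
  then show ?thesis by (rule thin_negligible[OF _ card_minus])
qed

lemma negligible_linking_stratum: "(i, j) \<in> labels \<Longrightarrow> negligible (linking_stratum (l i) (S i j))"
proof -
  assume ij: "(i, j) \<in> labels"
  then have i: "i \<in> I" "j \<in> J i" by auto
  have "linking_vector (l i) differentiable_on S i j"
    by (rule smooth_on_imp_differentiable_on[OF vec_smooth[OF ij]])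
  then have "(\<lambda>p. fst p + linking_vector (l i) p) differentiable_on S i j"
    unfolding differentiable_on_def
    by (intro ballI differentiable_add bounded_linear_imp_differentiable[OF bounded_linear_fst]) blast
  then have "thin (CARD('n) - 1) ((\<lambda>p. fst p + linking_vector (l i) p) ` S i j)"
    by (intro thin_image[OF thin_S[OF i]]) auto
  then show ?thesis unfolding linking_stratum_def by (rule thin_negligible[OF _ card_minus])
qed

text \<open>Sweeping along lines raises the dimension by one, from \<open>k < CARD('n) - 1\<close>
  to \<open>Suc k < CARD('n)\<close>, so the sweep is still of dimension below that of the
  space.\<close>

lemma negligible_bad:
  assumes i: "i \<in> I" "j \<in> J i" "\<not> good i j"
  shows "negligible (\<Phi> ` (S i j \<times> UNIV))"
proof -
  obtain k where k: "k < CARD('n) - 1" "thin k (S i j)" using bad_thin[OF i] by blast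
  have "snd p \<noteq> 0" if "p \<in> S i j" for p using snd_nonzero[OF i(1)] S_sub_D[OF i(1,2)] that by blast
  then have "(\<lambda>(p, s). fst p + s *\<^sub>R sgn (snd p)) differentiable_on (S i j \<times> (UNIV :: real set))"
    by (rule smooth_on_sweep_point)
  then have "\<Phi> differentiable_on (S i j \<times> UNIV)"
  proof -
    have "(\<lambda>(p, s). fst p + s *\<^sub>R sgn (snd p)) = \<Phi>" by (auto simp: fun_eq_iff \<Phi>_def)
    then show "(\<lambda>(p, s). fst p + s *\<^sub>R sgn (snd p)) differentiable_on (S i j \<times> UNIV) \<Longrightarrow> \<Phi> differentiable_on (S i j \<times> UNIV)"
      by simp
  qed
  then have "thin (Suc k) (\<Phi> ` (S i j \<times> UNIV))"
    by (rule thin_image[OF thin_Times_real[OF k(2)]]) (use k(1) in simp)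
  then show ?thesis by (rule thin_negligible) (use k(1) in simp)
qed

lemma negligible_UN_finite: "finite A \<Longrightarrow> (\<And>a. a \<in> A \<Longrightarrow> negligible (f a)) \<Longrightarrow> negligible (\<Union>a\<in>A. f a)"
  by (intro negligible_Union) auto

text \<open>A point off the exceptional set \<open>Z\<close> lies in the image of the linking flow
  or in its complement. In the first case its arc length is neither \<open>0\<close>, as it is not
  on a skeletal set, nor the value of \<open>l\<close>, as it is not on a linking stratum; in the
  second case the radial flow reaches it from the unlinked part. Either way it lies on an open
  segment, and the stratum is good because sweeps of the others belong to \<open>Z\<close>.\<close>

lemma complement_negligible:
  "negligible (- (\<Union>i\<in>I. \<Phi> ` {q \<in> E i. fst q \<in> Good i}))"
proof -
  define Z where "Z = (\<Union>i\<in>I. M i) \<union> (\<Union>i\<in>I. \<Union>j\<in>{j\<in>J i. S i j \<inter> Dinf i = {}}. linking_stratum (l i) (S i j)) \<union>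
     (\<Union>i\<in>I. \<Union>j\<in>{j\<in>J i. \<not> good i j}. \<Phi> ` (S i j \<times> UNIV))"
  have "negligible Z"
    unfolding Z_def
  proof (intro negligible_Un negligible_UN_finite)
    show "finite I" by (rule finite_I)
    show "negligible (M i)" if "i \<in> I" for i by (rule negligible_M[OF that])
    show "finite {j\<in>J i. S i j \<inter> Dinf i = {}}" "finite {j\<in>J i. \<not> good i j}" if "i \<in> I" for i
      using S_strat(1)[OF that] by auto
    show "negligible (linking_stratum (l i) (S i j))" if "i \<in> I" "j \<in> {j\<in>J i. S i j \<inter> Dinf i = {}}" for i j
      using that by (intro negligible_linking_stratum) auto
    show "negligible (\<Phi> ` (S i j \<times> UNIV))" if "i \<in> I" "j \<in> {j\<in>J i. \<not> good i j}" for i j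
      using that by (intro negligible_bad) auto
  qed (rule finite_I)+
  moreover have "- (\<Union>i\<in>I. \<Phi> ` {q \<in> E i. fst q \<in> Good i}) \<subseteq> Z"
  proof (rule ccontr)
    assume "\<not> ?thesis"
    then obtain y where y: "y \<notin> (\<Union>i\<in>I. \<Phi> ` {q \<in> E i. fst q \<in> Good i})" "y \<notin> Z" by blast
    have key: False if i: "i \<in> I" and q: "(p, s) \<in> E i" "y = \<Phi> (p, s)" for i p s
    proof -
      have "p \<in> D i" using q(1) by (simp add: E_def)
      then have "p \<in> \<Union>(S i ` J i)" by (simp only: stratificationD(1)[OF S_strat(2)[OF i]])
      then obtain j where j: "j \<in> J i" "p \<in> S i j" by blast
      show False
      proof (cases "good i j")
        case True
        then have "p \<in> Good i" using j by (auto simp: Good_def)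
        then show False using y(1) q i by auto
      next
        case False
        have "(p, s) \<in> S i j \<times> UNIV" using j(2) by simp
        then have yn: "y \<in> \<Phi> ` (S i j \<times> UNIV)" unfolding q(2) by (rule imageI)
        have jn: "j \<in> {j\<in>J i. \<not> good i j}" using j(1) False by simp
        have "y \<in> Z" unfolding Z_def by (rule UnI2, rule UN_I[OF i], rule UN_I[OF jn], rule yn)
        then show False using y(2) by simp
      qed
    qed
    have yM: "y \<notin> M i" if "i \<in> I" for i using y(2) that by (auto simp: Z_def)
    show False
    proof (cases "y \<in> flow_image")
      case True
      then obtain i j p t where ij: "(i, j) \<in> labels" and pt: "p \<in> S i j" "0 \<le> t" "t \<le> 1" "y = linking_flow (l i) (p, t)"
        by auto
      have i: "i \<in> I" "j \<in> J i" using ij by auto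
      have p: "p \<in> D i" using S_sub_D[OF i] pt(1) by blast
      have "p \<notin> Dinf i" using ij pt(1) by auto
      then have "l i p \<noteq> \<infinity>" using p by (auto simp: unlinked_part_def)
      define r where "r = norm (snd p)"
      have r: "r > 0" using snd_nonzero[OF i(1) p] by (simp add: r_def)
      obtain L where L: "l i p = ereal L" using \<open>l i p \<noteq> \<infinity>\<close> l_ge[OF i(1) p] by (cases "l i p") auto
      have rL: "r \<le> L" using l_ge[OF i(1) p] by (simp add: L r_def)
      define s where "s = (if t \<le> 1/2 then 2 * t * r else 2 * (1 - t) * r + (2 * t - 1) * L)"
      have ys: "y = \<Phi> (p, s)" unfolding pt(4) by (simp add: linking_flow_def \<Phi>_def Let_def s_def r_def L)
      have s: "0 \<le> s" "s \<le> L"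
      proof -
        show "0 \<le> s" using pt(2,3) r rL by (auto simp: s_def intro!: add_nonneg_nonneg mult_nonneg_nonneg)
        show "s \<le> L"
        proof (cases "t \<le> 1/2")
          case True
          then have "2 * t * r \<le> 1 * r" using r by (intro mult_right_mono) auto
          then show ?thesis using True rL by (simp add: s_def)
        next
          case False
          have "(1 - t) * r \<le> (1 - t) * L" using pt(3) rL by (intro mult_left_mono) auto
          then show ?thesis using False by (simp add: s_def algebra_simps)
        qed
      qed
      have "s \<noteq> 0"
      proof
        assume "s = 0"
        then have "y = fst p" using ys by (simp add: \<Phi>_def)
        then have "y \<in> M i" using p by (auto simp: double_def)
        then show False using yM[OF i(1)] by blast
      qed
      moreover have "s \<noteq> L"
      proof
        assume "s = L"
        then have "y = fst p + linking_vector (l i) p" using ys by (simp add: \<Phi>_def linking_vector_def L)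
        then have "y \<in> linking_stratum (l i) (S i j)" using pt(1) by (auto simp: linking_stratum_def)
        then show False using y(2) ij by (auto simp: Z_def)
      qed
      ultimately have "(p, s) \<in> E i" using s p by (simp add: E_def L)
      then show False using key[OF i(1) _ ys] by blast
    next
      case False
      then have yc: "y \<in> - (flow_image \<union> (\<Union>i\<in>I. M i))" using yM by blast
      obtain \<psi> where h: "homeomorphism ((\<Union>i\<in>I. Dinf i) \<times> {0<..}) (- (flow_image \<union> (\<Union>i\<in>I. M i))) radial_flow \<psi>"
        using radial_homeo by (elim exE)
      have "y \<in> radial_flow ` ((\<Union>i\<in>I. Dinf i) \<times> {0<..})" unfolding homeomorphism_image1[OF h] by (rule yc)
      then obtain p c where pc: "p \<in> (\<Union>i\<in>I. Dinf i)" "c > 0" "y = radial_flow (p, c)" by auto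
      then obtain i where i: "i \<in> I" "p \<in> Dinf i" by blast
      then have p: "p \<in> D i" "l i p = \<infinity>" by (auto simp: unlinked_part_def)
      have n: "snd p \<noteq> 0" by (rule snd_nonzero[OF i(1) p(1)])
      have "y = \<Phi> (p, c * norm (snd p))" using radial_\<Phi>[OF n, of "c * norm (snd p)"] n pc(3) by simp
      moreover have "(p, c * norm (snd p)) \<in> E i" using p pc(2) n by (simp add: E_def)
      ultimately show False using key[OF i(1)] by blast
    qed
  qed
  ultimately show ?thesis by (rule negligible_subset)
qed

text \<open>The point at arc length \<open>s\<close> is reached by the radial flow on an unlinked
  stratum, or by the first or the second half of the linking flow. On the fixed ray each moves
  affinely in time with nonzero slope, as \<open>flow_nonsingular\<close> requires. Only
  nonvanishing is obtained here; the sign comes from \<open>shape_positive\<close>.\<close>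

lemma det0_positive:
  assumes i: "i \<in> I" and bc: "branch_chart (\<T> i) (U i) V W \<psi> k H H'"
    and x: "x \<in> regular_part (\<T> i)" "x \<in> W" and G: "(x, H x) \<in> Good i" and E: "((x, H x), s) \<in> E i"
  shows "branch_chart.det0 V \<psi> k H (the_inv_into V \<psi> x + s *\<^sub>R axis k 1) \<noteq> 0"
proof -
  interpret b: branch_chart "\<T> i" "U i" V W \<psi> k H H' by (rule bc)
  let ?p = "(x, H x)"
  obtain j where j: "good i j" "?p \<in> S i j" using G by (auto simp: Good_def)
  then have jJ: "j \<in> J i" by (simp add: good_def)
  obtain k' where k': "CARD('n) - 1 \<le> k'" "submanifold k' (S i j)" using j(1) by (auto simp: good_def)
  have A: "\<And>q. q \<in> S i j \<Longrightarrow> fst q \<in> b.R \<and> snd q \<in> U i (fst q)" using good_regular[OF j(1)] .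
  have p: "?p \<in> D i" and s0: "s > 0" and sl: "ereal s < l i ?p" using E by (auto simp: E_def)
  have r: "norm (H x) > 0" using b.nz[OF x(2)] by simp
  note y = b.chart_point[OF x]
  have d0: "b.det0 (the_inv_into V \<psi> x + s *\<^sub>R axis k 1) = det (matrix (b.\<Theta>' (the_inv_into V \<psi> x + s *\<^sub>R axis k 1)))"
    unfolding b.det0_def b.drop_shift[OF y(2)] using y(1) by simp
  show ?thesis
    unfolding d0
  proof (cases "S i j \<subseteq> Dinf i")
    case True
    have ns: "nonsingular_on (S i j \<times> {0<..}) (radial_flow :: ((real^'n) \<times> (real^'n)) \<times> real \<Rightarrow> real^'n)"
      by (rule diffeomorphism_nonsingular_on[OF radial_diffeo[OF i jJ True]])
    have "det (matrix (b.\<Theta>' (the_inv_into V \<psi> x + (s / norm (H x) * norm (snd ?p)) *\<^sub>R axis k 1))) \<noteq> 0"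
    \<comment> \<open>The radial flow on an unlinked stratum: its times form an open half-line, in
      which any forward motion stays, so \<open>\<delta> = 1\<close> will do.\<close>
    proof (rule b.flow_nonsingular[OF x A k'(2,1) j(2) ns, where \<sigma> = "\<lambda>q \<tau>. \<tau> * norm (snd q)" and \<delta> = 1 and \<alpha> = 0 and \<beta> = "norm (H x)"])
      show "s / norm (H x) \<in> {0<..}" using s0 r by simp
      show "s / norm (H x) + s' * 1 \<in> {0<..}" if "s' \<in> {0..<1}" for s' using s0 r that by (simp add: add_pos_nonneg)
      show "radial_flow (q, \<tau>) = fst q + (\<tau> * norm (snd q)) *\<^sub>R sgn (snd q)" if "q \<in> S i j" for q \<tau>
        by (cases "snd q = 0") (simp_all add: radial_flow_def sgn_div_norm)
    qed (use r in auto)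
    then show "det (matrix (b.\<Theta>' (the_inv_into V \<psi> x + s *\<^sub>R axis k 1))) \<noteq> 0" using r by simp
  next
    case False
    then have dis: "S i j \<inter> Dinf i = {}" using S_unlinked[OF i jJ] by blast
    then have lab: "(i, j) \<in> labels" using i jJ by simp
    have "?p \<notin> Dinf i" using dis j(2) by blast
    then have fin: "l i ?p \<noteq> \<infinity>" using p by (auto simp: unlinked_part_def)
    obtain t where t: "0 < t" "t < 1"
      "t \<le> 1/2 \<Longrightarrow> s = 2 * t * norm (snd ?p)"
      "t > 1/2 \<Longrightarrow> s = 2 * (1 - t) * norm (snd ?p) + (2 * t - 1) * real_of_ereal (l i ?p) \<and> ereal (norm (snd ?p)) < l i ?p"
      by (rule linking_time[OF i p fin E]) (rule that)
    note nl = nonsing[OF lab, unfolded nonsingular_linking_def]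
    show "det (matrix (b.\<Theta>' (the_inv_into V \<psi> x + s *\<^sub>R axis k 1))) \<noteq> 0"
    proof (cases "t \<le> 1/2")
      case True
      have "det (matrix (b.\<Theta>' (the_inv_into V \<psi> x + (2 * t * norm (snd ?p)) *\<^sub>R axis k 1))) \<noteq> 0"
      \<comment> \<open>The motion goes backwards, towards time \<open>0\<close>, so that
        \<open>t = 1/2\<close>, the right end of the interval, is covered too.\<close>
      proof (rule b.flow_nonsingular[OF x A k'(2,1) j(2) conjunct1[OF nl], where \<sigma> = "\<lambda>q \<tau>. 2 * \<tau> * norm (snd q)" and \<delta> = "- t" and \<alpha> = 0 and \<beta> = "2 * norm (H x)"])
        show "t \<in> {0..1/2}" using t True by simp
        show "t + s' * - t \<in> {0..1/2}" if "s' \<in> {0..<1}" for s'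
        proof -
          have "s' * t \<le> 1 * t" "0 \<le> s' * t" using that t by (auto intro: mult_right_mono)
          then show ?thesis using True by simp
        qed
        show "linking_flow (l i) (q, \<tau>) = fst q + (2 * \<tau> * norm (snd q)) *\<^sub>R sgn (snd q)" if "\<tau> \<in> {0..1/2}" for q \<tau>
          using that by (simp add: linking_flow_def Let_def)
      qed (use r t in auto)
      then show ?thesis using t(3)[OF True] by simp
    next
      case False
      then have rl: "ereal (norm (snd ?p)) < l i ?p" and st: "s = 2 * (1 - t) * norm (snd ?p) + (2 * t - 1) * real_of_ereal (l i ?p)"
        using t(4) by auto
      have ns: "nonsingular_on (S i j \<times> {1/2..1}) (linking_flow (l i))"
        using conjunct2[OF nl] rl j(2) by (metis less_irrefl)
      obtain L where L: "l i ?p = ereal L" using fin rl by (cases "l i ?p") auto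
      have Lr: "norm (H x) < L" using rl by (simp add: L)
      have "det (matrix (b.\<Theta>' (the_inv_into V \<psi> x + (2 * (1 - t) * norm (snd ?p) + (2 * t - 1) * real_of_ereal (l i ?p)) *\<^sub>R axis k 1))) \<noteq> 0"
      \<comment> \<open>Expanding the arc length as an affine function of \<open>\<tau>\<close>
        gives the constant \<open>2 * r - L\<close> and the slope \<open>2 * (L - r)\<close>, which
        is nonzero because \<open>r < L\<close>. The motion goes forward by \<open>1 - t\<close>,
        towards the end of the interval.\<close>
      proof (rule b.flow_nonsingular[OF x A k'(2,1) j(2) ns, where \<sigma> = "\<lambda>q \<tau>. 2 * (1 - \<tau>) * norm (snd q) + (2 * \<tau> - 1) * real_of_ereal (l i q)"
          and \<delta> = "1 - t" and \<alpha> = "2 * norm (H x) - L" and \<beta> = "2 * (L - norm (H x))"])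
        show "t \<in> {1/2..1}" using t False by simp
        show "t + s' * (1 - t) \<in> {1/2..1}" if "s' \<in> {0..<1}" for s'
        proof -
          have "s' * (1 - t) \<le> 1 * (1 - t)" "0 \<le> s' * (1 - t)" using that t by (auto intro: mult_right_mono)
          then show ?thesis using False by simp
        qed
        show "linking_flow (l i) (q, \<tau>) = fst q + (2 * (1 - \<tau>) * norm (snd q) + (2 * \<tau> - 1) * real_of_ereal (l i q)) *\<^sub>R sgn (snd q)"
          if "\<tau> \<in> {1/2..1}" for q \<tau>
        proof (cases "\<tau> = 1/2")
          case True
          show ?thesis unfolding True by (simp add: linking_flow_def Let_def)
        next
          case False
          then have "\<not> \<tau> \<le> 1/2" using that by simp
          then show ?thesis by (simp add: linking_flow_def Let_def)
        qed
      qed (use Lr t in \<open>auto simp: L algebra_simps\<close>)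
      then show ?thesis using st by simp
    qed
  qed
qed

end

section \<open>Change of variables along radial segments\<close>

lemma measurable_ray:
  "(\<lambda>q :: ((real^'n) \<times> (real^'n)) \<times> real. fst (fst q) + snd q *\<^sub>R sgn (snd (fst q))) \<in> borel \<rightarrow>\<^sub>M borel"
proof -
  have f1: "(\<lambda>q :: ((real^'n) \<times> (real^'n)) \<times> real. fst (fst q)) \<in> borel \<rightarrow>\<^sub>M borel"
    and f2: "(\<lambda>q :: ((real^'n) \<times> (real^'n)) \<times> real. snd (fst q)) \<in> borel \<rightarrow>\<^sub>M borel"
    and f3: "(\<lambda>q :: ((real^'n) \<times> (real^'n)) \<times> real. snd q) \<in> borel \<rightarrow>\<^sub>M borel"
    by (intro borel_measurable_continuous_onI continuous_intros)+
  have s: "(\<lambda>x :: real^'n. sgn x) \<in> borel \<rightarrow>\<^sub>M borel"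
    unfolding sgn_div_norm by (intro borel_measurable_scaleR borel_measurable_inverse borel_measurable_norm measurable_ident_sets refl)
  show ?thesis
    by (rule borel_measurable_add[OF f1 borel_measurable_scaleR[OF f3 measurable_compose[OF f2 s]]])
qed

context skeletal_atlas
begin

abbreviation \<Theta> where "\<Theta> m b \<equiv> branch_chart.\<Theta> (\<psi> m) (k m) (H m b)"

definition shape :: "(real^'n) \<times> (real^'n) \<Rightarrow> real \<Rightarrow> real" where
  "shape p t = (if fst p \<in> R \<and> snd p \<in> U (fst p)
     then det_on (tangent_space R (fst p)) (\<lambda>w. w - t *\<^sub>R radial_shape_operator \<T> U p w) else 0)"

lemma R_U_borel: "{p. fst p \<in> R \<and> snd p \<in> U (fst p)} \<in> sets borel"
  unfolding UN_graph[symmetric] using graph_borel by blast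

lemma shape_graph:
  assumes "p \<in> graph m b"
  shows "shape p t = det0 m b (branch_chart.\<phi>0 (V m) (W m) (\<psi> m) (fst p) + t *\<^sub>R axis (k m) 1) /
     det0 m b (branch_chart.\<phi>0 (V m) (W m) (\<psi> m) (fst p))"
proof -
  have p: "fst p \<in> B m" "snd p = H m b (fst p)" using assms by (auto simp: graph_def)
  then have x: "fst p \<in> R" "fst p \<in> W m" using B(2) by auto
  have "p \<in> (\<Union>m. \<Union>b. graph m b)" using assms by blast
  then have "fst p \<in> R \<and> snd p \<in> U (fst p)" unfolding UN_graph by simp
  moreover have "p = (fst p, H m b (fst p))" using p(2) by (simp add: prod_eq_iff)
  ultimately show ?thesis
    using branch_chart.shape_det(2)[OF bc[of m b] x, of t] x
    by (simp add: shape_def branch_chart.\<phi>0_def[OF bc])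
qed

text \<open>On each graph the determinant is a quotient of values of the Borel function
  \<open>det0\<close>; the countably many graphs and the complement of their union cover
  everything.\<close>

lemma shape_measurable: "(\<lambda>q. shape (fst q) (snd q)) \<in> borel_measurable borel"
proof (rule measurable_pieces[of "insert ({q. \<not> (fst (fst q) \<in> R \<and> snd (fst q) \<in> U (fst (fst q)))}) (range (\<lambda>(m, b). graph m b \<times> (UNIV :: real set)))"])
  let ?N = "{q :: ((real^'n) \<times> (real^'n)) \<times> real. \<not> (fst (fst q) \<in> R \<and> snd (fst q) \<in> U (fst (fst q)))}"
  show "countable (insert ?N (range (\<lambda>(m, b). graph m b \<times> (UNIV :: real set))))" by simp
  have N: "?N = - ({p. fst p \<in> R \<and> snd p \<in> U (fst p)} \<times> UNIV)" by auto
  have prod: "A \<times> (UNIV :: real set) \<in> sets borel" if "A \<in> sets borel" for A :: "((real^'n) \<times> (real^'n)) set"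
    using that by (simp add: borel_prod[symmetric])
  have NB: "?N \<in> sets borel" unfolding N using prod[OF R_U_borel] by (rule borel_comp)
  fix X assume X: "X \<in> insert ?N (range (\<lambda>(m, b). graph m b \<times> (UNIV :: real set)))"
  then show "X \<in> sets borel" using NB prod[OF graph_borel] by auto
  show "\<exists>g\<in>borel_measurable borel. \<forall>q\<in>X. shape (fst q) (snd q) = g q"
  proof (cases "X = ?N")
    case True
    then show ?thesis by (intro bexI[of _ "\<lambda>_. 0"]) (auto simp: shape_def)
  next
    case False
    then obtain m b where mb: "X = graph m b \<times> UNIV" using X by auto
    let ?f = "branch_chart.\<phi>0 (V m) (W m) (\<psi> m)"
    have f: "?f \<in> borel \<rightarrow>\<^sub>M borel" by (rule branch_chart.measurable_\<phi>0[OF bc])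
    have d: "det0 m b \<in> borel_measurable borel" by (rule branch_chart.measurable_det0[OF bc])
    have f1: "(\<lambda>q :: ((real^'n) \<times> (real^'n)) \<times> real. fst (fst q)) \<in> borel \<rightarrow>\<^sub>M borel"
      by (intro borel_measurable_continuous_onI continuous_intros)
    have f2: "(\<lambda>q :: ((real^'n) \<times> (real^'n)) \<times> real. snd q *\<^sub>R axis (k m) (1::real)) \<in> borel \<rightarrow>\<^sub>M borel"
      by (intro borel_measurable_continuous_onI continuous_intros)
    note ff = measurable_compose[OF f1 f]
    have "(\<lambda>q :: ((real^'n) \<times> (real^'n)) \<times> real. det0 m b (?f (fst (fst q)) + snd q *\<^sub>R axis (k m) 1) / det0 m b (?f (fst (fst q)))) \<in> borel_measurable borel"
      by (rule borel_measurable_divide[OF measurable_compose[OF borel_measurable_add[OF ff f2] d] measurable_compose[OF ff d]])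
    then show ?thesis
      unfolding mb using shape_graph by (intro bexI) auto
  qed
next
  let ?N = "{q :: ((real^'n) \<times> (real^'n)) \<times> real. \<not> (fst (fst q) \<in> R \<and> snd (fst q) \<in> U (fst (fst q)))}"
  show "space borel \<subseteq> \<Union>(insert ?N (range (\<lambda>(m, b). graph m b \<times> (UNIV :: real set))))"
  proof
    fix q :: "((real^'n) \<times> (real^'n)) \<times> real"
    show "q \<in> \<Union>(insert ?N (range (\<lambda>(m, b). graph m b \<times> (UNIV :: real set))))"
    proof (cases "q \<in> ?N")
      case False
      then have "fst q \<in> (\<Union>m. \<Union>b. graph m b)" unfolding UN_graph by simp
      then obtain m b where "q \<in> graph m b \<times> UNIV" by (cases q) auto
      then show ?thesis by auto
    qed simp
  qed
qed

text \<open>Clearing the denominator in \<open>shape_graph\<close>: the shape determinant turns the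
  Jacobian at time zero into the Jacobian at time \<open>z $ k m\<close>.\<close>

lemma shape_slab:
  assumes z: "z \<in> slab m"
  shows "shape (point m b z) (z $ k m) * det0 m b (drop_coord (k m) z) = det0 m b z"
    "point m b z \<in> graph m b"
proof -
  have d: "drop_coord (k m) z \<in> V m" "\<psi> m (drop_coord (k m) z) \<in> B m" using z by (auto simp: slab_def)
  show g: "point m b z \<in> graph m b" using d(2) by (simp add: graph_def point_def)
  have x: "\<psi> m (drop_coord (k m) z) \<in> R" "\<psi> m (drop_coord (k m) z) \<in> W m" using d(2) B(2) by auto
  have f: "branch_chart.\<phi>0 (V m) (W m) (\<psi> m) (fst (point m b z)) = drop_coord (k m) z"
    using x by (simp add: point_def branch_chart.\<phi>0_def[OF bc] branch_chart.dfacts(4)[OF bc d(1)])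
  have "det0 m b (drop_coord (k m) z) \<noteq> 0"
    using branch_chart.shape_det(1)[OF bc[of m b] x] unfolding branch_chart.dfacts(4)[OF bc d(1)] .
  then show "shape (point m b z) (z $ k m) * det0 m b (drop_coord (k m) z) = det0 m b z"
    unfolding shape_graph[OF g] f by simp
qed

lemma \<Theta>_point: "\<Theta> m b z = fst (point m b z) + (z $ k m) *\<^sub>R sgn (snd (point m b z))"
  by (simp add: point_def branch_chart.\<Theta>_def[OF bc] branch_chart.u_def[OF bc])

lemma point_slab_inj:
  assumes z: "z \<in> slab m" "z' \<in> slab m" and eq: "point m b z = point m b z'" "z $ k m = z' $ k m"
  shows "z = z'"
proof -
  have d: "drop_coord (k m) z \<in> V m" "drop_coord (k m) z' \<in> V m" using z by (auto simp: slab_def)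
  have "\<psi> m (drop_coord (k m) z) = \<psi> m (drop_coord (k m) z')" using eq(1) by (simp add: point_def)
  then have "drop_coord (k m) z = drop_coord (k m) z'"
    by (rule inj_onD[OF branch_chart.dfacts(1)[OF bc] _ d])
  then show ?thesis using eq(2) by simp
qed

text \<open>Passing from \<open>z\<close> to its point and time is undone by sending
  \<open>((x, v), s)\<close> to the chart coordinates of \<open>x\<close> plus \<open>s\<close> in
  the direction \<open>k m\<close>. The set is thus contained in a differentiable image of a part of
  \<open>A\<close> times the line, of dimension at most \<open>Suc j\<close>.\<close>

lemma negligible_point_vimage:
  assumes t: "thin j A" "Suc j < CARD('n)"
  shows "negligible {z \<in> slab m. point m b z \<in> A}"
proof -
  let ?\<phi> = "the_inv_into (V m) (\<psi> m)"
  let ?A = "A \<inter> {p. fst p \<in> W m}"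
  let ?f = "\<lambda>q :: ((real^'n) \<times> (real^'n)) \<times> real. ?\<phi> (fst (fst q)) + snd q *\<^sub>R axis (k m) 1"
  have "?f differentiable_on (?A \<times> UNIV)"
    unfolding differentiable_on_def
  proof
    fix q :: "((real^'n) \<times> (real^'n)) \<times> real" assume q: "q \<in> ?A \<times> UNIV"
    then have w: "fst (fst q) \<in> W m" by auto
    have d1: "((\<lambda>q :: ((real^'n) \<times> (real^'n)) \<times> real. fst (fst q)) has_derivative (\<lambda>h. fst (fst h))) (at q)"
      by (auto intro!: derivative_eq_intros)
    note d2 = has_derivative_compose[where g = ?\<phi>, OF d1 branch_chart.dfacts(9)[OF bc w]]
    have d3: "((\<lambda>q :: ((real^'n) \<times> (real^'n)) \<times> real. snd q *\<^sub>R axis (k m) (1::real)) has_derivative (\<lambda>h. snd h *\<^sub>R axis (k m) 1)) (at q)"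
      by (auto intro!: derivative_eq_intros)
    show "?f differentiable at q within ?A \<times> UNIV"
      by (rule has_derivative_imp_differentiable[OF has_derivative_at_withinI[OF has_derivative_add[OF d2 d3]]])
  qed
  moreover have "thin (Suc j) (?A \<times> (UNIV :: real set))"
    by (rule thin_Times_real[OF thin_subset[OF t(1)]]) simp
  ultimately have "thin (Suc j) (?f ` (?A \<times> UNIV))" using t(2) by (intro thin_image) auto
  then have "negligible (?f ` (?A \<times> UNIV))" by (rule thin_negligible) (use t(2) in simp)
  then show ?thesis
  proof (rule negligible_subset)
    show "{z \<in> slab m. point m b z \<in> A} \<subseteq> ?f ` (?A \<times> UNIV)"
    proof
      fix z assume "z \<in> {z \<in> slab m. point m b z \<in> A}"
      then have z: "z \<in> slab m" "point m b z \<in> A" by auto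
      then have d: "drop_coord (k m) z \<in> V m" "\<psi> m (drop_coord (k m) z) \<in> W m" using B(2) by (auto simp: slab_def)
      have "?f (point m b z, z $ k m) = drop_coord (k m) z + (z $ k m) *\<^sub>R axis (k m) 1"
        using branch_chart.dfacts(4)[OF bc d(1)] by (simp add: point_def)
      then have e: "?f (point m b z, z $ k m) = z" by simp
      have "(point m b z, z $ k m) \<in> ?A \<times> UNIV" using z d(2) by (simp add: point_def)
      then show "z \<in> ?f ` (?A \<times> UNIV)" by (rule image_eqI[where f = ?f and x = "(point m b z, z $ k m)", rotated]) (rule e[symmetric])
    qed
  qed
qed

lemma AE_skel_regular: "AE p in skel. fst p \<in> R \<and> snd p \<in> U (fst p)"
proof -
  let ?A = "{p. fst p \<in> R \<and> snd p \<in> U (fst p)}"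
  have m: "(\<lambda>p. indicator (- ?A) p :: ennreal) \<in> borel_measurable borel"
    by (rule borel_measurable_indicator[OF borel_comp[OF R_U_borel]])
  have "(\<integral>\<^sup>+p. indicator (- ?A) p \<partial>skel) = (\<integral>\<^sup>+x. 0 \<partial>\<mu>)"
    unfolding nn_integral_skel[OF m]
    by (rule nn_integral_cong) (auto simp: indicator_def intro!: sum.neutral)
  then have "AE p in skel. indicator (- ?A) p = (0::ennreal)"
    using nn_integral_0_iff_AE[OF measurable_skel[OF m]] by simp
  then show ?thesis by (rule eventually_mono) (auto simp: indicator_def split: if_splits)
qed

definition swept where "swept A m b = {z \<in> slab m. (point m b z, z $ k m) \<in> A}"

lemma swept_borel: "A \<in> sets borel \<Longrightarrow> swept A m b \<in> sets borel"
proof -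
  assume A: "A \<in> sets borel"
  have f: "(\<lambda>z. (point0 m b z, z $ k m)) \<in> borel \<rightarrow>\<^sub>M borel"
    by (rule borel_measurable_Pair[OF point0_measurable]) (intro borel_measurable_continuous_onI continuous_intros)
  have "swept A m b = slab m \<inter> (\<lambda>z. (point0 m b z, z $ k m)) -` A" by (auto simp: swept_def point0)
  also have "\<dots> \<in> sets borel" using slab_borel measurable_sets_borel[OF f A] by (rule sets.Int)
  finally show ?thesis .
qed

lemma \<Theta>_swept: "\<Theta> m b ` swept A m b = (\<lambda>q. fst (fst q) + snd q *\<^sub>R sgn (snd (fst q))) ` {q \<in> A. fst q \<in> graph m b}"
proof (intro equalityI subsetI)
  fix y assume "y \<in> \<Theta> m b ` swept A m b"
  then obtain z where z: "z \<in> slab m" "(point m b z, z $ k m) \<in> A" "y = \<Theta> m b z" by (auto simp: swept_def)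
  show "y \<in> (\<lambda>q. fst (fst q) + snd q *\<^sub>R sgn (snd (fst q))) ` {q \<in> A. fst q \<in> graph m b}"
    by (rule image_eqI[where x = "(point m b z, z $ k m)"]) (use z shape_slab(2)[OF z(1)] in \<open>auto simp: \<Theta>_point\<close>)
next
  fix y assume "y \<in> (\<lambda>q. fst (fst q) + snd q *\<^sub>R sgn (snd (fst q))) ` {q \<in> A. fst q \<in> graph m b}"
  then obtain x v s where q: "((x, v), s) \<in> A" "(x, v) \<in> graph m b" "y = x + s *\<^sub>R sgn v" by auto
  then have x: "x \<in> B m" "v = H m b x" by (auto simp: graph_def)
  then have xR: "x \<in> R" "x \<in> W m" using B(2) by auto
  note c = branch_chart.chart_point[OF bc[of m b] xR]
  define z where "z = the_inv_into (V m) (\<psi> m) x + s *\<^sub>R axis (k m) 1"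
  have d: "drop_coord (k m) z = the_inv_into (V m) (\<psi> m) x"
    unfolding z_def by (rule branch_chart.drop_shift[OF bc[of m b] c(2)])
  have zk: "z $ k m = s" unfolding z_def using c(2) by simp
  have pt: "point m b z = (x, v)" unfolding point_def d c(3) x(2) ..
  have "z \<in> slab m" unfolding slab_def mem_Collect_eq d using c x(1) by simp
  then have "z \<in> swept A m b" unfolding swept_def using q(1) by (simp add: pt zk)
  moreover have "y = \<Theta> m b z" unfolding \<Theta>_point pt zk q(3) by simp
  ultimately show "y \<in> \<Theta> m b ` swept A m b" by blast
qed

lemma graph_disjoint: "p \<in> graph m b \<Longrightarrow> p \<in> graph m' b' \<Longrightarrow> m = m' \<and> b = b'"
proof -
  assume p: "p \<in> graph m b" "p \<in> graph m' b'"
  then have "fst p \<in> B m" "fst p \<in> B m'" by (auto simp: graph_def)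
  then have m: "m = m'" using B(3) by (auto simp: disjoint_family_on_def)
  moreover have "b = b'" using p U_eq(2)[of "fst p" m] by (cases b; cases b') (auto simp: graph_def m)
  ultimately show ?thesis by blast
qed

text \<open>On each piece the shape determinant times the Jacobian at time zero is the Jacobian of
  \<open>\<Theta>\<close>, so the change of variables formula turns the slab integral into an
  integral over the image of the piece. Injectivity of \<open>F\<close> makes these images disjoint,
  and the sum over the pieces is the integral over the image of \<open>A\<close>.\<close>

lemma
  fixes A :: "(((real^'n) \<times> (real^'n)) \<times> real) set" and h :: "real^'n \<Rightarrow> ennreal"
  defines "F \<equiv> \<lambda>q :: ((real^'n) \<times> (real^'n)) \<times> real. fst (fst q) + snd q *\<^sub>R sgn (snd (fst q))"
  assumes A: "A \<in> sets borel" "\<And>q. q \<in> A \<Longrightarrow> fst (fst q) \<in> R \<and> snd (fst q) \<in> U (fst (fst q))"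
    and inj: "inj_on F A"
  shows sweep_lebesgue: "F ` A \<in> sets lebesgue"
    and nn_integral_sweep: "h \<in> borel_measurable borel \<Longrightarrow>
      (\<integral>\<^sup>+p. (\<integral>\<^sup>+s. h (F (p, s)) * ennreal \<bar>shape p s\<bar> * indicator A (p, s) \<partial>lborel) \<partial>skel) = (\<integral>\<^sup>+y\<in>F ` A. h y \<partial>lebesgue)"
proof -
  have der: "(\<Theta> m b has_derivative branch_chart.\<Theta>' (\<psi> m) (k m) (H m b) z) (at z within swept A m b)" if "z \<in> swept A m b" for m b z
  proof (rule has_derivative_at_withinI, rule branch_chart.has_derivative_\<Theta>[OF bc])
    have "z \<in> slab m" using that unfolding swept_def by blast
    then show "drop_coord (k m) z \<in> V m" unfolding slab_def by blast
  qed
  have inj\<Theta>: "inj_on (\<Theta> m b) (swept A m b)" for m b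
  proof (rule inj_onI)
    fix z z' assume z: "z \<in> swept A m b" "z' \<in> swept A m b" "\<Theta> m b z = \<Theta> m b z'"
    then have "F (point m b z, z $ k m) = F (point m b z', z' $ k m)" by (simp add: F_def \<Theta>_point)
    then have "(point m b z, z $ k m) = (point m b z', z' $ k m)"
      by (rule inj_onD[OF inj]) (use z in \<open>auto simp: swept_def\<close>)
    then show "z = z'" using z(1,2) by (intro point_slab_inj[of z m z' b]) (auto simp: swept_def)
  qed
  have det: "det0 m b z = det (matrix (branch_chart.\<Theta>' (\<psi> m) (k m) (H m b) z))" if "z \<in> swept A m b" for m b z
  proof -
    have "z \<in> slab m" using that unfolding swept_def by blast
    then have "drop_coord (k m) z \<in> V m" unfolding slab_def by blast
    then show ?thesis unfolding branch_chart.det0_def[OF bc] by (rule if_P)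
  qed
  have leb: "\<Theta> m b ` swept A m b \<in> sets lebesgue" for m b
    by (rule emeasure_differentiable_image(1)[where d = "\<lambda>z. \<bar>det0 m b z\<bar>", OF swept_borel[OF A(1)] der inj\<Theta>
        borel_measurable_abs[OF branch_chart.measurable_det0[OF bc]]]) (simp_all add: det)
  have im: "\<Theta> m b ` swept A m b = F ` {q \<in> A. fst q \<in> graph m b}" for m b
    unfolding \<Theta>_swept F_def ..
  have gr: "\<exists>m b. fst q \<in> graph m b" if "q \<in> A" for q
  proof -
    have "fst q \<in> (\<Union>m. \<Union>b. graph m b)" unfolding UN_graph using A(2)[OF that] by simp
    then show ?thesis by blast
  qed
  have "F ` A = (\<Union>m. \<Union>b. \<Theta> m b ` swept A m b)"
    unfolding im using gr by fast
  also have "\<dots> \<in> sets lebesgue" using leb by (intro sets.countable_UN sets.finite_UN) auto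
  finally show "F ` A \<in> sets lebesgue" .
  assume h: "h \<in> borel_measurable borel"
  let ?q = "\<lambda>q. h (F q) * ennreal \<bar>shape (fst q) (snd q)\<bar> * indicator A q"
  have F: "F \<in> borel \<rightarrow>\<^sub>M borel" unfolding F_def by (rule measurable_ray)
  have q: "?q \<in> borel_measurable borel"
    by (intro borel_measurable_times_ennreal measurable_compose[OF F h] borel_measurable_indicator A(1)
        measurable_compose[OF borel_measurable_abs[OF shape_measurable] measurable_ennreal])
  have "(\<integral>\<^sup>+p. (\<integral>\<^sup>+s. h (F (p, s)) * ennreal \<bar>shape p s\<bar> * indicator A (p, s) \<partial>lborel) \<partial>skel) =
     (\<Sum>m. \<Sum>b\<in>UNIV. \<integral>\<^sup>+z\<in>slab m. ?q (point m b z, z $ k m) * ennreal \<bar>det0 m b (drop_coord (k m) z)\<bar> \<partial>lborel)"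
    using nn_integral_skel_slab[OF q] by simp
  also have "\<dots> = (\<Sum>m. \<Sum>b\<in>UNIV. \<integral>\<^sup>+z\<in>swept A m b. h (\<Theta> m b z) * ennreal \<bar>det0 m b z\<bar> \<partial>lborel)"
  proof (intro suminf_cong sum.cong refl nn_integral_cong)
    fix m b z
    show "?q (point m b z, z $ k m) * ennreal \<bar>det0 m b (drop_coord (k m) z)\<bar> * indicator (slab m) z =
       h (\<Theta> m b z) * ennreal \<bar>det0 m b z\<bar> * indicator (swept A m b) z"
    proof (cases "z \<in> swept A m b")
      case True
      then have z: "z \<in> slab m" "(point m b z, z $ k m) \<in> A" by (auto simp: swept_def)
      have e: "ennreal \<bar>shape (point m b z) (z $ k m)\<bar> * ennreal \<bar>det0 m b (drop_coord (k m) z)\<bar> = ennreal \<bar>det0 m b z\<bar>"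
        unfolding shape_slab(1)[OF z(1), of b, symmetric] abs_mult by (rule ennreal_mult[symmetric]) auto
      show ?thesis using z True by (simp add: \<Theta>_point F_def mult.assoc e del: ennreal_mult_cancel_left)
    next
      case False
      then show ?thesis by (auto simp: swept_def indicator_def)
    qed
  qed
  also have "\<dots> = (\<Sum>m. \<Sum>b\<in>UNIV. \<integral>\<^sup>+y\<in>\<Theta> m b ` swept A m b. h y \<partial>lebesgue)"
  proof (intro suminf_cong sum.cong refl)
    fix m b
    show "(\<integral>\<^sup>+z\<in>swept A m b. h (\<Theta> m b z) * ennreal \<bar>det0 m b z\<bar> \<partial>lborel) = (\<integral>\<^sup>+y\<in>\<Theta> m b ` swept A m b. h y \<partial>lebesgue)"
    proof (rule nn_integral_change_of_variables[symmetric])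
      show "(\<lambda>z. \<bar>det0 m b z\<bar>) \<in> borel_measurable borel"
        by (rule borel_measurable_abs[OF branch_chart.measurable_det0[OF bc]])
      show "\<bar>det0 m b z\<bar> = \<bar>det (matrix (branch_chart.\<Theta>' (\<psi> m) (k m) (H m b) z))\<bar>" if "z \<in> swept A m b" for z
        unfolding det[OF that] ..
    qed (rule swept_borel[OF A(1)] der inj\<Theta> h, assumption?)+
  qed
  also have "\<dots> = (\<integral>\<^sup>+y. (\<Sum>m. \<Sum>b\<in>UNIV. h y * indicator (\<Theta> m b ` swept A m b) y) \<partial>lebesgue)"
  proof -
    have mh: "h \<in> borel_measurable lebesgue" using h by (simp add: measurable_completion)
    have mm: "(\<lambda>y. h y * indicator (\<Theta> m b ` swept A m b) y) \<in> borel_measurable lebesgue" for m b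
      by (intro borel_measurable_times_ennreal mh borel_measurable_indicator leb)
    show ?thesis
      by (subst nn_integral_suminf) (intro borel_measurable_sum mm, subst nn_integral_sum, rule mm, rule refl)
  qed
  also have "\<dots> = (\<integral>\<^sup>+y\<in>F ` A. h y \<partial>lebesgue)"
  proof (rule nn_integral_cong)
    fix y
    show "(\<Sum>m. \<Sum>b\<in>UNIV. h y * indicator (\<Theta> m b ` swept A m b) y) = h y * indicator (F ` A) y"
    proof (cases "y \<in> F ` A")
      case False
      then have "indicator (\<Theta> m b ` swept A m b) y = (0::ennreal)" for m b unfolding im by (auto simp: indicator_def)
      then show ?thesis using False by simp
    next
      case True
      then obtain q where q: "q \<in> A" "y = F q" by blast
      from gr[OF q(1)] obtain n c where g: "fst q \<in> graph n c" by blast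
      \<comment> \<open>\<open>F\<close> is injective on \<open>A\<close> and the graphs are
        disjoint, so exactly one pair \<open>(m, b)\<close> contributes at \<open>y\<close>.\<close>
      have i: "indicator (\<Theta> m b ` swept A m b) y = (if m = n \<and> b = c then 1 else 0 :: ennreal)" for m b
      proof (cases "m = n \<and> b = c")
        case True
        then show ?thesis unfolding im using q g by (auto simp: indicator_def)
      next
        case False
        have "y \<notin> F ` {q \<in> A. fst q \<in> graph m b}"
        proof
          assume "y \<in> F ` {q \<in> A. fst q \<in> graph m b}"
          then obtain q' where q': "q' \<in> A" "fst q' \<in> graph m b" "y = F q'" by blast
          have "q' = q" by (rule inj_onD[OF inj _ q'(1) q(1)]) (use q(2) q'(3) in simp)
          then show False using False graph_disjoint[OF q'(2), of n c] g by blast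
        qed
        then show ?thesis unfolding im using False by (simp add: indicator_def)
      qed
      have "(\<Sum>b\<in>UNIV. h y * indicator (\<Theta> m b ` swept A m b) y) = (if m = n then h y else 0)" for m
        unfolding i by (cases c) (auto simp: UNIV_bool)
      moreover have "(\<Sum>m. if m = n then h y else 0) = h y" by (subst suminf_finite[of "{n}"]) auto
      ultimately show ?thesis using True by simp
    qed
  qed
  finally show "(\<integral>\<^sup>+p. (\<integral>\<^sup>+s. h (F (p, s)) * ennreal \<bar>shape p s\<bar> * indicator A (p, s) \<partial>lborel) \<partial>skel) = (\<integral>\<^sup>+y\<in>F ` A. h y \<partial>lebesgue)" .
qed

end

section \<open>Integration along radial lines\<close>

text \<open>The inner integrals of positive part, negative part and absolute value are measurable
  functions \<open>P\<close>, \<open>Q\<close> and \<open>T\<close> of \<open>p\<close>. Finiteness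
  of the integral of \<open>T\<close> makes \<open>P\<close> and \<open>Q\<close> finite almost
  everywhere, and \<open>f\<close> is their difference; the default value \<open>0\<close> is taken
  on a null set only.\<close>

lemma iterated_integral:
  fixes w :: "'p \<Rightarrow> real \<Rightarrow> real" and f :: "'p \<Rightarrow> real"
  assumes w[measurable]: "case_prod w \<in> borel_measurable (N \<Otimes>\<^sub>M lborel)"
    and fin: "(\<integral>\<^sup>+p. (\<integral>\<^sup>+s. ennreal \<bar>w p s\<bar> \<partial>lborel) \<partial>N) < \<infinity>"
    and A[measurable]: "Measurable.pred N A" and AE: "AE p in N. A p"
    and f: "\<And>p. p \<in> space N \<Longrightarrow> f p = (if A p \<and> integrable lborel (w p) then \<integral>s. w p s \<partial>lborel else 0)"
  shows "AE p in N. A p \<and> integrable lborel (w p)" "integrable N f"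
    "(\<integral>p. f p \<partial>N) = enn2real (\<integral>\<^sup>+p. (\<integral>\<^sup>+s. ennreal (w p s) \<partial>lborel) \<partial>N) -
       enn2real (\<integral>\<^sup>+p. (\<integral>\<^sup>+s. ennreal (- w p s) \<partial>lborel) \<partial>N)"
proof -
  define P where "P p = (\<integral>\<^sup>+s. ennreal (w p s) \<partial>lborel)" for p
  define Q where "Q p = (\<integral>\<^sup>+s. ennreal (- w p s) \<partial>lborel)" for p
  define T where "T p = (\<integral>\<^sup>+s. ennreal \<bar>w p s\<bar> \<partial>lborel)" for p
  have [measurable]: "P \<in> borel_measurable N" "Q \<in> borel_measurable N" "T \<in> borel_measurable N"
    unfolding P_def Q_def T_def by measurable
  have le: "P p \<le> T p" "Q p \<le> T p" for p
    unfolding P_def Q_def T_def by (intro nn_integral_mono ennreal_leI; simp)+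
  have mw: "w p \<in> borel_measurable lborel" if "p \<in> space N" for p
    using measurable_Pair2[OF w that] by simp
  have "AE p in N. T p \<noteq> \<infinity>"
    using fin by (intro nn_integral_PInf_AE) (simp_all add: T_def)
  then have AET: "AE p in N. A p \<and> integrable lborel (w p) \<and> P p < \<infinity> \<and> Q p < \<infinity>"
    using AE AE_space
  proof eventually_elim
    fix p assume p: "T p \<noteq> \<infinity>" "A p" "p \<in> space N"
    have "integrable lborel (w p)"
      using mw[OF p(3)] p(1) by (intro integrableI_bounded) (simp_all add: T_def top.not_eq_extremum)
    then show "A p \<and> integrable lborel (w p) \<and> P p < \<infinity> \<and> Q p < \<infinity>"
      using p le[of p] by (auto simp: top.not_eq_extremum intro: le_less_trans)
  qed
  then show "AE p in N. A p \<and> integrable lborel (w p)" by (rule eventually_mono) simp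
  define F where "F p = (if A p \<and> integrable lborel (w p) then \<integral>s. w p s \<partial>lborel else 0)" for p
  have [measurable]: "F \<in> borel_measurable N" unfolding F_def by measurable
  have AEF: "AE p in N. F p = enn2real (P p) - enn2real (Q p)"
    using AET by (rule eventually_mono) (simp add: F_def P_def Q_def real_lebesgue_integral_def)
  have lt: "(\<integral>\<^sup>+p. P p \<partial>N) < \<infinity>" "(\<integral>\<^sup>+p. Q p \<partial>N) < \<infinity>"
    using nn_integral_mono[of N P T] nn_integral_mono[of N Q T] le fin unfolding T_def[symmetric]
    by (auto intro: le_less_trans)
  have e: "(\<integral>\<^sup>+p. ennreal (enn2real (P p)) \<partial>N) = (\<integral>\<^sup>+p. P p \<partial>N)" "(\<integral>\<^sup>+p. ennreal (enn2real (Q p)) \<partial>N) = (\<integral>\<^sup>+p. Q p \<partial>N)"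
    by (rule nn_integral_cong_AE, rule eventually_mono[OF AET], simp add: top.not_eq_extremum)+
  have iP: "integrable N (\<lambda>p. enn2real (P p))" and iQ: "integrable N (\<lambda>p. enn2real (Q p))"
    using lt by (auto intro!: integrableI_bounded simp: e)
  have iF: "integrable N F"
    using Bochner_Integration.integrable_diff[OF iP iQ] by (rule integrable_cong_AE_imp) (use AEF in \<open>auto simp: eq_commute\<close>)
  then show "integrable N f" by (rule Bochner_Integration.integrable_cong[THEN iffD1, rotated -1]) (auto simp: f F_def)
  have "(\<integral>p. f p \<partial>N) = (\<integral>p. F p \<partial>N)" by (rule Bochner_Integration.integral_cong) (auto simp: f F_def)
  also have "\<dots> = (\<integral>p. enn2real (P p) - enn2real (Q p) \<partial>N)" by (rule integral_cong_AE) (use AEF in auto)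
  also have "\<dots> = (\<integral>p. enn2real (P p) \<partial>N) - (\<integral>p. enn2real (Q p) \<partial>N)" by (rule Bochner_Integration.integral_diff[OF iP iQ])
  also have "\<dots> = enn2real (\<integral>\<^sup>+p. P p \<partial>N) - enn2real (\<integral>\<^sup>+p. Q p \<partial>N)"
    by (simp add: integral_eq_nn_integral e)
  finally show "(\<integral>p. f p \<partial>N) = enn2real (\<integral>\<^sup>+p. (\<integral>\<^sup>+s. ennreal (w p s) \<partial>lborel) \<partial>N) -
       enn2real (\<integral>\<^sup>+p. (\<integral>\<^sup>+s. ennreal (- w p s) \<partial>lborel) \<partial>N)" unfolding P_def Q_def .
qed

context skeletal_atlas
begin

text \<open>The indicator of \<open>A\<close> is integrated over all times \<open>s\<close>, which
  gives \<open>\<infinity>\<close> at points of \<open>A\<close>. In the slabs the corresponding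
  sets are negligible, so the total is zero, and \<open>A\<close> must be null.\<close>

lemma AE_skel_not_thin:
  assumes A: "A \<in> sets borel" and t: "thin j A" "Suc j < CARD('n)"
  shows "AE p in skel. p \<notin> A"
proof -
  let ?q = "\<lambda>q :: ((real^'n) \<times> (real^'n)) \<times> real. indicator A (fst q) :: ennreal"
  have f1: "(\<lambda>q :: ((real^'n) \<times> (real^'n)) \<times> real. fst q) \<in> borel \<rightarrow>\<^sub>M borel"
    by (intro borel_measurable_continuous_onI continuous_intros)
  have m: "?q \<in> borel_measurable borel" by (rule measurable_compose[OF f1 borel_measurable_indicator[OF A]])
  have 0: "(\<integral>\<^sup>+z\<in>slab m. ?q (point m b z, z $ k m) * ennreal \<bar>det0 m b (drop_coord (k m) z)\<bar> \<partial>lborel) = 0" for m b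
  proof -
    have "{z \<in> slab m. point m b z \<in> A} \<in> null_sets lebesgue"
      using negligible_point_vimage[OF t] by (simp add: negligible_iff_null_sets)
    then have "AE z in lborel. z \<notin> {z \<in> slab m. point m b z \<in> A}"
      using AE_not_in AE_completion_iff by blast
    then have "(\<integral>\<^sup>+z\<in>slab m. ?q (point m b z, z $ k m) * ennreal \<bar>det0 m b (drop_coord (k m) z)\<bar> \<partial>lborel) = (\<integral>\<^sup>+z. 0 \<partial>(lborel :: (real^'n) measure))"
      by (intro nn_integral_cong_AE) (auto elim!: eventually_mono simp: indicator_def)
    then show ?thesis by simp
  qed
  have "(\<integral>\<^sup>+p. (\<integral>\<^sup>+s. ?q (p, s) \<partial>lborel) \<partial>skel) = 0"
    unfolding nn_integral_skel_slab[OF m] 0 by simp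
  moreover have "(\<integral>\<^sup>+s. ?q (p, s) \<partial>lborel) = \<infinity> * indicator A p" for p
    by (simp add: mult.commute)
  ultimately have "(\<integral>\<^sup>+p. \<infinity> * indicator A p \<partial>skel) = 0" by simp
  moreover have "(\<lambda>p. \<infinity> * indicator A p :: ennreal) \<in> borel_measurable skel"
    by (rule measurable_skel) (intro borel_measurable_times_ennreal borel_measurable_const borel_measurable_indicator A)
  ultimately have "AE p in skel. \<infinity> * indicator A p = (0 :: ennreal)" by (simp only: nn_integral_0_iff_AE)
  then show ?thesis by (rule eventually_mono) (auto simp: indicator_def split: if_splits)
qed

text \<open>The intermediate value theorem for the quotient of Jacobians on \<open>[0, s]\<close>.
  The assumption excludes zeros at positive times; at time \<open>0\<close> the quotient is
  \<open>1\<close> because \<open>shape_det\<close> makes its denominator nonzero.\<close>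

lemma shape_positive:
  assumes p: "p \<in> graph m b" and s: "0 \<le> s"
    and nz: "\<And>\<tau>. 0 < \<tau> \<Longrightarrow> \<tau> \<le> s \<Longrightarrow> det0 m b (the_inv_into (V m) (\<psi> m) (fst p) + \<tau> *\<^sub>R axis (k m) 1) \<noteq> 0"
  shows "shape p s > 0"
proof -
  have x: "fst p \<in> R" "fst p \<in> W m" using p B(2) by (auto simp: graph_def)
  let ?y = "the_inv_into (V m) (\<psi> m) (fst p)"
  note y = branch_chart.chart_point[OF bc[of m b] x]
  let ?f = "\<lambda>\<tau>. det0 m b (?y + \<tau> *\<^sub>R axis (k m) 1) / det0 m b ?y"
  have n0: "det0 m b ?y \<noteq> 0" by (rule branch_chart.shape_det(1)[OF bc x])
  have c: "continuous_on UNIV ?f"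
  proof -
    have d: "drop_coord (k m) (?y + \<tau> *\<^sub>R axis (k m) 1) \<in> V m" for \<tau>
      unfolding branch_chart.drop_shift[OF bc[of m b] y(2)] by (rule y(1))
    have "det0 m b (?y + \<tau> *\<^sub>R axis (k m) 1) = det (matrix (branch_chart.\<Theta>' (\<psi> m) (k m) (H m b) (?y + \<tau> *\<^sub>R axis (k m) 1)))" for \<tau>
      unfolding branch_chart.det0_def[OF bc] using d[of \<tau>] by (rule if_P)
    moreover have "continuous_on UNIV (\<lambda>\<tau>. det (matrix (branch_chart.\<Theta>' (\<psi> m) (k m) (H m b) (?y + \<tau> *\<^sub>R axis (k m) 1))))"
      by (rule continuous_on_compose2[OF branch_chart.continuous_det_\<Theta>'[OF bc]]) (use d in \<open>auto intro!: continuous_intros\<close>)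
    ultimately show ?thesis using n0 by (intro continuous_on_divide continuous_on_const) simp_all
  qed
  have f0: "?f 0 = 1" using n0 by simp
  have nzf: "?f \<tau> \<noteq> 0" if "0 \<le> \<tau>" "\<tau> \<le> s" for \<tau>
    using nz[of \<tau>] n0 that by (cases "\<tau> = 0") auto
  have "?f s > 0"
  proof (rule ccontr)
    assume "\<not> ?f s > 0"
    then obtain \<tau> where "0 \<le> \<tau>" "\<tau> \<le> s" "?f \<tau> = 0"
      using IVT2'[of ?f s 0 0] s f0 continuous_on_subset[OF c, of "{0..s}"] by auto
    then show False using nzf by blast
  qed
  moreover have "branch_chart.\<phi>0 (V m) (W m) (\<psi> m) (fst p) = ?y"
    unfolding branch_chart.\<phi>0_def[OF bc[of m b]] using x(2) by (rule if_P)
  ultimately show ?thesis unfolding shape_graph[OF p] by simp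
qed

end

lemma (in skeletal_atlas) id_measurable_skel: "(\<lambda>p. p) \<in> skel \<rightarrow>\<^sub>M borel"
  unfolding measurable_cong_sets[OF sets_skel refl] by (rule measurable_restrict_space1) simp

context linking
begin

section \<open>Measurability and positivity on the swept regions\<close>

lemma S_borel: "i \<in> I \<Longrightarrow> j \<in> J i \<Longrightarrow> S i j \<in> sets borel"
  using S_submanifold submanifold_charted charted_borel by metis

lemma D_borel: "i \<in> I \<Longrightarrow> D i \<in> sets borel"
proof -
  assume i: "i \<in> I"
  have "(\<Union>j\<in>J i. S i j) \<in> sets borel" using S_borel[OF i] S_strat(1)[OF i] by (intro sets.finite_UN) auto
  then show ?thesis using stratificationD(1)[OF S_strat(2)[OF i]] by simp
qed

lemma Dinf_borel: "i \<in> I \<Longrightarrow> Dinf i \<in> sets borel"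
proof -
  assume i: "i \<in> I"
  have "Dinf i = (\<Union>j\<in>{j\<in>J i. S i j \<subseteq> Dinf i}. S i j)"
  proof (intro equalityI subsetI)
    fix p assume p: "p \<in> Dinf i"
    then have "p \<in> D i" by (simp add: unlinked_part_def)
    then have "p \<in> \<Union>(S i ` J i)" by (simp only: stratificationD(1)[OF S_strat(2)[OF i]])
    then obtain j where j: "j \<in> J i" "p \<in> S i j" by blast
    then have "S i j \<subseteq> Dinf i" using S_unlinked[OF i j(1)] p by blast
    then show "p \<in> (\<Union>j\<in>{j\<in>J i. S i j \<subseteq> Dinf i}. S i j)" using j by blast
  qed blast
  also have "\<dots> \<in> sets borel" using S_borel[OF i] S_strat(1)[OF i] by (intro sets.finite_UN) auto
  finally show ?thesis .
qed

lemma E_borel: assumes i: "i \<in> I" shows "E i \<in> sets borel"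
proof -
  let ?l = "\<lambda>p. if p \<in> D i - Dinf i then real_of_ereal (l i p) else 0"
  have l: "?l \<in> borel_measurable borel"
    using D_borel[OF i] Dinf_borel[OF i] l_cont[OF i] by (intro borel_measurable_continuous_on_if) auto
  have f1: "(\<lambda>q :: ((real^'n) \<times> (real^'n)) \<times> real. fst q) \<in> borel \<rightarrow>\<^sub>M borel"
    and f2: "(\<lambda>q :: ((real^'n) \<times> (real^'n)) \<times> real. snd q) \<in> borel \<rightarrow>\<^sub>M borel"
    by (intro borel_measurable_continuous_onI continuous_intros)+
  have "E i = {q. 0 < snd q} \<inter> (fst -` Dinf i \<union> (fst -` (D i - Dinf i) \<inter> {q. snd q < ?l (fst q)}))"
  proof -
    have "(ereal s < l i p) = (p \<in> Dinf i \<or> s < ?l p)" if p: "p \<in> D i" for p s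
    proof (cases "p \<in> Dinf i")
      case True
      then show ?thesis by (simp add: unlinked_part_def)
    next
      case False
      then have "l i p \<noteq> \<infinity>" using p by (simp add: unlinked_part_def)
      then obtain L where "l i p = ereal L" using l_ge[OF i p] by (cases "l i p") auto
      then show ?thesis using False p by simp
    qed
    then show ?thesis by (auto simp: E_def unlinked_part_def split: if_splits)
  qed
  also have "\<dots> \<in> sets borel"
  proof (intro sets.Int sets.Un)
    have "{q \<in> space borel. snd q < ?l (fst q)} \<in> sets (borel :: (((real^'n) \<times> (real^'n)) \<times> real) measure)"
      by (rule borel_measurable_less[OF f2 measurable_compose[OF f1 l]])
    then show "{q. snd q < ?l (fst q)} \<in> sets (borel :: (((real^'n) \<times> (real^'n)) \<times> real) measure)" by simp
    have "{q \<in> space borel. 0 < snd q} \<in> sets (borel :: (((real^'n) \<times> (real^'n)) \<times> real) measure)"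
      by (rule borel_measurable_less[OF borel_measurable_const f2])
    then show "{q. 0 < snd q} \<in> sets (borel :: (((real^'n) \<times> (real^'n)) \<times> real) measure)" by simp
    show "fst -` Dinf i \<in> sets (borel :: (((real^'n) \<times> (real^'n)) \<times> real) measure)"
      by (rule measurable_sets_borel[OF f1 Dinf_borel[OF i]])
    show "fst -` (D i - Dinf i) \<in> sets (borel :: (((real^'n) \<times> (real^'n)) \<times> real) measure)"
      by (rule measurable_sets_borel[OF f1 sets.Diff[OF D_borel[OF i] Dinf_borel[OF i]]])
  qed
  finally show ?thesis .
qed

lemma Good_borel: "i \<in> I \<Longrightarrow> Good i \<in> sets borel"
proof -
  assume i: "i \<in> I"
  have "Good i = (\<Union>j\<in>{j\<in>J i. good i j}. S i j)" by (auto simp: Good_def good_def)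
  also have "\<dots> \<in> sets borel" using S_borel[OF i] S_strat(1)[OF i] by (intro sets.finite_UN) auto
  finally show ?thesis .
qed

abbreviation atlas where "atlas i \<equiv> skeletal_atlas (\<T> i) (U i)"

lemma atlas_exists:
  assumes "i \<in> I" obtains V W \<psi> k B H where "atlas i V W \<psi> k B H"
  by (rule skeletal_atlas_exists[OF skel_facts(3,2)[OF assms]]) (rule that)

text \<open>There are finitely many strata, and those that are not good have dimension
  \<open>k'\<close> with \<open>Suc k' < CARD('n)\<close>, hence are null by
  \<open>AE_skel_not_thin\<close>.\<close>

lemma AE_Good:
  assumes i: "i \<in> I"
  shows "AE p in skeletal_measure (\<T> i) (U i). p \<in> Good i"
proof -
  obtain V W \<psi> k B H where a: "atlas i V W \<psi> k B H" by (rule atlas_exists[OF i])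
  interpret a: skeletal_atlas "\<T> i" "U i" V W \<psi> k B H by (rule a)
  have "AE p in a.skel. \<forall>j\<in>{j\<in>J i. \<not> good i j}. p \<notin> S i j"
  proof (rule AE_finite_allI)
    show "finite {j\<in>J i. \<not> good i j}" using S_strat(1)[OF i] by simp
    fix j assume j: "j \<in> {j\<in>J i. \<not> good i j}"
    then obtain k' where k: "k' < CARD('n) - 1" "thin k' (S i j)" using bad_thin[OF i, of j] by blast
    show "AE p in a.skel. p \<notin> S i j"
      by (rule a.AE_skel_not_thin[OF S_borel[OF i] k(2)]) (use j k(1) in auto)
  qed
  then show ?thesis using AE_space
  proof eventually_elim
    fix p assume p: "\<forall>j\<in>{j\<in>J i. \<not> good i j}. p \<notin> S i j" "p \<in> space a.skel"
    then have "p \<in> \<Union>(S i ` J i)" unfolding a.space_skel by (simp only: stratificationD(1)[OF S_strat(2)[OF i]])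
    then obtain j where "j \<in> J i" "p \<in> S i j" by blast
    then show "p \<in> Good i" using p(1) by (auto simp: Good_def)
  qed
qed

text \<open>With \<open>(p, s)\<close> also every \<open>(p, \<tau>)\<close> with
  \<open>0 < \<tau> \<le> s\<close> lies in \<open>E i\<close>, so the Jacobian has no zero between
  the skeletal point and arc length \<open>s\<close>.\<close>

lemma shape_positive_sweep:
  assumes i: "i \<in> I" and p: "p \<in> Good i" and E: "(p, s) \<in> E i"
  shows "skeletal_atlas.shape (\<T> i) (U i) p s > 0"
proof -
  obtain V W \<psi> k B H where a: "atlas i V W \<psi> k B H" by (rule atlas_exists[OF i])
  interpret a: skeletal_atlas "\<T> i" "U i" V W \<psi> k B H by (rule a)
  have "fst p \<in> a.R \<and> snd p \<in> U i (fst p)"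
    using p good_regular unfolding Good_def by blast
  then have "p \<in> (\<Union>m. \<Union>b. a.graph m b)" unfolding a.UN_graph by simp
  then obtain m b where g: "p \<in> a.graph m b" by blast
  then have x: "fst p \<in> a.R" "fst p \<in> W m" and pe: "p = (fst p, H m b (fst p))"
    using a.B(2) by (auto simp: a.graph_def prod_eq_iff)
  have s: "p \<in> D i" "0 < s" "ereal s < l i p" using E by (auto simp: E_def)
  show ?thesis
  proof (rule a.shape_positive[OF g])
    show "0 \<le> s" using s by simp
    fix \<tau> assume t: "0 < \<tau>" "\<tau> \<le> s"
    have "ereal \<tau> < l i p" using t(2) s(3) by (metis ereal_less_eq(3) le_less_trans)
    then have "(p, \<tau>) \<in> E i" using s(1) t(1) by (simp add: E_def)
    then show "a.det0 m b (the_inv_into (V m) (\<psi> m) (fst p) + \<tau> *\<^sub>R axis (k m) 1) \<noteq> 0"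
      using det0_positive[OF i a.bc[of m b] x] p pe by metis
  qed
qed

abbreviation A where "A i \<equiv> {q \<in> E i. fst q \<in> Good i}"

lemma A_borel: assumes i: "i \<in> I" shows "A i \<in> sets borel"
proof -
  have f1: "(\<lambda>q :: ((real^'n) \<times> (real^'n)) \<times> real. fst q) \<in> borel \<rightarrow>\<^sub>M borel"
    by (intro borel_measurable_continuous_onI continuous_intros)
  have "A i = E i \<inter> fst -` Good i" by auto
  also have "\<dots> \<in> sets borel" by (rule sets.Int[OF E_borel[OF i] measurable_sets_borel[OF f1 Good_borel[OF i]]])
  finally show ?thesis .
qed

lemma A_regular: "q \<in> A i \<Longrightarrow> fst (fst q) \<in> regular_part (\<T> i) \<and> snd (fst q) \<in> U i (fst (fst q))"
  using good_regular unfolding Good_def by blast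

lemma inj_\<Phi>: assumes i: "i \<in> I" shows "inj_on \<Phi> (A i)"
proof (rule inj_onI)
  fix q q' assume q: "q \<in> A i" "q' \<in> A i" "\<Phi> q = \<Phi> q'"
  have "(fst q, snd q) \<in> E i" "(fst q', snd q') \<in> E i" "\<Phi> (fst q, snd q) = \<Phi> (fst q', snd q')" using q by auto
  from sweep_injective[OF i i this] show "q = q'" by (simp add: prod_eq_iff)
qed

lemma \<Phi>_eq: "\<Phi> = (\<lambda>q. fst (fst q) + snd q *\<^sub>R sgn (snd (fst q)))"
  by (simp add: fun_eq_iff \<Phi>_def)

abbreviation shape where "shape i \<equiv> skeletal_atlas.shape (\<T> i) (U i)"
abbreviation skel where "skel i \<equiv> skeletal_measure (\<T> i) (U i)"

text \<open>The sets swept out by the radial lines of the regions partition space up to a null set.\<close>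

lemma nn_integral_sweeps:
  assumes h: "h \<in> borel_measurable borel"
  shows "(\<integral>\<^sup>+y. h y \<partial>lborel) =
    (\<Sum>i\<in>I. \<integral>\<^sup>+p. (\<integral>\<^sup>+s. h (\<Phi> (p, s)) * ennreal \<bar>shape i p s\<bar> * indicator (A i) (p, s) \<partial>lborel) \<partial>skel i)"
proof -
  have im: "\<Phi> ` A i \<in> sets lebesgue" and nn: "(\<integral>\<^sup>+p. (\<integral>\<^sup>+s. h (\<Phi> (p, s)) * ennreal \<bar>shape i p s\<bar> * indicator (A i) (p, s) \<partial>lborel) \<partial>skel i) =
     (\<integral>\<^sup>+y\<in>\<Phi> ` A i. h y \<partial>lebesgue)" if i: "i \<in> I" for i
  proof -
    obtain V W \<psi> k B H where a: "atlas i V W \<psi> k B H" by (rule atlas_exists[OF i])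
    note inj = inj_\<Phi>[OF i, unfolded \<Phi>_eq]
    show "\<Phi> ` A i \<in> sets lebesgue"
      unfolding \<Phi>_eq by (rule skeletal_atlas.sweep_lebesgue[OF a A_borel[OF i] A_regular inj])
    show "(\<integral>\<^sup>+p. (\<integral>\<^sup>+s. h (\<Phi> (p, s)) * ennreal \<bar>shape i p s\<bar> * indicator (A i) (p, s) \<partial>lborel) \<partial>skel i) =
     (\<integral>\<^sup>+y\<in>\<Phi> ` A i. h y \<partial>lebesgue)"
      unfolding \<Phi>_eq by (rule skeletal_atlas.nn_integral_sweep[OF a A_borel[OF i] A_regular inj h])
  qed
  have dis: "i = i'" if i: "i \<in> I" "i' \<in> I" and y: "y \<in> \<Phi> ` A i" "y \<in> \<Phi> ` A i'" for i i' y
  proof -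
    obtain q where q: "q \<in> A i" "y = \<Phi> q" using y(1) by blast
    obtain q' where q': "q' \<in> A i'" "y = \<Phi> q'" using y(2) by blast
    have "(fst q, snd q) \<in> E i" "(fst q', snd q') \<in> E i'" "\<Phi> (fst q, snd q) = \<Phi> (fst q', snd q')" using q q' by auto
    from sweep_injective[OF i this] show ?thesis by blast
  qed
  have mh: "h \<in> borel_measurable lebesgue" using h by (simp add: measurable_completion)
  have N: "- (\<Union>i\<in>I. \<Phi> ` A i) \<in> null_sets lebesgue" using complement_negligible by (simp add: negligible_iff_null_sets)
  then have AE: "AE y in lebesgue. y \<in> (\<Union>i\<in>I. \<Phi> ` A i)" using AE_not_in[OF N] by (simp only: Compl_iff not_not)
  have "(\<integral>\<^sup>+y. h y \<partial>lborel) = (\<integral>\<^sup>+y. h y \<partial>lebesgue)" using h by (simp add: nn_integral_completion)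
  also have "\<dots> = (\<integral>\<^sup>+y. (\<Sum>i\<in>I. h y * indicator (\<Phi> ` A i) y) \<partial>lebesgue)"
  proof (rule nn_integral_cong_AE, rule eventually_mono[OF AE])
    fix y assume "y \<in> (\<Union>i\<in>I. \<Phi> ` A i)"
    then obtain i where i: "i \<in> I" "y \<in> \<Phi> ` A i" by blast
    have "(\<Sum>i\<in>I. h y * indicator (\<Phi> ` A i) y) = (\<Sum>i'\<in>I. if i' = i then h y else 0)"
    proof (intro sum.cong refl)
      fix i' assume i': "i' \<in> I"
      show "h y * indicator (\<Phi> ` A i') y = (if i' = i then h y else 0)"
      proof (cases "i' = i")
        case True
        then show ?thesis using i(2) by (simp only: indicator_simps mult_1_right if_True refl)
      next
        case False
        then have "y \<notin> \<Phi> ` A i'" using dis[OF i(1) i' i(2)] by blast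
        then show ?thesis using False by (simp only: indicator_simps mult_zero_right if_False not_False_eq_True)
      qed
    qed
    then show "h y = (\<Sum>i\<in>I. h y * indicator (\<Phi> ` A i) y)" using i(1) finite_I by simp
  qed
  also have "\<dots> = (\<Sum>i\<in>I. \<integral>\<^sup>+y\<in>\<Phi> ` A i. h y \<partial>lebesgue)"
    by (rule nn_integral_sum) (intro borel_measurable_times_ennreal mh borel_measurable_indicator im)
  finally show ?thesis by (simp add: nn)
qed

end

context linking
begin

text \<open>The integrand along radial lines, cut off outside the swept region; it is jointly measurable
  although \<open>radial_integrand\<close> itself is only controlled over the regular part.\<close>

definition cut_integrand where
  "cut_integrand i g p s = indicator (E i) (p, s) * (g (\<Phi> (p, s)) * shape i p s)"

lemma cut_integrand_measurable:
  assumes i: "i \<in> I" and g: "g \<in> borel_measurable borel"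
  shows "case_prod (cut_integrand i g) \<in> borel_measurable borel"
proof -
  obtain V W \<psi> k B H where a: "atlas i V W \<psi> k B H" by (rule atlas_exists[OF i])
  have 1: "(\<lambda>q. g (\<Phi> q)) \<in> borel_measurable borel" unfolding \<Phi>_eq by (rule measurable_compose[OF measurable_ray g])
  have "(\<lambda>q. indicator (E i) q * (g (\<Phi> q) * shape i (fst q) (snd q))) \<in> borel_measurable borel"
    by (intro borel_measurable_times borel_measurable_indicator E_borel[OF i] 1 skeletal_atlas.shape_measurable[OF a])
  then show ?thesis by (simp add: cut_integrand_def case_prod_beta')
qed

text \<open>Since \<open>l i p\<close> is nonnegative, the interval integral is the set integral
  over \<open>einterval 0 (l i p)\<close>, and membership in \<open>E i\<close> describes the same
  open interval.\<close>

lemma radial_integral_cut: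
  assumes i: "i \<in> I" and p: "p \<in> D i"
  shows "radial_integral_defined (\<T> i) (U i) (l i) g p \<longleftrightarrow>
      fst p \<in> regular_part (\<T> i) \<and> integrable lborel (cut_integrand i g p)"
    "radial_integral (\<T> i) (U i) (l i) g p =
      (if fst p \<in> regular_part (\<T> i) \<and> integrable lborel (cut_integrand i g p) then \<integral>s. cut_integrand i g p s \<partial>lborel else 0)"
proof -
  obtain V W \<psi> k B H where a: "atlas i V W \<psi> k B H" by (rule atlas_exists[OF i])
  have U: "snd p \<in> U i (fst p)" using p by (auto simp: double_def)
  have "0 \<le> ereal (norm (snd p))" by simp
  then have l0: "0 \<le> l i p" using l_ge[OF i p] order_trans by blast
  have cut: "indicator (einterval 0 (l i p)) s *\<^sub>R radial_integrand (\<T> i) (U i) g p s = cut_integrand i g p s"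
    if "fst p \<in> regular_part (\<T> i)" for s
    using that U p
    by (auto simp: cut_integrand_def radial_integrand_def skeletal_atlas.shape_def[OF a] E_def \<Phi>_def einterval_def indicator_def)
  show d: "radial_integral_defined (\<T> i) (U i) (l i) g p \<longleftrightarrow>
      fst p \<in> regular_part (\<T> i) \<and> integrable lborel (cut_integrand i g p)"
    using l0 cut by (auto simp: radial_integral_defined_def interval_lebesgue_integrable_def set_integrable_def cong: conj_cong)
  show "radial_integral (\<T> i) (U i) (l i) g p =
      (if fst p \<in> regular_part (\<T> i) \<and> integrable lborel (cut_integrand i g p) then \<integral>s. cut_integrand i g p s \<partial>lborel else 0)"
    using l0 cut by (auto simp: radial_integral_def d interval_lebesgue_integral_def set_lebesgue_integral_def)
qed

text \<open>\<open>ennreal\<close> truncates negative values. At almost every \<open>p\<close> the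
  shape determinant is positive along the segment, so truncating the product amounts to truncating
  \<open>f\<close>, and the determinant equals its absolute value.\<close>

lemma nn_integral_cut:
  assumes i: "i \<in> I" and f: "f \<in> borel_measurable borel" and h: "\<And>s p. p \<in> Good i \<Longrightarrow> h p s = ennreal (cut_integrand i f p s)"
  shows "(\<integral>\<^sup>+p. (\<integral>\<^sup>+s. h p s \<partial>lborel) \<partial>skel i) =
     (\<integral>\<^sup>+p. (\<integral>\<^sup>+s. ennreal (f (\<Phi> (p, s))) * ennreal \<bar>shape i p s\<bar> * indicator (A i) (p, s) \<partial>lborel) \<partial>skel i)"
proof (rule nn_integral_cong_AE, rule eventually_mono[OF AE_Good[OF i]], rule nn_integral_cong)
  fix p s assume p: "p \<in> Good i"
  show "h p s = ennreal (f (\<Phi> (p, s))) * ennreal \<bar>shape i p s\<bar> * indicator (A i) (p, s)"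
  proof (cases "(p, s) \<in> E i")
    case True
    note s = shape_positive_sweep[OF i p True]
    have "ennreal (f (\<Phi> (p, s)) * shape i p s) = ennreal (f (\<Phi> (p, s))) * ennreal (shape i p s)"
      using s by (intro ennreal_mult'') simp
    then show ?thesis using s True p by (simp add: h[OF p] cut_integrand_def)
  next
    case False
    then show ?thesis by (simp add: h[OF p] cut_integrand_def)
  qed
qed

text \<open>\<open>nn_integral_sweeps\<close> is applied to \<open>\<bar>g\<bar>\<close> for
  finiteness and to \<open>g\<close> and \<open>- g\<close>, truncated by \<open>ennreal\<close>,
  for the positive and negative parts. \<open>iterated_integral\<close> turns each region's share
  into a real integral over its double.\<close>

theorem radial_integrals:
  assumes g: "g \<in> borel_measurable borel" "integrable lborel g"
  shows "i \<in> I \<Longrightarrow> AE p in skel i. radial_integral_defined (\<T> i) (U i) (l i) g p"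
    "i \<in> I \<Longrightarrow> integrable (skel i) (radial_integral (\<T> i) (U i) (l i) g)"
    "(\<integral>x. g x \<partial>lborel) = (\<Sum>i\<in>I. \<integral>p. radial_integral (\<T> i) (U i) (l i) g p \<partial>skel i)"
proof -
  define Z where "Z f i = (\<integral>\<^sup>+p. (\<integral>\<^sup>+s. ennreal (f (\<Phi> (p, s))) * ennreal \<bar>shape i p s\<bar> * indicator (A i) (p, s) \<partial>lborel) \<partial>skel i)"
    for f :: "real^'n \<Rightarrow> real" and i
  have Z: "(\<integral>\<^sup>+y. ennreal (f y) \<partial>lborel) = (\<Sum>i\<in>I. Z f i)" if "f \<in> borel_measurable borel" for f
    unfolding Z_def using that by (intro nn_integral_sweeps) simp
  have fin: "(\<integral>\<^sup>+y. ennreal \<bar>g y\<bar> \<partial>lborel) < \<infinity>" using g(2) by (simp add: integrable_iff_bounded)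
  have ma: "(\<lambda>y. \<bar>g y\<bar>) \<in> borel_measurable borel" and mm: "(\<lambda>y. - g y) \<in> borel_measurable borel" using g(1) by simp_all
  have le: "(\<integral>\<^sup>+y. ennreal (g y) \<partial>lborel) \<le> (\<integral>\<^sup>+y. ennreal \<bar>g y\<bar> \<partial>lborel)"
    "(\<integral>\<^sup>+y. ennreal (- g y) \<partial>lborel) \<le> (\<integral>\<^sup>+y. ennreal \<bar>g y\<bar> \<partial>lborel)"
    by (intro nn_integral_mono ennreal_leI; simp)+
  have finZ: "Z f i < \<infinity>" if "i \<in> I" "(\<Sum>i\<in>I. Z f i) < \<infinity>" for f i
    using that finite_I by simp
  have fg: "(\<Sum>i\<in>I. Z (\<lambda>y. \<bar>g y\<bar>) i) < \<infinity>" "(\<Sum>i\<in>I. Z g i) < \<infinity>" "(\<Sum>i\<in>I. Z (\<lambda>y. - g y) i) < \<infinity>"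
    using fin le unfolding Z[OF ma] Z[OF g(1)] Z[OF mm] by (auto intro: le_less_trans)
  have main: "(AE p in skel i. fst p \<in> regular_part (\<T> i) \<and> integrable lborel (cut_integrand i g p)) \<and>
      integrable (skel i) (radial_integral (\<T> i) (U i) (l i) g) \<and>
      (\<integral>p. radial_integral (\<T> i) (U i) (l i) g p \<partial>skel i) = enn2real (Z g i) - enn2real (Z (\<lambda>y. - g y) i)"
    if i: "i \<in> I" for i
  proof -
    obtain V W \<psi> k B H where a: "atlas i V W \<psi> k B H" by (rule atlas_exists[OF i])
    interpret a: skeletal_atlas "\<T> i" "U i" V W \<psi> k B H by (rule a)
    have id: "(\<lambda>p. p) \<in> a.skel \<rightarrow>\<^sub>M borel" by (rule a.id_measurable_skel)
    have pr: "(\<lambda>q. (fst q, snd q)) \<in> a.skel \<Otimes>\<^sub>M lborel \<rightarrow>\<^sub>M (borel \<Otimes>\<^sub>M borel :: (((real^'n) \<times> (real^'n)) \<times> real) measure)"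
      by (intro measurable_Pair measurable_compose[OF measurable_fst id] measurable_snd'')
         (simp add: measurable_lborel1)
    have w: "case_prod (cut_integrand i g) \<in> borel_measurable (a.skel \<Otimes>\<^sub>M lborel)"
      using measurable_compose[OF pr[unfolded borel_prod] cut_integrand_measurable[OF i g(1)]] by simp
    have Rm: "Measurable.pred a.skel (\<lambda>p. fst p \<in> regular_part (\<T> i))"
    proof -
      have "Measurable.pred borel (\<lambda>x. x \<in> regular_part (\<T> i))" using a.R_borel by (simp add: pred_def)
      moreover have "(\<lambda>p :: (real^'n) \<times> (real^'n). fst p) \<in> borel \<rightarrow>\<^sub>M borel"
        by (intro borel_measurable_continuous_onI continuous_intros)
      ultimately show ?thesis using measurable_compose[OF measurable_compose[OF id]] by blast
    qed
    have 1: "(\<integral>\<^sup>+p. (\<integral>\<^sup>+s. ennreal \<bar>cut_integrand i g p s\<bar> \<partial>lborel) \<partial>a.skel) = Z (\<lambda>y. \<bar>g y\<bar>) i"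
      unfolding Z_def
    proof (rule nn_integral_cut[OF i ma])
      fix s p assume p: "p \<in> Good i"
      show "ennreal \<bar>cut_integrand i g p s\<bar> = ennreal (cut_integrand i (\<lambda>y. \<bar>g y\<bar>) p s)"
      proof (cases "(p, s) \<in> E i")
        case True
        then show ?thesis using shape_positive_sweep[OF i p True] by (simp add: cut_integrand_def abs_mult)
      qed (simp add: cut_integrand_def)
    qed
    have 2: "(\<integral>\<^sup>+p. (\<integral>\<^sup>+s. ennreal (cut_integrand i g p s) \<partial>lborel) \<partial>a.skel) = Z g i"
      unfolding Z_def by (rule nn_integral_cut[OF i g(1)]) simp
    have 3: "(\<integral>\<^sup>+p. (\<integral>\<^sup>+s. ennreal (- cut_integrand i g p s) \<partial>lborel) \<partial>a.skel) = Z (\<lambda>y. - g y) i"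
      unfolding Z_def by (rule nn_integral_cut[OF i mm]) (simp add: cut_integrand_def)
    have R: "AE p in a.skel. fst p \<in> regular_part (\<T> i)" using a.AE_skel_regular by (rule eventually_mono) simp
    have f: "radial_integral (\<T> i) (U i) (l i) g p =
      (if fst p \<in> regular_part (\<T> i) \<and> integrable lborel (cut_integrand i g p) then \<integral>s. cut_integrand i g p s \<partial>lborel else 0)"
      if "p \<in> space a.skel" for p using radial_integral_cut(2)[OF i] that unfolding a.space_skel .
    \<comment> \<open>The three iterated integrals are \<open>Z\<close> of
      \<open>\<bar>g\<bar>\<close>, \<open>g\<close> and \<open>- g\<close>; the first is finite as
      one summand of the integral of \<open>\<bar>g\<bar>\<close> over space.\<close>
    note it = iterated_integral[OF w _ Rm R f, unfolded 1 2 3, OF finZ[OF i fg(1)]]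
    show ?thesis using it by blast
  qed
  show "AE p in skel i. radial_integral_defined (\<T> i) (U i) (l i) g p" if i: "i \<in> I"
  proof -
    obtain V W \<psi> k B H where a: "atlas i V W \<psi> k B H" by (rule atlas_exists[OF i])
    show ?thesis
      using main[OF i, THEN conjunct1] AE_space
    proof eventually_elim
      fix p assume "fst p \<in> regular_part (\<T> i) \<and> integrable lborel (cut_integrand i g p)" "p \<in> space (skel i)"
      then show "radial_integral_defined (\<T> i) (U i) (l i) g p"
        unfolding skeletal_atlas.space_skel[OF a] using radial_integral_cut(1)[OF i] by blast
    qed
  qed
  show "integrable (skel i) (radial_integral (\<T> i) (U i) (l i) g)" if "i \<in> I" using main[OF that] by blast
  \<comment> \<open>Additivity of \<open>enn2real\<close> rests on the finiteness of every
    summand.\<close>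
  have e: "enn2real (\<Sum>i\<in>I. Z f i) = (\<Sum>i\<in>I. enn2real (Z f i))" if "(\<Sum>i\<in>I. Z f i) < \<infinity>" for f
    using enn2real_sum[of I "Z f"] finZ[OF _ that] by (simp add: comp_def)
  have "(\<integral>x. g x \<partial>lborel) = enn2real (\<Sum>i\<in>I. Z g i) - enn2real (\<Sum>i\<in>I. Z (\<lambda>y. - g y) i)"
    using g(2) by (simp add: real_lebesgue_integral_def Z[OF g(1)] Z[OF mm])
  also have "\<dots> = (\<Sum>i\<in>I. enn2real (Z g i) - enn2real (Z (\<lambda>y. - g y) i))"
    unfolding e[OF fg(2)] e[OF fg(3)] by (rule sum_subtractf[symmetric])
  also have "\<dots> = (\<Sum>i\<in>I. \<integral>p. radial_integral (\<T> i) (U i) (l i) g p \<partial>skel i)"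
    using main by (intro sum.cong refl) simp
  finally show "(\<integral>x. g x \<partial>lborel) = (\<Sum>i\<in>I. \<integral>p. radial_integral (\<T> i) (U i) (l i) g p \<partial>skel i)" .
qed

end

theorem theorem10p6:
  fixes \<Omega> :: "'i \<Rightarrow> (real^'n) set"
    and \<T> :: "'i \<Rightarrow> (real^'n) set set"
    and U :: "'i \<Rightarrow> real^'n \<Rightarrow> (real^'n) set"
    and l :: "'i \<Rightarrow> (real^'n) \<times> (real^'n) \<Rightarrow> ereal"
    and S :: "'i \<Rightarrow> 'j \<Rightarrow> ((real^'n) \<times> (real^'n)) set"
    and g :: "real^'n \<Rightarrow> real"
  assumes "multi_region_configuration I \<Omega>"
    and "skeletal_linking_structure I \<Omega> \<T> U l J S"
    and "g \<in> borel_measurable borel"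
    and "integrable lborel g"
    and "compact (closure {x. g x \<noteq> 0})"
  shows "(\<forall>i\<in>I. AE p in skeletal_measure (\<T> i) (U i).
            radial_integral_defined (\<T> i) (U i) (l i) g p) \<and>
         (\<forall>i\<in>I. integrable (skeletal_measure (\<T> i) (U i)) (radial_integral (\<T> i) (U i) (l i) g)) \<and>
         (LINT x|lborel. g x) =
           (\<Sum>i\<in>I. LINT p|skeletal_measure (\<T> i) (U i). radial_integral (\<T> i) (U i) (l i) g p)"
proof -
  interpret linking I \<Omega> \<T> U l J S by unfold_locales fact+
  show ?thesis using radial_integrals[OF assms(3,4)] by blast
qed

end
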